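(* Let $N\ge 3$, $2^\ast=\frac{2N}{N-2}$, and let $\mu_1,\mu_2,\beta>0$. Let $(u,v)$ be a solution of $$\begin{cases}-\Delta u=\mu_1u^{2^\ast-1}+\beta u^{\frac{2^\ast}{2}-1}v^{\frac{2^\ast}{2}} & \text{in }\mathbb R^N\setminus\{0\},\\ -\Delta v=\mu_2v^{2^\ast-1}+\beta v^{\frac{2^\ast}{2}-1}u^{\frac{2^\ast}{2}} & \text{in }\mathbb R^N\setminus\{0\},\\ u,v>0,\quad u,v\in C^2(\mathbb R^N\setminus\{0\}),\end{cases}$$ with Pohozaev constant $K(u,v)=0$. Then $(u,v)=(kU,lU)$, where $k,l>0$ satisfy $$\mu_1k^{2^\ast-2}+\beta k^{\frac{2^\ast}{2}-2}l^{\frac{2^\ast}{2}}=1,\qquad \mu_2l^{2^\ast-2}+\beta l^{\frac{2^\ast}{2}-2}k^{\frac{2^\ast}{2}}=1,$$ and, for some $\epsilon>0$ and $y\in\mathbb R^N$, $$U(x)=[N(N-2)]^{\frac{N-2}{4}}\Big(\frac{\epsilon}{\epsilon^2+|x-y|^2}\Big)^{\frac{N-2}{2}}.$$ In particular, the functions $$\mathcal K_1=\tfrac{4(N-1)}{N-2}\Big(\mu_1+\beta\big(\tfrac vu\big)^{\frac{2^\ast}{2}}\Big),\qquad \mathcal K_2=\tfrac{4(N-1)}{N-2}\Big(\mu_2+\beta\big(\tfrac uv\big)^{\frac{2^\ast}{2}}\Big)$$ are constants.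
   Context: Let $B_r=\{x\in\mathbb R^N:|x|<r\}$ and let $\nu$ be the unit outer normal of $\partial B_r$. For a solution $(u,v)$ of the system and $r>0$ put $$K(r;u,v)=\int_{\partial B_r}\Big[\tfrac{N-2}{2}\big(u\tfrac{\partial u}{\partial\nu}+v\tfrac{\partial v}{\partial\nu}\big)-\tfrac r2(|\nabla u|^2+|\nabla v|^2)+r\big|\tfrac{\partial u}{\partial\nu}\big|^2+r\big|\tfrac{\partial v}{\partial\nu}\big|^2+\tfrac{r}{2^\ast}\big(\mu_1u^{2^\ast}+\mu_2v^{2^\ast}+2\beta u^{\frac{2^\ast}{2}}v^{\frac{2^\ast}{2}}\big)\Big]d\sigma.$$ By the Pohozaev identity, $K(r;u,v)$ is independent of $r>0$; its constant value is denoted $K(u,v)$ (the Pohozaev constant). $\mathcal K_1,\mathcal K_2$ are the scalar curvature functions of the conformally flat metrics $u^{\frac4{N-2}}\delta_{ij}$ and $v^{\frac4{N-2}}\delta_{ij}$. *)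

theory Defs
  imports "HOL-Analysis.Analysis"
begin

section \<open>Calculus in coordinates\<close>

definition partial :: "'n \<Rightarrow> (real ^ 'n \<Rightarrow> real) \<Rightarrow> real ^ 'n \<Rightarrow> real" where
  "partial i f x = frechet_derivative f (at x) (axis i 1)"

definition grad :: "(real ^ 'n \<Rightarrow> real) \<Rightarrow> real ^ 'n \<Rightarrow> real ^ 'n" where
  "grad f x = (\<chi> i. partial i f x)"

definition laplacian :: "(real ^ 'n \<Rightarrow> real) \<Rightarrow> real ^ 'n \<Rightarrow> real" where
  "laplacian f x = (\<Sum>i\<in>UNIV. partial i (partial i f) x)"

text \<open>The class \<open>C\<^sup>k(S)\<close>; intended for open \<open>S\<close>, since derivatives are taken in the whole space.\<close>

fun Ck_on :: "nat \<Rightarrow> (real ^ 'n \<Rightarrow> real) \<Rightarrow> (real ^ 'n) set \<Rightarrow> bool" where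
  "Ck_on 0 f S \<longleftrightarrow> continuous_on S f"
| "Ck_on (Suc k) f S \<longleftrightarrow>
     (\<forall>x\<in>S. f differentiable (at x)) \<and> (\<forall>i. Ck_on k (partial i f) S)"


section \<open>Surface measure on spheres\<close>

text \<open>The surface measure \<open>\<sigma>\<close> on the sphere \<open>\<partial>B\<^sub>r\<close> is the usual cone measure of polar coordinates:
  \<open>\<sigma>(A) = (N / r) * vol {t x | 0 < t < 1, x \<in> A}\<close>, obtained by pushing Lebesgue measure on the
  punctured ball forward under radial projection (see \<open>emeasure_sphere_measure\<close> below).
  Meaningful for \<open>r > 0\<close> only.\<close>

definition sphere_measure :: "real \<Rightarrow> 'a::euclidean_space measure" where
  "sphere_measure r =
     scale_measure (ennreal (DIM('a) / r))
       (distr (restrict_space lborel (ball 0 r - {0})) (restrict_space borel (sphere 0 r))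
          (\<lambda>x. (r / norm x) *\<^sub>R x))"

lemma space_sphere_measure [simp]: "space (sphere_measure r) = sphere 0 r"
  by (simp add: sphere_measure_def space_scale_measure space_restrict_space)

lemma sets_sphere_measure [simp, measurable_cong]:
  "sets (sphere_measure r) = sets (restrict_space borel (sphere 0 r))"
  by (simp add: sphere_measure_def)

lemma measurable_radial_projection:
  assumes "r > 0"
  shows "(\<lambda>x. (r / norm x) *\<^sub>R x) \<in>
    restrict_space lborel (ball 0 r - {0}) \<rightarrow>\<^sub>M restrict_space borel (sphere (0::'a::euclidean_space) r)"
proof (rule measurable_restrict_space2)
  show "(\<lambda>x::'a. (r / norm x) *\<^sub>R x) \<in> space (restrict_space lborel (ball 0 r - {0})) \<rightarrow> sphere 0 r"
    using assms by (auto simp: space_restrict_space)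
  show "(\<lambda>x::'a. (r / norm x) *\<^sub>R x) \<in> restrict_space lborel (ball 0 r - {0}) \<rightarrow>\<^sub>M borel"
    by (rule measurable_restrict_space1) measurable
qed

lemma emeasure_sphere_measure:
  fixes A :: "'a::euclidean_space set"
  assumes "r > 0" and A: "A \<in> sets (sphere_measure r)"
  shows "emeasure (sphere_measure r) A =
    ennreal (DIM('a) / r) * emeasure lborel {t *\<^sub>R x | t x. 0 < t \<and> t < 1 \<and> x \<in> A}"
proof -
  let ?p = "\<lambda>x::'a. (r / norm x) *\<^sub>R x"
  have AS: "A \<subseteq> sphere 0 r"
    using sets.sets_into_space[OF A] by simp
  have eq: "?p -` A \<inter> (ball 0 r - {0}) = {t *\<^sub>R x | t x. 0 < t \<and> t < 1 \<and> x \<in> A}"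
  proof (intro equalityI subsetI)
    fix x assume "x \<in> ?p -` A \<inter> (ball 0 r - {0})"
    then have x: "?p x \<in> A" "norm x < r" "x \<noteq> 0" by auto
    then have "x = (norm x / r) *\<^sub>R ?p x" using \<open>r > 0\<close> by simp
    moreover have "0 < norm x / r" "norm x / r < 1" using x \<open>r > 0\<close> by auto
    ultimately show "x \<in> {t *\<^sub>R x | t x. 0 < t \<and> t < 1 \<and> x \<in> A}" using x(1) by blast
  next
    fix z assume "z \<in> {t *\<^sub>R x | t x. 0 < t \<and> t < 1 \<and> x \<in> A}"
    then obtain t x where z: "z = t *\<^sub>R x" "0 < t" "t < 1" "x \<in> A" by blast
    then have nx: "norm x = r" using AS by auto
    then have "?p z = x" "norm z < r" "z \<noteq> 0" using z \<open>r > 0\<close> by auto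
    then show "z \<in> ?p -` A \<inter> (ball 0 r - {0})" using z by auto
  qed
  have B: "ball 0 r - {0::'a} \<in> sets lborel" by simp
  have "emeasure (sphere_measure r) A = ennreal (DIM('a) / r) *
      emeasure (restrict_space lborel (ball 0 r - {0})) (?p -` A \<inter> (ball 0 r - {0}))"
    using emeasure_distr[OF measurable_radial_projection[OF \<open>r > 0\<close>], of A] A
    by (simp add: sphere_measure_def space_restrict_space)
  also have "\<dots> = ennreal (DIM('a) / r) * emeasure lborel (?p -` A \<inter> (ball 0 r - {0}))"
    using B by (simp add: emeasure_restrict_space)
  finally show ?thesis by (simp only: eq)
qed


section \<open>Scalar curvature of a Riemannian metric given in one chart\<close>

definition christoffel ::
  "(real ^ 'n \<Rightarrow> real ^ 'n ^ 'n) \<Rightarrow> 'n \<Rightarrow> 'n \<Rightarrow> 'n \<Rightarrow> real ^ 'n \<Rightarrow> real" where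
  "christoffel g k i j x = (\<Sum>l\<in>UNIV. matrix_inv (g x) $ k $ l *
     (partial i (\<lambda>y. g y $ j $ l) x + partial j (\<lambda>y. g y $ i $ l) x - partial l (\<lambda>y. g y $ i $ j) x)) / 2"

definition ricci :: "(real ^ 'n \<Rightarrow> real ^ 'n ^ 'n) \<Rightarrow> 'n \<Rightarrow> 'n \<Rightarrow> real ^ 'n \<Rightarrow> real" where
  "ricci g i j x =
     (\<Sum>k\<in>UNIV. partial k (christoffel g k i j) x - partial j (christoffel g k i k) x) +
     (\<Sum>k\<in>UNIV. \<Sum>l\<in>UNIV. christoffel g k k l x * christoffel g l i j x
                        - christoffel g k j l x * christoffel g l i k x)"

definition scalar_curvature :: "(real ^ 'n \<Rightarrow> real ^ 'n ^ 'n) \<Rightarrow> real ^ 'n \<Rightarrow> real" where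
  "scalar_curvature g x = (\<Sum>i\<in>UNIV. \<Sum>j\<in>UNIV. matrix_inv (g x) $ i $ j * ricci g i j x)"

text \<open>The conformally flat metric \<open>w\<^bsup>4/(N-2)\<^esup> \<delta>\<^sub>i\<^sub>j\<close>.\<close>

definition conformal_metric :: "(real ^ 'n \<Rightarrow> real) \<Rightarrow> real ^ 'n \<Rightarrow> real ^ 'n ^ 'n" where
  "conformal_metric w x = mat (w x powr (4 / (real CARD('n) - 2)))"


section \<open>Critical exponent, bubbles and the Pohozaev constant\<close>

definition crit_exp :: "nat \<Rightarrow> real" where
  "crit_exp N = 2 * real N / (real N - 2)"

definition bubble :: "real \<Rightarrow> real ^ 'n \<Rightarrow> real ^ 'n \<Rightarrow> real" where
  "bubble \<epsilon> y x = (let N = real CARD('n) in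
     (N * (N - 2)) powr ((N - 2) / 4) * (\<epsilon> / (\<epsilon>\<^sup>2 + (norm (x - y))\<^sup>2)) powr ((N - 2) / 2))"

text \<open>On \<open>\<partial>B\<^sub>r\<close> the outer unit normal at \<open>x\<close> is \<open>x / |x|\<close>.\<close>

definition normal_deriv :: "(real ^ 'n \<Rightarrow> real) \<Rightarrow> real ^ 'n \<Rightarrow> real" where
  "normal_deriv w x = grad w x \<bullet> (x /\<^sub>R norm x)"

definition pohozaev ::
  "real \<Rightarrow> real \<Rightarrow> real \<Rightarrow> (real ^ 'n \<Rightarrow> real) \<Rightarrow> (real ^ 'n \<Rightarrow> real) \<Rightarrow> real \<Rightarrow> real" where
  "pohozaev \<mu>1 \<mu>2 \<beta> u v r = (let N = real CARD('n); p = crit_exp CARD('n) in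
     \<integral>x. ((N - 2) / 2 * (u x * normal_deriv u x + v x * normal_deriv v x)
          - r / 2 * ((norm (grad u x))\<^sup>2 + (norm (grad v x))\<^sup>2)
          + r * \<bar>normal_deriv u x\<bar>\<^sup>2 + r * \<bar>normal_deriv v x\<bar>\<^sup>2
          + r / p * (\<mu>1 * u x powr p + \<mu>2 * v x powr p
                     + 2 * \<beta> * u x powr (p / 2) * v x powr (p / 2)))
       \<partial>(sphere_measure r))"

text \<open>The common value of \<open>K(r; u, v)\<close> over all \<open>r > 0\<close>. It exists for every solution of the system,
  by the Pohozaev identity; for other pairs \<open>(u, v)\<close> the description may be void.\<close>

definition pohozaev_const ::
  "real \<Rightarrow> real \<Rightarrow> real \<Rightarrow> (real ^ 'n \<Rightarrow> real) \<Rightarrow> (real ^ 'n \<Rightarrow> real) \<Rightarrow> real" where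
  "pohozaev_const \<mu>1 \<mu>2 \<beta> u v = (THE c. \<forall>r>0. pohozaev \<mu>1 \<mu>2 \<beta> u v r = c)"

end

theory Submission imports Defs
begin

section \<open>Classification of solutions with vanishing Pohozaev constant\<close>

text \<open>The method of moving spheres compares \<open>(u, v)\<close> with its Kelvin transforms in spheres about every
  centre. For a solution on the whole space some sphere about each centre \<open>y\<close> leaves \<open>(u, v)\<close> invariant, and the
  squared radius turns out to be \<open>\<bar>y - x0\<bar>\<^sup>2 + d\<close>, which determines \<open>u\<close> and \<open>v\<close> up to constants. For a
  singular solution either a sphere about some \<open>x \<noteq> 0\<close> of radius \<open>< \<bar>x\<bar>\<close> leaves \<open>(u, v)\<close> invariant, so that
  the Kelvin transform extends it over \<open>0\<close>, or \<open>(u, v)\<close> is radial. In the radial case put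
  \<open>\<delta> = (N - 2) / 2\<close>, \<open>w\<^sub>i(t) = r\<^sup>\<delta> (u, v)\<close> with \<open>t = - ln r\<close>, and \<open>y\<^sub>i = w\<^sub>i' / w\<^sub>i\<close>. The Pohozaev constant is
  the energy of the resulting autonomous system. If it vanishes, the part
  \<open>D = w\<^sub>1\<^sup>2 (\<delta>\<^sup>2 - y\<^sub>1\<^sup>2) - (2/p) (\<mu>\<^sub>1 w\<^sub>1\<^sup>p + \<beta> (w\<^sub>1 w\<^sub>2)\<^bsup>p/2\<^esup>)\<close> belonging to \<open>u\<close> is the negative of the one
  belonging to \<open>v\<close>, and the logarithmic derivative of the component with the negative part is
  decreasing. This forces \<open>w\<^sub>i = O(e\<^bsup>-\<delta>t\<^esup>)\<close>: the solution is bounded near \<open>0\<close>, hence smooth there.\<close>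

subsection \<open>Twice differentiable functions and the Laplacian\<close>

text \<open>\<open>twice_on\<close> asks for second derivatives pointwise, which is what a minimum
  argument sees and what survives products, translation and inversion. The moving spheres use only
  positivity, monotonicity and homogeneity of degree (N + 2)/(N - 2) of the nonlinearity, the degree
  for which Kelvin transforms of solutions are solutions; it stays abstract there. The obstacle is
  the radial case: two coupled oscillators share one conserved energy, which does not force both
  components to 0 by itself. The parts \<open>D\<close> and \<open>- D\<close> exchange energy only
  through the coupling \<open>C\<close>, by D' = C (y1 - y2), and this sign makes the logarithmic
  derivative followed in the proof jump downwards whenever the two components change roles. Being
  bounded, it limits how long both potentials \<open>g1\<close> and \<open>g2\<close> can stay
  large. How decay follows depends on the sign of p/2 - 2, since \<open>g2\<close> contains w1^(p/2)
  w2^(p/2 - 2): for p \<le> 4 one large component keeps both potentials large; for p > 4, that is N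
  = 3, a small component has a small potential, and \<open>D\<close> must be compared with
  \<open>C\<close>.\<close>

definition twice_on :: "(real ^ 'n \<Rightarrow> real) \<Rightarrow> (real ^ 'n) set \<Rightarrow> bool" where
  "twice_on f S \<longleftrightarrow> (\<forall>x\<in>S. f differentiable (at x) \<and> (\<forall>i. partial i f differentiable (at x)))"

text \<open>The second derivative as the linear map that the chain rule produces for
  \<open>grad f\<close>; the Laplacian becomes its trace, so second order computations reduce to
  traces of rank-one maps.\<close>

definition hess :: "(real ^ 'n \<Rightarrow> real) \<Rightarrow> real ^ 'n \<Rightarrow> real ^ 'n \<Rightarrow> real ^ 'n" where
  "hess f x h = (\<chi> i. grad (partial i f) x \<bullet> h)"

lemma partial_eq:
  assumes "(f has_derivative f') (at x)"
  shows "partial i f x = f' (axis i 1)"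
  unfolding partial_def using frechet_derivative_at[OF assms] by simp

lemma linear_axis_expansion:
  fixes T :: "real ^ 'n \<Rightarrow> 'a::real_vector"
  assumes "linear T"
  shows "T h = (\<Sum>i\<in>UNIV. h $ i *\<^sub>R T (axis i 1))"
proof -
  have "T h = T (\<Sum>i\<in>UNIV. h $ i *\<^sub>R axis i 1)"
    using basis_expansion[of h] by (simp add: scalar_mult_eq_scaleR)
  then show ?thesis
    by (simp add: linear_sum[OF assms] linear_cmul[OF assms])
qed

lemma has_derivative_grad:
  assumes "f differentiable (at x)"
  shows "(f has_derivative (\<lambda>h. grad f x \<bullet> h)) (at x)"
proof -
  let ?D = "frechet_derivative f (at x)"
  have D: "(f has_derivative ?D) (at x)"
    using assms by (simp add: frechet_derivative_works)
  have "?D = (\<lambda>h. grad f x \<bullet> h)"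
  proof
    fix h
    show "?D h = grad f x \<bullet> h"
      using linear_axis_expansion[OF has_derivative_linear[OF D], of h]
      by (simp add: grad_def partial_def inner_vec_def mult.commute)
  qed
  with D show ?thesis by simp
qed

lemma grad_eq:
  assumes "(f has_derivative (\<lambda>h. G \<bullet> h)) (at x)"
  shows "grad f x = G"
  using partial_eq[OF assms] by (simp add: grad_def vec_eq_iff inner_axis)

text \<open>\<open>frechet_derivative\<close> is a choice from the relation
  \<open>has_derivative\<close>, and functions agreeing near \<open>x\<close> have the same relation
  there. Hence the partial derivatives agree even where neither function is differentiable.\<close>

lemma partial_cong_open:
  assumes "open S" "x \<in> S" "\<And>y. y \<in> S \<Longrightarrow> f y = g y"
  shows "partial i f x = partial i g x"
proof -
  have "(f has_derivative D) (at x) \<longleftrightarrow> (g has_derivative D) (at x)" for D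
    using has_derivative_transform_within_open[OF _ assms(1,2), of f D UNIV g]
      has_derivative_transform_within_open[OF _ assms(1,2), of g D UNIV f] assms(3) by auto
  then show ?thesis
    by (simp add: partial_def frechet_derivative_def)
qed

lemma laplacian_cong_open:
  assumes "open S" "x \<in> S" "\<And>y. y \<in> S \<Longrightarrow> f y = g y"
  shows "laplacian f x = laplacian g x"
  unfolding laplacian_def
  by (intro sum.cong refl partial_cong_open[OF assms(1,2)] partial_cong_open[OF assms(1)] assms(3))

lemma differentiable_transform_open:
  assumes "f differentiable (at x)" "open S" "x \<in> S" "\<And>y. y \<in> S \<Longrightarrow> f y = g y"
  shows "g differentiable (at x)"
  using assms(1) has_derivative_transform_within_open[OF _ assms(2,3), of f _ UNIV g] assms(4)
  unfolding differentiable_def by auto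

lemma twice_on_cong:
  assumes "open S" "\<And>y. y \<in> S \<Longrightarrow> f y = g y" "twice_on f S"
  shows "twice_on g S"
  unfolding twice_on_def
proof (intro ballI conjI allI)
  fix x i assume x: "x \<in> S"
  have f: "f differentiable (at x)" "partial i f differentiable (at x)"
    using assms(3) x by (auto simp: twice_on_def)
  show "g differentiable (at x)"
    by (rule differentiable_transform_open[OF f(1) assms(1) x assms(2)])
  show "partial i g differentiable (at x)"
    by (rule differentiable_transform_open[OF f(2) assms(1) x partial_cong_open[OF assms(1) _ assms(2)]])
qed

lemma twice_on_subset: "twice_on f T \<Longrightarrow> S \<subseteq> T \<Longrightarrow> twice_on f S"
  by (auto simp: twice_on_def)

lemma twice_on_Un: "twice_on f S \<Longrightarrow> twice_on f T \<Longrightarrow> twice_on f (S \<union> T)"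
  by (auto simp: twice_on_def)

lemma Ck_on_2_twice_on: "Ck_on 2 f S \<Longrightarrow> twice_on f S"
  by (auto simp: numeral_2_eq_2 twice_on_def)

lemma has_derivative_vec:
  fixes G :: "'a::real_normed_vector \<Rightarrow> real ^ 'n"
  assumes "\<And>i. ((\<lambda>y. G y $ i) has_derivative (\<lambda>h. G' h $ i)) (at x)"
  shows "(G has_derivative G') (at x)"
  unfolding has_derivative_componentwise_within[of G]
  using assms by (auto simp: Basis_vec_def inner_axis)

lemma twice_on_has_derivative:
  assumes "twice_on f S" "x \<in> S"
  shows "(f has_derivative (\<lambda>h. grad f x \<bullet> h)) (at x)"
    and "(grad f has_derivative hess f x) (at x)"
proof -
  show "(f has_derivative (\<lambda>h. grad f x \<bullet> h)) (at x)"
    using assms by (auto simp: twice_on_def intro: has_derivative_grad)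
  show "(grad f has_derivative hess f x) (at x)"
  proof (rule has_derivative_vec)
    fix i
    have "((\<lambda>y. partial i f y) has_derivative (\<lambda>h. grad (partial i f) x \<bullet> h)) (at x)"
      using assms by (auto simp: twice_on_def intro: has_derivative_grad)
    then show "((\<lambda>y. grad f y $ i) has_derivative (\<lambda>h. hess f x h $ i)) (at x)"
      by (simp add: hess_def grad_def[of f])
  qed
qed

definition trace_map :: "(real ^ 'n \<Rightarrow> real ^ 'n) \<Rightarrow> real" where
  "trace_map T = (\<Sum>i\<in>UNIV. T (axis i 1) $ i)"

lemma laplacian_hess: "laplacian f x = trace_map (hess f x)"
  by (simp add: laplacian_def trace_map_def hess_def grad_def inner_axis)

lemma linear_hess: "linear (hess f x)"
  by (rule linearI) (simp_all add: hess_def vec_eq_iff inner_add_right)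

text \<open>The way all Laplacians below are computed: exhibit a gradient field \<open>G\<close>
  together with its derivative \<open>G'\<close>. The partial derivatives are the components of
  \<open>G\<close>, so the pure second ones are the diagonal entries of \<open>G'\<close>.\<close>

lemma twice_onI:
  assumes S: "open S"
    and G: "\<And>x. x \<in> S \<Longrightarrow> (f has_derivative (\<lambda>h. G x \<bullet> h)) (at x)"
    and G': "\<And>x. x \<in> S \<Longrightarrow> (G has_derivative G' x) (at x)"
  shows "twice_on f S"
    and "x \<in> S \<Longrightarrow> grad f x = G x"
    and "x \<in> S \<Longrightarrow> laplacian f x = trace_map (G' x)"
proof -
  have p: "partial i f x = G x $ i" if "x \<in> S" for x i
    using partial_eq[OF G[OF that]] by (simp add: inner_axis)
  have pd: "(partial i f has_derivative (\<lambda>h. G' x h $ i)) (at x)" if "x \<in> S" for x i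
  proof -
    have "((\<lambda>y. G y \<bullet> axis i 1) has_derivative (\<lambda>h. G' x h \<bullet> axis i 1)) (at x)"
      by (intro has_derivative_inner_left G' that)
    then have "((\<lambda>y. G y $ i) has_derivative (\<lambda>h. G' x h $ i)) (at x)"
      by (simp add: inner_axis)
    then show ?thesis
      by (rule has_derivative_transform_within_open[OF _ S that]) (simp add: p)
  qed
  show "twice_on f S"
    using G pd by (auto simp: twice_on_def differentiable_def)
  show "x \<in> S \<Longrightarrow> grad f x = G x"
    using p by (simp add: grad_def vec_eq_iff)
  show "x \<in> S \<Longrightarrow> laplacian f x = trace_map (G' x)"
    using partial_eq[OF pd] by (simp add: laplacian_def trace_map_def)
qed

lemma trace_map_add: "trace_map (\<lambda>h. S h + T h) = trace_map S + trace_map T"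
  by (simp add: trace_map_def sum.distrib)

lemma trace_map_diff: "trace_map (\<lambda>h. S h - T h) = trace_map S - trace_map T"
  by (simp add: trace_map_def sum_subtractf)

lemma trace_map_scale: "trace_map (\<lambda>h. c *\<^sub>R T h) = c * trace_map T"
  by (simp add: trace_map_def sum_distrib_left)

lemma trace_map_ident: "trace_map (\<lambda>h::real^'n. h) = real CARD('n)"
  by (simp add: trace_map_def axis_def)

lemma trace_map_inner_scale:
  assumes "linear T"
  shows "trace_map (\<lambda>h. (T h \<bullet> w) *\<^sub>R z) = T z \<bullet> w"
proof -
  have "T z \<bullet> w = (\<Sum>i\<in>UNIV. z $ i *\<^sub>R T (axis i 1)) \<bullet> w"
    by (subst linear_axis_expansion[OF assms]) simp
  also have "\<dots> = (\<Sum>i\<in>UNIV. z $ i * (T (axis i 1) \<bullet> w))"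
    by (simp add: inner_sum_left)
  finally show ?thesis
    by (simp add: trace_map_def mult.commute)
qed

lemma trace_map_inner: "trace_map (\<lambda>h. (w \<bullet> h) *\<^sub>R z) = w \<bullet> z"
  using trace_map_inner_scale[of "\<lambda>h. h" w z] by (simp add: linear_id inner_commute linear_iff)

lemma twice_on_add:
  assumes "open S" "twice_on f S" "twice_on g S"
  shows "twice_on (\<lambda>y. f y + g y) S"
    and "x \<in> S \<Longrightarrow> laplacian (\<lambda>y. f y + g y) x = laplacian f x + laplacian g x"
proof -
  have 1: "((\<lambda>y. f y + g y) has_derivative (\<lambda>h. (grad f x + grad g x) \<bullet> h)) (at x)"
    and 2: "((\<lambda>y. grad f y + grad g y) has_derivative (\<lambda>h. hess f x h + hess g x h)) (at x)"
    if "x \<in> S" for x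
    by (auto intro!: derivative_eq_intros twice_on_has_derivative[OF assms(2) that]
        twice_on_has_derivative[OF assms(3) that] simp: inner_add_left)
  show "twice_on (\<lambda>y. f y + g y) S"
    by (rule twice_onI(1)[OF assms(1) 1 2])
  show "laplacian (\<lambda>y. f y + g y) x = laplacian f x + laplacian g x" if "x \<in> S"
    using twice_onI(3)[OF assms(1) 1 2 that]
    by (simp add: laplacian_hess trace_map_add)
qed

lemma
  fixes S :: "(real ^ 'n) set" and x :: "real ^ 'n"
  shows twice_on_const: "open S \<Longrightarrow> twice_on (\<lambda>y. c) S"
  and laplacian_const: "laplacian (\<lambda>y. c) x = 0"
proof -
  have *: "((\<lambda>y. c) has_derivative (\<lambda>h. 0 \<bullet> h)) (at x)" for x :: "real ^ 'n"
    by simp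
  show "twice_on (\<lambda>y. c) S" if "open S"
    by (rule twice_onI(1)[OF that * has_derivative_const])
  show "laplacian (\<lambda>y. c) x = 0"
    using twice_onI(3)[OF open_UNIV * has_derivative_const, of x] by (simp add: trace_map_def)
qed

lemma twice_on_mult:
  assumes "open S" "twice_on f S" "twice_on g S"
  shows "twice_on (\<lambda>y. f y * g y) S"
    and "x \<in> S \<Longrightarrow> laplacian (\<lambda>y. f y * g y) x
      = f x * laplacian g x + 2 * (grad f x \<bullet> grad g x) + g x * laplacian f x"
proof -
  have 1: "((\<lambda>y. f y * g y) has_derivative (\<lambda>h. (f x *\<^sub>R grad g x + g x *\<^sub>R grad f x) \<bullet> h)) (at x)"
    and 2: "((\<lambda>y. f y *\<^sub>R grad g y + g y *\<^sub>R grad f y) has_derivative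
      (\<lambda>h. (f x *\<^sub>R hess g x h + (grad f x \<bullet> h) *\<^sub>R grad g x)
         + (g x *\<^sub>R hess f x h + (grad g x \<bullet> h) *\<^sub>R grad f x))) (at x)"
    if "x \<in> S" for x
    by (auto intro!: derivative_eq_intros twice_on_has_derivative[OF assms(2) that]
        twice_on_has_derivative[OF assms(3) that] simp: inner_add_left mult.commute)
  show "twice_on (\<lambda>y. f y * g y) S"
    by (rule twice_onI(1)[OF assms(1) 1 2])
  show "laplacian (\<lambda>y. f y * g y) x
      = f x * laplacian g x + 2 * (grad f x \<bullet> grad g x) + g x * laplacian f x" if "x \<in> S"
    using twice_onI(3)[OF assms(1) 1 2 that]
    by (simp add: laplacian_hess trace_map_add trace_map_scale trace_map_inner
        inner_commute[of "grad g x" "grad f x"])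
qed

lemma twice_on_cmult:
  assumes "open S" "twice_on f S"
  shows "twice_on (\<lambda>y. c * f y) S"
    and "x \<in> S \<Longrightarrow> laplacian (\<lambda>y. c * f y) x = c * laplacian f x"
  using twice_on_mult[OF assms(1) twice_on_const[OF assms(1), of c] assms(2)]
    grad_eq[of "\<lambda>y. c" 0 x]
  by (simp_all add: laplacian_const)

lemma twice_on_diff:
  assumes "open S" "twice_on f S" "twice_on g S"
  shows "twice_on (\<lambda>y. f y - g y) S"
    and "x \<in> S \<Longrightarrow> laplacian (\<lambda>y. f y - g y) x = laplacian f x - laplacian g x"
  using twice_on_add[OF assms(1,2) twice_on_cmult(1)[OF assms(1,3), of "-1"]]
    twice_on_cmult(2)[OF assms(1,3), of x "-1"] by simp_all

text \<open>The radial variable is the square of the distance to \<open>c\<close>. It is a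
  polynomial, so the centre needs no separate treatment whenever \<phi> is differentiable at
  0.\<close>

lemma twice_on_radial:
  fixes c :: "real ^ 'n"
  assumes S: "open S"
    and \<phi>: "\<And>y. y \<in> S \<Longrightarrow> (\<phi> has_real_derivative \<phi>' ((y - c) \<bullet> (y - c))) (at ((y - c) \<bullet> (y - c)))"
      "\<And>y. y \<in> S \<Longrightarrow> (\<phi>' has_real_derivative \<phi>'' ((y - c) \<bullet> (y - c))) (at ((y - c) \<bullet> (y - c)))"
  shows "twice_on (\<lambda>y. \<phi> ((y - c) \<bullet> (y - c))) S"
    and "x \<in> S \<Longrightarrow> grad (\<lambda>y. \<phi> ((y - c) \<bullet> (y - c))) x = (2 * \<phi>' ((x - c) \<bullet> (x - c))) *\<^sub>R (x - c)"
    and "x \<in> S \<Longrightarrow> laplacian (\<lambda>y. \<phi> ((y - c) \<bullet> (y - c))) x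
      = 4 * \<phi>'' ((x - c) \<bullet> (x - c)) * ((x - c) \<bullet> (x - c)) + 2 * real CARD('n) * \<phi>' ((x - c) \<bullet> (x - c))"
proof -
  let ?s = "\<lambda>y. (y - c) \<bullet> (y - c)"
  have s: "(?s has_derivative (\<lambda>h. 2 * ((x - c) \<bullet> h))) (at x)" for x
    by (auto intro!: derivative_eq_intros simp: inner_commute)
  have 1: "((\<lambda>y. \<phi> (?s y)) has_derivative (\<lambda>h. ((2 * \<phi>' (?s x)) *\<^sub>R (x - c)) \<bullet> h)) (at x)" 
    if "x \<in> S" for x
    using has_derivative_compose[OF s, of _ "\<lambda>h. \<phi>' (?s x) * h", OF \<phi>(1)[OF that, unfolded has_field_derivative_def]]
    by (simp add: mult.assoc mult.left_commute)
  have 2: "((\<lambda>y. \<phi>' (?s y)) has_derivative (\<lambda>h. \<phi>'' (?s x) * (2 * ((x - c) \<bullet> h)))) (at x)" 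
    if "x \<in> S" for x
    using has_derivative_compose[OF s, of _ "\<lambda>h. \<phi>'' (?s x) * h", OF \<phi>(2)[OF that, unfolded has_field_derivative_def]]
    by simp
  have 3: "((\<lambda>y. (2 * \<phi>' (?s y)) *\<^sub>R (y - c)) has_derivative
      (\<lambda>h. (2 * \<phi>' (?s x)) *\<^sub>R h + (4 * \<phi>'' (?s x)) *\<^sub>R (((x - c) \<bullet> h) *\<^sub>R (x - c)))) (at x)"
    if "x \<in> S" for x
  proof -
    have "((\<lambda>y. (2 * \<phi>' (?s y)) *\<^sub>R (y - c)) has_derivative
      (\<lambda>h. (2 * \<phi>' (?s x)) *\<^sub>R (h - 0) + (2 * (\<phi>'' (?s x) * (2 * ((x - c) \<bullet> h)))) *\<^sub>R (x - c))) (at x)"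
      by (rule derivative_intros 2[OF that])+
    then show ?thesis
      by (rule has_derivative_eq_rhs) (simp add: fun_eq_iff)
  qed
  show "twice_on (\<lambda>y. \<phi> (?s y)) S"
    by (rule twice_onI(1)[OF S 1 3])
  show "grad (\<lambda>y. \<phi> (?s y)) x = (2 * \<phi>' (?s x)) *\<^sub>R (x - c)" if "x \<in> S"
    by (rule twice_onI(2)[OF S 1 3 that])
  show "laplacian (\<lambda>y. \<phi> (?s y)) x = 4 * \<phi>'' (?s x) * ?s x + 2 * real CARD('n) * \<phi>' (?s x)" if "x \<in> S"
    using twice_onI(3)[OF S 1 3 that]
    by (simp add: trace_map_add trace_map_scale trace_map_inner trace_map_ident del: scaleR_scaleR)
qed

lemma twice_on_shift:
  assumes "open S" "twice_on f S"
  shows "twice_on (\<lambda>y. f (c + y)) {y. c + y \<in> S}"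
    and "c + x \<in> S \<Longrightarrow> laplacian (\<lambda>y. f (c + y)) x = laplacian f (c + x)"
proof -
  have S: "open {y. c + y \<in> S}"
  proof -
    have "{y. c + y \<in> S} = (\<lambda>y. c + y) -` S" by auto
    moreover have "continuous_on UNIV (\<lambda>y. c + y)" by (intro continuous_intros)
    ultimately show ?thesis using open_vimage[OF assms(1), of "\<lambda>y. c + y"] by simp
  qed
  have sh: "((\<lambda>y. c + y) has_derivative (\<lambda>h. h)) (at x)" for x
    by (auto intro!: derivative_eq_intros)
  have 1: "((\<lambda>y. f (c + y)) has_derivative (\<lambda>h. grad f (c + x) \<bullet> h)) (at x)"
    and 2: "((\<lambda>y. grad f (c + y)) has_derivative hess f (c + x)) (at x)"
    if "x \<in> {y. c + y \<in> S}" for x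
    using has_derivative_compose[OF sh twice_on_has_derivative(1)[OF assms(2)]]
      has_derivative_compose[OF sh twice_on_has_derivative(2)[OF assms(2)]] that by simp_all
  show "twice_on (\<lambda>y. f (c + y)) {y. c + y \<in> S}"
    by (rule twice_onI(1)[OF S 1 2])
  show "laplacian (\<lambda>y. f (c + y)) x = laplacian f (c + x)" if "c + x \<in> S"
    using twice_onI(3)[OF S 1 2, of x] that by (simp add: laplacian_hess)
qed

text \<open>A negative Laplacian would make one pure second derivative negative. Along that axis the
  first derivative vanishes at the minimum and is negative just after it, so \<open>f\<close> would
  drop below its minimum.\<close>

lemma laplacian_nonneg_at_local_min:
  fixes f :: "real ^ 'n \<Rightarrow> real"
  assumes S: "open S" "x \<in> S" and f: "twice_on f S" and min: "\<And>y. y \<in> S \<Longrightarrow> f x \<le> f y"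
  shows "0 \<le> laplacian f x"
  unfolding laplacian_def
proof (rule sum_nonneg, rule ccontr)
  fix i :: 'n
  let ?L = "\<lambda>t. x + t *\<^sub>R axis i 1"
  let ?h = "\<lambda>t. partial i f (?L t)"
  assume "\<not> 0 \<le> partial i (partial i f) x"
  then have neg: "partial i (partial i f) x < 0" by simp
  obtain e where e: "e > 0" "ball x e \<subseteq> S"
    using S openE by blast
  have LS: "?L t \<in> S" if "\<bar>t\<bar> < e" for t
  proof -
    have "norm (axis i (1::real)) = 1"
      by (simp add: norm_eq_sqrt_inner inner_axis)
    then have "?L t \<in> ball x e"
      using that by (simp add: dist_norm)
    then show ?thesis
      using e(2) by blast
  qed
  have L: "(?L has_derivative (\<lambda>h. h *\<^sub>R axis i 1)) (at t)" for t
    by (auto intro!: derivative_eq_intros)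
  have d1: "((\<lambda>t. f (?L t)) has_real_derivative ?h t) (at t)" if "\<bar>t\<bar> < e" for t
    unfolding has_field_derivative_def
    by (rule has_derivative_eq_rhs[OF has_derivative_compose[OF L twice_on_has_derivative(1)[OF f LS[OF that]]]])
      (simp add: grad_def inner_axis fun_eq_iff)
  have d2: "(?h has_real_derivative partial i (partial i f) x) (at 0)"
  proof -
    have "partial i f differentiable (at x)"
      using f S(2) unfolding twice_on_def by blast
    then have "(partial i f has_derivative (\<lambda>h. grad (partial i f) x \<bullet> h)) (at (?L 0))"
      using has_derivative_grad[of "partial i f" x] by simp
    from has_derivative_compose[OF L this] show ?thesis
      unfolding has_field_derivative_def
      by (rule has_derivative_eq_rhs) (simp add: grad_def inner_axis fun_eq_iff)
  qed
  have h0: "?h 0 = 0"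
  proof (rule DERIV_local_min[OF d1])
    show "\<bar>0\<bar> < e" "0 < e" using e by auto
    show "\<forall>y. \<bar>0 - y\<bar> < e \<longrightarrow> f (?L 0) \<le> f (?L y)" using min[OF LS] by simp
  qed
  obtain d where d: "d > 0" "\<And>t. 0 < t \<Longrightarrow> t < d \<Longrightarrow> ?h t < 0"
    using DERIV_neg_dec_right[OF d2 neg] h0 by (auto simp: scaleR_left_distrib)
  define b where "b = min d e / 2"
  have b: "0 < b" "b < d" "b < e" using d(1) e(1) by (auto simp: b_def)
  have "f (?L b) < f (?L 0)"
  proof (rule DERIV_neg_imp_decreasing_open[OF b(1)])
    show "\<exists>y. ((\<lambda>t. f (?L t)) has_real_derivative y) (at t) \<and> y < 0" if "0 < t" "t < b" for t
      using d1[of t] d(2)[of t] that b by auto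
    show "continuous_on {0..b} (\<lambda>t. f (?L t))"
      using b by (intro continuous_at_imp_continuous_on ballI DERIV_isCont[OF d1]) auto
  qed
  with min[OF LS[of b]] b show False by simp
qed

subsection \<open>Minimum principles\<close>

text \<open>The fundamental solution of the Laplacian up to a constant factor. A natural power of
  the reciprocal is taken so that it matches the weight in the Kelvin transform; for N \<ge> 3 its
  conventional value at \<open>c\<close> is 0.\<close>

definition fund :: "real ^ 'n \<Rightarrow> real ^ 'n \<Rightarrow> real" where
  "fund c y = (1 / norm (y - c)) ^ (CARD('n) - 2)"

lemma fund_eq_powr:
  fixes c :: "real ^ 'n"
  assumes "3 \<le> CARD('n)" "y \<noteq> c"
  shows "fund c y = ((y - c) \<bullet> (y - c)) powr (1 - real CARD('n) / 2)"
proof -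
  have n: "norm (y - c) > 0" using assms by simp
  have "fund c y = (1 / norm (y - c)) powr (real CARD('n) - 2)"
    unfolding fund_def using n assms(1)
    by (subst powr_realpow[symmetric]) (auto simp: of_nat_diff)
  also have "\<dots> = ((norm (y - c)) powr 2) powr (1 - real CARD('n) / 2)"
  proof -
    have "2 * (1 - real CARD('n) / 2) = - (real CARD('n) - 2)" by simp
    then show ?thesis
      using n by (simp only: powr_powr powr_minus_divide) (simp add: powr_divide)
  qed
  also have "(norm (y - c)) powr 2 = (y - c) \<bullet> (y - c)"
    using n by (simp add: power2_norm_eq_inner)
  finally show ?thesis .
qed

lemma fund_harmonic:
  fixes c :: "real ^ 'n"
  assumes N: "3 \<le> CARD('n)"
  shows "twice_on (fund c) (- {c})"
    and "y \<noteq> c \<Longrightarrow> laplacian (fund c) y = 0"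
proof -
  \<comment> \<open>The exponent solves 4 s (s - 1) + 2 N s = 0, which is harmonicity in the
    variable |y - c|^2.\<close>
  define s where "s = 1 - real CARD('n) / 2"
  let ?q = "\<lambda>y. (y - c) \<bullet> (y - c)"
  let ?f' = "\<lambda>x. s * x powr (s - 1)"
  let ?f'' = "\<lambda>x. s * ((s - 1) * x powr (s - 2))"
  have op: "open (- {c})" by auto
  have d1: "((\<lambda>x. x powr s) has_real_derivative ?f' x) (at x)" if "x > 0" for x
    using that by (auto intro!: derivative_eq_intros)
  have d2: "(?f' has_real_derivative ?f'' x) (at x)" if "x > 0" for x
    using that by (auto intro!: derivative_eq_intros)
  have q: "?q y > 0" if "y \<in> - {c}" for y
    using that by simp
  note R = twice_on_radial[OF op d1[OF q] d2[OF q]]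
  have eq: "?q y powr s = fund c y" if "y \<in> - {c}" for y
    using that fund_eq_powr[OF N, of y c] by (simp add: s_def)
  show "twice_on (fund c) (- {c})"
    by (rule twice_on_cong[OF op eq R(1)])
  show "laplacian (fund c) y = 0" if "y \<noteq> c"
  proof -
    have y: "y \<in> - {c}" using that by simp
    have "laplacian (fund c) y = laplacian (\<lambda>y. ?q y powr s) y"
      using laplacian_cong_open[OF op y eq] by (rule sym)
    also have "\<dots> = 4 * ?f'' (?q y) * ?q y + 2 * real CARD('n) * ?f' (?q y)"
      using R(3)[of y] y by auto
    also have "?q y powr (s - 1) = ?q y powr (s - 2) * ?q y"
      using q[OF y] powr_add[of "?q y" "s - 2" 1] by simp
    finally show ?thesis
      by (simp add: s_def field_simps)
  qed
qed

lemma fund_nonneg: "0 \<le> fund c y"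
  by (simp add: fund_def)

lemma fund_scale: "0 \<le> R \<Longrightarrow> (R / norm (y - c)) ^ (CARD('n) - 2) = R ^ (CARD('n) - 2) * fund c y"
  for c :: "real ^ 'n"
  by (simp add: fund_def power_divide)

lemma continuous_on_fund: "continuous_on (- {c}) (fund c)"
  unfolding fund_def by (auto intro!: continuous_intros)

lemma fund_large_near:
  fixes c :: "real ^ 'n"
  assumes N: "3 \<le> CARD('n)"
  obtains r where "r > 0" "\<And>y. y \<noteq> c \<Longrightarrow> norm (y - c) \<le> r \<Longrightarrow> B \<le> fund c y"
proof
  define r where "r = 1 / (\<bar>B\<bar> + 1)"
  show "r > 0" by (simp add: r_def)
  fix y :: "real ^ 'n"
  assume y: "y \<noteq> c" "norm (y - c) \<le> r"
  have "B \<le> \<bar>B\<bar> + 1" by simp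
  also have "\<dots> = 1 / r" by (simp add: r_def)
  also have b: "\<dots> \<le> 1 / norm (y - c)" using y by (intro divide_left_mono) (auto simp: r_def)
  also have "1 / norm (y - c) \<le> fund c y"
  proof -
    have "1 \<le> 1 / r" by (simp add: r_def)
    with b have "1 \<le> 1 / norm (y - c)" by linarith
    moreover have "0 < CARD('n) - 2" using N by simp
    ultimately show ?thesis
      unfolding fund_def by (rule self_le_power)
  qed
  finally show "B \<le> fund c y" .
qed

lemma fund_small_far:
  fixes c :: "real ^ 'n"
  assumes N: "3 \<le> CARD('n)" and e: "e > 0"
  obtains R where "\<And>y. R \<le> norm y \<Longrightarrow> fund c y \<le> e"
proof
  fix y :: "real ^ 'n"
  assume y: "norm c + 1 + 1 / e \<le> norm y"
  have n: "1 + 1 / e \<le> norm (y - c)"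
    using y norm_triangle_sub[of y c] by linarith
  have e': "1 / e > 0" using e by simp
  have p: "1 \<le> norm (y - c)" "1 / e \<le> norm (y - c)" using n e' by linarith+
  have "1 / norm (y - c) \<le> 1 / (1 / e)"
    using p e' by (intro divide_left_mono mult_pos_pos) auto
  then have q: "1 / norm (y - c) \<le> 1" "1 / norm (y - c) \<le> e"
    using p order.strict_trans2[OF zero_less_one p(1)] by (simp_all add: pos_divide_le_eq del: zero_less_norm_iff)
  have "fund c y \<le> (1 / norm (y - c)) ^ 1"
    unfolding fund_def using q N by (intro power_decreasing) auto
  with q show "fund c y \<le> e" by simp
qed

lemma twice_on_norm_square:
  shows "twice_on (\<lambda>y::real^'n. y \<bullet> y) S'" and "laplacian (\<lambda>y::real^'n. y \<bullet> y) x = 2 * real CARD('n)"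
proof -
  have 1: "((\<lambda>x. x) has_real_derivative (\<lambda>x. 1) t) (at t)"
    and 2: "((\<lambda>x::real. 1::real) has_real_derivative (\<lambda>x. 0) t) (at t)" for t :: real
    by (auto intro!: derivative_eq_intros)
  note R = twice_on_radial[OF open_UNIV 1 2, where c = "0::real^'n"]
  show "twice_on (\<lambda>y::real^'n. y \<bullet> y) S'"
    using twice_on_subset[OF R(1)] by simp
  show "laplacian (\<lambda>y::real^'n. y \<bullet> y) x = 2 * real CARD('n)"
    using R(3)[of x] by simp
qed

text \<open>At \<open>p\<close> only a lower bound is assumed: adding e times the fundamental
  solution with pole \<open>p\<close> makes the function large near \<open>p\<close>, and e is sent
  to 0 in the end. Subtracting a small multiple of |y|^2 makes the Laplacian strictly negative, so
  the minimum over a compact piece cannot be interior.\<close>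

lemma min_principle:
  fixes w :: "real ^ 'n \<Rightarrow> real"
  assumes N: "3 \<le> CARD('n)" and \<Omega>: "open \<Omega>" "closed F" "\<Omega> \<subseteq> F"
    and cont: "continuous_on (F - {p}) w"
    and tw: "twice_on w (\<Omega> - {p})"
    and lap: "\<And>y. y \<in> \<Omega> - {p} \<Longrightarrow> laplacian w y \<le> 0"
    and bd: "\<And>y. y \<in> F - \<Omega> - {p} \<Longrightarrow> 0 \<le> w y"
    and inf: "\<And>e. e > 0 \<Longrightarrow> \<exists>R. \<forall>y\<in>\<Omega> - {p}. R \<le> norm y \<longrightarrow> - e \<le> w y"
    and pun: "\<exists>M r. r > 0 \<and> (\<forall>y\<in>\<Omega> - {p}. norm (y - p) < r \<longrightarrow> - M \<le> w y)"
    and y0: "y0 \<in> \<Omega> - {p}"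
  shows "0 \<le> w y0"
proof -
  have main: "- (e * (1 + fund p y0)) \<le> w y0" if e: "e > 0" for e
  proof -
    obtain R1 where R1: "\<And>y. y \<in> \<Omega> - {p} \<Longrightarrow> R1 \<le> norm y \<Longrightarrow> - e \<le> w y"
      using inf[OF e] by blast
    define R where "R = max (max R1 (norm y0 + 1)) 1"
    have R: "R1 \<le> R" "norm y0 < R" "1 \<le> R" by (auto simp: R_def)
    obtain M r where M: "r > 0" "\<And>y. y \<in> \<Omega> - {p} \<Longrightarrow> norm (y - p) < r \<Longrightarrow> - M \<le> w y"
      using pun by blast
    obtain r1 where r1: "r1 > 0" "\<And>y. y \<noteq> p \<Longrightarrow> norm (y - p) \<le> r1 \<Longrightarrow> M / e \<le> fund p y"
      using fund_large_near[OF N] by blast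
    \<comment> \<open>Small enough that on the sphere of radius \<open>r2\<close> about
      \<open>p\<close> the term \<open>e * fund p\<close> outweighs the lower bound
      \<open>- M\<close>, and that \<open>y0\<close> stays outside.\<close>
    define r2 where "r2 = min (min r r1) (norm (y0 - p)) / 2"
    have r2: "0 < r2" "r2 < r" "r2 < r1" "r2 < norm (y0 - p)"
      using M(1) r1(1) y0 zero_less_norm_iff[of "y0 - p"] unfolding r2_def
      by (simp_all add: min_def del: zero_less_norm_iff) 
    define K where "K = F \<inter> cball 0 R - ball p r2"
    have K: "compact K"
      unfolding K_def using \<Omega> by (intro compact_diff closed_Int_compact) auto
    have pK: "p \<notin> K" using r2 by (simp add: K_def)
    have y0K: "y0 \<in> K"
      using y0 R r2 \<Omega>(3) by (auto simp: K_def dist_norm norm_minus_commute)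
    define W where "W = (\<lambda>y. w y + e * fund p y)"
    have "- e \<le> W y0 + h" if h: "h > 0" for h
    proof -
      \<comment> \<open>The perturbation \<open>t * (y \<bullet> y)\<close> then costs at most
        \<open>h\<close> on the ball of radius \<open>R\<close>.\<close>
      define t where "t = h / R\<^sup>2"
      have t: "t > 0" using h R by (simp add: t_def)
      define V where "V = (\<lambda>y. W y - t * (y \<bullet> y))"
      have "continuous_on K V"
        unfolding V_def W_def using pK
        by (intro continuous_intros continuous_on_subset[OF cont] continuous_on_subset[OF continuous_on_fund])
          (auto simp: K_def)
      then obtain z where z: "z \<in> K" "\<And>y. y \<in> K \<Longrightarrow> V z \<le> V y"
        using continuous_attains_inf[OF K] y0K by blast
      have zR: "z \<bullet> z \<le> R\<^sup>2" "norm z \<le> R"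
        using z(1) R(3) by (auto simp: K_def dist_norm power2_norm_eq_inner[symmetric] intro: power_mono)
      have zp: "z \<noteq> p" using z pK by auto
      have W0: "W y0 \<ge> W z - h"
      proof -
        have "V z \<le> W y0"
        proof -
          have "V z \<le> V y0" by (rule z(2)[OF y0K])
          also have "\<dots> \<le> W y0" using t by (simp add: V_def)
          finally show ?thesis .
        qed
        moreover have "t * (z \<bullet> z) \<le> t * R\<^sup>2"
          using t zR(1) by (intro mult_left_mono) auto
        moreover have "t * R\<^sup>2 = h" using R(3) by (simp add: t_def)
        ultimately show ?thesis by (simp add: V_def)
      qed
      have "- e \<le> W z"
      proof (cases "z \<in> \<Omega>")
        case False
        then have "0 \<le> w z" using z zp by (intro bd) (auto simp: K_def)
        then show ?thesis using e fund_nonneg[of p z] by (simp add: W_def add_nonneg_nonneg order.trans[of "-e" 0])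
      next
        case z\<Omega>: True
        consider "norm z = R" | "norm (z - p) = r2" | "norm z < R" "r2 < norm (z - p)"
          using z(1) by (fastforce simp: K_def dist_norm norm_minus_commute)
        then show ?thesis
        proof cases
          case 1
          then have "- e \<le> w z" using R1[of z] z\<Omega> zp R by simp
          then show ?thesis using e fund_nonneg[of p z] mult_nonneg_nonneg[of e "fund p z"] unfolding W_def by linarith
        next
          case 2
          then have "- M \<le> w z" "M / e \<le> fund p z"
            using M(2)[of z] r1(2)[of z] z\<Omega> zp r2 by auto
          moreover have "e * (M / e) \<le> e * fund p z"
            using calculation(2) e by (intro mult_left_mono) auto
          ultimately show ?thesis using e by (simp add: W_def)
        next
          case 3
          define U where "U = \<Omega> \<inter> ball 0 R - cball p r2"
          have U: "open U" "z \<in> U" "U \<subseteq> K" "U \<subseteq> \<Omega> - {p}" "U \<subseteq> - {p}"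
            using 3 z\<Omega> \<Omega> r2 by (auto simp: U_def K_def dist_norm norm_minus_commute)
          have tf: "twice_on (fund p) U" and twU: "twice_on w U"
            using twice_on_subset[OF fund_harmonic(1)[OF N, of p] U(5)] twice_on_subset[OF tw U(4)] by auto
          note c1 = twice_on_cmult[OF U(1) tf, where c = e]
          note c2 = twice_on_cmult[OF U(1) twice_on_norm_square(1), where c = t]
          note a = twice_on_add[OF U(1) twU c1(1)]
          note d = twice_on_diff[OF U(1) a(1) c2(1)]
          have "0 \<le> laplacian V z"
            using laplacian_nonneg_at_local_min[OF U(1,2) d(1)] z(2) U(3)
            unfolding V_def W_def by blast
          also have "laplacian V z = laplacian w z - t * (2 * real CARD('n))"
            unfolding V_def W_def
            using d(2)[OF U(2)] a(2)[OF U(2)] c1(2)[OF U(2)] c2(2)[OF U(2)] fund_harmonic(2)[OF N zp]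
              twice_on_norm_square(2)[of z] by simp
          also have "\<dots> < 0"
            using lap[of z] z\<Omega> zp t by (smt (verit) Diff_iff N mult_pos_pos of_nat_0_less_iff singletonD zero_less_card_finite)
          finally show ?thesis by simp
        qed
      qed
      with W0 show ?thesis by simp
    qed
    then have "- e \<le> W y0" by (rule field_le_epsilon)
    then show ?thesis by (simp add: W_def algebra_simps)
  qed
  show ?thesis
  proof (rule field_le_epsilon)
    fix h :: real assume "h > 0"
    moreover have "0 < 1 + fund p y0" using fund_nonneg[of p y0] by linarith
    ultimately show "0 \<le> w y0 + h"
      using main[of "h / (1 + fund p y0)"] by simp
  qed
qed

text \<open>Radial harmonic functions with pole outside the domain serve as barriers: subtracting
  one keeps the function superharmonic, and it is bounded on \<open>F\<close>, so the hypothesis at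
  \<open>p\<close> survives.\<close>

lemma min_principle_fund:
  fixes w :: "real ^ 'n \<Rightarrow> real"
  assumes N: "3 \<le> CARD('n)" and \<Omega>: "open \<Omega>" "closed F" "\<Omega> \<subseteq> F" and c: "c \<notin> F"
    and cont: "continuous_on (F - {p}) w"
    and tw: "twice_on w (\<Omega> - {p})"
    and lap: "\<And>y. y \<in> \<Omega> - {p} \<Longrightarrow> laplacian w y \<le> 0"
    and bd: "\<And>y. y \<in> F - \<Omega> - {p} \<Longrightarrow> a + b * fund c y \<le> w y"
    and inf: "\<And>e. e > 0 \<Longrightarrow> \<exists>R. \<forall>y\<in>\<Omega> - {p}. R \<le> norm y \<longrightarrow> a + b * fund c y - e \<le> w y"
    and pun: "\<exists>M r. r > 0 \<and> (\<forall>y\<in>\<Omega> - {p}. norm (y - p) < r \<longrightarrow> - M \<le> w y)"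
    and y0: "y0 \<in> \<Omega> - {p}"
  shows "a + b * fund c y0 \<le> w y0"
proof -
  let ?b = "\<lambda>y. a + b * fund c y"
  have op: "open (\<Omega> - {p})" using \<Omega> by auto
  have sub: "\<Omega> - {p} \<subseteq> - {c}" "F - {p} \<subseteq> - {c}" using \<Omega> c by auto
  have tb: "twice_on ?b (\<Omega> - {p})" and lb: "y \<in> \<Omega> - {p} \<Longrightarrow> laplacian ?b y = 0" for y
  proof -
    note f = twice_on_subset[OF fund_harmonic(1)[OF N, of c] sub(1)]
    note m = twice_on_cmult[OF op f, where c = b]
    note A = twice_on_add[OF op twice_on_const[OF op, where c = a] m(1)]
    show "twice_on ?b (\<Omega> - {p})" by (rule A(1))
    assume y: "y \<in> \<Omega> - {p}"
    then show "laplacian ?b y = 0"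
      using A(2)[OF y] m(2)[OF y] fund_harmonic(2)[OF N, of y c] sub(1) by (auto simp: laplacian_const)
  qed
  obtain r0 where r0: "r0 > 0" "\<And>y. y \<in> F \<Longrightarrow> r0 \<le> norm (y - c)"
  proof -
    have "open (- F)" "c \<in> - F" using \<Omega>(2) c by auto
    then obtain r where "r > 0" "ball c r \<subseteq> - F" using openE by blast
    then show ?thesis
      by (intro that[of r]) (auto simp: dist_norm norm_minus_commute subset_iff linorder_not_less[symmetric])
  qed
  have "0 \<le> w y0 - ?b y0"
  proof (rule min_principle[OF N \<Omega>, where p = p and w = "\<lambda>y. w y - ?b y"])
    show "continuous_on (F - {p}) (\<lambda>y. w y - ?b y)"
      by (intro continuous_intros cont continuous_on_subset[OF continuous_on_fund sub(2)])
    show "twice_on (\<lambda>y. w y - ?b y) (\<Omega> - {p})"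
      by (rule twice_on_diff(1)[OF op tw tb])
    show "laplacian (\<lambda>y. w y - ?b y) y \<le> 0" if "y \<in> \<Omega> - {p}" for y
      using twice_on_diff(2)[OF op tw tb that] lb[OF that] lap[OF that] by simp
    show "0 \<le> w y - ?b y" if "y \<in> F - \<Omega> - {p}" for y
      using bd[OF that] by simp
    show "\<exists>R. \<forall>y\<in>\<Omega> - {p}. R \<le> norm y \<longrightarrow> - e \<le> w y - ?b y" if e: "e > 0" for e
    proof -
      obtain R where R: "\<forall>y\<in>\<Omega> - {p}. R \<le> norm y \<longrightarrow> ?b y - e \<le> w y"
        using inf[OF e] ..
      show ?thesis
      proof (intro exI[of _ R] ballI impI)
        fix y assume "y \<in> \<Omega> - {p}" "R \<le> norm y"
        with R have "?b y - e \<le> w y" by blast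
        then show "- e \<le> w y - ?b y" by linarith
      qed
    qed
    show "\<exists>M r. 0 < r \<and> (\<forall>y\<in>\<Omega> - {p}. norm (y - p) < r \<longrightarrow> - M \<le> w y - ?b y)"
    proof -
      obtain M r where M: "r > 0" "\<And>y. y \<in> \<Omega> - {p} \<Longrightarrow> norm (y - p) < r \<Longrightarrow> - M \<le> w y"
        using pun by blast
      \<comment> \<open>A bound for the barrier, as all of \<open>F\<close> has distance at least
        \<open>r0\<close> from the pole.\<close>
      define B where "B = \<bar>a\<bar> + \<bar>b\<bar> * (1 / r0) ^ (CARD('n) - 2)"
      have "?b y \<le> B" if "y \<in> \<Omega>" for y
      proof -
        have n: "r0 \<le> norm (y - c)" using r0(2)[of y] that \<Omega>(3) by blast
        then have "y \<noteq> c" using r0(1) by auto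
        with n have "fund c y \<le> (1 / r0) ^ (CARD('n) - 2)"
          unfolding fund_def using r0(1)
          by (intro power_mono divide_left_mono mult_pos_pos) (auto simp: less_le_trans[OF r0(1)])
        then have "\<bar>b\<bar> * fund c y \<le> \<bar>b\<bar> * (1 / r0) ^ (CARD('n) - 2)"
          by (intro mult_left_mono) auto
        moreover have "b * fund c y \<le> \<bar>b\<bar> * fund c y"
          by (intro mult_right_mono fund_nonneg) auto
        ultimately show ?thesis by (simp add: B_def)
      qed
      then have "- (M + B) \<le> w y - ?b y" if "y \<in> \<Omega> - {p}" "norm (y - p) < r" for y
        using M(2)[OF that] that(1) by (smt (verit) DiffD1)
      with M(1) show ?thesis by blast
    qed
  qed (rule y0)
  then show ?thesis by simp
qed

text \<open>Hopf's boundary point argument. If zeros and nonzeros met, a ball of positivity would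
  touch the zero set at some \<open>z\<close>; a radial barrier makes \<open>w\<close> grow at least
  linearly from \<open>z\<close> into the ball, whereas the gradient vanishes at \<open>z\<close>,
  an interior minimum.\<close>

lemma strong_min_principle:
  fixes w :: "real ^ 'n \<Rightarrow> real"
  assumes N: "3 \<le> CARD('n)" and U: "open U" "connected U"
    and tw: "twice_on w U" and lap: "\<And>y. y \<in> U \<Longrightarrow> laplacian w y \<le> 0"
    and nn: "\<And>y. y \<in> U \<Longrightarrow> 0 \<le> w y" and q: "q \<in> U" "w q = 0" and y: "y \<in> U"
  shows "w y = 0"
proof -
  have cw: "continuous_on U w"
    using tw by (auto simp: twice_on_def intro!: continuous_at_imp_continuous_on differentiable_imp_continuous_within)
  have key: "w c = 0" if s: "s > 0" "cball z0 (3 * s) \<subseteq> U" and z0: "w z0 = 0" and cb: "c \<in> ball z0 s" for z0 c s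
  proof (rule ccontr)
    assume "w c \<noteq> 0"
    \<comment> \<open>Since \<open>c\<close> has distance less than \<open>s\<close> from the zero
      \<open>z0\<close>, the zero nearest to \<open>c\<close> has distance r < s, and the closed
      ball of radius \<open>r\<close> about \<open>c\<close> stays within distance 2 s of
      \<open>z0\<close>.\<close>
    define Z where "Z = cball z0 (2 * s) \<inter> w -` {0}"
    have sub2: "cball z0 (2 * s) \<subseteq> U" using s by (auto simp: subset_iff)
    have "closed Z"
      unfolding Z_def
      by (intro continuous_closed_preimage continuous_on_subset[OF cw sub2]) auto
    moreover have "z0 \<in> Z" using s z0 by (simp add: Z_def)
    ultimately obtain z where z: "z \<in> Z" "\<And>y. y \<in> Z \<Longrightarrow> dist c z \<le> dist c y"
      using distance_attains_inf[of Z c] by blast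
    define r where "r = norm (z - c)"
    have rs: "r < s" using z(2)[OF \<open>z0 \<in> Z\<close>] cb by (simp add: r_def dist_norm norm_minus_commute)
    have wz: "w z = 0" using z by (simp add: Z_def)
    have r: "r > 0" using wz \<open>w c \<noteq> 0\<close> by (auto simp: r_def)
    have cr: "cball c r \<subseteq> cball z0 (2 * s)"
    proof
      fix y assume "y \<in> cball c r"
      then show "y \<in> cball z0 (2 * s)"
        using rs cb dist_triangle[of z0 y c] by simp
    qed
    have crU: "cball c r \<subseteq> U" using cr sub2 by blast
    have pos: "w y > 0" if "y \<in> ball c r" for y
    proof -
      have "y \<in> cball z0 (2 * s)" using that cr ball_subset_cball[of c r] by blast
      moreover have "y \<notin> Z" using z(2)[of y] that by (auto simp: r_def dist_norm norm_minus_commute)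
      ultimately show ?thesis using nn[of y] sub2 by (auto simp: Z_def less_le)
    qed
    have "sphere c (r / 2) \<subseteq> cball c r" using r by auto
    then have "continuous_on (sphere c (r / 2)) w"
      using crU by (intro continuous_on_subset[OF cw]) (rule order_trans)
    moreover have "sphere c (r / 2) \<noteq> {}" using r by (simp add: sphere_eq_empty)
    ultimately obtain x1 where x1: "x1 \<in> sphere c (r / 2)" "\<And>y. y \<in> sphere c (r / 2) \<Longrightarrow> w x1 \<le> w y"
      using continuous_attains_inf[OF compact_sphere] by blast
    define m where "m = w x1"
    have m: "m > 0" using pos[of x1] x1 r by (simp add: m_def)
    let ?k = "CARD('n) - 2"
    define d where "d = (2 / r) ^ ?k - (1 / r) ^ ?k"
    have d: "d > 0"
      unfolding d_def using r N by (simp add: power_strict_mono divide_strict_right_mono)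
    \<comment> \<open>Normalises the barrier to be 0 on the outer sphere of radius \<open>r\<close>
      and \<open>m\<close> on the inner sphere of radius r/2.\<close>
    define \<kappa> where "\<kappa> = m / d"
    have \<kappa>: "\<kappa> > 0" using m d by (simp add: \<kappa>_def)
    let ?\<Omega> = "ball c r - cball c (r / 2)"
    let ?F = "cball c r - ball c (r / 2)"
    have bar: "- (\<kappa> * (1 / r) ^ ?k) + \<kappa> * fund c y \<le> w y" if "y \<in> ?\<Omega> - {c}" for y
    proof (rule min_principle_fund[OF N, where F = ?F and \<Omega> = ?\<Omega> and p = c and w = w])
      show "continuous_on (?F - {c}) w" using crU by (intro continuous_on_subset[OF cw]) auto
      show "twice_on w (?\<Omega> - {c})" using crU by (intro twice_on_subset[OF tw]) auto
      show "laplacian w y \<le> 0" if "y \<in> ?\<Omega> - {c}" for y using crU that by (intro lap) auto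
      show "- (\<kappa> * (1 / r) ^ ?k) + \<kappa> * fund c y \<le> w y" if "y \<in> ?F - ?\<Omega> - {c}" for y
      proof -
        consider "norm (y - c) = r" | "norm (y - c) = r / 2"
          using \<open>y \<in> ?F - ?\<Omega> - {c}\<close> by (fastforce simp: dist_norm norm_minus_commute)
        then show ?thesis
        proof cases
          case 1
          then show ?thesis using nn[of y] crU by (auto simp: fund_def dist_norm norm_minus_commute)
        next
          case 2
          then have "- (\<kappa> * (1 / r) ^ ?k) + \<kappa> * fund c y = m"
          proof -
            have "1 / norm (y - c) = 2 / r" by (subst 2) simp
            then have "- (\<kappa> * (1 / r) ^ ?k) + \<kappa> * fund c y = \<kappa> * d"
              by (simp add: fund_def d_def right_diff_distrib)
            then show ?thesis using d by (simp add: \<kappa>_def)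
          qed
          then show ?thesis using x1(2)[of y] 2 by (simp add: m_def dist_norm norm_minus_commute)
        qed
      qed
      show "\<exists>R. \<forall>y\<in>?\<Omega> - {c}. R \<le> norm y \<longrightarrow> - (\<kappa> * (1 / r) ^ ?k) + \<kappa> * fund c y - e \<le> w y" for e
      proof (intro exI ballI impI)
        fix y assume "y \<in> ?\<Omega> - {c}" "norm c + r + 1 \<le> norm y"
        then show "- (\<kappa> * (1 / r) ^ ?k) + \<kappa> * fund c y - e \<le> w y"
          using norm_triangle_sub[of y c] by (auto simp: dist_norm norm_minus_commute)
      qed
      show "\<exists>M ra. 0 < ra \<and> (\<forall>y\<in>?\<Omega> - {c}. norm (y - c) < ra \<longrightarrow> - M \<le> w y)"
        using r by (intro exI[of _ 0] exI[of _ "r/2"]) (auto simp: dist_norm norm_minus_commute)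
    qed (use r that in auto)
    let ?h = "\<lambda>t. w (z + t *\<^sub>R (c - z))"
    have L: "((\<lambda>t. z + t *\<^sub>R (c - z)) has_derivative (\<lambda>h. h *\<^sub>R (c - z))) (at t)" for t
      by (auto intro!: derivative_eq_intros)
    have zU: "z \<in> U" using z sub2 by (auto simp: Z_def)
    have dh: "(?h has_real_derivative (grad w z \<bullet> (c - z))) (at 0)"
    proof -
      have "(w has_derivative (\<lambda>h. grad w z \<bullet> h)) (at (z + 0 *\<^sub>R (c - z)))"
        using twice_on_has_derivative(1)[OF tw zU] by simp
      from has_derivative_compose[OF L this] show ?thesis
        unfolding has_field_derivative_def
        by (rule has_derivative_eq_rhs) (simp add: fun_eq_iff)
    qed
    have h0: "?h 0 = 0" using wz by simp
    have g0: "grad w z \<bullet> (c - z) = 0"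
    proof (rule DERIV_local_min[OF dh])
      show "0 < (1::real)" by simp
      \<comment> \<open>Here the third \<open>s\<close> is spent: z is within 2 s of
        \<open>z0\<close>, and moving by |t| r < s stays in \<open>U\<close>.\<close>
      show "\<forall>t. \<bar>0 - t\<bar> < 1 \<longrightarrow> ?h 0 \<le> ?h t"
      proof (intro allI impI)
        fix t :: real assume t: "\<bar>0 - t\<bar> < 1"
        have "norm (z + t *\<^sub>R (c - z) - z0) \<le> norm (z - z0) + \<bar>t\<bar> * r"
          using norm_triangle_ineq[of "z - z0" "t *\<^sub>R (c - z)"]
          by (simp add: r_def norm_minus_commute[of z c] add_diff_eq diff_add_eq)
        also have "\<dots> \<le> 2 * s + 1 * s"
          using z(1) t rs r s(1) by (intro add_mono mult_mono) (auto simp: Z_def dist_norm norm_minus_commute)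
        finally have "z + t *\<^sub>R (c - z) \<in> U" using s(2) by (auto simp: dist_norm norm_minus_commute subset_iff)
        then show "?h 0 \<le> ?h t" using nn h0 by simp
      qed
    qed
    define C where "C = \<kappa> * (1 / r) ^ ?k"
    have C: "C > 0" using \<kappa> r by (simp add: C_def)
    \<comment> \<open>Linear growth off the zero: on the radius towards \<open>c\<close> the barrier
      equals C ((1/(1 - t))^(N - 2) - 1), which is at least C t.\<close>
    have hb: "C * t \<le> ?h t" if t: "0 < t" "t < 1 / 2" for t
    proof -
      let ?y = "z + t *\<^sub>R (c - z)"
      have "?y - c = (1 - t) *\<^sub>R (z - c)" by (simp add: algebra_simps)
      then have n: "norm (?y - c) = (1 - t) * r" using t by (simp add: r_def)
      have "?y \<in> ?\<Omega> - {c}"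
        using t r n by (auto simp: dist_norm norm_minus_commute mult_less_cancel_right1 mult_strict_right_mono simp flip: less_divide_eq)
      from bar[OF this] have "- C + \<kappa> * (1 / ((1 - t) * r)) ^ ?k \<le> ?h t"
        by (simp add: fund_def n C_def)
      moreover have "\<kappa> * (1 / ((1 - t) * r)) ^ ?k = C * (1 / (1 - t)) ^ ?k"
        by (simp add: C_def power_divide power_mult_distrib)
      moreover have "1 + t \<le> (1 / (1 - t)) ^ ?k"
      proof -
        have "1 + t \<le> 1 / (1 - t)" using t by (simp add: field_simps)
        moreover have "1 / (1 - t) \<le> (1 / (1 - t)) ^ ?k"
          using t N by (intro self_le_power) auto
        ultimately show ?thesis by linarith
      qed
      then have "C * (1 + t) \<le> C * (1 / (1 - t)) ^ ?k"
        using C by (intro mult_left_mono) auto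
      ultimately show ?thesis by (simp add: algebra_simps)
    qed
    have "((\<lambda>t. (?h (0 + t) - ?h 0) / t) \<longlongrightarrow> 0) (at_right 0)"
      using dh g0 unfolding DERIV_def by (auto intro: tendsto_mono[OF at_le])
    moreover have "\<forall>\<^sub>F t in at_right 0. C \<le> (?h (0 + t) - ?h 0) / t"
      unfolding eventually_at_right_field
      using hb h0 by (intro exI[of _ "1/2"]) (auto simp: field_simps)
    ultimately have "C \<le> 0"
      by (intro tendsto_lowerbound) auto
    with C show False by simp
  qed
  \<comment> \<open>The zero set is open by the Hopf argument and relatively closed by continuity,
    so connectedness decides.\<close>
  have "open {y \<in> U. w y = 0}"
    unfolding open_contains_ball
  proof
    fix z0 assume z0: "z0 \<in> {y \<in> U. w y = 0}"
    then obtain e where e: "e > 0" "cball z0 e \<subseteq> U"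
      using U(1) open_contains_cball by blast
    have "ball z0 (e / 3) \<subseteq> {y \<in> U. w y = 0}"
      using key[of "e/3" z0] e z0 by (auto simp: subset_iff)
    then show "\<exists>e>0. ball z0 e \<subseteq> {y \<in> U. w y = 0}"
      using e by (intro exI[of _ "e/3"]) auto
  qed
  moreover have "open {y \<in> U. w y \<noteq> 0}"
  proof -
    have "{y \<in> U. w y \<noteq> 0} = U \<inter> w -` (- {0})" by auto
    then show ?thesis using continuous_open_preimage[OF cw U(1), of "- {0}"] by auto
  qed
  ultimately have "{y \<in> U. w y = 0} \<inter> U = {} \<or> {y \<in> U. w y \<noteq> 0} \<inter> U = {}"
    by (rule connectedD[OF U(2)]) auto
  with q y show ?thesis by blast
qed

subsection \<open>Kelvin transform\<close>

definition sinv :: "real \<Rightarrow> 'a::real_inner \<Rightarrow> 'a" where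
  "sinv l y = (l / norm y)\<^sup>2 *\<^sub>R y"

text \<open>Spheres are always centred at 0; a centre \<open>c\<close> is reached by transforming
  \<open>\<lambda>z. u (c + z)\<close>. The value at y = 0 is the convention 0 for N \<ge>
  3.\<close>

definition kel :: "real \<Rightarrow> (real ^ 'n \<Rightarrow> real) \<Rightarrow> real ^ 'n \<Rightarrow> real" where
  "kel l u y = (l / norm y) ^ (CARD('n) - 2) * u (sinv l y)"

lemma sinv_eq: "sinv l y = (l\<^sup>2 / (y \<bullet> y)) *\<^sub>R y"
  by (simp add: sinv_def power_divide power2_norm_eq_inner)

lemma norm_sinv: "norm (sinv l y) = l\<^sup>2 / norm y"
  by (simp add: sinv_def power_divide power2_eq_square)

lemma sinv_sphere: "norm y = l \<Longrightarrow> l > 0 \<Longrightarrow> sinv l y = y"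
  by (simp add: sinv_def)

lemma kel_sphere: "norm y = l \<Longrightarrow> l > 0 \<Longrightarrow> kel l u y = u y"
  by (simp add: kel_def sinv_sphere)

lemma has_derivative_power_ratio:
  fixes y :: "'a::real_inner"
  assumes "y \<noteq> 0"
  shows "((\<lambda>y. c / (y \<bullet> y)) has_derivative (\<lambda>h. - 2 * (c / (y \<bullet> y)\<^sup>2) * (y \<bullet> h))) (at y)"
    and "((\<lambda>y. c / (y \<bullet> y)\<^sup>2) has_derivative (\<lambda>h. - 4 * (c / (y \<bullet> y) ^ 3) * (y \<bullet> h))) (at y)"
proof -
  have s: "((\<lambda>y. y \<bullet> y) has_derivative (\<lambda>h. 2 * (y \<bullet> h))) (at y)"
    by (auto intro!: derivative_eq_intros simp: inner_commute)
  have p: "y \<bullet> y \<noteq> 0" using assms by simp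
  have 1: "((\<lambda>t. c / t) has_real_derivative - (c / t\<^sup>2)) (at t)"
    and 2: "((\<lambda>t. c / t\<^sup>2) has_real_derivative - 2 * c / t ^ 3) (at t)" if "t \<noteq> 0" for t :: real
    using that by (auto intro!: derivative_eq_intros simp: field_simps power2_eq_square power3_eq_cube)
  show "((\<lambda>y. c / (y \<bullet> y)) has_derivative (\<lambda>h. - 2 * (c / (y \<bullet> y)\<^sup>2) * (y \<bullet> h))) (at y)"
    by (rule has_derivative_eq_rhs[OF has_derivative_compose[OF s 1[OF p, unfolded has_field_derivative_def]]])
      (simp add: fun_eq_iff)
  show "((\<lambda>y. c / (y \<bullet> y)\<^sup>2) has_derivative (\<lambda>h. - 4 * (c / (y \<bullet> y) ^ 3) * (y \<bullet> h))) (at y)"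
    by (rule has_derivative_eq_rhs[OF has_derivative_compose[OF s 2[OF p, unfolded has_field_derivative_def]]])
      (simp add: fun_eq_iff)
qed

lemma continuous_on_sinv: "continuous_on (- {0}) (sinv l)"
  unfolding sinv_def by (auto intro!: continuous_intros)

lemma open_sinv_preimage:
  fixes S :: "'a::real_inner set"
  assumes "open S"
  shows "open {y. y \<noteq> 0 \<and> sinv l y \<in> S}"
proof -
  have "{y. y \<noteq> 0 \<and> sinv l y \<in> S} = (- {0}) \<inter> sinv l -` S" by auto
  then show ?thesis
    using continuous_open_preimage[OF continuous_on_sinv _ assms] by auto
qed

lemma fund_grad:
  fixes c :: "real ^ 'n"
  assumes N: "3 \<le> CARD('n)" and y: "y \<noteq> c"
  shows "grad (fund c) y = (- (real CARD('n) - 2) * fund c y / ((y - c) \<bullet> (y - c))) *\<^sub>R (y - c)"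
proof (rule grad_eq)
  define s where "s = 1 - real CARD('n) / 2"
  let ?q = "\<lambda>y. (y - c) \<bullet> (y - c)"
  have q: "?q y > 0" using y by simp
  have s: "(?q has_derivative (\<lambda>h. 2 * ((y - c) \<bullet> h))) (at y)"
    by (auto intro!: derivative_eq_intros simp: inner_commute)
  have "((\<lambda>x. x powr s) has_real_derivative s * ?q y powr (s - 1)) (at (?q y))"
    using q by (auto intro!: derivative_eq_intros)
  note d = has_derivative_compose[OF s this[unfolded has_field_derivative_def]]
  have "?q y powr (s - 1) = ?q y powr s / ?q y"
    using q by (simp add: powr_diff)
  also have "?q y powr s = fund c y"
    using fund_eq_powr[OF N y] by (simp add: s_def)
  finally have e: "?q y powr (s - 1) = fund c y / ?q y" .
  have "((\<lambda>y. ?q y powr s) has_derivative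
      (\<lambda>h. ((- (real CARD('n) - 2) * fund c y / ((y - c) \<bullet> (y - c))) *\<^sub>R (y - c)) \<bullet> h)) (at y)"
    by (rule has_derivative_eq_rhs[OF d]) (simp add: fun_eq_iff e, simp add: s_def field_simps)
  then show "(fund c has_derivative
      (\<lambda>h. ((- (real CARD('n) - 2) * fund c y / ((y - c) \<bullet> (y - c))) *\<^sub>R (y - c)) \<bullet> h)) (at y)"
    by (rule has_derivative_transform_within_open[of _ _ _ _ "- {c}"])
      (use y in \<open>auto simp: s_def fund_eq_powr[OF N]\<close>)
qed

text \<open>The derivative of the inversion at \<open>y\<close> is l^2/|y|^2 times the reflection in
  the hyperplane orthogonal to \<open>y\<close>. Conformality turns the second order part of the
  Laplacian into a multiple of the Laplacian of \<open>u\<close>; the remaining first order term is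
  what the weight in \<open>kel\<close> will cancel.\<close>

lemma twice_on_sinv:
  fixes u :: "real ^ 'n \<Rightarrow> real" and l :: real
  assumes S: "open S" and u: "twice_on u S"
  defines "T \<equiv> {y. y \<noteq> 0 \<and> sinv l y \<in> S}"
  shows "twice_on (\<lambda>y. u (sinv l y)) T"
    and "y \<in> T \<Longrightarrow> y \<bullet> grad (\<lambda>y. u (sinv l y)) y = - (l\<^sup>2 / (y \<bullet> y)) * (grad u (sinv l y) \<bullet> y)"
    and "y \<in> T \<Longrightarrow> laplacian (\<lambda>y. u (sinv l y)) y = (l\<^sup>2 / (y \<bullet> y))\<^sup>2 * laplacian u (sinv l y)
           - 2 * (real CARD('n) - 2) * (l\<^sup>2 / (y \<bullet> y)\<^sup>2) * (grad u (sinv l y) \<bullet> y)"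
proof -
  have T: "open T" unfolding T_def by (rule open_sinv_preimage[OF S])
  define q m m' where "q = (\<lambda>y::real^'n. l\<^sup>2 / (y \<bullet> y))" and "m = (\<lambda>y::real^'n. l\<^sup>2 / (y \<bullet> y)\<^sup>2)"
    and "m' = (\<lambda>y::real^'n. l\<^sup>2 / (y \<bullet> y) ^ 3)"
  define DI where "DI = (\<lambda>y h::real^'n. q y *\<^sub>R h - (2 * m y * (y \<bullet> h)) *\<^sub>R y)"
  define g where "g = (\<lambda>y. grad u (sinv l y))"
  define A where "A = (\<lambda>y. hess u (sinv l y))"
  define G where "G = (\<lambda>y. q y *\<^sub>R g y - (2 * m y * (g y \<bullet> y)) *\<^sub>R y)"
  define G' where "G' = (\<lambda>y h. (q y *\<^sub>R A y (DI y h) - (2 * m y * (y \<bullet> h)) *\<^sub>R g y)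
    - ((2 * m y * (g y \<bullet> y)) *\<^sub>R h + (2 * m y * (g y \<bullet> h + A y (DI y h) \<bullet> y) - 8 * m' y * (y \<bullet> h) * (g y \<bullet> y)) *\<^sub>R y))"
  have dI: "(sinv l has_derivative DI y) (at y)" if "y \<in> T" for y
  proof -
    have y: "y \<noteq> 0" using that by (simp add: T_def)
    have "((\<lambda>y. (l\<^sup>2 / (y \<bullet> y)) *\<^sub>R y) has_derivative
        (\<lambda>h. (l\<^sup>2 / (y \<bullet> y)) *\<^sub>R h + (- 2 * (l\<^sup>2 / (y \<bullet> y)\<^sup>2) * (y \<bullet> h)) *\<^sub>R y)) (at y)"
      by (rule derivative_intros has_derivative_power_ratio(1)[OF y])+
    then show ?thesis
      unfolding sinv_eq[abs_def] by (rule has_derivative_eq_rhs) (simp add: DI_def q_def m_def fun_eq_iff)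
  qed
  have du: "((\<lambda>y. u (sinv l y)) has_derivative (\<lambda>h. G y \<bullet> h)) (at y)" if y: "y \<in> T" for y
  proof -
    have "(u has_derivative (\<lambda>h. g y \<bullet> h)) (at (sinv l y))"
      unfolding g_def using y by (intro twice_on_has_derivative(1)[OF u]) (simp add: T_def)
    from has_derivative_compose[OF dI[OF y] this] show ?thesis
      by (rule has_derivative_eq_rhs) (simp add: fun_eq_iff G_def DI_def inner_diff_left inner_diff_right)
  qed
  have dg: "(g has_derivative (\<lambda>h. A y (DI y h))) (at y)" if y: "y \<in> T" for y
  proof -
    have "(grad u has_derivative A y) (at (sinv l y))"
      unfolding A_def using y by (intro twice_on_has_derivative(2)[OF u]) (simp add: T_def)
    from has_derivative_compose[OF dI[OF y] this] show ?thesis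
      unfolding g_def .
  qed
  have dG: "(G has_derivative G' y) (at y)" if y: "y \<in> T" for y
  proof -
    have y0: "y \<noteq> 0" using y by (simp add: T_def)
    have "(G has_derivative (\<lambda>h. (q y *\<^sub>R A y (DI y h) + (- 2 * (l\<^sup>2 / (y \<bullet> y)\<^sup>2) * (y \<bullet> h)) *\<^sub>R g y)
      - ((2 * m y * (g y \<bullet> y)) *\<^sub>R h +
         ((2 * m y) * (g y \<bullet> h + A y (DI y h) \<bullet> y) + (2 * (- 4 * (l\<^sup>2 / (y \<bullet> y) ^ 3) * (y \<bullet> h))) * (g y \<bullet> y)) *\<^sub>R y))) (at y)"
      unfolding G_def q_def m_def
      by (rule derivative_intros has_derivative_power_ratio[OF y0] dg[OF y])+
    then show ?thesis
      by (rule has_derivative_eq_rhs) (simp add: G'_def m_def m'_def fun_eq_iff)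
  qed
  show "twice_on (\<lambda>y. u (sinv l y)) T"
    by (rule twice_onI(1)[OF T du dG])
  assume y: "y \<in> T"
  then have y0: "y \<noteq> 0" by (simp add: T_def)
  then have v: "y \<bullet> y \<noteq> 0" by simp
  have mq: "m y * (y \<bullet> y) = q y" "m' y * (y \<bullet> y) = m y"
    using v by (simp_all add: m_def q_def m'_def power2_eq_square power3_eq_cube)
  have "grad (\<lambda>y. u (sinv l y)) y = G y"
    by (rule twice_onI(2)[OF T du dG y])
  then have "y \<bullet> grad (\<lambda>y. u (sinv l y)) y = q y * (g y \<bullet> y) - 2 * (m y * (y \<bullet> y)) * (g y \<bullet> y)"
    by (simp add: G_def inner_diff_right inner_commute[of y "g y"])
  also have "\<dots> = - (l\<^sup>2 / (y \<bullet> y)) * (grad u (sinv l y) \<bullet> y)"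
    by (simp add: mq, simp add: q_def g_def)
  finally show "y \<bullet> grad (\<lambda>y. u (sinv l y)) y = - (l\<^sup>2 / (y \<bullet> y)) * (grad u (sinv l y) \<bullet> y)" .
  have linA: "linear (A y)" by (simp add: A_def linear_hess)
  have linI: "linear (DI y)" by (rule has_derivative_linear[OF dI[OF y]])
  have AD: "A y (DI y h) = q y *\<^sub>R A y h - (2 * m y) *\<^sub>R ((y \<bullet> h) *\<^sub>R A y y)" for h
    by (simp add: DI_def linear_diff[OF linA] linear_cmul[OF linA])
  have DIy: "DI y y = (- q y) *\<^sub>R y"
  proof -
    have "DI y y = (q y - 2 * (m y * (y \<bullet> y))) *\<^sub>R y" by (simp add: DI_def scaleR_diff_left mult.assoc)
    then show ?thesis by (simp add: mq)
  qed
  have linAD: "linear (\<lambda>h. A y (DI y h))" using linear_compose[OF linI linA] by (simp add: o_def)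
  have t1: "trace_map (\<lambda>h. A y (DI y h)) = q y * trace_map (A y) - 2 * m y * (y \<bullet> A y y)"
    unfolding AD by (simp add: trace_map_diff trace_map_scale trace_map_inner del: scaleR_scaleR)
  have t2: "trace_map (\<lambda>h. (A y (DI y h) \<bullet> y) *\<^sub>R y) = - q y * (A y y \<bullet> y)"
    using trace_map_inner_scale[OF linAD, of y y] by (simp add: DIy linear_cmul[OF linA] linear_neg[OF linA])
  have G'eq: "G' y h = (q y *\<^sub>R A y (DI y h) - (2 * m y) *\<^sub>R ((y \<bullet> h) *\<^sub>R g y))
     - ((2 * m y * (g y \<bullet> y)) *\<^sub>R h + (((2 * m y) *\<^sub>R ((g y \<bullet> h) *\<^sub>R y) + (2 * m y) *\<^sub>R ((A y (DI y h) \<bullet> y) *\<^sub>R y))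
       - (8 * m' y * (g y \<bullet> y)) *\<^sub>R ((y \<bullet> h) *\<^sub>R y)))" for h
    by (simp add: G'_def algebra_simps)
  have "laplacian (\<lambda>y. u (sinv l y)) y = trace_map (G' y)"
    by (rule twice_onI(3)[OF T du dG y])
  also have "\<dots> = (q y * (q y * trace_map (A y) - 2 * m y * (y \<bullet> A y y)) - 2 * m y * (y \<bullet> g y))
     - (2 * m y * (g y \<bullet> y) * real CARD('n) + ((2 * m y * (g y \<bullet> y) + 2 * m y * (- q y * (A y y \<bullet> y)))
        - 8 * m' y * (g y \<bullet> y) * (y \<bullet> y)))"
    unfolding G'eq[abs_def]
    by (simp only: trace_map_diff trace_map_add trace_map_scale trace_map_inner trace_map_ident t1 t2)
  \<comment> \<open>The terms with y \<bullet> A y y have cancelled because the reflection sends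
    \<open>y\<close> to \<open>- y\<close>.\<close>
  also have "\<dots> = (q y)\<^sup>2 * trace_map (A y) - 2 * (real CARD('n) + 2) * m y * (g y \<bullet> y) + 8 * (m' y * (y \<bullet> y)) * (g y \<bullet> y)"
    by (simp add: inner_commute[of y "g y"] inner_commute[of y "A y y"] power2_eq_square algebra_simps)
  also have "\<dots> = (q y)\<^sup>2 * trace_map (A y) - 2 * (real CARD('n) - 2) * m y * (g y \<bullet> y)"
    unfolding mq by (simp add: algebra_simps)
  finally show "laplacian (\<lambda>y. u (sinv l y)) y = (l\<^sup>2 / (y \<bullet> y))\<^sup>2 * laplacian u (sinv l y)
           - 2 * (real CARD('n) - 2) * (l\<^sup>2 / (y \<bullet> y)\<^sup>2) * (grad u (sinv l y) \<bullet> y)"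
    by (simp add: q_def m_def A_def g_def laplacian_hess)
qed

text \<open>Product rule with the harmonic weight \<open>fund 0\<close>: its mixed gradient term is
  exactly opposite to the first order term left by the inversion. Two powers of l^2/|y|^2 raise the
  exponent from N - 2 to N + 2.\<close>

lemma twice_on_kel:
  fixes u :: "real ^ 'n \<Rightarrow> real"
  assumes N: "3 \<le> CARD('n)" and l: "l > 0" and S: "open S" and u: "twice_on u S"
  defines "T \<equiv> {y. y \<noteq> 0 \<and> sinv l y \<in> S}"
  shows "twice_on (kel l u) T"
    and "y \<in> T \<Longrightarrow> laplacian (kel l u) y = (l / norm y) ^ (CARD('n) + 2) * laplacian u (sinv l y)"
proof -
  have T: "open T" unfolding T_def by (rule open_sinv_preimage[OF S])
  let ?b = "\<lambda>y. u (sinv l y)"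
  note b = twice_on_sinv[OF S u, where l = l, folded T_def]
  have sub: "T \<subseteq> - {0}" by (auto simp: T_def)
  note f = twice_on_subset[OF fund_harmonic(1)[OF N, of 0] sub]
  note fb = twice_on_mult[OF T f b(1)]
  note k = twice_on_cmult[OF T fb(1), where c = "l ^ (CARD('n) - 2)"]
  have eq: "l ^ (CARD('n) - 2) * (fund 0 y * ?b y) = kel l u y" for y
    using fund_scale[of l y 0] l by (simp add: kel_def)
  show "twice_on (kel l u) T"
    using k(1) by (simp add: eq)
  assume y: "y \<in> T"
  then have y0: "y \<noteq> 0" by (simp add: T_def)
  let ?c = "real CARD('n) - 2"
  have g: "grad (fund 0) y = (- ?c * fund 0 y / (y \<bullet> y)) *\<^sub>R y"
    using fund_grad[OF N y0] by simp
  have "laplacian (kel l u) y = l ^ (CARD('n) - 2) *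
      (fund 0 y * laplacian ?b y + 2 * (grad (fund 0) y \<bullet> grad ?b y))"
    using k(2)[OF y] fb(2)[OF y] fund_harmonic(2)[OF N y0] by (simp add: eq)
  also have "grad (fund 0) y \<bullet> grad ?b y = (- ?c * fund 0 y / (y \<bullet> y)) * (- (l\<^sup>2 / (y \<bullet> y)) * (grad u (sinv l y) \<bullet> y))"
    unfolding g using b(2)[OF y] by simp
  also have "l ^ (CARD('n) - 2) * (fund 0 y * laplacian ?b y
      + 2 * ((- ?c * fund 0 y / (y \<bullet> y)) * (- (l\<^sup>2 / (y \<bullet> y)) * (grad u (sinv l y) \<bullet> y))))
    = l ^ (CARD('n) - 2) * fund 0 y * ((l\<^sup>2 / (y \<bullet> y))\<^sup>2 * laplacian u (sinv l y))"
  proof -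
    have "L * (f * (A - 2 * c * (q / V\<^sup>2) * G) + 2 * ((- c * f / V) * (- (q / V) * G))) = L * f * A"
      for L f A c q V G :: real
      by (cases "V = 0") (simp_all add: field_simps power2_eq_square)
    then show ?thesis unfolding b(3)[OF y] .
  qed
  also have "l ^ (CARD('n) - 2) * fund 0 y = (l / norm y) ^ (CARD('n) - 2)"
    using fund_scale[of l y 0] l by simp
  also have "(l\<^sup>2 / (y \<bullet> y))\<^sup>2 = (l / norm y) ^ 4"
    by (simp add: power_divide flip: power2_norm_eq_inner)
  also have "(l / norm y) ^ (CARD('n) - 2) * ((l / norm y) ^ 4 * laplacian u (sinv l y))
      = (l / norm y) ^ (CARD('n) - 2 + 4) * laplacian u (sinv l y)"
    by (simp only: power_add mult.assoc)
  also have "CARD('n) - 2 + 4 = CARD('n) + 2" using N by simp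
  finally show "laplacian (kel l u) y = (l / norm y) ^ (CARD('n) + 2) * laplacian u (sinv l y)" .
qed

lemma twice_on_continuous:
  assumes "twice_on w S" "T \<subseteq> S"
  shows "continuous_on T w" "continuous_on T (grad w)"
proof -
  have "isCont w x" "isCont (grad w) x" if "x \<in> T" for x
    using twice_on_has_derivative[OF assms(1)] that assms(2) has_derivative_continuous by blast+
  then show "continuous_on T w" "continuous_on T (grad w)"
    by (auto intro: continuous_at_imp_continuous_on)
qed

text \<open>The comparison function is harmonic and decays at infinity, so nonnegativity of
  \<open>w\<close> is all the control required far out and near the puncture
  \<open>p\<close>.\<close>

lemma superharmonic_exterior_lower_bound:
  fixes w :: "real ^ 'n \<Rightarrow> real"
  assumes N: "3 \<le> CARD('n)" and R: "R > 0" and m: "m \<ge> 0"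
    and cont: "continuous_on ({y. R \<le> norm y} - {p}) w"
    and tw: "twice_on w ({y. R < norm y} - {p})"
    and lap: "\<And>y. R < norm y \<Longrightarrow> y \<noteq> p \<Longrightarrow> laplacian w y \<le> 0"
    and nn: "\<And>y. R \<le> norm y \<Longrightarrow> y \<noteq> p \<Longrightarrow> 0 \<le> w y"
    and sph: "\<And>y. norm y = R \<Longrightarrow> y \<noteq> p \<Longrightarrow> m \<le> w y"
    and y: "R \<le> norm y" "y \<noteq> p"
  shows "m * (R / norm y) ^ (CARD('n) - 2) \<le> w y"
proof (cases "norm y = R")
  case True
  then show ?thesis using sph[OF True y(2)] R by simp
next
  case False
  define b where "b = m * R ^ (CARD('n) - 2)"
  have b: "b \<ge> 0" using m R by (simp add: b_def)
  have eq: "m * (R / norm y) ^ (CARD('n) - 2) = 0 + b * fund 0 y" for y :: "real ^ 'n"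
    using fund_scale[of R y 0] R by (simp add: b_def)
  have "0 + b * fund 0 y \<le> w y"
  proof (rule min_principle_fund[OF N, where \<Omega> = "{y. R < norm y}" and F = "{y. R \<le> norm y}" and p = p])
    show "open {y::real^'n. R < norm y}"
      by (intro open_Collect_less continuous_intros)
    show "closed {y::real^'n. R \<le> norm y}"
      by (intro closed_Collect_le continuous_intros)
    show "0 + b * fund 0 y \<le> w y" if "y \<in> {y. R \<le> norm y} - {y. R < norm y} - {p}" for y
    proof -
      have "norm y = R" "y \<noteq> p" using that by auto
      then show ?thesis unfolding eq[symmetric] using sph[of y] R by simp
    qed
    show "\<exists>Ra. \<forall>y\<in>{y. R < norm y} - {p}. Ra \<le> norm y \<longrightarrow> 0 + b * fund 0 y - e \<le> w y" if e: "e > 0" for e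
    proof -
      obtain R1 where R1: "\<And>y::real^'n. R1 \<le> norm y \<Longrightarrow> fund 0 y \<le> e / (b + 1)"
        using fund_small_far[OF N, of "e / (b + 1)" 0] b e by auto
      have "b * fund 0 y \<le> e" if "R1 \<le> norm y" for y :: "real ^ 'n"
      proof -
        have "b * fund 0 y \<le> b * (e / (b + 1))"
          by (intro mult_left_mono R1 that b)
        also have "\<dots> \<le> e" using b e by (simp add: field_simps)
        finally show ?thesis .
      qed
      then show ?thesis
        using nn by (intro exI[of _ R1]) (smt (verit) DiffE mem_Collect_eq singletonI)
    qed
    show "\<exists>M r. 0 < r \<and> (\<forall>y\<in>{y. R < norm y} - {p}. norm (y - p) < r \<longrightarrow> - M \<le> w y)"
      using nn by (intro exI[of _ 0] exI[of _ 1]) auto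
  qed (use R cont tw lap y False in auto)
  then show ?thesis unfolding eq .
qed

text \<open>The condition in \<open>d\<close> says that r^((N - 2)/2) u(r \<theta>) increases along
  the ray of \<open>y\<close>, and the claim compares its values at the mirror radii l^2/|y| and
  |y|. Squaring avoids half-integer powers.\<close>

lemma kel_le_of_radial_monotone:
  fixes u :: "real ^ 'n \<Rightarrow> real"
  assumes N: "3 \<le> CARD('n)" and l: "0 < l" and y: "l \<le> norm y"
    and d: "\<And>z. l\<^sup>2 / norm y \<le> norm z \<Longrightarrow> norm z \<le> norm y \<Longrightarrow>
      u differentiable (at z) \<and> 0 < u z \<and> 0 < (real CARD('n) - 2) * u z + 2 * (grad u z \<bullet> z)"
  shows "kel l u y \<le> u y"
proof -
  define k where "k = CARD('n) - 2"
  have k: "real k = real CARD('n) - 2" "k > 0" using N by (auto simp: k_def)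
  define \<rho> s where "\<rho> = norm y" and "s = l\<^sup>2 / norm y"
  define \<theta> where "\<theta> = y /\<^sub>R norm y"
  have \<rho>: "0 < \<rho>" "l \<le> \<rho>" using y l by (auto simp: \<rho>_def simp del: zero_less_norm_iff)
  then have y0: "y \<noteq> 0" by (auto simp: \<rho>_def)
  have s: "0 < s" "s \<le> \<rho>"
    using \<rho> l mult_mono[of l \<rho> l \<rho>] by (auto simp: s_def \<rho>_def[symmetric] divide_le_eq power2_eq_square)
  have \<theta>: "norm \<theta> = 1" "y = \<rho> *\<^sub>R \<theta>" "sinv l y = s *\<^sub>R \<theta>"
    using y0 by (auto simp: \<theta>_def \<rho>_def s_def sinv_def power_divide power2_eq_square divide_inverse)
  let ?h = "\<lambda>r. r ^ k * (u (r *\<^sub>R \<theta>))\<^sup>2"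
  have "?h s \<le> ?h \<rho>"
  proof (rule DERIV_nonneg_imp_nondecreasing[OF s(2)])
    fix r assume r: "s \<le> r" "r \<le> \<rho>"
    then have r0: "r > 0" using s by simp
    let ?z = "r *\<^sub>R \<theta>"
    have z: "u differentiable (at ?z)" "0 < u ?z" "0 < real k * u ?z + 2 * (grad u ?z \<bullet> ?z)"
      using d[of ?z] r r0 \<theta>(1) by (auto simp: s_def \<rho>_def k)
    have L: "((\<lambda>t. t *\<^sub>R \<theta>) has_derivative (\<lambda>h. h *\<^sub>R \<theta>)) (at r)"
      by (auto intro!: derivative_eq_intros)
    have du: "((\<lambda>t. u (t *\<^sub>R \<theta>)) has_real_derivative (grad u ?z \<bullet> \<theta>)) (at r)"
      unfolding has_field_derivative_def
      by (rule has_derivative_eq_rhs[OF has_derivative_compose[OF L has_derivative_grad[OF z(1)]]])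
        (simp add: fun_eq_iff)
    have dh: "(?h has_real_derivative
        (real k * r ^ (k - 1) * (u ?z)\<^sup>2 + r ^ k * (2 * u ?z * (grad u ?z \<bullet> \<theta>)))) (at r)"
      by (auto intro!: derivative_eq_intros du simp: algebra_simps)
    have "real k * r ^ (k - 1) * (u ?z)\<^sup>2 + r ^ k * (2 * u ?z * (grad u ?z \<bullet> \<theta>))
       = r ^ (k - 1) * u ?z * (real k * u ?z + 2 * (grad u ?z \<bullet> ?z))"
    proof -
      have "r ^ k = r ^ (k - 1) * r" using k(2) by (simp add: power_eq_if)
      then show ?thesis by (simp add: algebra_simps power2_eq_square)
    qed
    also have "\<dots> \<ge> 0" using z r0 by (intro mult_nonneg_nonneg) auto
    finally show "\<exists>D. (?h has_real_derivative D) (at r) \<and> 0 \<le> D" using dh by blast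
  qed
  have ls: "l\<^sup>2 = s * \<rho>" using \<rho> by (simp add: s_def \<rho>_def)
  have "(kel l u y)\<^sup>2 = ((l / \<rho>)\<^sup>2) ^ k * (u (s *\<^sub>R \<theta>))\<^sup>2"
    by (simp add: kel_def \<theta>(3) \<rho>_def k_def power_mult_distrib flip: power_mult) (simp add: mult.commute)
  also have "(l / \<rho>)\<^sup>2 = s / \<rho>"
    using ls \<rho> by (simp add: power_divide power2_eq_square)
  also have "(s / \<rho>) ^ k * (u (s *\<^sub>R \<theta>))\<^sup>2 \<le> (u y)\<^sup>2"
    using \<open>?h s \<le> ?h \<rho>\<close> \<rho> by (simp add: power_divide divide_le_eq \<theta>(2)[symmetric] mult.commute)
  finally have "(kel l u y)\<^sup>2 \<le> (u y)\<^sup>2" .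
  moreover have "0 \<le> u y"
  proof -
    have "0 < u y" using d[of y] s by (auto simp: s_def \<rho>_def)
    then show ?thesis by simp
  qed
  ultimately show ?thesis by (rule power2_le_imp_le)
qed

subsection \<open>Moving spheres\<close>

text \<open>After translation the centre is 0 and \<open>p\<close> is the singularity. A singularity
  never sits at the centre, so p = 0 is free to encode an entire solution, and both cases share all
  lemmas.\<close>

definition punct :: "real ^ 'n \<Rightarrow> (real ^ 'n) set" where
  "punct p = (if p = 0 then UNIV else - {p})"

text \<open>The radii whose closed ball about the centre contains no singularity, so that the Kelvin
  transform is regular on and outside the sphere.\<close>

definition adm :: "real ^ 'n \<Rightarrow> real \<Rightarrow> bool" where
  "adm p l \<longleftrightarrow> 0 < l \<and> (p = 0 \<or> l < norm p)"

lemma open_punct: "open (punct p)"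
  by (auto simp: punct_def)

lemma adm_cball: "adm p l \<Longrightarrow> cball 0 l \<subseteq> punct p"
  by (auto simp: adm_def punct_def)

lemma punct_ne: "y \<in> punct p \<Longrightarrow> y \<noteq> 0 \<Longrightarrow> y \<noteq> p"
  by (auto simp: punct_def split: if_splits)

lemma ne_punct: "y \<noteq> p \<Longrightarrow> y \<in> punct p"
  by (auto simp: punct_def)

lemma adm_sinv: "adm p l \<Longrightarrow> l \<le> norm y \<Longrightarrow> sinv l y \<in> cball 0 l"
proof -
  assume a: "adm p l" "l \<le> norm y"
  then have l: "0 < l" by (simp add: adm_def)
  have "l * l \<le> l * norm y" using a l by (intro mult_left_mono) auto
  then show ?thesis
    using l a by (auto simp: norm_sinv divide_le_eq power2_eq_square)
qed

lemma adm_larger: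
  assumes "adm p l"
  obtains R where "l < R" "adm p R"
proof (cases "p = 0")
  case True
  with assms that[of "l + 1"] show ?thesis by (auto simp: adm_def)
next
  case False
  with assms that[of "(l + norm p) / 2"] show ?thesis by (auto simp: adm_def)
qed

text \<open>Near the centre the term grad u \<bullet> y is small against u > 0, so the radial
  monotonicity criterion applies. Outside the ball of radius \<open>r\<close>, the function
  dominates m (r/|y|)^(N - 2) while its transform is at most M (l/|y|)^(N - 2); the choice l \<le> r
  m/M settles it.\<close>

lemma kel_start:
  fixes u :: "real ^ 'n \<Rightarrow> real"
  assumes N: "3 \<le> CARD('n)" and tw: "twice_on u (punct p)"
    and pos: "\<And>y. y \<in> punct p \<Longrightarrow> 0 < u y" and lap: "\<And>y. y \<in> punct p \<Longrightarrow> laplacian u y \<le> 0"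
  obtains l0 where "l0 > 0" "\<And>l y. 0 < l \<Longrightarrow> l \<le> l0 \<Longrightarrow> l \<le> norm y \<Longrightarrow> y \<in> punct p \<Longrightarrow> kel l u y \<le> u y"
proof -
  let ?q = "\<lambda>y. (real CARD('n) - 2) * u y + 2 * (grad u y \<bullet> y)"
  have 0: "0 \<in> punct p" by (auto simp: punct_def)
  have cq: "continuous_on (punct p) ?q"
    by (intro continuous_intros twice_on_continuous[OF tw] order_refl)
  have op: "open (punct p \<inter> ?q -` {0<..})"
    using continuous_open_preimage[OF cq open_punct] by auto
  have "0 \<in> punct p \<inter> ?q -` {0<..}" using 0 pos[OF 0] N by auto
  then obtain r where r: "r > 0" "cball 0 r \<subseteq> punct p \<inter> ?q -` {0<..}"
    using op open_contains_cball by blast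
  have rd: "cball 0 r \<subseteq> punct p" using r by auto
  have cu: "continuous_on (cball 0 r) u" by (rule twice_on_continuous[OF tw rd])
  have ne: "cball 0 r \<noteq> {}" using r by auto
  obtain z1 z2 where z: "z1 \<in> cball 0 r" "z2 \<in> cball 0 r"
    "\<And>y. y \<in> cball 0 r \<Longrightarrow> u z1 \<le> u y" "\<And>y. y \<in> cball 0 r \<Longrightarrow> u y \<le> u z2"
    using continuous_attains_inf[OF compact_cball ne cu] continuous_attains_sup[OF compact_cball ne cu] by metis
  define m M where "m = u z1" and "M = u z2"
  have m: "0 < m" "m \<le> M" using pos[of z1] z rd by (auto simp: m_def M_def)
  have LB: "m * (r / norm y) ^ (CARD('n) - 2) \<le> u y" if "r \<le> norm y" "y \<noteq> p" for y
  proof (rule superharmonic_exterior_lower_bound[OF N r(1), where p = p])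
    show "continuous_on ({y. r \<le> norm y} - {p}) u"
      by (rule twice_on_continuous[OF tw]) (use ne_punct in blast)
    show "twice_on u ({y. r < norm y} - {p})"
      by (rule twice_on_subset[OF tw]) (use ne_punct in blast)
    show "m \<le> u y" if "norm y = r" for y using z(3)[of y] that by (auto simp: m_def)
  qed (use m that lap pos in \<open>auto simp: ne_punct less_imp_le\<close>)
  show ?thesis
  proof
    show l0: "r * (m / M) > 0" using r m by auto
    fix l y assume l: "0 < l" "l \<le> r * (m / M)" and y: "l \<le> norm y" "y \<in> punct p"
    have "r * (m / M) \<le> r * 1" using m r by (intro mult_left_mono) auto
    with l have lr: "l \<le> r" by simp
    have "y \<noteq> 0" using y(1) l by auto
    then have yp: "y \<noteq> p" by (rule punct_ne[OF y(2)])
    show "kel l u y \<le> u y"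
    proof (cases "norm y \<le> r")
      case True
      show ?thesis
      proof (rule kel_le_of_radial_monotone[OF N l(1) y(1)])
        fix z :: "real ^ 'n" assume "norm z \<le> norm y"
        then have "z \<in> cball 0 r" using True by simp
        then show "u differentiable (at z) \<and> 0 < u z \<and> 0 < ?q z"
          using r(2) tw pos by (auto simp: twice_on_def)
      qed
    next
      case False
      then have y0: "0 < norm y" using r by linarith
      have sr: "sinv l y \<in> cball 0 r"
      proof -
        have "l * l \<le> r * norm y" using lr l False by (intro mult_mono) auto
        then show ?thesis using y0 by (simp add: norm_sinv divide_le_eq power2_eq_square)
      qed
      have "kel l u y \<le> (l / norm y) ^ (CARD('n) - 2) * M"
        unfolding kel_def M_def using l y0 by (intro mult_left_mono z(4) sr) auto
      also have "\<dots> \<le> m * (r / norm y) ^ (CARD('n) - 2)"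
      proof -
        have "(l / r) ^ (CARD('n) - 2) \<le> (l / r) ^ 1"
          using l lr r N by (intro power_decreasing) auto
        also have "\<dots> \<le> m / M" using l(2) r by (simp add: divide_le_eq mult.commute)
        finally have "(l / r) ^ (CARD('n) - 2) * M \<le> m" using m by (simp add: le_divide_eq)
        then have "(l / r) ^ (CARD('n) - 2) * M * (r / norm y) ^ (CARD('n) - 2) \<le> m * (r / norm y) ^ (CARD('n) - 2)"
          using r by (intro mult_right_mono) auto
        moreover have "(l / r) ^ (CARD('n) - 2) * (r / norm y) ^ (CARD('n) - 2) = (l / norm y) ^ (CARD('n) - 2)"
          using r by (simp flip: power_mult_distrib)
        ultimately show ?thesis by (simp add: mult.commute mult.left_commute)
      qed
      also have "\<dots> \<le> u y" using LB[of y] False yp by simp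
      finally show ?thesis .
    qed
  qed
qed

text \<open>On the sphere \<open>u\<close> and \<open>kel l u\<close> agree, and the derivative of
  their difference in direction \<open>y\<close> is the expression shown. The barrier vanishes on
  the sphere with nonzero slope, which gives Hopf's strict sign.\<close>

lemma kel_boundary_derivative:
  fixes u :: "real ^ 'n \<Rightarrow> real"
  assumes N: "3 \<le> CARD('n)" and l: "0 < l" and y: "norm y = l" and d: "u differentiable (at y)"
    and \<kappa>: "\<kappa> > 0" and R: "l < R"
    and bar: "\<And>z. l < norm z \<Longrightarrow> norm z < R \<Longrightarrow> \<kappa> * (1 - (l / norm z) ^ (CARD('n) - 2)) \<le> u z - kel l u z"
  shows "0 < (real CARD('n) - 2) * u y + 2 * (grad u y \<bullet> y)"
proof -
  define k where "k = CARD('n) - 2"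
  have k: "real k = real CARD('n) - 2" "k > 0" using N by (auto simp: k_def)
  let ?D = "grad u y \<bullet> y"
  let ?U = "\<lambda>t. u (y + t *\<^sub>R y)"
  have L: "((\<lambda>t. y + t *\<^sub>R y) has_derivative (\<lambda>h. h *\<^sub>R y)) (at 0)"
    by (auto intro!: derivative_eq_intros)
  have "(u has_derivative (\<lambda>h. grad u y \<bullet> h)) (at (y + 0 *\<^sub>R y))"
    using has_derivative_grad[OF d] by simp
  then have dU: "(?U has_real_derivative ?D) (at 0)"
    unfolding has_field_derivative_def
    by (rule has_derivative_eq_rhs[OF has_derivative_compose[OF L]]) (simp add: fun_eq_iff)
  \<comment> \<open>The inversion maps (1 + t) y to y/(1 + t), that is, to y + \<open>?s t\<close>
    y.\<close>
  let ?s = "\<lambda>t::real. 1 / (1 + t) - 1"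
  have ds: "(?s has_real_derivative - 1) (at 0)"
    by (auto intro!: derivative_eq_intros)
  have dUs: "((\<lambda>t. ?U (?s t)) has_real_derivative ?D * (- 1)) (at 0)"
    using DERIV_chain2[OF _ ds, of ?U ?D] dU by simp
  have dp: "((\<lambda>t. (1 / (1 + t)) ^ k) has_real_derivative - real k) (at 0)"
    by (auto intro!: derivative_eq_intros)
  let ?h = "\<lambda>t. ?U t - (1 / (1 + t)) ^ k * ?U (?s t)"
  have dh: "(?h has_real_derivative (?D - (- real k * u y + ?D * (- 1)))) (at 0)"
    by (rule DERIV_cong[OF DERIV_diff[OF dU DERIV_mult[OF dp dUs]]]) simp
  define b where "b = min 1 (R / l - 1)"
  have b: "0 < b" "b \<le> 1" "l * (1 + b) \<le> R" using R l by (auto simp: b_def field_simps min_def)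
  have lower: "\<kappa> / 2 \<le> (?h (0 + t) - ?h 0) / t" if t: "0 < t" "t < b" for t
  proof -
    let ?z = "y + t *\<^sub>R y"
    have z: "?z = (1 + t) *\<^sub>R y" by (simp add: scaleR_add_left)
    then have nz: "norm ?z = (1 + t) * l" using t y by simp
    have tb: "t * l < b * l" using t l by (intro mult_strict_right_mono) auto
    have "(1 + t) * l = l + t * l" and R': "l + b * l \<le> R"
      using b(3) by (simp_all add: algebra_simps)
    then have nz': "norm ?z = l + t * l" using nz by simp
    have zR: "l < norm ?z" unfolding nz' using mult_pos_pos[OF t(1) l] by simp
    have zR: "l < norm ?z" "norm ?z < R"
      using zR order.strict_trans2[OF add_strict_left_mono[OF tb, of l] R'] by (simp_all only: nz')
    have si: "sinv l ?z = y + ?s t *\<^sub>R y"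
    proof -
      have "sinv l ?z = ((1 / (1 + t))\<^sup>2 * (1 + t)) *\<^sub>R y"
        unfolding sinv_def nz using l by (simp add: z del: scaleR_add_left)
      also have "(1 / (1 + t))\<^sup>2 * (1 + t) = 1 + ?s t" using t by (simp add: power2_eq_square)
      finally show ?thesis unfolding scaleR_add_left by simp
    qed
    have "l / norm ?z = 1 / (1 + t)" unfolding nz using l by simp
    then have "\<kappa> * (1 - (1 / (1 + t)) ^ k) \<le> ?h t"
      using bar[OF zR] by (simp add: kel_def si k_def)
    moreover have "t / 2 \<le> 1 - (1 / (1 + t)) ^ k"
    proof -
      have "(1 / (1 + t)) ^ k \<le> (1 / (1 + t)) ^ 1"
        using t k(2) by (intro power_decreasing) auto
      moreover have "t / 2 \<le> 1 - 1 / (1 + t)"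
      proof -
        have "t / 2 \<le> t / (1 + t)" using t b(2) by (intro divide_left_mono) auto
        also have "t / (1 + t) = 1 - 1 / (1 + t)" using t by (simp add: field_simps)
        finally show ?thesis .
      qed
      ultimately show ?thesis by simp
    qed
    then have "\<kappa> * (t / 2) \<le> \<kappa> * (1 - (1 / (1 + t)) ^ k)" using \<kappa> by (intro mult_left_mono) auto
    ultimately have "\<kappa> * (t / 2) \<le> ?h t" by linarith
    then show ?thesis using t by (simp add: field_simps)
  qed
  have "((\<lambda>t. (?h (0 + t) - ?h 0) / t) \<longlongrightarrow> (?D - (- real k * u y + ?D * (- 1)))) (at_right 0)"
    using dh unfolding DERIV_def by (auto intro: tendsto_mono[OF at_le])
  moreover have "\<forall>\<^sub>F t in at_right 0. \<kappa> / 2 \<le> (?h (0 + t) - ?h 0) / t"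
    unfolding eventually_at_right_field using lower b(1) by blast
  ultimately have "\<kappa> / 2 \<le> ?D - (- real k * u y + ?D * (- 1))"
    by (intro tendsto_lowerbound) auto
  also have "\<dots> = real k * u y + 2 * ?D" by simp
  finally show ?thesis using \<kappa> unfolding k(1)[symmetric] by simp
qed

lemma open_exterior: "open {y::'a::real_normed_vector. l < norm y}"
  by (intro open_Collect_less continuous_intros)

lemma twice_on_kel_exterior:
  fixes u :: "real ^ 'n \<Rightarrow> real"
  assumes N: "3 \<le> CARD('n)" and l: "adm p l" and tw: "twice_on u (punct p)"
  obtains T where "open T" "{y. l \<le> norm y} \<subseteq> T" "twice_on (kel l u) T"
    and "\<And>y. y \<in> T \<Longrightarrow> laplacian (kel l u) y = (l / norm y) ^ (CARD('n) + 2) * laplacian u (sinv l y)"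
proof (rule that)
  let ?T = "{y. y \<noteq> 0 \<and> sinv l y \<in> punct p}"
  have l0: "0 < l" using l by (simp add: adm_def)
  show "open ?T" by (rule open_sinv_preimage[OF open_punct])
  show "{y. l \<le> norm y} \<subseteq> ?T"
    using adm_sinv[OF l] adm_cball[OF l] l0 by fastforce
  show "twice_on (kel l u) ?T" by (rule twice_on_kel(1)[OF N l0 open_punct tw])
  show "laplacian (kel l u) y = (l / norm y) ^ (CARD('n) + 2) * laplacian u (sinv l y)" if "y \<in> ?T" for y
    by (rule twice_on_kel(2)[OF N l0 open_punct tw that])
qed

text \<open>Strictness at radius \<open>l\<close> leaves room for slightly larger radii. Near the
  sphere Hopf's lemma makes the radial monotonicity criterion hold on a whole shell; beyond radius
  \<open>b\<close> the difference dominates a multiple of |y|^(2 - N), while changing the radius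
  alters \<open>kel\<close> by less than that, uniformly up to infinity.\<close>

lemma kel_step:
  fixes u :: "real ^ 'n \<Rightarrow> real"
  assumes N: "3 \<le> CARD('n)" and l: "adm p l" and tw: "twice_on u (punct p)"
    and pos: "\<And>y. y \<in> punct p \<Longrightarrow> 0 < u y"
    and gt: "\<And>y. l < norm y \<Longrightarrow> y \<noteq> p \<Longrightarrow> kel l u y < u y"
    and sup: "\<And>y. l < norm y \<Longrightarrow> y \<noteq> p \<Longrightarrow> laplacian (\<lambda>y. u y - kel l u y) y \<le> 0"
  obtains \<eta> where "\<eta> > 0"
    "\<And>\<mu> y. l \<le> \<mu> \<Longrightarrow> \<mu> < l + \<eta> \<Longrightarrow> \<mu> \<le> norm y \<Longrightarrow> y \<in> punct p \<Longrightarrow> kel \<mu> u y \<le> u y"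
proof -
  define k where "k = CARD('n) - 2"
  have k: "k > 0" using N by (simp add: k_def)
  have l0: "0 < l" using l by (simp add: adm_def)
  obtain T where T: "open T" "{y. l \<le> norm y} \<subseteq> T" "twice_on (kel l u) T"
    using twice_on_kel_exterior[OF N l tw] by metis
  let ?w = "\<lambda>y. u y - kel l u y"
  have oT: "open (T \<inter> punct p)" using T(1) open_punct by auto
  have tww: "twice_on ?w (T \<inter> punct p)"
    by (rule twice_on_diff(1)[OF oT twice_on_subset[OF tw] twice_on_subset[OF T(3)]]) auto
  have sub: "{y. l \<le> norm y} - {p} \<subseteq> T \<inter> punct p" using T(2) ne_punct by blast
  obtain R where R: "l < R" "adm p R" by (rule adm_larger[OF l])
  have cR: "cball 0 R \<subseteq> punct p" by (rule adm_cball[OF R(2)])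
  have Rp: "y \<noteq> p" if "l \<le> norm y" "norm y \<le> R" for y
    using R(2) that l0 by (auto simp: adm_def)
  have cw: "continuous_on {y. l \<le> norm y \<and> y \<noteq> p} ?w"
    by (rule twice_on_continuous[OF tww]) (use sub in blast)
  have sphere_min: "\<exists>m>0. \<forall>y. norm y = r \<longrightarrow> m \<le> ?w y" if r: "l < r" "r \<le> R" for r
  proof -
    have "sphere (0::real^'n) r \<noteq> {}" using r l0 by simp
    moreover have "continuous_on (sphere 0 r) ?w"
      by (rule continuous_on_subset[OF cw]) (use r Rp[of p] in auto)
    ultimately obtain x where x: "x \<in> sphere 0 r" "\<And>y. y \<in> sphere 0 r \<Longrightarrow> ?w x \<le> ?w y"
      using continuous_attains_inf[OF compact_sphere] by blast
    have "0 < ?w x" using gt[of x] Rp[of x] x(1) r by auto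
    with x(2) show ?thesis by (intro exI[of _ "?w x"]) auto
  qed
  obtain m where m: "m > 0" "\<And>y. norm y = R \<Longrightarrow> m \<le> ?w y"
    using sphere_min[of R] R by auto
  define d where "d = 1 - (l / R) ^ k"
  have d: "d > 0"
    using l0 R(1) k by (simp add: d_def power_less_one_iff)
  define \<kappa> where "\<kappa> = m / d"
  have \<kappa>: "\<kappa> > 0" using m d by (simp add: \<kappa>_def)
  have fs: "\<kappa> * (1 - (l / norm z) ^ k) = \<kappa> + (- \<kappa> * l ^ k) * fund 0 z" for z :: "real ^ 'n"
    using fund_scale[of l z 0] l0 by (simp add: k_def algebra_simps)
  have bar: "\<kappa> * (1 - (l / norm z) ^ k) \<le> ?w z" if z: "l < norm z" "norm z < R" for z
    unfolding fs
  proof (rule min_principle_fund[OF N, where \<Omega> = "{z. l < norm z} \<inter> ball 0 R"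
        and F = "{z. l \<le> norm z} \<inter> cball 0 R" and p = 0 and w = ?w])
    show "closed ({z::real^'n. l \<le> norm z} \<inter> cball 0 R)"
      by (intro closed_Int closed_Collect_le continuous_intros closed_cball)
    show "continuous_on ({z. l \<le> norm z} \<inter> cball 0 R - {0}) ?w"
      by (rule continuous_on_subset[OF cw]) (use Rp[of p] in auto)
    show "twice_on ?w ({z. l < norm z} \<inter> ball 0 R - {0})"
      by (rule twice_on_subset[OF tww]) (use sub Rp[of p] in fastforce)
    show "laplacian ?w y \<le> 0" if "y \<in> {z. l < norm z} \<inter> ball 0 R - {0}" for y
      using sup[of y] Rp[of y] that by auto
    show "\<kappa> + (- \<kappa> * l ^ k) * fund 0 y \<le> ?w y"
      if "y \<in> {z. l \<le> norm z} \<inter> cball 0 R - {z. l < norm z} \<inter> ball 0 R - {0}" for y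
    proof -
      from that consider "norm y = l" | "norm y = R" by fastforce
      then show ?thesis
      proof cases
        case 1
        then show ?thesis unfolding fs[symmetric] using l0 by (simp add: kel_sphere)
      next
        case 2
        then have "\<kappa> * (1 - (l / norm y) ^ k) = m" using d by (simp add: \<kappa>_def d_def)
        then show ?thesis unfolding fs[symmetric] using m(2)[OF 2] by simp
      qed
    qed
    show "\<exists>Ra. \<forall>y\<in>{z. l < norm z} \<inter> ball 0 R - {0}. Ra \<le> norm y \<longrightarrow> \<kappa> + (- \<kappa> * l ^ k) * fund 0 y - e \<le> ?w y" for e
      by (intro exI[of _ R]) auto
    show "\<exists>M r. 0 < r \<and> (\<forall>y\<in>{z. l < norm z} \<inter> ball 0 R - {0}. norm (y - 0) < r \<longrightarrow> - M \<le> ?w y)"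
      using l0 by (intro exI[of _ 0] exI[of _ l]) auto
  qed (use z l0 open_exterior in auto)
  let ?q = "\<lambda>y. (real CARD('n) - 2) * u y + 2 * (grad u y \<bullet> y)"
  have qpos: "0 < ?q y" if "norm y = l" for y
  proof (rule kel_boundary_derivative[OF N l0 that _ \<kappa> R(1)])
    show "u differentiable (at y)"
      using tw cR that R(1) by (auto simp: twice_on_def subset_iff)
  qed (use bar in \<open>auto simp: k_def\<close>)
  have "continuous_on (cball 0 R) ?q"
    by (intro continuous_intros twice_on_continuous[OF tw] cR)
  then have "closed (cball 0 R \<inter> ?q -` {..0})"
    by (intro continuous_closed_preimage) auto
  then have "compact (cball 0 R \<inter> (cball 0 R \<inter> ?q -` {..0}))"
    by (intro compact_Int_closed) auto
  then have "compact (norm ` (cball 0 R \<inter> (cball 0 R \<inter> ?q -` {..0})))"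
    by (intro compact_continuous_image continuous_intros)
  then have "open (- (norm ` (cball 0 R \<inter> (cball 0 R \<inter> ?q -` {..0}))))"
    by (simp add: compact_imp_closed open_Compl)
  moreover have "l \<in> - (norm ` (cball 0 R \<inter> (cball 0 R \<inter> ?q -` {..0})))"
    using qpos by force
  ultimately obtain e where e: "e > 0" "ball l e \<subseteq> - (norm ` (cball 0 R \<inter> (cball 0 R \<inter> ?q -` {..0})))"
    using openE by blast
  \<comment> \<open>The shell contains mirror radii: with b < l + e, also l^2/b \<ge> 2 l - b > l -
    e.\<close>
  define b where "b = l + min e (R - l) / 2"
  have b: "l < b" "b < R" "b < l + e" using e(1) R(1) by (auto simp: b_def min_def field_simps)
  have qb: "0 < ?q y" if "l\<^sup>2 / b \<le> norm y" "norm y \<le> b" for y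
  proof -
    have "(2 * l - b) * b \<le> l\<^sup>2" using zero_le_power2[of "b - l"] by (simp add: power2_eq_square algebra_simps)
    then have "2 * l - b \<le> l\<^sup>2 / b" using b l0 by (simp add: le_divide_eq)
    then have "norm y \<in> ball l e" using that b by (auto simp: dist_real_def)
    then have "y \<notin> cball 0 R \<inter> (cball 0 R \<inter> ?q -` {..0})" using e(2) by blast
    then show ?thesis using that b by auto
  qed
  obtain m' where m': "m' > 0" "\<And>y. norm y = b \<Longrightarrow> m' \<le> ?w y"
    using sphere_min[of b] b by auto
  have LB: "m' * (b / norm y) ^ (CARD('n) - 2) \<le> ?w y" if "b \<le> norm y" "y \<noteq> p" for y
  proof (rule superharmonic_exterior_lower_bound[OF N, where p = p])
    show "continuous_on ({y. b \<le> norm y} - {p}) ?w"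
      by (rule continuous_on_subset[OF cw]) (use b in auto)
    show "twice_on ?w ({y. b < norm y} - {p})"
      by (rule twice_on_subset[OF tww]) (use sub b in fastforce)
    show "0 \<le> ?w y" if "b \<le> norm y" "y \<noteq> p" for y using gt[of y] that b by auto
  qed (use b l0 m' that sup in auto)
  \<comment> \<open>With z = y/|y|^2 one has kel \<mu> u y = |y|^(2 - N)
    \<open>?F (\<mu>, z)\<close>. The far region becomes a compact ball, infinity corresponding to z
    = 0, so uniform continuity in \<mu> is available.\<close>
  let ?F = "\<lambda>(\<mu>, z). \<mu> ^ k * u (\<mu>\<^sup>2 *\<^sub>R z)"
  define X where "X = {l..b} \<times> cball (0::real^'n) (1 / b)"
  have inball: "\<mu>\<^sup>2 *\<^sub>R z \<in> cball 0 R" if "(\<mu>, z) \<in> X" for \<mu> z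
  proof -
    have "\<mu>\<^sup>2 * norm z \<le> b\<^sup>2 * (1 / b)"
      using that l0 by (intro mult_mono power_mono) (auto simp: X_def)
    also have "\<dots> \<le> R" using b l0 by (simp add: power2_eq_square)
    finally show ?thesis by simp
  qed
  have "continuous_on X ?F"
    unfolding case_prod_unfold
    by (intro continuous_intros continuous_on_compose2[OF twice_on_continuous(1)[OF tw cR]])
      (use inball in auto)
  moreover have "compact X" unfolding X_def by (intro compact_Times) auto
  ultimately have "uniformly_continuous_on X ?F" by (rule compact_uniformly_continuous)
  moreover have "m' * b ^ k > 0" using m' b l0 by simp
  ultimately have "\<exists>\<delta>>0. \<forall>x\<in>X. \<forall>x'\<in>X. dist x' x < \<delta> \<longrightarrow> dist (?F x') (?F x) < m' * b ^ k"
    unfolding uniformly_continuous_on_def by blast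
  then obtain \<delta> where \<delta>: "\<delta> > 0"
    "\<And>x x'. x \<in> X \<Longrightarrow> x' \<in> X \<Longrightarrow> dist x' x < \<delta> \<Longrightarrow> dist (?F x') (?F x) < m' * b ^ k"
    by blast
  show ?thesis
  proof
    show "min \<delta> (b - l) > 0" using \<delta>(1) b by simp
    fix \<mu> y assume \<mu>: "l \<le> \<mu>" "\<mu> < l + min \<delta> (b - l)" and y: "\<mu> \<le> norm y" "y \<in> punct p"
    have "y \<noteq> 0" using y(1) \<mu>(1) l0 by auto
    then have yp: "y \<noteq> p" by (rule punct_ne[OF y(2)])
    show "kel \<mu> u y \<le> u y"
    proof (cases "norm y \<le> b")
      case True
      show ?thesis
      proof (rule kel_le_of_radial_monotone[OF N _ y(1)])
        show "0 < \<mu>" using \<mu> l0 by simp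
        fix z :: "real ^ 'n" assume z: "\<mu>\<^sup>2 / norm y \<le> norm z" "norm z \<le> norm y"
        have "l\<^sup>2 / b \<le> \<mu>\<^sup>2 / norm y"
          using \<mu> l0 True y by (intro frac_le power_mono) (auto simp: \<open>y \<noteq> 0\<close>)
        then have "0 < ?q z" using qb[of z] z True by auto
        moreover have "z \<in> punct p" using z True b cR by (auto simp: subset_iff)
        ultimately show "u differentiable (at z) \<and> 0 < u z \<and> 0 < ?q z"
          using tw pos by (auto simp: twice_on_def)
      qed
    next
      case False
      define z where "z = (1 / (y \<bullet> y)) *\<^sub>R y"
      have nz: "norm z = 1 / norm y"
        using \<open>y \<noteq> 0\<close> by (simp add: z_def power2_norm_eq_inner[symmetric] power2_eq_square)
      have "1 / norm y \<le> 1 / b" using False b l0 \<open>y \<noteq> 0\<close> by (intro divide_left_mono mult_pos_pos) auto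
      then have X: "(\<mu>, z) \<in> X" "(l, z) \<in> X" using \<mu> b by (auto simp: X_def nz)
      have "dist (\<mu>, z) (l, z) < \<delta>" using \<mu> by (simp add: dist_Pair_Pair dist_real_def)
      then have "dist (?F (\<mu>, z)) (?F (l, z)) < m' * b ^ k" by (rule \<delta>(2)[OF X(2,1)])
      then have Fd: "?F (\<mu>, z) \<le> ?F (l, z) + m' * b ^ k" by (simp add: dist_real_def)
      have kF: "kel r u y = (1 / norm y) ^ k * ?F (r, z)" for r
        by (simp add: kel_def sinv_eq z_def k_def power_divide)
      have "kel \<mu> u y \<le> (1 / norm y) ^ k * (?F (l, z) + m' * b ^ k)"
        unfolding kF[of \<mu>] by (intro mult_left_mono Fd) auto
      also have "\<dots> = kel l u y + m' * (b / norm y) ^ (CARD('n) - 2)"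
        unfolding kF[of l] by (simp add: k_def power_divide algebra_simps add_divide_distrib)
      also have "\<dots> \<le> u y" using LB[of y] False yp by simp
      finally show ?thesis .
    qed
  qed
qed

definition below_sphere :: "real ^ 'n \<Rightarrow> (real ^ 'n \<Rightarrow> real) \<Rightarrow> real \<Rightarrow> bool" where
  "below_sphere p u l \<longleftrightarrow> (\<forall>y\<in>punct p. l \<le> norm y \<longrightarrow> kel l u y \<le> u y)"

lemma below_sphere_limit:
  fixes u :: "real ^ 'n \<Rightarrow> real"
  assumes tw: "twice_on u (punct p)" and s: "adm p s"
    and bl: "\<And>l. 0 < l \<Longrightarrow> l < s \<Longrightarrow> below_sphere p u l"
  shows "below_sphere p u s"
  unfolding below_sphere_def
proof (intro ballI impI)
  fix y assume y: "y \<in> punct p" "s \<le> norm y"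
  have s0: "s > 0" using s by (simp add: adm_def)
  have y0: "y \<noteq> 0" using y s0 by auto
  have "sinv s y \<in> punct p" using adm_sinv[OF s y(2)] adm_cball[OF s] by blast
  then have "isCont u (sinv s y)"
    using twice_on_has_derivative(1)[OF tw] has_derivative_continuous by blast
  moreover have "((\<lambda>l. sinv l y) \<longlongrightarrow> sinv s y) (at_left s)"
    unfolding sinv_def by (intro tendsto_intros) (use y0 in auto)
  ultimately have "((\<lambda>l. u (sinv l y)) \<longlongrightarrow> u (sinv s y)) (at_left s)"
    by (rule isCont_tendsto_compose)
  then have "((\<lambda>l. kel l u y) \<longlongrightarrow> kel s u y) (at_left s)"
    unfolding kel_def by (intro tendsto_intros) (use y0 in auto)
  moreover have "\<forall>\<^sub>F l in at_left s. kel l u y \<le> u y"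
    unfolding eventually_at_left_field
    using s0 bl y by (intro exI[of _ 0]) (auto simp: below_sphere_def)
  ultimately show "kel s u y \<le> u y"
    by (intro tendsto_upperbound) auto
qed

text \<open>Monotonicity makes the difference between a solution and its smaller Kelvin transform
  superharmonic; strictness in the partner's argument carries equality from one component to the
  other; homogeneity is invariance under Kelvin transforms. The list is symmetric, so
  \<open>swap\<close> gives every statement for the other component.\<close>

locale conformal_pair =
  fixes N :: nat and f g :: "real \<Rightarrow> real \<Rightarrow> real"
  assumes N3: "3 \<le> N"
    and f_pos: "0 < a \<Longrightarrow> 0 < b \<Longrightarrow> 0 < f a b"
    and g_pos: "0 < a \<Longrightarrow> 0 < b \<Longrightarrow> 0 < g a b"
    and f_mono: "0 < a \<Longrightarrow> a \<le> a' \<Longrightarrow> 0 < b \<Longrightarrow> b \<le> b' \<Longrightarrow> f a b \<le> f a' b'"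
    and g_mono: "0 < a \<Longrightarrow> a \<le> a' \<Longrightarrow> 0 < b \<Longrightarrow> b \<le> b' \<Longrightarrow> g a b \<le> g a' b'"
    and f_strict: "0 < a \<Longrightarrow> 0 < b \<Longrightarrow> b < b' \<Longrightarrow> f a b < f a b'"
    and g_strict: "0 < a \<Longrightarrow> 0 < b \<Longrightarrow> a < a' \<Longrightarrow> g a b < g a' b"
    and f_hom: "0 < c \<Longrightarrow> 0 < a \<Longrightarrow> 0 < b \<Longrightarrow> f (c ^ (N - 2) * a) (c ^ (N - 2) * b) = c ^ (N + 2) * f a b"
    and g_hom: "0 < c \<Longrightarrow> 0 < a \<Longrightarrow> 0 < b \<Longrightarrow> g (c ^ (N - 2) * a) (c ^ (N - 2) * b) = c ^ (N + 2) * g a b"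
begin

lemma swap: "conformal_pair N (\<lambda>a b. g b a) (\<lambda>a b. f b a)"
  by unfold_locales (use N3 f_pos g_pos f_mono g_mono f_strict g_strict f_hom g_hom in auto)

definition sol :: "(real ^ 'n \<Rightarrow> real) \<Rightarrow> (real ^ 'n \<Rightarrow> real) \<Rightarrow> (real ^ 'n) set \<Rightarrow> bool" where
  "sol u v S \<longleftrightarrow> CARD('n) = N \<and> open S \<and> twice_on u S \<and> twice_on v S \<and>
    (\<forall>y\<in>S. 0 < u y \<and> 0 < v y \<and> laplacian u y = - f (u y) (v y) \<and> laplacian v y = - g (u y) (v y))"

lemma laplacian_kel:
  fixes u v :: "real ^ 'n \<Rightarrow> real"
  assumes s: "sol u v S" and l: "l > 0" and y: "y \<noteq> 0" "sinv l y \<in> S"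
  shows "laplacian (kel l u) y = - f (kel l u y) (kel l v y)"
    and "laplacian (kel l v) y = - g (kel l u y) (kel l v y)"
    and "0 < kel l u y" "0 < kel l v y"
proof -
  have N: "3 \<le> CARD('n)" and S: "open S" "twice_on u S" "twice_on v S" and CN: "CARD('n) = N"
    using s N3 by (auto simp: sol_def)
  have 1: "laplacian u (sinv l y) = - f (u (sinv l y)) (v (sinv l y))"
    "laplacian v (sinv l y) = - g (u (sinv l y)) (v (sinv l y))"
    "0 < u (sinv l y)" "0 < v (sinv l y)"
    using s y by (auto simp: sol_def)
  have c: "0 < l / norm y" using l y by simp
  show "laplacian (kel l u) y = - f (kel l u y) (kel l v y)"
    using twice_on_kel(2)[OF N l S(1,2), of y] y 1 f_hom[OF c 1(3,4)] by (simp add: kel_def CN)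
  show "laplacian (kel l v) y = - g (kel l u y) (kel l v y)"
    using twice_on_kel(2)[OF N l S(1,3), of y] y 1 g_hom[OF c 1(3,4)] by (simp add: kel_def CN)
  show "0 < kel l u y" "0 < kel l v y"
    using 1 c by (auto simp: kel_def simp del: zero_less_divide_iff)
qed

text \<open>Both components lie above their transforms, so u - kel l u is superharmonic by
  monotonicity of \<open>f\<close> and the strong minimum principle applies. If it vanishes, so does
  its Laplacian, and strict monotonicity of \<open>f\<close> in its second argument forces equality
  for \<open>v\<close>.\<close>

lemma kel_dichotomy:
  fixes u v :: "real ^ 'n \<Rightarrow> real"
  assumes s: "sol u v (punct p)" and l: "adm p l"
    and bl: "below_sphere p u l" "below_sphere p v l"
  defines "U \<equiv> {y. l < norm y} - {p}"
  shows "\<And>y. y \<in> U \<Longrightarrow> laplacian (\<lambda>y. u y - kel l u y) y \<le> 0"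
    and "(\<forall>y\<in>U. kel l u y = u y) \<or> (\<forall>y\<in>U. kel l u y < u y)"
    and "(\<forall>y\<in>U. kel l u y = u y) \<Longrightarrow> (\<forall>y\<in>U. kel l v y = v y)"
proof -
  have N: "3 \<le> CARD('n)" and tu: "twice_on u (punct p)"
    using s N3 by (auto simp: sol_def)
  have l0: "l > 0" using l by (simp add: adm_def)
  have U: "open U" unfolding U_def using open_exterior by auto
  have Uc: "connected U"
  proof -
    have "connected (- cball (0::real^'n) l)"
      using N by (intro connected_complement_bounded_convex) auto
    moreover have "- cball (0::real^'n) l = {y. l < norm y}" by auto
    ultimately show ?thesis
      unfolding U_def using N open_exterior by (intro connected_open_delete) auto
  qed
  obtain T where T: "open T" "{y. l \<le> norm y} \<subseteq> T" "twice_on (kel l u) T"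
    using twice_on_kel_exterior[OF N l tu] by metis
  have Up: "U \<subseteq> punct p" "U \<subseteq> T" using T(2) by (auto simp: U_def ne_punct subset_iff)
  let ?w = "\<lambda>y. u y - kel l u y"
  note d = twice_on_diff[OF U twice_on_subset[OF tu Up(1)] twice_on_subset[OF T(3) Up(2)]]
  have le: "kel l u y \<le> u y" "kel l v y \<le> v y" if "y \<in> U" for y
    using bl that Up by (auto simp: below_sphere_def U_def)
  have sn: "sinv l y \<in> punct p" "y \<noteq> 0" if "y \<in> U" for y
    using adm_sinv[OF l, of y] adm_cball[OF l] that l0 by (auto simp: U_def)
  have lw: "laplacian ?w y = f (kel l u y) (kel l v y) - f (u y) (v y)" if y: "y \<in> U" for y
    using d(2)[OF y] laplacian_kel(1)[OF s l0 sn(2)[OF y] sn(1)[OF y]] s y Up by (auto simp: sol_def)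
  have kpos: "0 < kel l u y" "0 < kel l v y" if y: "y \<in> U" for y
    using laplacian_kel(3,4)[OF s l0 sn(2)[OF y] sn(1)[OF y]] by auto
  show sup: "laplacian ?w y \<le> 0" if y: "y \<in> U" for y
    using lw[OF y] f_mono[OF kpos(1)[OF y] le(1)[OF y] kpos(2)[OF y] le(2)[OF y]] by simp
  show "(\<forall>y\<in>U. kel l u y = u y) \<or> (\<forall>y\<in>U. kel l u y < u y)"
  proof (cases "\<exists>q\<in>U. ?w q = 0")
    case True
    then obtain q where q: "q \<in> U" "?w q = 0" by blast
    have "?w y = 0" if "y \<in> U" for y
      by (rule strong_min_principle[OF N U Uc d(1) sup _ q that]) (use le in auto)
    then show ?thesis by auto
  next
    case False
    then show ?thesis using le by (force simp: less_le)
  qed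
  show "\<forall>y\<in>U. kel l v y = v y" if eq: "\<forall>y\<in>U. kel l u y = u y"
  proof
    fix y assume y: "y \<in> U"
    have "laplacian ?w y = laplacian (\<lambda>_. 0) y"
      by (rule laplacian_cong_open[OF U y]) (use eq in auto)
    then have "f (kel l u y) (kel l v y) = f (u y) (v y)"
      using lw[OF y] by (simp add: laplacian_const)
    then have e: "f (u y) (kel l v y) = f (u y) (v y)" using eq y by simp
    show "kel l v y = v y"
    proof (rule ccontr)
      assume "kel l v y \<noteq> v y"
      then have "kel l v y < v y" using le(2)[OF y] by simp
      from f_strict[OF _ kpos(2)[OF y] this, of "u y"] e s y Up show False
        by (auto simp: sol_def)
    qed
  qed
qed

lemma sol_swap: "sol u v S \<Longrightarrow> conformal_pair.sol N (\<lambda>a b. g b a) (\<lambda>a b. f b a) v u S"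
  unfolding conformal_pair.sol_def[OF swap] sol_def by auto

text \<open>If strictness fails in one component, that component coincides with its transform, and
  then the other one does too; otherwise both can be stepped.\<close>

lemma kel_equal_or_step:
  fixes u v :: "real ^ 'n \<Rightarrow> real"
  assumes s: "sol u v (punct p)" and l: "adm p l"
    and bl: "below_sphere p u l" "below_sphere p v l"
  shows "(\<forall>y\<in>punct p. l \<le> norm y \<longrightarrow> kel l u y = u y \<and> kel l v y = v y) \<or>
    (\<exists>\<eta>>0. \<forall>\<mu>. l \<le> \<mu> \<and> \<mu> < l + \<eta> \<longrightarrow> below_sphere p u \<mu> \<and> below_sphere p v \<mu>)"
proof -
  have N: "3 \<le> CARD('n)" and tu: "twice_on u (punct p)" "twice_on v (punct p)"
    and pos: "\<And>y. y \<in> punct p \<Longrightarrow> 0 < u y" "\<And>y. y \<in> punct p \<Longrightarrow> 0 < v y"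
    using s N3 by (auto simp: sol_def)
  have l0: "l > 0" using l by (simp add: adm_def)
  let ?U = "{y. l < norm y} - {p}"
  note D = kel_dichotomy[OF s l bl]
  note D' = conformal_pair.kel_dichotomy[OF swap sol_swap[OF s] l bl(2,1)]
  show ?thesis
  proof (cases "\<forall>y\<in>?U. kel l u y < u y \<and> kel l v y < v y")
    case True
    obtain e1 where e1: "e1 > 0"
      "\<And>\<mu> y. l \<le> \<mu> \<Longrightarrow> \<mu> < l + e1 \<Longrightarrow> \<mu> \<le> norm y \<Longrightarrow> y \<in> punct p \<Longrightarrow> kel \<mu> u y \<le> u y"
      by (rule kel_step[OF N l tu(1) pos(1)]) (use True D(1) in auto)
    obtain e2 where e2: "e2 > 0"
      "\<And>\<mu> y. l \<le> \<mu> \<Longrightarrow> \<mu> < l + e2 \<Longrightarrow> \<mu> \<le> norm y \<Longrightarrow> y \<in> punct p \<Longrightarrow> kel \<mu> v y \<le> v y"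
      by (rule kel_step[OF N l tu(2) pos(2)]) (use True D'(1) in auto)
    show ?thesis
      using e1 e2 by (intro disjI2 exI[of _ "min e1 e2"]) (auto simp: below_sphere_def)
  next
    case False
    then have "(\<forall>y\<in>?U. kel l u y = u y) \<or> (\<forall>y\<in>?U. kel l v y = v y)"
      using D(2) D'(2) by blast
    then have eq: "kel l u y = u y \<and> kel l v y = v y" if "y \<in> ?U" for y
      using D(3) D'(3) that by blast
    have "kel l u y = u y \<and> kel l v y = v y" if y: "y \<in> punct p" "l \<le> norm y" for y
    proof (cases "norm y = l")
      case True then show ?thesis using l0 by (simp add: kel_sphere)
    next
      case False
      have "y \<noteq> 0" using y l0 by auto
      then have "y \<noteq> p" by (rule punct_ne[OF y(1)])
      then show ?thesis using False y by (intro eq) auto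
    qed
    then show ?thesis by blast
  qed
qed

text \<open>At the supremum of the radii up to which both comparisons hold, they still hold by
  continuity. If that supremum lies below a failing radius, stepping further would contradict it, so
  equality must occur there.\<close>

theorem moving_spheres:
  fixes u v :: "real ^ 'n \<Rightarrow> real"
  assumes s: "sol u v (punct p)"
  shows "(\<forall>l. adm p l \<longrightarrow> below_sphere p u l \<and> below_sphere p v l) \<or>
    (\<exists>l. adm p l \<and> (\<forall>y\<in>punct p. l \<le> norm y \<longrightarrow> kel l u y = u y \<and> kel l v y = v y))"
proof (rule ccontr)
  assume contra: "\<not> ?thesis"
  let ?B = "\<lambda>l. below_sphere p u l \<and> below_sphere p v l"
  have N: "3 \<le> CARD('n)" and tu: "twice_on u (punct p)" "twice_on v (punct p)"
    and pos: "\<And>y. y \<in> punct p \<Longrightarrow> 0 < u y" "\<And>y. y \<in> punct p \<Longrightarrow> 0 < v y"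
    and lap: "\<And>y. y \<in> punct p \<Longrightarrow> laplacian u y \<le> 0" "\<And>y. y \<in> punct p \<Longrightarrow> laplacian v y \<le> 0"
    using s N3 f_pos g_pos by (auto simp: sol_def less_imp_le)
  obtain l1 where l1: "adm p l1" "\<not> ?B l1" using contra by blast
  obtain a where a: "a > 0" "\<And>l y. 0 < l \<Longrightarrow> l \<le> a \<Longrightarrow> l \<le> norm y \<Longrightarrow> y \<in> punct p \<Longrightarrow> kel l u y \<le> u y"
    using kel_start[OF N tu(1) pos(1) lap(1)] by metis
  obtain b where b: "b > 0" "\<And>l y. 0 < l \<Longrightarrow> l \<le> b \<Longrightarrow> l \<le> norm y \<Longrightarrow> y \<in> punct p \<Longrightarrow> kel l v y \<le> v y"
    using kel_start[OF N tu(2) pos(2) lap(2)] by metis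
  \<comment> \<open>Requiring the comparison for all smaller radii as well makes this an initial
    segment, cut off at the failing radius \<open>l1\<close> to have a supremum.\<close>
  define A where "A = {l. 0 < l \<and> l \<le> l1 \<and> (\<forall>\<mu>. 0 < \<mu> \<and> \<mu> \<le> l \<longrightarrow> ?B \<mu>)}"
  have l10: "l1 > 0" using l1 by (simp add: adm_def)
  have "min l1 (min a b) \<in> A"
    using l10 a b by (auto simp: A_def below_sphere_def)
  then have Ane: "A \<noteq> {}" by blast
  have Abd: "bdd_above A" by (rule bdd_aboveI[of _ l1]) (simp add: A_def)
  define t where "t = Sup A"
  have t: "0 < t" "t \<le> l1"
    using cSup_upper[OF \<open>min l1 (min a b) \<in> A\<close> Abd] cSup_least[OF Ane, of l1] l10 a b
    by (auto simp: t_def A_def)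
  have adt: "adm p \<mu>" if "0 < \<mu>" "\<mu> \<le> l1" for \<mu> using l1(1) that by (auto simp: adm_def)
  have Blt: "?B l" if l: "0 < l" "l < t" for l
  proof -
    obtain l' where "l' \<in> A" "l < l'" using less_cSup_iff[OF Ane Abd] l by (auto simp: t_def)
    then show ?thesis using l by (simp add: A_def)
  qed
  have Bt: "?B t"
    using below_sphere_limit[OF tu(1) adt[OF t]] below_sphere_limit[OF tu(2) adt[OF t]] Blt by blast
  obtain \<eta> where \<eta>: "\<eta> > 0" "\<And>\<mu>. t \<le> \<mu> \<Longrightarrow> \<mu> < t + \<eta> \<Longrightarrow> ?B \<mu>"
    using kel_equal_or_step[OF s adt[OF t]] Bt contra adt[OF t] by blast
  have "t \<noteq> l1" using Bt l1(2) by auto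
  then have tl: "t < l1" using t by simp
  define x where "x = t + min \<eta> (l1 - t) / 2"
  have x: "t < x" "x \<le> l1" "x < t + \<eta>" using tl \<eta>(1) by (auto simp: x_def min_def field_simps)
  have "x \<in> A"
    unfolding A_def using x t Blt \<eta>(2) by (auto simp: not_less) (meson le_less_trans less_le_not_le linorder_not_le)+
  then have "x \<le> t" unfolding t_def by (intro cSup_upper Abd)
  with x show False by simp
qed

end

subsection \<open>Entire solutions\<close>

text \<open>Here \<phi> is the squared radius of the invariant spheres along a line. Letting D tend
  to infinity in the functional equation gives (\<phi>(t + D) - D^2)/D \<rightarrow> \<phi>'(t).
  Computing the same limit from base point 0 gives \<phi>'(0) + 2 t, so \<phi>' is affine.\<close>

lemma inversion_equation_imp_quadratic:
  fixes \<phi> \<phi>' :: "real \<Rightarrow> real"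
  assumes pos: "\<And>t. 0 < \<phi> t"
    and d: "\<And>t. (\<phi> has_real_derivative \<phi>' t) (at t)"
    and eq: "\<And>t D. 0 < D \<Longrightarrow> \<phi> t \<le> D\<^sup>2 \<Longrightarrow> \<phi> (t + D) * \<phi> t = D\<^sup>2 * \<phi> (t + \<phi> t / D)"
  shows "\<phi> t = t\<^sup>2 + \<phi>' 0 * t + \<phi> 0"
proof -
  have lim: "((\<lambda>D. (\<phi> (t + D) - D\<^sup>2) / D) \<longlongrightarrow> \<phi>' t) at_top" for t
  proof -
    have f0: "((\<lambda>D. \<phi> t / D) \<longlongrightarrow> 0) at_top"
      by (rule real_tendsto_divide_at_top[OF tendsto_const filterlim_ident])
    have fl: "filterlim (\<lambda>D. \<phi> t / D) (at 0) at_top"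
      unfolding filterlim_at using f0 pos[of t]
      by (auto intro!: eventually_mono[OF eventually_gt_at_top[of 0]])
    \<comment> \<open>The difference quotient with increment \<phi> t/D, the offset of the mirror
      image of t + D; the functional equation rewrites it through \<phi>(t + D).\<close>
    have "((\<lambda>D. (\<phi> (t + \<phi> t / D) - \<phi> t) / (\<phi> t / D)) \<longlongrightarrow> \<phi>' t) at_top"
      by (rule filterlim_compose[OF d[of t, unfolded DERIV_def] fl])
    moreover have "\<forall>\<^sub>F D in at_top. (\<phi> (t + \<phi> t / D) - \<phi> t) / (\<phi> t / D) = (\<phi> (t + D) - D\<^sup>2) / D"
      using eventually_ge_at_top[of "max 1 (\<phi> t)"]
    proof eventually_elim
      case (elim D)
      then have D: "0 < D" "\<phi> t \<le> D\<^sup>2"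
        using mult_mono[of 1 D "\<phi> t" D] pos[of t] by (auto simp: power2_eq_square)
      from eq[OF this] pos[of t] have "\<phi> (t + \<phi> t / D) = \<phi> (t + D) * \<phi> t / D\<^sup>2"
        using D by (simp add: field_simps)
      then show ?case using pos[of t] D by (simp add: field_simps power2_eq_square)
    qed
    ultimately show ?thesis by (rule Lim_transform_eventually)
  qed
  have der: "\<phi>' t = 2 * t + \<phi>' 0" for t
  proof -
    have fl: "filterlim (\<lambda>D. t + D) at_top at_top"
      by (rule filterlim_tendsto_add_at_top[OF tendsto_const filterlim_ident])
    have t0: "((\<lambda>D. c / D) \<longlongrightarrow> 0) at_top" for c :: real
      by (rule real_tendsto_divide_at_top[OF tendsto_const filterlim_ident])
    \<comment> \<open>The same limit with base point 0 and distance t + D; shifting the square from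
      t + D to D contributes 2 t.\<close>
    have "((\<lambda>D. (\<phi> (0 + (t + D)) - (t + D)\<^sup>2) / (t + D)) \<longlongrightarrow> \<phi>' 0) at_top"
      by (rule filterlim_compose[OF lim fl])
    then have "((\<lambda>D. (\<phi> (t + D) - (t + D)\<^sup>2) / (t + D) * (t / D + 1) + (2 * t + t\<^sup>2 / D)) \<longlongrightarrow> \<phi>' 0 * (0 + 1) + (2 * t + 0)) at_top"
      by (intro tendsto_intros t0) simp
    moreover have "\<forall>\<^sub>F D in at_top. (\<phi> (t + D) - (t + D)\<^sup>2) / (t + D) * (t / D + 1) + (2 * t + t\<^sup>2 / D) = (\<phi> (t + D) - D\<^sup>2) / D"
      using eventually_gt_at_top[of "max 0 (- t)"]
    proof eventually_elim
      case (elim D)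
      then have D: "D > 0" "t + D \<noteq> 0" by auto
      have "t / D + 1 = (t + D) / D" using D(1) by (simp add: add_divide_distrib)
      then have "(\<phi> (t + D) - (t + D)\<^sup>2) / (t + D) * (t / D + 1) = (\<phi> (t + D) - (t + D)\<^sup>2) / D"
        using D(2) by simp
      moreover have "2 * t + t\<^sup>2 / D = ((t + D)\<^sup>2 - D\<^sup>2) / D"
        using D(1) by (simp add: field_simps power2_eq_square)
      ultimately show ?case by (simp flip: add_divide_distrib)
    qed
    ultimately have "((\<lambda>D. (\<phi> (t + D) - D\<^sup>2) / D) \<longlongrightarrow> \<phi>' 0 * (0 + 1) + (2 * t + 0)) at_top"
      by (rule Lim_transform_eventually)
    from tendsto_unique[OF _ this lim[of t]] show ?thesis by simp
  qed
  have "((\<lambda>t. \<phi> t - t\<^sup>2 - \<phi>' 0 * t) has_real_derivative 0) (at t)" for t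
    using der[of t] by (auto intro!: derivative_eq_intros d)
  then have "(\<lambda>t. \<phi> t - t\<^sup>2 - \<phi>' 0 * t) t = (\<lambda>t. \<phi> t - t\<^sup>2 - \<phi>' 0 * t) 0"
    using DERIV_isconst_all by blast
  then show ?thesis by simp
qed

lemma eventually_norm_diff_ge:
  fixes c :: "'a::real_normed_vector"
  shows "\<forall>\<^sub>F y in at_infinity. Z \<le> norm (y - c)"
  unfolding eventually_at_infinity
proof (intro exI allI impI)
  fix x :: 'a assume "norm c + Z \<le> norm x"
  then show "Z \<le> norm (x - c)" using norm_triangle_sub[of x c] by linarith
qed

lemma tendsto_norm_ratio_at_infinity:
  fixes c :: "'a::real_normed_vector"
  shows "((\<lambda>y. norm y / norm (y - c)) \<longlongrightarrow> 1) at_infinity"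
proof -
  have fl: "filterlim (\<lambda>y. norm (y - c)) at_top at_infinity"
    unfolding filterlim_at_top using eventually_norm_diff_ge by blast
  have "((\<lambda>y. norm y / norm (y - c) - 1) \<longlongrightarrow> 0) at_infinity"
  proof (rule Lim_null_comparison)
    show "((\<lambda>y. norm c / norm (y - c)) \<longlongrightarrow> 0) at_infinity"
      by (rule real_tendsto_divide_at_top[OF tendsto_const fl])
    from eventually_norm_diff_ge[of 1 c]
    show "\<forall>\<^sub>F y in at_infinity. norm (norm y / norm (y - c) - 1) \<le> norm c / norm (y - c)"
    proof eventually_elim
      case (elim y)
      then have n: "0 < norm (y - c)" by linarith
      then have "norm y / norm (y - c) - 1 = (norm y - norm (y - c)) / norm (y - c)"
        by (simp add: diff_divide_distrib)
      moreover have "\<bar>norm y - norm (y - c)\<bar> \<le> norm c"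
        using norm_triangle_ineq3[of y "y - c"] by simp
      ultimately show ?case using n by (simp add: divide_right_mono del: zero_less_norm_iff)
    qed
  qed
  then have "((\<lambda>y. norm y / norm (y - c) - 1 + 1) \<longlongrightarrow> 0 + 1) at_infinity"
    by (intro tendsto_intros)
  then show ?thesis by simp
qed

text \<open>If the sphere about \<open>c\<close> leaves \<open>u\<close> invariant, this is the
  limit of |y|^(N - 2) u itself, so l^(N - 2) u(c) is the same number for every such centre.\<close>

lemma kel_at_infinity:
  fixes u :: "real ^ 'n \<Rightarrow> real"
  assumes u: "isCont u c"
  shows "((\<lambda>y. norm y ^ (CARD('n) - 2) * kel l (\<lambda>z. u (c + z)) (y - c)) \<longlongrightarrow> l ^ (CARD('n) - 2) * u c) at_infinity"
proof -
  have fl: "filterlim (\<lambda>y. y - c) at_infinity at_infinity"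
    unfolding filterlim_at_infinity_conv_norm_at_top filterlim_at_top
    using eventually_norm_diff_ge by blast
  have "((\<lambda>y::real^'n. sinv l y) \<longlongrightarrow> 0) at_infinity"
  proof (rule tendsto_norm_zero_cancel)
    show "((\<lambda>y::real^'n. norm (sinv l y)) \<longlongrightarrow> 0) at_infinity"
      unfolding norm_sinv by (rule real_tendsto_divide_at_top[OF tendsto_const filterlim_norm_at_top])
  qed
  then have "((\<lambda>y. sinv l (y - c)) \<longlongrightarrow> 0) at_infinity"
    by (rule filterlim_compose[OF _ fl])
  then have "((\<lambda>y. c + sinv l (y - c)) \<longlongrightarrow> c + 0) at_infinity"
    by (intro tendsto_intros)
  then have "((\<lambda>y. u (c + sinv l (y - c))) \<longlongrightarrow> u c) at_infinity"
    using isCont_tendsto_compose[OF u] by simp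
  from tendsto_mult[OF tendsto_power[OF tendsto_mult[OF tendsto_norm_ratio_at_infinity[of c] tendsto_const[of l]]] this]
  have "((\<lambda>y. (norm y / norm (y - c) * l) ^ (CARD('n) - 2) * u (c + sinv l (y - c))) \<longlongrightarrow> (1 * l) ^ (CARD('n) - 2) * u c) at_infinity" .
  then show ?thesis
    by (simp add: kel_def power_mult_distrib power_divide mult.assoc)
qed

text \<open>The centre lies on the ray from \<open>a\<close> through \<open>b\<close>, beyond
  \<open>b\<close>, and the radius is chosen so that inversion sends \<open>a\<close> to
  \<open>b\<close>. As t grows the sphere approaches the perpendicular bisector of the two points
  and the Kelvin weight tends to 1, so comparison in all these spheres yields u b \<le> u a.\<close>

lemma kel_on_line:
  fixes u :: "real ^ 'n \<Rightarrow> real"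
  assumes ab: "a \<noteq> b" and t: "t > 0"
  defines "x \<equiv> b + t *\<^sub>R (b - a)" and "l \<equiv> sqrt (t * (1 + t)) * norm (b - a)"
  shows "kel l (\<lambda>z. u (x + z)) (a - x) = sqrt (t / (1 + t)) ^ (CARD('n) - 2) * u b"
    and "l \<le> norm (a - x)" "0 < l" "l\<^sup>2 = norm (a - x) * norm (b - x)"
proof -
  have ax: "a - x = - ((1 + t) *\<^sub>R (b - a))" and bx: "b - x = - (t *\<^sub>R (b - a))"
    by (simp_all add: x_def algebra_simps)
  have n: "norm (a - x) = (1 + t) * norm (b - a)" "norm (b - x) = t * norm (b - a)"
    unfolding ax bx norm_minus_cancel norm_scaleR using t by auto
  have D: "norm (b - a) > 0" using ab by simp
  have "t * (1 + t) \<le> (1 + t)\<^sup>2" using t by (simp add: power2_eq_square algebra_simps)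
  then have "sqrt (t * (1 + t)) \<le> 1 + t" using t by (simp add: real_le_lsqrt)
  then show "l \<le> norm (a - x)"
    unfolding n l_def using D by (intro mult_right_mono) auto
  show "0 < l" using D t by (simp add: l_def)
  show "l\<^sup>2 = norm (a - x) * norm (b - x)"
    unfolding n l_def using t by (simp add: power_mult_distrib power2_eq_square)
  have r2: "(l / norm (a - x))\<^sup>2 = t / (1 + t)"
    unfolding n l_def using t D by (simp add: power_mult_distrib power_divide power2_eq_square)
  then have "l / norm (a - x) = sqrt (t / (1 + t))"
    using real_sqrt_unique[OF r2] \<open>0 < l\<close> by simp
  moreover have "x + sinv l (a - x) = b"
  proof -
    have "sinv l (a - x) = (t / (1 + t)) *\<^sub>R (a - x)"
      unfolding sinv_def r2 ..
    also have "\<dots> = b - x" unfolding ax bx using t by simp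
    finally show ?thesis by simp
  qed
  ultimately show "kel l (\<lambda>z. u (x + z)) (a - x) = sqrt (t / (1 + t)) ^ (CARD('n) - 2) * u b"
    by (simp add: kel_def)
qed

lemma le_of_kel_on_lines:
  fixes A B :: real
  assumes "\<And>t. t > 0 \<Longrightarrow> sqrt (t / (1 + t)) ^ k * B \<le> A"
  shows "B \<le> A"
proof -
  have "((\<lambda>t::real. 1 / (1 + t)) \<longlongrightarrow> 0) at_top"
    by (rule real_tendsto_divide_at_top[OF tendsto_const
          filterlim_tendsto_add_at_top[OF tendsto_const filterlim_ident]])
  then have "((\<lambda>t::real. sqrt (1 - 1 / (1 + t)) ^ k * B) \<longlongrightarrow> sqrt (1 - 0) ^ k * B) at_top"
    by (intro tendsto_intros)
  moreover have "\<forall>\<^sub>F t in at_top. sqrt (1 - 1 / (1 + t)) ^ k * B \<le> A"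
    using eventually_gt_at_top[of 0]
  proof eventually_elim
    case (elim t)
    then have "1 - 1 / (1 + t) = t / (1 + t)" by (simp add: field_simps)
    then show ?case using assms[OF elim] by simp
  qed
  ultimately have "sqrt (1 - 0) ^ k * B \<le> A"
    by (intro tendsto_upperbound) auto
  then show ?thesis by simp
qed

context conformal_pair begin

lemma sol_shift:
  assumes "sol u v S"
  shows "sol (\<lambda>y. u (c + y)) (\<lambda>y. v (c + y)) {y. c + y \<in> S}"
proof -
  have S: "open S" "twice_on u S" "twice_on v S" using assms by (auto simp: sol_def)
  have "open ((\<lambda>y. c + y) -` S)"
    by (intro open_vimage S continuous_intros)
  moreover have "(\<lambda>y. c + y) -` S = {y. c + y \<in> S}" by auto
  ultimately show ?thesis
    using twice_on_shift[OF S(1,2), of c] twice_on_shift[OF S(1,3), of c] assms by (auto simp: sol_def)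
qed

text \<open>Suppose every sphere about \<open>c\<close> only gives an inequality. An invariant
  sphere about another centre makes |y|^(N - 2) u converge, while the inequalities at
  \<open>c\<close> make the limit exceed l^(N - 2) u(c) for all l. Without any invariant sphere
  \<open>u\<close> would be constant, contradicting its negative Laplacian.\<close>

lemma entire_sphere_everywhere:
  fixes u v :: "real ^ 'n \<Rightarrow> real"
  assumes s: "sol u v UNIV"
  shows "\<exists>l>0. \<forall>y. l \<le> norm y \<longrightarrow>
      kel l (\<lambda>z. u (c + z)) y = u (c + y) \<and> kel l (\<lambda>z. v (c + z)) y = v (c + y)"
proof (rule ccontr)
  let ?E = "\<lambda>c l. \<forall>y. l \<le> norm y \<longrightarrow>
      kel l (\<lambda>z. u (c + z)) y = u (c + y) \<and> kel l (\<lambda>z. v (c + z)) y = v (c + y)"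
  let ?k = "CARD('n) - 2"
  assume "\<not> (\<exists>l>0. ?E c l)"
  have k: "?k > 0" using s N3 by (auto simp: sol_def)
  have up: "0 < u y" for y using s by (simp add: sol_def)
  have cu: "isCont u y" for y
    using s twice_on_has_derivative(1)[of u UNIV y] has_derivative_continuous by (auto simp: sol_def)
  have dich: "(\<forall>l>0. below_sphere 0 (\<lambda>z. u (c + z)) l) \<or> (\<exists>l>0. ?E c l)" for c
    using moving_spheres[of "\<lambda>y. u (c + y)" "\<lambda>y. v (c + y)" 0] sol_shift[OF s, of c]
    by (auto simp: punct_def adm_def)
  have bl: "\<forall>l>0. below_sphere 0 (\<lambda>z. u (c + z)) l" using dich[of c] \<open>\<not> (\<exists>l>0. ?E c l)\<close> by blast
  show False
  proof (cases "\<exists>c' l. l > 0 \<and> ?E c' l")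
    case True
    then obtain c' l' where E: "l' > 0" "?E c' l'" by blast
    define A where "A = l' ^ ?k * u c'"
    have lim: "((\<lambda>y. norm y ^ ?k * u y) \<longlongrightarrow> A) at_infinity"
    proof (rule Lim_transform_eventually)
      show "((\<lambda>y. norm y ^ ?k * kel l' (\<lambda>z. u (c' + z)) (y - c')) \<longlongrightarrow> A) at_infinity"
        unfolding A_def by (rule kel_at_infinity[OF cu])
      show "\<forall>\<^sub>F y in at_infinity. norm y ^ ?k * kel l' (\<lambda>z. u (c' + z)) (y - c') = norm y ^ ?k * u y"
        by (rule eventually_mono[OF eventually_norm_diff_ge[of l' c']]) (use E(2) in simp)
    qed
    have le: "l ^ ?k * u c \<le> A" if l: "l > 0" for l
    proof (rule tendsto_le[OF _ lim kel_at_infinity[OF cu, of l c]])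
      show "\<forall>\<^sub>F y in at_infinity. norm y ^ ?k * kel l (\<lambda>z. u (c + z)) (y - c) \<le> norm y ^ ?k * u y"
        using eventually_norm_diff_ge[of l c]
      proof eventually_elim
        case (elim y)
        then have "y - c \<in> punct 0" "l \<le> norm (y - c)" by (auto simp: punct_def)
        with bl l have "kel l (\<lambda>z. u (c + z)) (y - c) \<le> u (c + (y - c))"
          unfolding below_sphere_def by blast
        then show ?case
          by (intro mult_left_mono) auto
      qed
    qed (rule trivial_limit_at_infinity)
    \<comment> \<open>Then l^(N - 2) u(c) \<ge> l u(c) = |A| + u(c), which exceeds
      \<open>A\<close>.\<close>
    define l where "l = \<bar>A\<bar> / u c + 1"
    have l: "l \<ge> 1" using up[of c] by (simp add: l_def)
    then have "l \<le> l ^ ?k" using k by (intro self_le_power) auto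
    then have "l * u c \<le> A" using le[of l] l up[of c] by (smt (verit) mult_right_mono)
    moreover have "l * u c = \<bar>A\<bar> + u c" using up[of c] by (simp add: l_def field_simps)
    ultimately show False using up[of c] by linarith
  next
    case False
    then have bl: "below_sphere 0 (\<lambda>z. u (c + z)) l" if "l > 0" for c l
      using dich[of c] that by blast
    have le: "u b \<le> u a" for a b
    proof (cases "a = b")
      case ab: False
      show ?thesis
      proof (rule le_of_kel_on_lines)
        fix t :: real assume t: "t > 0"
        define x where "x = b + t *\<^sub>R (b - a)"
        define l where "l = sqrt (t * (1 + t)) * norm (b - a)"
        note K1 = kel_on_line(1)[OF ab t, where u = u, folded x_def l_def]
        note K = kel_on_line(2,3)[OF ab t, folded x_def l_def]
        have "kel l (\<lambda>z. u (x + z)) (a - x) \<le> u (x + (a - x))"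
          using bl[OF K(2), of x] K(1) by (auto simp: below_sphere_def punct_def)
        then show "sqrt (t / (1 + t)) ^ ?k * u b \<le> u a" using K1 by simp
      qed
    qed simp
    have "u y = u 0" for y using le[of y 0] le[of 0 y] by simp
    then have "laplacian u 0 = laplacian (\<lambda>_. u 0) (0::real^'n)"
      by (intro laplacian_cong_open[OF open_UNIV]) auto
    then have "laplacian u 0 = 0" by (simp add: laplacian_const)
    moreover have "laplacian u 0 < 0" using s f_pos[of "u 0" "v 0"] by (simp add: sol_def)
    ultimately show False by simp
  qed
qed

text \<open>The common limit at infinity turns the invariant spheres into u = A/l^(N - 2) and v =
  B/l^(N - 2) with one radius function \<open>l\<close>. It remains to determine the squared radius,
  which invariance forces to be a quadratic polynomial on every line through 0.\<close>

theorem entire_classification: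
  fixes u v :: "real ^ 'n \<Rightarrow> real"
  assumes s: "sol u v UNIV"
  obtains A B d x0 where "A > 0" "B > 0" "d > 0"
    "\<And>y. u y = A * (1 / (d + (y - x0) \<bullet> (y - x0))) powr ((real N - 2) / 2)"
    "\<And>y. v y = B * (1 / (d + (y - x0) \<bullet> (y - x0))) powr ((real N - 2) / 2)"
proof -
  let ?k = "CARD('n) - 2"
  have k: "?k > 0" and CN: "CARD('n) = N" using s N3 by (auto simp: sol_def)
  have rk: "real ?k = real N - 2" using CN N3 by (simp add: of_nat_diff)
  have pos: "0 < u y" "0 < v y" for y using s by (simp_all add: sol_def)
  have tw: "twice_on u UNIV" "twice_on v UNIV" using s by (auto simp: sol_def)
  have cu: "isCont u y" "isCont v y" for y
    using twice_on_has_derivative(1)[OF tw(1), of y] twice_on_has_derivative(1)[OF tw(2), of y]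
      has_derivative_continuous by auto
  obtain l where l: "\<And>c. 0 < l c" and
    E: "\<And>c y. l c \<le> norm y \<Longrightarrow> kel (l c) (\<lambda>z. u (c + z)) y = u (c + y) \<and> kel (l c) (\<lambda>z. v (c + z)) y = v (c + y)"
    using entire_sphere_everywhere[OF s] by metis
  have lim: "((\<lambda>y. norm y ^ ?k * u y) \<longlongrightarrow> l c ^ ?k * u c) at_infinity"
    "((\<lambda>y. norm y ^ ?k * v y) \<longlongrightarrow> l c ^ ?k * v c) at_infinity" for c
  proof -
    have ev: "\<forall>\<^sub>F y in at_infinity. l c \<le> norm (y - c)"
      by (rule eventually_norm_diff_ge)
    show "((\<lambda>y. norm y ^ ?k * u y) \<longlongrightarrow> l c ^ ?k * u c) at_infinity"
      by (rule Lim_transform_eventually[OF kel_at_infinity[OF cu(1)] eventually_mono[OF ev]])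
        (use E[of c] in simp)
    show "((\<lambda>y. norm y ^ ?k * v y) \<longlongrightarrow> l c ^ ?k * v c) at_infinity"
      by (rule Lim_transform_eventually[OF kel_at_infinity[OF cu(2)] eventually_mono[OF ev]])
        (use E[of c] in simp)
  qed
  define A B where "A = l 0 ^ ?k * u 0" and "B = l 0 ^ ?k * v 0"
  have AB: "A > 0" "B > 0" using pos l[of 0] by (auto simp: A_def B_def)
  have lA: "l c ^ ?k * u c = A" and lB: "l c ^ ?k * v c = B" for c
    using tendsto_unique[OF _ lim(1)[of c] lim(1)[of 0]] tendsto_unique[OF _ lim(2)[of c] lim(2)[of 0]]
    by (simp_all add: A_def B_def trivial_limit_at_infinity)
  have uA: "u c = A / l c ^ ?k" for c using lA[of c] l[of c] by (simp add: field_simps)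
  have vB: "v c = B / l c ^ ?k" for c using lB[of c] l[of c] by (simp add: field_simps)
  define L where "L = (\<lambda>c. (l c)\<^sup>2)"
  have Lpos: "L c > 0" for c using l[of c] by (simp add: L_def)
  \<comment> \<open>Writing the squared radius as a power of A/u shows that it is
    differentiable.\<close>
  define q where "q = 2 / (real N - 2)"
  have Lu: "L c = (A / u c) powr q" for c
  proof -
    have "A / u c = l c powr (real N - 2)"
      using lA[of c] pos(1)[of c] l[of c] rk by (simp add: field_simps flip: powr_realpow)
    then have "(A / u c) powr q = l c powr 2"
    proof -
      have "(real N - 2) * q = 2" unfolding q_def using N3 by (simp del: right_diff_distrib left_diff_distrib right_diff_distrib_numeral left_diff_distrib_numeral)
      with \<open>A / u c = _\<close> show ?thesis by (simp only: powr_powr)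
    qed
    then show ?thesis using l[of c] by (simp add: L_def)
  qed
  \<comment> \<open>Invariance under the sphere about \<open>c\<close>, expressed through the radii
    alone; on a line this is the functional equation solved above.\<close>
  have Leq: "L (c + y) * L c = (norm y)\<^sup>2 * L (c + (L c / (norm y)\<^sup>2) *\<^sub>R y)" if y: "l c \<le> norm y" for c y
  proof -
    let ?z = "c + sinv (l c) y"
    have n: "0 < norm y" using y l[of c] by linarith
    have "u (c + y) = (l c / norm y) ^ ?k * u ?z" using E[OF y] by (simp add: kel_def)
    then have "A / l (c + y) ^ ?k = (l c / norm y) ^ ?k * (A / l ?z ^ ?k)"
      unfolding uA .
    then have "(l (c + y) * l c) ^ ?k = (norm y * l ?z) ^ ?k"
    proof -
      have "P * Q = R * S" if "A / P = Q / R * (A / S)" "P > 0" "R > 0" "S > 0" for P Q R S :: real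
        using that AB(1) by (simp add: field_simps)
      from this[of "l (c + y) ^ ?k" "l c ^ ?k" "norm y ^ ?k" "l ?z ^ ?k"]
      show ?thesis
        using \<open>A / l (c + y) ^ ?k = _\<close> n l[of "c + y"] l[of ?z]
        by (simp add: power_divide power_mult_distrib del: zero_less_norm_iff)
    qed
    then have "l (c + y) * l c = norm y * l ?z"
      by (rule power_eq_imp_eq_base[OF _ _ _ k])
        (intro mult_nonneg_nonneg norm_ge_zero less_imp_le[OF l])+
    then have "(l (c + y) * l c)\<^sup>2 = (norm y * l ?z)\<^sup>2" by simp
    then show ?thesis by (simp add: L_def power_mult_distrib sinv_def power_divide)
  qed
  define K where "K = (\<lambda>s. q * (A / s) powr (q - 1) * (- (A / s\<^sup>2)))"
  have dK: "((\<lambda>s. (A / s) powr q) has_real_derivative K s) (at s)" if "s > 0" for s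
  proof -
    have 1: "((\<lambda>s. A / s) has_real_derivative - (A / s\<^sup>2)) (at s)"
      using that by (auto intro!: derivative_eq_intros simp: power2_eq_square)
    have "((\<lambda>x. x powr q) has_real_derivative q * (A / s) powr (q - 1)) (at (A / s))"
      using that AB by (auto intro!: derivative_eq_intros)
    from DERIV_chain2[OF this 1] show ?thesis by (simp add: K_def)
  qed
  \<comment> \<open>The derivative at 0 along a unit vector is linear in it, so the quadratics on
    the lines through 0 fit together.\<close>
  have quad: "L y = (norm y)\<^sup>2 + (K (u 0) *\<^sub>R grad u 0) \<bullet> y + L 0" for y
  proof (cases "y = 0")
    case False
    define e where "e = y /\<^sub>R norm y"
    have e: "norm e = 1" "y = norm y *\<^sub>R e" using False by (auto simp: e_def)
    have Ld: "((\<lambda>t. t *\<^sub>R e) has_derivative (\<lambda>h. h *\<^sub>R e)) (at t)" for t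
      by (auto intro!: derivative_eq_intros)
    have du: "((\<lambda>t. u (t *\<^sub>R e)) has_real_derivative (grad u (t *\<^sub>R e) \<bullet> e)) (at t)" for t
      unfolding has_field_derivative_def
      by (rule has_derivative_eq_rhs[OF has_derivative_compose[OF Ld twice_on_has_derivative(1)[OF tw(1)]]])
        (simp_all add: fun_eq_iff)
    have "L (norm y *\<^sub>R e) = (norm y)\<^sup>2 + (K (u (0 *\<^sub>R e)) * (grad u (0 *\<^sub>R e) \<bullet> e)) * norm y + L (0 *\<^sub>R e)"
    proof (rule inversion_equation_imp_quadratic[where \<phi> = "\<lambda>t. L (t *\<^sub>R e)"
          and \<phi>' = "\<lambda>t. K (u (t *\<^sub>R e)) * (grad u (t *\<^sub>R e) \<bullet> e)"])
      show "0 < L (t *\<^sub>R e)" for t by (rule Lpos)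
      show "((\<lambda>t. L (t *\<^sub>R e)) has_real_derivative K (u (t *\<^sub>R e)) * (grad u (t *\<^sub>R e) \<bullet> e)) (at t)" for t
        unfolding Lu by (rule DERIV_chain2[OF dK[OF pos(1)] du])
      show "L ((t + D) *\<^sub>R e) * L (t *\<^sub>R e) = D\<^sup>2 * L ((t + L (t *\<^sub>R e) / D) *\<^sub>R e)"
        if D: "0 < D" "L (t *\<^sub>R e) \<le> D\<^sup>2" for t D
      proof -
        have "l (t *\<^sub>R e) \<le> norm (D *\<^sub>R e)"
          using D power2_le_imp_le[of "l (t *\<^sub>R e)" D] by (simp add: L_def e)
        from Leq[OF this] D show ?thesis
          by (simp add: e(1) scaleR_add_left power2_eq_square)
      qed
    qed
    then show ?thesis unfolding e(2)[symmetric] by (simp add: e_def mult.commute mult.left_commute False)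
  qed simp
  define x0 where "x0 = - (1 / 2) *\<^sub>R (K (u 0) *\<^sub>R grad u 0)"
  define d where "d = L 0 - x0 \<bullet> x0"
  have Ld: "L y = d + (y - x0) \<bullet> (y - x0)" for y
  proof -
    have "K (u 0) *\<^sub>R grad u 0 = - 2 *\<^sub>R x0" by (simp add: x0_def)
    then show ?thesis unfolding quad[of y]
      by (simp add: d_def power2_norm_eq_inner inner_diff_left inner_diff_right inner_commute)
  qed
  have d: "d > 0" using Lpos[of x0] Ld[of x0] by simp
  have lp: "l y ^ ?k = L y powr ((real N - 2) / 2)" for y
  proof -
    have "L y powr ((real N - 2) / 2) = (l y powr 2) powr ((real N - 2) / 2)"
      using l[of y] by (simp add: L_def)
    also have "\<dots> = l y powr real ?k"
    proof -
      have "2 * (x / 2) = x" for x :: real by simp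
      then have "2 * ((real N - 2) / 2) = real ?k" unfolding rk .
      then show ?thesis by (simp only: powr_powr)
    qed
    finally show ?thesis using l[of y] by (simp add: powr_realpow)
  qed
  show ?thesis
  proof (rule that[OF AB d])
    fix y
    have e: "(1 / L y) powr ((real N - 2) / 2) = 1 / l y ^ ?k"
      using Lpos[of y] by (simp add: powr_divide lp)
    show "u y = A * (1 / (d + (y - x0) \<bullet> (y - x0))) powr ((real N - 2) / 2)"
      "v y = B * (1 / (d + (y - x0) \<bullet> (y - x0))) powr ((real N - 2) / 2)"
      unfolding Ld[symmetric] e uA[of y] vB[of y] by simp_all
  qed
qed

end

subsection \<open>Decay for the radial system with vanishing energy\<close>

text \<open>The equations say w'' = (\<delta>^2 - g) w. If y < - \<delta> at some time, then b = (w'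
  + \<delta> w) exp(- \<delta> t) is negative there and nonincreasing, so the derivative b exp(2
  \<delta> t) of w exp(\<delta> t) stays below a negative constant and \<open>w\<close> would reach
  0 in finite time.\<close>

lemma riccati_lower_bound:
  fixes w y g :: "real \<Rightarrow> real" and \<delta> :: real
  assumes \<delta>: "\<delta> > 0" and w: "\<And>t. 0 < w t" and g: "\<And>t. 0 \<le> g t"
    and dw: "\<And>t. (w has_real_derivative w t * y t) (at t)"
    and dy: "\<And>t. (y has_real_derivative \<delta>\<^sup>2 - (y t)\<^sup>2 - g t) (at t)"
  shows "- \<delta> \<le> y t0"
proof (rule ccontr)
  assume "\<not> - \<delta> \<le> y t0"
  define b where "b = (\<lambda>t. w t * (y t + \<delta>) * exp (- \<delta> * t))"
  have db: "(b has_real_derivative - w t * g t * exp (- \<delta> * t)) (at t)" for t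
    unfolding b_def
    by (auto intro!: derivative_eq_intros dw dy simp: algebra_simps power2_eq_square)
  have bmono: "b t \<le> b t0" if "t0 \<le> t" for t
  proof (rule DERIV_nonpos_imp_nonincreasing[OF that])
    fix x
    have "- w x * g x * exp (- \<delta> * x) \<le> 0"
      using w[of x] g[of x] by simp
    then show "\<exists>D. (b has_real_derivative D) (at x) \<and> D \<le> 0" using db by blast
  qed
  have b0: "b t0 < 0"
    using \<open>\<not> - \<delta> \<le> y t0\<close> w[of t0] by (simp add: b_def mult_less_0_iff)
  define c where "c = - b t0 * exp (2 * \<delta> * t0)"
  have c: "c > 0" using b0 by (simp add: c_def mult_neg_pos)
  have dv: "((\<lambda>t. w t * exp (\<delta> * t) + c * t) has_real_derivative (b t * exp (2 * \<delta> * t) + c)) (at t)" for t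
  proof -
    have "exp (2 * \<delta> * t) = exp (\<delta> * t) * exp (\<delta> * t)" "exp (- \<delta> * t) * exp (\<delta> * t) = 1"
      by (simp_all flip: exp_add)
    then show ?thesis
      by (auto intro!: derivative_eq_intros dw simp: b_def algebra_simps)
  qed
  have vmono: "w t * exp (\<delta> * t) + c * t \<le> w t0 * exp (\<delta> * t0) + c * t0" if "t0 \<le> t" for t
  proof (rule DERIV_nonpos_imp_nonincreasing[OF that])
    fix s assume s: "t0 \<le> s" "s \<le> t"
    have "b s * exp (2 * \<delta> * s) \<le> b t0 * exp (2 * \<delta> * s)" using bmono[OF s(1)] by simp
    also have "\<dots> \<le> b t0 * exp (2 * \<delta> * t0)" using b0 s \<delta> by (intro mult_left_mono_neg) auto
    finally have "b s * exp (2 * \<delta> * s) + c \<le> 0" by (simp add: c_def)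
    then show "\<exists>D. ((\<lambda>t. w t * exp (\<delta> * t) + c * t) has_real_derivative D) (at s) \<and> D \<le> 0"
      using dv by blast
  qed
  define t where "t = t0 + w t0 * exp (\<delta> * t0) / c"
  have "t0 \<le> t" using c w[of t0] by (simp add: t_def)
  from vmono[OF this] have "w t * exp (\<delta> * t) \<le> w t0 * exp (\<delta> * t0) + c * (t0 - t)"
    by (simp add: algebra_simps)
  also have "\<dots> = 0" using c by (simp add: t_def)
  finally show False using w[of t] by (simp add: mult_le_0_iff)
qed

text \<open>Time reversal changes the sign of \<open>y\<close> and preserves the Riccati
  equation.\<close>

lemma riccati_upper_bound:
  fixes w y g :: "real \<Rightarrow> real" and \<delta> :: real
  assumes \<delta>: "\<delta> > 0" and w: "\<And>t. 0 < w t" and g: "\<And>t. 0 \<le> g t"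
    and dw: "\<And>t. (w has_real_derivative w t * y t) (at t)"
    and dy: "\<And>t. (y has_real_derivative \<delta>\<^sup>2 - (y t)\<^sup>2 - g t) (at t)"
  shows "y t0 \<le> \<delta>"
proof -
  have m: "((\<lambda>t. - t) has_real_derivative - 1) (at t)" for t :: real
    by (auto intro!: derivative_eq_intros)
  have "- \<delta> \<le> - y (- (- t0))"
  proof (rule riccati_lower_bound[OF \<delta>, where w = "\<lambda>t. w (- t)" and g = "\<lambda>t. g (- t)" and y = "\<lambda>t. - y (- t)"])
    show "((\<lambda>t. w (- t)) has_real_derivative w (- t) * - y (- t)) (at t)" for t
      using DERIV_chain2[OF dw m, of t] by simp
    show "((\<lambda>t. - y (- t)) has_real_derivative \<delta>\<^sup>2 - (- y (- t))\<^sup>2 - g (- t)) (at t)" for t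
      using DERIV_minus[OF DERIV_chain2[OF dy m, of t]] by simp
  qed (use w g in auto)
  then show ?thesis by simp
qed

text \<open>Formulated by comparison with neighbouring values because it is applied to a function
  that may jump; bisection of the interval replaces the mean value theorem.\<close>

lemma local_imp_nonincreasing:
  fixes F :: "real \<Rightarrow> real"
  assumes "a \<le> b"
    and loc: "\<And>x. a \<le> x \<Longrightarrow> x \<le> b \<Longrightarrow> \<exists>d>0. \<forall>h. 0 < h \<and> h < d \<longrightarrow> F (x + h) \<le> F x \<and> F x \<le> F (x - h)"
  shows "F b \<le> F a"
  using assms(1)
proof (induction rule: Bolzano)
  case (trans a b c)
  then show ?case by linarith
next
  case (local x)
  obtain d where d: "d > 0" "\<And>h. 0 < h \<Longrightarrow> h < d \<Longrightarrow> F (x + h) \<le> F x \<and> F x \<le> F (x - h)"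
    using loc[OF local] by blast
  have "F v \<le> F u" if "u \<le> x" "x \<le> v" "v - u < d" for u v
  proof -
    have "F v \<le> F x" using d(2)[of "v - x"] that by (cases "v = x") auto
    moreover have "F x \<le> F u" using d(2)[of "x - u"] that by (cases "u = x") auto
    ultimately show ?thesis by linarith
  qed
  with d(1) show ?case by blast
qed

lemma DERIV_neg_local:
  fixes F :: "real \<Rightarrow> real"
  assumes "(F has_real_derivative l) (at x)" "l < 0"
  shows "\<exists>d>0. \<forall>h. 0 < h \<and> h < d \<longrightarrow> F (x + h) < F x \<and> F x < F (x - h)"
proof -
  obtain d1 where d1: "d1 > 0" "\<And>h. 0 < h \<Longrightarrow> h < d1 \<Longrightarrow> F (x + h) < F x"
    using DERIV_neg_dec_right[OF assms] by blast
  obtain d2 where d2: "d2 > 0" "\<And>h. 0 < h \<Longrightarrow> h < d2 \<Longrightarrow> F x < F (x - h)"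
    using DERIV_neg_dec_left[OF assms] by blast
  show ?thesis
    using d1 d2 by (intro exI[of _ "min d1 d2"]) auto
qed

lemma isCont_pos_local:
  fixes F :: "real \<Rightarrow> real"
  assumes "isCont F x" "0 < F x"
  shows "\<exists>d>0. \<forall>s. \<bar>s - x\<bar> < d \<longrightarrow> 0 < F s"
proof -
  have "\<forall>\<^sub>F s in at x. 0 < F s"
    using assms by (intro order_tendstoD(1)[of F "F x"]) (auto simp: isCont_def)
  then obtain d where d: "d > 0" "\<And>s. s \<noteq> x \<Longrightarrow> dist s x < d \<Longrightarrow> 0 < F s"
    unfolding eventually_at by auto
  then show ?thesis
    using assms(2) by (intro exI[of _ d]) (metis dist_real_def)
qed

text \<open>For \<delta> = (N - 2)/2 the value 2 + 2/\<delta> is the critical exponent 2N/(N - 2).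
  The logarithmic derivatives turn the second order equations into coupled Riccati
  equations.\<close>

locale crit_ode =
  fixes \<mu>1 \<mu>2 \<beta> \<delta> p :: real and w1 w2 y1 y2 :: "real \<Rightarrow> real"
  assumes \<mu>1: "\<mu>1 > 0" and \<mu>2: "\<mu>2 > 0" and \<beta>: "\<beta> > 0" and \<delta>: "\<delta> > 0" and p: "p = 2 + 2 / \<delta>"
    and w1: "\<And>t. 0 < w1 t" and w2: "\<And>t. 0 < w2 t"
    and dw1: "\<And>t. (w1 has_real_derivative w1 t * y1 t) (at t)"
    and dw2: "\<And>t. (w2 has_real_derivative w2 t * y2 t) (at t)"
    and dy1: "\<And>t. (y1 has_real_derivative
        \<delta>\<^sup>2 - (y1 t)\<^sup>2 - (\<mu>1 * w1 t powr (p - 2) + \<beta> * (w1 t * w2 t) powr (p / 2) / (w1 t)\<^sup>2)) (at t)"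
    and dy2: "\<And>t. (y2 has_real_derivative
        \<delta>\<^sup>2 - (y2 t)\<^sup>2 - (\<mu>2 * w2 t powr (p - 2) + \<beta> * (w2 t * w1 t) powr (p / 2) / (w2 t)\<^sup>2)) (at t)"
    and energy: "\<And>t. (w1 t)\<^sup>2 * (\<delta>\<^sup>2 - (y1 t)\<^sup>2) + (w2 t)\<^sup>2 * (\<delta>\<^sup>2 - (y2 t)\<^sup>2)
        = 2 / p * (\<mu>1 * w1 t powr p + \<mu>2 * w2 t powr p + 2 * (\<beta> * (w1 t * w2 t) powr (p / 2)))"
begin

section \<open>Splitting of the energy and bounds on the logarithmic derivatives\<close>

lemma swap: "crit_ode \<mu>2 \<mu>1 \<beta> \<delta> p w2 w1 y2 y1"
  by unfold_locales
    (use \<mu>1 \<mu>2 \<beta> \<delta> p w1 w2 dw1 dw2 dy1 dy2 energy in \<open>auto simp: mult.commute add.commute add.left_commute\<close>)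

definition C where "C t = \<beta> * (w1 t * w2 t) powr (p / 2)"
text \<open>The potential in w1'' = (\<delta>^2 - g1) w1.\<close>

definition g1 where "g1 t = \<mu>1 * w1 t powr (p - 2) + C t / (w1 t)\<^sup>2"
definition g2 where "g2 t = \<mu>2 * w2 t powr (p - 2) + C t / (w2 t)\<^sup>2"
definition D where "D t = (w1 t)\<^sup>2 * (\<delta>\<^sup>2 - (y1 t)\<^sup>2) - 2 / p * (\<mu>1 * w1 t powr p + C t)"
text \<open>The minimum at zeros of \<open>D\<close> fits the jumps: where \<open>D\<close> crosses
  0 upwards with nonzero slope, y1 > y2, so the value drops from \<open>y1\<close> to
  \<open>y2\<close>, and symmetrically for downward crossings.\<close>

definition Y where "Y t = (if D t > 0 then y2 t else if D t < 0 then y1 t else min (y1 t) (y2 t))"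

lemma C_swap: "crit_ode.C \<beta> p w2 w1 = C"
  unfolding crit_ode.C_def[OF swap] C_def[abs_def] by (auto simp: fun_eq_iff mult.commute crit_ode.C_def[OF swap] C_def)

lemma g_swap: "crit_ode.g1 \<mu>2 \<beta> p w2 w1 = g2" "crit_ode.g2 \<mu>1 \<beta> p w2 w1 = g1"
  by (auto simp: fun_eq_iff crit_ode.g1_def[OF swap] crit_ode.g2_def[OF swap] g1_def g2_def C_swap)

lemma p_gt: "p > 2" using \<delta> p by simp

lemma C_pos: "C t > 0" using \<beta> w1[of t] w2[of t] by (simp add: C_def)

lemma g_pos: "g1 t > 0" "g2 t > 0"
  unfolding g1_def g2_def using \<mu>1 \<mu>2 w1[of t] w2[of t] C_pos[of t] by (auto intro!: add_pos_pos)

lemma D_swap: "crit_ode.D \<mu>2 \<beta> \<delta> p w2 w1 y2 = (\<lambda>t. - D t)"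
proof
  fix t
  show "crit_ode.D \<mu>2 \<beta> \<delta> p w2 w1 y2 t = - D t"
    using energy[of t] by (simp add: crit_ode.D_def[OF swap] D_def C_swap) (simp add: C_def algebra_simps add_divide_distrib)
qed

lemma Y_swap: "crit_ode.Y \<mu>2 \<beta> \<delta> p w2 w1 y2 y1 = Y"
  by (auto simp: fun_eq_iff crit_ode.Y_def[OF swap] Y_def D_swap min.commute)

lemma w2g: "(w1 t)\<^sup>2 * g1 t = \<mu>1 * w1 t powr p + C t"
proof -
  have "(w1 t)\<^sup>2 * w1 t powr (p - 2) = w1 t powr p"
    using w1[of t] powr_add[of "w1 t" 2 "p - 2"] by simp
  then show ?thesis using w1[of t] by (simp add: g1_def algebra_simps)
qed

lemma D_eq: "D t = (w1 t)\<^sup>2 * (\<delta>\<^sup>2 - (y1 t)\<^sup>2 - 2 / p * g1 t)"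
  unfolding D_def w2g[symmetric] by (simp add: algebra_simps)

lemma D_eq2: "D t = - ((w2 t)\<^sup>2 * (\<delta>\<^sup>2 - (y2 t)\<^sup>2 - 2 / p * g2 t))"
  using crit_ode.D_eq[OF swap, of t] by (simp add: D_swap g_swap)

lemma dy1': "(y1 has_real_derivative \<delta>\<^sup>2 - (y1 t)\<^sup>2 - g1 t) (at t)"
  using dy1[of t] by (simp add: g1_def C_def)

lemma dy2': "(y2 has_real_derivative \<delta>\<^sup>2 - (y2 t)\<^sup>2 - g2 t) (at t)"
  using dy2[of t] by (simp add: g2_def C_def mult.commute)

lemma y_bound: "- \<delta> \<le> y1 t" "y1 t \<le> \<delta>" "- \<delta> \<le> y2 t" "y2 t \<le> \<delta>"
  using riccati_lower_bound[OF \<delta> w1 less_imp_le[OF g_pos(1)] dw1 dy1']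
    riccati_upper_bound[OF \<delta> w1 less_imp_le[OF g_pos(1)] dw1 dy1']
    riccati_lower_bound[OF \<delta> w2 less_imp_le[OF g_pos(2)] dw2 dy2']
    riccati_upper_bound[OF \<delta> w2 less_imp_le[OF g_pos(2)] dw2 dy2'] by auto

lemma Y_cases: "Y t = y1 t \<or> Y t = y2 t"
  by (auto simp: Y_def min_def)

lemma Y_bound: "- \<delta> \<le> Y t" "Y t \<le> \<delta>"
  using Y_cases[of t] y_bound[of t] by auto

lemma y_ge_Y_at_zero: "D t = 0 \<Longrightarrow> Y t \<le> y1 t \<and> Y t \<le> y2 t"
  by (simp add: Y_def)

definition \<kappa> where "\<kappa> = 1 - 2 / p"

lemma \<kappa>_pos: "\<kappa> > 0" using p_gt by (simp add: \<kappa>_def)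

text \<open>The energy part of the second component is \<open>- D\<close>, so D \<ge> 0 means
  \<delta>^2 - y2^2 \<le> (2/p) g2. In the Riccati equation this leaves the fraction 1 - 2/p of the
  potential as a rate of decrease.\<close>

lemma dy2_neg: "0 \<le> D t \<Longrightarrow> \<delta>\<^sup>2 - (y2 t)\<^sup>2 - g2 t \<le> - \<kappa> * g2 t"
proof -
  assume "0 \<le> D t"
  then have "(w2 t)\<^sup>2 * (\<delta>\<^sup>2 - (y2 t)\<^sup>2 - 2 / p * g2 t) \<le> 0" using D_eq2[of t] by simp
  then have "\<delta>\<^sup>2 - (y2 t)\<^sup>2 - 2 / p * g2 t \<le> 0" using w2[of t] by (simp add: mult_le_0_iff)
  then show ?thesis by (simp add: \<kappa>_def algebra_simps)
qed

lemma dC: "(C has_real_derivative p / 2 * C t * (y1 t + y2 t)) (at t)"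
proof -
  have "((\<lambda>t. w1 t * w2 t) has_real_derivative w1 t * w2 t * (y1 t + y2 t)) (at t)"
    by (auto intro!: derivative_eq_intros dw1 dw2 simp: algebra_simps)
  moreover have "((\<lambda>x. \<beta> * x powr (p / 2)) has_real_derivative \<beta> * (p / 2 * (w1 t * w2 t) powr (p / 2 - 1))) (at (w1 t * w2 t))"
    using w1[of t] w2[of t] by (auto intro!: derivative_eq_intros)
  moreover have "(w1 t * w2 t) powr (p / 2 - 1) * (w1 t * w2 t) = (w1 t * w2 t) powr (p / 2)"
    using w1[of t] w2[of t] powr_add[of "w1 t * w2 t" "p / 2 - 1" 1] by simp
  ultimately show ?thesis
    using DERIV_chain2[of "\<lambda>x. \<beta> * x powr (p / 2)" _ "\<lambda>t. w1 t * w2 t" t]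
    unfolding C_def[abs_def] by (smt (verit, ccfv_SIG) DERIV_cong mult.assoc mult.commute)
qed

text \<open>The terms from the uncoupled equation for \<open>w1\<close> cancel, since that equation
  conserves its own energy. Only the exchange through the coupling remains.\<close>

lemma dD: "(D has_real_derivative C t * (y1 t - y2 t)) (at t)"
proof -
  have 1: "((\<lambda>x. x powr p) has_real_derivative p * w1 t powr (p - 1)) (at (w1 t))"
    using w1[of t] by (auto intro!: derivative_eq_intros)
  have 2: "w1 t powr (p - 1) * w1 t = w1 t powr p"
    using w1[of t] powr_add[of "w1 t" "p - 1" 1] by simp
  have 3: "((\<lambda>t. w1 t powr p) has_real_derivative p * w1 t powr p * y1 t) (at t)"
    using DERIV_chain2[OF 1 dw1] by (simp add: 2[symmetric] mult.assoc)
  have pp: "p \<noteq> 0" using p_gt by simp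
  have "(D has_real_derivative
     (2 * w1 t * (w1 t * y1 t) * (\<delta>\<^sup>2 - (y1 t)\<^sup>2) + (w1 t)\<^sup>2 * (- (2 * y1 t * (\<delta>\<^sup>2 - (y1 t)\<^sup>2 - g1 t))))
      - 2 / p * (\<mu>1 * (p * w1 t powr p * y1 t) + p / 2 * C t * (y1 t + y2 t))) (at t)"
  proof -
    define P where "P = (\<lambda>t. w1 t powr p)"
    have dP: "(P has_real_derivative p * w1 t powr p * y1 t) (at t)" using 3 by (simp add: P_def)
    have "D = (\<lambda>t. (w1 t)\<^sup>2 * (\<delta>\<^sup>2 - (y1 t)\<^sup>2) - 2 / p * (\<mu>1 * P t + C t))"
      by (simp add: fun_eq_iff D_def P_def)
    then show ?thesis
      using pp by (auto intro!: derivative_eq_intros dP dC dw1 dy1' simp: power2_eq_square)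
  qed
  moreover have "(2 * w1 t * (w1 t * y1 t) * (\<delta>\<^sup>2 - (y1 t)\<^sup>2) + (w1 t)\<^sup>2 * (- (2 * y1 t * (\<delta>\<^sup>2 - (y1 t)\<^sup>2 - g1 t))))
      - 2 / p * (\<mu>1 * (p * w1 t powr p * y1 t) + p / 2 * C t * (y1 t + y2 t))
    = 2 * y1 t * ((w1 t)\<^sup>2 * g1 t) - 2 * \<mu>1 * w1 t powr p * y1 t - C t * (y1 t + y2 t)"
    using pp by (simp add: field_simps power2_eq_square)
  moreover have "\<dots> = C t * (y1 t - y2 t)"
    by (simp add: w2g algebra_simps)
  ultimately show ?thesis by (simp only:)
qed

section \<open>Monotonicity of the logarithmic derivative of the component with negative
  part\<close>

lemma cont: "isCont D t" "isCont C t" "isCont y1 t" "isCont y2 t" "isCont w1 t" "isCont w2 t"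
  using dD dC dy1' dy2' dw1 dw2 DERIV_isCont by blast+

lemma Y_local_pos:
  assumes x: "D x > 0" and c: "c < g2 x"
  shows "\<exists>d>0. \<forall>h. 0 < h \<and> h < d \<longrightarrow>
    Y (x + h) + \<kappa> * c * (x + h) \<le> Y x + \<kappa> * c * x \<and> Y x + \<kappa> * c * x \<le> Y (x - h) + \<kappa> * c * (x - h)"
proof -
  let ?f = "\<lambda>s. y2 s + \<kappa> * c * s"
  have f: "(?f has_real_derivative (\<delta>\<^sup>2 - (y2 x)\<^sup>2 - g2 x + \<kappa> * c)) (at x)"
    by (auto intro!: derivative_eq_intros dy2')
  have "\<kappa> * c < \<kappa> * g2 x" using c \<kappa>_pos by simp
  then have "\<delta>\<^sup>2 - (y2 x)\<^sup>2 - g2 x + \<kappa> * c < 0" using dy2_neg[of x] x by linarith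
  from DERIV_neg_local[OF f this] obtain d1 where d1: "d1 > 0"
    "\<And>h. 0 < h \<Longrightarrow> h < d1 \<Longrightarrow> ?f (x + h) < ?f x \<and> ?f x < ?f (x - h)" by blast
  obtain d2 where d2: "d2 > 0" "\<And>s. \<bar>s - x\<bar> < d2 \<Longrightarrow> D s > 0"
    using isCont_pos_local[OF cont(1) x] by blast
  have Yy: "Y s = y2 s" if "\<bar>s - x\<bar> < d2" for s using d2(2)[OF that] by (simp add: Y_def)
  show ?thesis
  proof (intro exI[of _ "min d1 d2"] conjI allI impI)
    show "0 < min d1 d2" using d1 d2 by simp
    fix h assume h: "0 < h \<and> h < min d1 d2"
    then have "Y (x + h) = y2 (x + h)" "Y x = y2 x" "Y (x - h) = y2 (x - h)"
      using d2(1) by (auto intro!: Yy)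
    then show "Y (x + h) + \<kappa> * c * (x + h) \<le> Y x + \<kappa> * c * x" "Y x + \<kappa> * c * x \<le> Y (x - h) + \<kappa> * c * (x - h)"
      using d1(2)[of h] h by auto
  qed
qed

text \<open>At a zero of \<open>D\<close> both energy parts vanish, so \<open>y1\<close> and
  \<open>y2\<close> both decrease. To the left either choice lies above the minimum at
  \<open>x\<close>. To the right the choice matters only if y2 < y1, and then \<open>D\<close>
  increases through 0 and selects \<open>y2\<close>.\<close>

lemma Y_local_zero:
  assumes x: "D x = 0" and c: "c < g1 x" "c < g2 x" and le: "y2 x \<le> y1 x"
  shows "\<exists>d>0. \<forall>h. 0 < h \<and> h < d \<longrightarrow>
    Y (x + h) + \<kappa> * c * (x + h) \<le> Y x + \<kappa> * c * x \<and> Y x + \<kappa> * c * x \<le> Y (x - h) + \<kappa> * c * (x - h)"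
proof -
  let ?f1 = "\<lambda>s. y1 s + \<kappa> * c * s" and ?f2 = "\<lambda>s. y2 s + \<kappa> * c * s"
  have f1: "(?f1 has_real_derivative (\<delta>\<^sup>2 - (y1 x)\<^sup>2 - g1 x + \<kappa> * c)) (at x)"
    and f2: "(?f2 has_real_derivative (\<delta>\<^sup>2 - (y2 x)\<^sup>2 - g2 x + \<kappa> * c)) (at x)"
    by (auto intro!: derivative_eq_intros dy2' dy1')
  have "\<kappa> * c < \<kappa> * g2 x" "\<kappa> * c < \<kappa> * g1 x" using c \<kappa>_pos by auto
  then have n: "\<delta>\<^sup>2 - (y2 x)\<^sup>2 - g2 x + \<kappa> * c < 0" "\<delta>\<^sup>2 - (y1 x)\<^sup>2 - g1 x + \<kappa> * c < 0"
    using dy2_neg[of x] crit_ode.dy2_neg[OF swap, of x] x by (auto simp: D_swap g_swap)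
  obtain d1 where d1: "d1 > 0"
    "\<And>h. 0 < h \<Longrightarrow> h < d1 \<Longrightarrow> ?f1 (x + h) < ?f1 x \<and> ?f1 x < ?f1 (x - h)"
    using DERIV_neg_local[OF f1 n(2)] by blast
  obtain d2 where d2: "d2 > 0"
    "\<And>h. 0 < h \<Longrightarrow> h < d2 \<Longrightarrow> ?f2 (x + h) < ?f2 x \<and> ?f2 x < ?f2 (x - h)"
    using DERIV_neg_local[OF f2 n(1)] by blast
  have Yx: "Y x = y2 x" using x le by (simp add: Y_def)
  obtain d3 where d3: "d3 > 0" "y2 x < y1 x \<Longrightarrow> 0 < h \<Longrightarrow> h < d3 \<Longrightarrow> 0 < D (x + h)" for h
  proof (cases "y2 x < y1 x")
    case True
    then have "0 < C x * (y1 x - y2 x)" using C_pos[of x] by simp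
    from DERIV_pos_inc_right[OF dD this] x obtain d where "d > 0" "\<forall>h>0. h < d \<longrightarrow> 0 < D (x + h)" by auto
    then show ?thesis using that by blast
  qed (use that[of 1] in auto)
  show ?thesis
  proof (intro exI[of _ "min (min d1 d2) d3"] conjI allI impI)
    show "0 < min (min d1 d2) d3" using d1 d2 d3 by simp
    fix h assume "0 < h \<and> h < min (min d1 d2) d3"
    then have h: "0 < h" "h < d1" "h < d2" "h < d3" by auto
    note f = d1(2)[OF h(1,2)] d2(2)[OF h(1,3)]
    show "Y (x + h) + \<kappa> * c * (x + h) \<le> Y x + \<kappa> * c * x"
    proof (cases "y2 x < y1 x")
      case True
      then have "Y (x + h) = y2 (x + h)" using d3(2)[OF True h(1,4)] by (simp add: Y_def)
      then show ?thesis using f Yx by simp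
    next
      case False
      then have "y1 x = y2 x" using le by simp
      then show ?thesis using Y_cases[of "x + h"] f Yx by auto
    qed
    show "Y x + \<kappa> * c * x \<le> Y (x - h) + \<kappa> * c * (x - h)"
      using Y_cases[of "x - h"] f Yx le by auto
  qed
qed

lemma Y_decrease:
  assumes ab: "a \<le> b" and c: "\<And>x. a \<le> x \<Longrightarrow> x \<le> b \<Longrightarrow> c < g1 x \<and> c < g2 x"
  shows "Y b \<le> Y a - \<kappa> * c * (b - a)"
proof -
  have "Y b + \<kappa> * c * b \<le> Y a + \<kappa> * c * a"
  proof (rule local_imp_nonincreasing[OF ab, where F = "\<lambda>s. Y s + \<kappa> * c * s"])
    fix x assume x: "a \<le> x" "x \<le> b"
    note cx = c[OF x, THEN conjunct1] c[OF x, THEN conjunct2]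
    consider "D x > 0" | "D x < 0" | "D x = 0" "y2 x \<le> y1 x" | "D x = 0" "y1 x \<le> y2 x" by linarith
    then show "\<exists>d>0. \<forall>h. 0 < h \<and> h < d \<longrightarrow>
      Y (x + h) + \<kappa> * c * (x + h) \<le> Y x + \<kappa> * c * x \<and> Y x + \<kappa> * c * x \<le> Y (x - h) + \<kappa> * c * (x - h)"
    proof cases
      case 1 then show ?thesis using Y_local_pos cx by blast
    next
      case 2 then show ?thesis
        using crit_ode.Y_local_pos[OF swap, of x c] cx by (simp add: D_swap g_swap Y_swap)
    next
      case 3 then show ?thesis using Y_local_zero cx by blast
    next
      case 4 then show ?thesis
        using crit_ode.Y_local_zero[OF swap, of x c] cx by (simp add: D_swap g_swap Y_swap)
    qed
  qed
  then show ?thesis by (simp add: algebra_simps)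
qed

lemma Y_mono: "a \<le> b \<Longrightarrow> Y b \<le> Y a"
  using Y_decrease[of a b 0] g_pos by simp

text \<open>\<open>Y\<close> is nonincreasing and bounded below, so its drop on late unit intervals
  is arbitrarily small, whereas potentials both above \<open>c\<close> would force a drop of
  \<kappa> c.\<close>

lemma g_not_both_large:
  assumes c: "c > 0"
  shows "\<forall>\<^sub>F t in at_top. \<exists>s. t \<le> s \<and> s \<le> t + 1 \<and> \<not> (c < g1 s \<and> c < g2 s)"
proof -
  have bd: "bdd_below (range Y)" using Y_bound by (intro bdd_belowI[of _ "- \<delta>"]) auto
  define I where "I = Inf (range Y)"
  have "I < I + \<kappa> * c" using c \<kappa>_pos by simp
  then obtain T where T: "Y T < I + \<kappa> * c"
    using cInf_less_iff[OF _ bd, of "I + \<kappa> * c"] by (auto simp: I_def)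
  show ?thesis
  proof (rule eventually_mono[OF eventually_ge_at_top[of T]])
    fix t assume t: "T \<le> t"
    show "\<exists>s. t \<le> s \<and> s \<le> t + 1 \<and> \<not> (c < g1 s \<and> c < g2 s)"
    proof (rule ccontr)
      assume "\<not> ?thesis"
      then have "Y (t + 1) \<le> Y t - \<kappa> * c * (t + 1 - t)" by (intro Y_decrease) auto
      also have "\<dots> \<le> Y T - \<kappa> * c" using Y_mono[OF t] by simp
      also have "\<dots> < I" using T by simp
      also have "I \<le> Y (t + 1)" unfolding I_def by (intro cInf_lower bd) auto
      finally show False by simp
    qed
  qed
qed

section \<open>Bounds on the components, and their decay for p \<le> 4\<close>

lemma w_exp_mono:
  assumes "s \<le> t"
  shows "w1 s * exp (\<delta> * s) \<le> w1 t * exp (\<delta> * t)"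
proof (rule DERIV_nonneg_imp_nondecreasing[OF assms])
  fix x
  have "((\<lambda>t. w1 t * exp (\<delta> * t)) has_real_derivative (w1 x * exp (\<delta> * x) * (y1 x + \<delta>))) (at x)"
    by (auto intro!: derivative_eq_intros dw1 simp: algebra_simps)
  moreover have "0 \<le> w1 x * exp (\<delta> * x) * (y1 x + \<delta>)"
    using w1[of x] y_bound(1)[of x] by (intro mult_nonneg_nonneg) auto
  ultimately show "\<exists>D. ((\<lambda>t. w1 t * exp (\<delta> * t)) has_real_derivative D) (at x) \<and> 0 \<le> D" by blast
qed

text \<open>Since y1 \<ge> - \<delta>, at most the factor exp(- \<delta>) is lost in unit time. This
  transfers a lower bound at \<open>t\<close> to the unknown time in [t, t + 1] supplied by
  \<open>g_not_both_large\<close>.\<close>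

lemma w_ge_next: "t \<le> s \<Longrightarrow> s \<le> t + 1 \<Longrightarrow> w1 t * exp (- \<delta>) \<le> w1 s"
proof -
  assume s: "t \<le> s" "s \<le> t + 1"
  have "w1 t * exp (- \<delta>) \<le> w1 t * exp (\<delta> * (t - s))"
  proof -
    have "\<delta> * (s - t) \<le> \<delta> * 1" using \<delta> s by (intro mult_left_mono) auto
    then have "- \<delta> \<le> \<delta> * (t - s)" by (simp add: algebra_simps)
    then show ?thesis using w1[of t] by simp
  qed
  also have "\<dots> = w1 t * exp (\<delta> * t) * exp (- (\<delta> * s))"
    by (simp add: right_diff_distrib exp_diff exp_minus divide_inverse)
  also have "\<dots> \<le> w1 s * exp (\<delta> * s) * exp (- (\<delta> * s))"
    by (intro mult_right_mono w_exp_mono s) auto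
  also have "\<dots> = w1 s" by (simp add: exp_minus)
  finally show ?thesis .
qed

text \<open>Let W be the larger component. The energy identity bounds (2/p) min(\<mu>1, \<mu>2) W^p
  by 2 e W^2, and W^2 cancels.\<close>

lemma w_power_bound:
  assumes e: "\<delta>\<^sup>2 - (y1 t)\<^sup>2 \<le> e" "\<delta>\<^sup>2 - (y2 t)\<^sup>2 \<le> e"
  shows "w1 t powr (p - 2) \<le> p * e / min \<mu>1 \<mu>2"
proof -
  define m where "m = min \<mu>1 \<mu>2"
  have m: "m > 0" "m \<le> \<mu>1" "m \<le> \<mu>2" using \<mu>1 \<mu>2 by (auto simp: m_def)
  define W where "W = max (w1 t) (w2 t)"
  have W: "W > 0" "w1 t \<le> W" "w2 t \<le> W" using w1[of t] by (auto simp: W_def)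
  have e0: "0 \<le> e"
  proof -
    have "(y1 t)\<^sup>2 \<le> \<delta>\<^sup>2" using y_bound[of t] \<delta> by (intro power2_le_iff_abs_le[THEN iffD2]) auto
    then show ?thesis using e by linarith
  qed
  have pp: "p > 0" using p_gt by simp
  have "2 / p * (m * W powr p) \<le> 2 / p * (\<mu>1 * w1 t powr p + \<mu>2 * w2 t powr p + 2 * (\<beta> * (w1 t * w2 t) powr (p / 2)))"
  proof -
    have "m * W powr p \<le> \<mu>1 * w1 t powr p + \<mu>2 * w2 t powr p"
    proof (cases "w2 t \<le> w1 t")
      case True
      then have "m * W powr p \<le> \<mu>1 * w1 t powr p" using m by (simp add: W_def max_def mult_right_mono)
      then show ?thesis using \<mu>2 by (simp add: add_increasing2)
    next
      case False
      then have "m * W powr p \<le> \<mu>2 * w2 t powr p" using m by (simp add: W_def max_def mult_right_mono)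
      then show ?thesis using \<mu>1 by (simp add: add_increasing)
    qed
    moreover have "0 \<le> 2 * (\<beta> * (w1 t * w2 t) powr (p / 2))" using \<beta> by simp
    ultimately show ?thesis using pp by (intro mult_left_mono) auto
  qed
  also have "\<dots> = (w1 t)\<^sup>2 * (\<delta>\<^sup>2 - (y1 t)\<^sup>2) + (w2 t)\<^sup>2 * (\<delta>\<^sup>2 - (y2 t)\<^sup>2)"
    using energy[of t] by simp
  also have "\<dots> \<le> W\<^sup>2 * e + W\<^sup>2 * e"
  proof (rule add_mono)
    have "(w1 t)\<^sup>2 * (\<delta>\<^sup>2 - (y1 t)\<^sup>2) \<le> (w1 t)\<^sup>2 * e" using e by (intro mult_left_mono) auto
    also have "\<dots> \<le> W\<^sup>2 * e" using e0 W w1[of t] by (intro mult_right_mono power_mono) auto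
    finally show "(w1 t)\<^sup>2 * (\<delta>\<^sup>2 - (y1 t)\<^sup>2) \<le> W\<^sup>2 * e" .
    have "(w2 t)\<^sup>2 * (\<delta>\<^sup>2 - (y2 t)\<^sup>2) \<le> (w2 t)\<^sup>2 * e" using e by (intro mult_left_mono) auto
    also have "\<dots> \<le> W\<^sup>2 * e" using e0 W w2[of t] by (intro mult_right_mono power_mono) auto
    finally show "(w2 t)\<^sup>2 * (\<delta>\<^sup>2 - (y2 t)\<^sup>2) \<le> W\<^sup>2 * e" .
  qed
  finally have "2 / p * (m * W powr p) \<le> 2 * (W\<^sup>2 * e)" by (simp add: mult.commute)
  moreover have "W powr p = W\<^sup>2 * W powr (p - 2)"
    using W powr_add[of W 2 "p - 2"] by simp
  ultimately have "W\<^sup>2 * (m * W powr (p - 2)) \<le> W\<^sup>2 * (p * e)"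
    using pp by (simp add: field_simps)
  then have "m * W powr (p - 2) \<le> p * e" using W by simp
  moreover have "w1 t powr (p - 2) \<le> W powr (p - 2)" using W w1[of t] p_gt by (intro powr_mono2) auto
  ultimately have "w1 t powr (p - 2) * m \<le> p * e" using m by (smt (verit) mult.commute mult_left_mono)
  then show ?thesis unfolding m_def[symmetric] using m by (simp add: pos_le_divide_eq)
qed

lemma w1_bounded: obtains M where "M > 0" "\<And>t. w1 t \<le> M"
proof -
  define M where "M = (p * \<delta>\<^sup>2 / min \<mu>1 \<mu>2) powr (1 / (p - 2))"
  show ?thesis
  proof
    show "M > 0" using p_gt \<delta> \<mu>1 \<mu>2 by (simp add: M_def)
    fix t
    have "(w1 t powr (p - 2)) powr (1 / (p - 2)) \<le> M"
      unfolding M_def using p_gt by (intro powr_mono2 w_power_bound) auto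
    then show "w1 t \<le> M" using p_gt w1[of t] by (simp add: powr_powr)
  qed
qed

lemma w2_bounded: obtains M where "M > 0" "\<And>t. w2 t \<le> M"
  using crit_ode.w1_bounded[OF swap] by blast

text \<open>The coupling part of \<open>g2\<close> is \<beta> w1^(p/2) w2^(p/2 - 2). For p \<le> 4
  the last exponent is nonpositive, so the upper bound on \<open>w2\<close> bounds this part below
  whenever \<open>w1\<close> is not small; \<open>g1\<close> is then bounded below as well, which is
  excluded at late times.\<close>

lemma w1_tendsto_0_if_le4:
  assumes p4: "p \<le> 4"
  shows "(w1 \<longlongrightarrow> 0) at_top"
proof (rule order_tendstoI)
  show "\<forall>\<^sub>F t in at_top. a < w1 t" if "a < 0" for a
    using that w1 by (intro always_eventually) (auto intro: less_trans)
  fix \<eta> :: real assume \<eta>: "0 < \<eta>"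
  obtain M where M: "M > 0" "\<And>t. w2 t \<le> M" using w2_bounded by blast
  define h where "h = \<eta> * exp (- \<delta>)"
  have h: "h > 0" using \<eta> by (simp add: h_def)
  \<comment> \<open>Lower bounds for both potentials when w1 \<ge> h, halved to make the
    inequalities strict.\<close>
  define c where "c = min (\<mu>1 * h powr (p - 2)) (\<beta> * h powr (p / 2) * M powr (p / 2 - 2)) / 2"
  have c: "c > 0" using h M \<mu>1 \<beta> by (simp add: c_def)
  show "\<forall>\<^sub>F t in at_top. w1 t < \<eta>"
    using g_not_both_large[OF c]
  proof eventually_elim
    case (elim t)
    then obtain s where s: "t \<le> s" "s \<le> t + 1" "\<not> (c < g1 s \<and> c < g2 s)" by blast
    show "w1 t < \<eta>"
    proof (rule ccontr)
      assume "\<not> w1 t < \<eta>"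
      then have "h \<le> w1 t * exp (- \<delta>)" by (simp add: h_def)
      then have ws: "h \<le> w1 s" using w_ge_next[OF s(1,2)] by linarith
      have "c < \<mu>1 * h powr (p - 2)" using c by (simp add: c_def min_def split: if_splits)
      also have "\<dots> \<le> \<mu>1 * w1 s powr (p - 2)" using \<mu>1 h ws p_gt by (intro mult_left_mono powr_mono2) auto
      also have "\<dots> \<le> g1 s" using C_pos[of s] by (simp add: g1_def)
      finally have 1: "c < g1 s" .
      have "c < \<beta> * h powr (p / 2) * M powr (p / 2 - 2)" using c by (simp add: c_def min_def split: if_splits)
      also have "\<dots> \<le> \<beta> * w1 s powr (p / 2) * w2 s powr (p / 2 - 2)"
        using \<beta> h ws p_gt M w2[of s] p4 by (intro mult_mono mult_left_mono powr_mono2 powr_mono2') auto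
      also have "\<dots> = C s / (w2 s)\<^sup>2"
        using w1[of s] w2[of s] by (simp add: C_def powr_mult powr_diff)
      also have "\<dots> \<le> g2 s" using \<mu>2 by (simp add: g2_def)
      finally have 2: "c < g2 s" .
      from 1 2 s(3) show False by blast
    qed
  qed
qed

section \<open>Comparing \<open>D\<close> with the coupling while \<open>Y\<close> is
  negative\<close>

lemma y_le_at_zero:
  assumes m: "\<And>s. T < s \<Longrightarrow> Y s \<le> m" and t: "T < t" "D t = 0"
  shows "y1 t \<le> m"
proof (rule ccontr)
  assume "\<not> y1 t \<le> m"
  then have y1: "m < y1 t" by simp
  moreover have "Y t \<le> m" using m t by blast
  ultimately have "y2 t < y1 t" using t(2) by (auto simp: Y_def min_def split: if_splits)
  \<comment> \<open>As \<open>D\<close> increases through 0 at \<open>t\<close>, it is negative just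
    before, where \<open>Y\<close> equals \<open>y1\<close> and exceeds \<open>m\<close> by
    continuity.\<close>
  then have "0 < C t * (y1 t - y2 t)" using C_pos[of t] by simp
  from DERIV_pos_inc_left[OF dD this] t(2)
  obtain d1 where d1: "d1 > 0" "\<And>h. 0 < h \<Longrightarrow> h < d1 \<Longrightarrow> D (t - h) < 0" by auto
  have "isCont (\<lambda>s. y1 s - m) t" by (intro continuous_intros cont)
  then obtain d2 where d2: "d2 > 0" "\<And>s. \<bar>s - t\<bar> < d2 \<Longrightarrow> m < y1 s"
    using isCont_pos_local[where F = "\<lambda>s. y1 s - m" and x = t] y1 by auto
  define h where "h = min (min d1 d2) (t - T) / 2"
  have h: "0 < h" "h < d1" "h < d2" "T < t - h" using d1(1) d2(1) t(1) by (auto simp: h_def min_def field_simps)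
  then have "m < y1 (t - h)" "D (t - h) < 0" using d1(2)[of h] d2(2)[of "t - h"] by auto
  then have "m < Y (t - h)" by (simp add: Y_def)
  with m[OF h(4)] show False by simp
qed

text \<open>The combination of \<open>C\<close> and \<open>D\<close> from whose derivative
  \<open>y1\<close> drops out.\<close>

lemma dE: "((\<lambda>s. C s - p / 2 * D s) has_real_derivative p * C t * y2 t) (at t)"
  by (rule DERIV_cong[OF DERIV_diff[OF dC DERIV_cmult[OF dD]]]) (simp add: field_simps)

lemma w_decay:
  assumes "c > 0" and y: "\<And>s. t0 \<le> s \<Longrightarrow> y2 s \<le> - c" and t: "t0 \<le> t"
  shows "w2 t \<le> w2 t0 * exp (- c * (t - t0))"
proof -
  have "w2 t * exp (c * t) \<le> w2 t0 * exp (c * t0)"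
  proof (rule DERIV_nonpos_imp_nonincreasing[OF t])
    fix x assume x: "t0 \<le> x" "x \<le> t"
    have "((\<lambda>t. w2 t * exp (c * t)) has_real_derivative (w2 x * exp (c * x) * (y2 x + c))) (at x)"
      by (auto intro!: derivative_eq_intros dw2 simp: algebra_simps)
    moreover have "w2 x * exp (c * x) * (y2 x + c) \<le> 0"
      using w2[of x] y[OF x(1)] by (intro mult_nonneg_nonpos) auto
    ultimately show "\<exists>D. ((\<lambda>t. w2 t * exp (c * t)) has_real_derivative D) (at x) \<and> D \<le> 0" by blast
  qed
  then have "w2 t * exp (c * t) * exp (- (c * t)) \<le> w2 t0 * exp (c * t0) * exp (- (c * t))"
    by (rule mult_right_mono) simp
  moreover have "exp (c * t) * exp (- (c * t)) = 1" by (simp flip: exp_add)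
  moreover have "exp (c * t0) * exp (- (c * t)) = exp (- c * (t - t0))"
    by (simp add: algebra_simps flip: exp_add)
  ultimately show ?thesis by (simp add: mult.assoc)
qed

lemma w_decay_tendsto:
  assumes "c > 0" and y: "\<And>s. t0 \<le> s \<Longrightarrow> y2 s \<le> - c"
  shows "(w2 \<longlongrightarrow> 0) at_top"
proof (rule tendsto_sandwich[of "\<lambda>_. 0"])
  show "\<forall>\<^sub>F t in at_top. w2 t \<le> w2 t0 * exp (- c * (t - t0))"
    using eventually_ge_at_top[of t0] by eventually_elim (rule w_decay[OF assms])
  show "\<forall>\<^sub>F t in at_top. 0 \<le> w2 t" using w2 by (intro always_eventually) (simp add: less_imp_le)
  have f: "filterlim (\<lambda>t. c * (- t0 + t)) at_top at_top"
    by (rule filterlim_tendsto_pos_mult_at_top[OF tendsto_const assms(1)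
          filterlim_tendsto_add_at_top[OF tendsto_const filterlim_ident]])
  have "((\<lambda>t. exp (- (c * (- t0 + t)))) \<longlongrightarrow> 0) at_top"
    by (rule filterlim_compose[OF exp_at_bot]) (rule filterlim_compose[OF filterlim_uminus_at_bot_at_top f])
  from tendsto_mult[OF tendsto_const[of "w2 t0"] this]
  show "((\<lambda>t. w2 t0 * exp (- c * (t - t0))) \<longlongrightarrow> 0) at_top"
    by (simp add: algebra_simps)
qed simp

lemma D_le_of_w2: "D t \<le> 2 / p * (\<mu>2 * w2 t powr p + C t)"
proof -
  have "- D t = (w2 t)\<^sup>2 * (\<delta>\<^sup>2 - (y2 t)\<^sup>2) - 2 / p * (\<mu>2 * w2 t powr p + C t)"
    using crit_ode.D_def[OF swap, of t] by (simp add: D_swap C_swap)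
  moreover have "(y2 t)\<^sup>2 \<le> \<delta>\<^sup>2"
    using y_bound[of t] \<delta> by (intro power2_le_iff_abs_le[THEN iffD2]) auto
  then have "0 \<le> (w2 t)\<^sup>2 * (\<delta>\<^sup>2 - (y2 t)\<^sup>2)" by (intro mult_nonneg_nonneg) auto
  ultimately show ?thesis by linarith
qed

text \<open>While D > 0 one has Y = y2 < 0, so C - (p/2) D decreases. At the next zero of
  \<open>D\<close> it equals C > 0. If no zero follows, then \<open>w2\<close> tends to 0 and the
  lower bound - \<mu>2 w2^p shows that it was nonnegative.\<close>

lemma D_le_C:
  assumes c: "c > 0" and Y: "\<And>s. T < s \<Longrightarrow> Y s \<le> - c" and t: "T < t" "D t > 0"
  shows "p / 2 * D t \<le> C t"
proof (cases "\<exists>b\<ge>t. D b = 0")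
  case True
  then obtain b0 where b0: "t \<le> b0" "D b0 = 0" by blast
  have "closed {b. t \<le> b \<and> D b = 0}"
    using cont(1) by (intro closed_Collect_conj closed_Collect_le closed_Collect_eq continuous_intros)
      (auto simp: continuous_at_imp_continuous_on)
  moreover have "bdd_below {b. t \<le> b \<and> D b = 0}" by (rule bdd_belowI[of _ t]) auto
  moreover have "{b. t \<le> b \<and> D b = 0} \<noteq> {}" using b0 by blast
  ultimately have "Inf {b. t \<le> b \<and> D b = 0} \<in> {b. t \<le> b \<and> D b = 0}"
    by (intro closed_contains_Inf)
  moreover define b where "b = Inf {b. t \<le> b \<and> D b = 0}"
  ultimately have b: "t \<le> b" "D b = 0" by auto
  have first: "D s \<noteq> 0" if "t \<le> s" "s < b" for s
    using cInf_lower[of s "{b. t \<le> b \<and> D b = 0}"] that \<open>bdd_below _\<close> by (auto simp: b_def)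
  have Dpos: "D s > 0" if s: "t \<le> s" "s < b" for s
  proof (rule ccontr)
    assume "\<not> 0 < D s"
    then have "\<exists>x\<ge>t. x \<le> s \<and> D x = 0"
      using t(2) s(1) cont(1) by (intro IVT2) auto
    then show False using first s(2) by auto
  qed
  have y2: "y2 s \<le> - c" if s: "t \<le> s" "s \<le> b" for s
  proof (cases "s = b")
    \<comment> \<open>At the zero \<open>b\<close> itself \<open>Y\<close> is only the minimum of
      the two, so the bound on \<open>y2\<close> comes from \<open>y_le_at_zero\<close> in swapped
      form.\<close>
    case True
    then show ?thesis
      using crit_ode.y_le_at_zero[OF swap, of T "- c" s] Y b t(1) s by (simp add: Y_swap D_swap)
  next
    case False
    then have "Y s = y2 s" using Dpos[of s] s by (simp add: Y_def)
    then show ?thesis using Y[of s] t(1) s by simp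
  qed
  have "C b - p / 2 * D b \<le> C t - p / 2 * D t"
  proof (rule DERIV_nonpos_imp_nonincreasing[OF b(1)])
    fix x assume "t \<le> x" "x \<le> b"
    then have "p * C x * y2 x \<le> 0"
      using y2[of x] c p_gt C_pos[of x] by (intro mult_nonneg_nonpos) auto
    then show "\<exists>D'. ((\<lambda>s. C s - p / 2 * D s) has_real_derivative D') (at x) \<and> D' \<le> 0" using dE by blast
  qed
  then show ?thesis using C_pos[of b] b(2) by simp
next
  case False
  have Dpos: "D s > 0" if s: "t \<le> s" for s
  proof (rule ccontr)
    assume "\<not> 0 < D s"
    then have "\<exists>x\<ge>t. x \<le> s \<and> D x = 0"
      using t(2) s(1) cont(1) by (intro IVT2) auto
    then show False using False by auto
  qed
  have y2: "y2 s \<le> - c" if s: "t \<le> s" for s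
    using Y[of s] t(1) Dpos[OF s] s by (simp add: Y_def)
  have "C s - p / 2 * D s \<le> C t - p / 2 * D t" if s: "t \<le> s" for s
  proof (rule DERIV_nonpos_imp_nonincreasing[OF s])
    fix x assume "t \<le> x" "x \<le> s"
    then have "p * C x * y2 x \<le> 0"
      using y2[of x] c p_gt C_pos[of x] by (intro mult_nonneg_nonpos) auto
    then show "\<exists>D'. ((\<lambda>s. C s - p / 2 * D s) has_real_derivative D') (at x) \<and> D' \<le> 0" using dE by blast
  qed
  moreover have "- (\<mu>2 * w2 s powr p) \<le> C s - p / 2 * D s" for s
  proof -
    have "p / 2 * D s \<le> p / 2 * (2 / p * (\<mu>2 * w2 s powr p + C s))"
      using p_gt by (intro mult_left_mono D_le_of_w2) auto
    then show ?thesis using p_gt by simp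
  qed
  ultimately have lb: "\<forall>\<^sub>F s in at_top. - (\<mu>2 * w2 s powr p) \<le> C t - p / 2 * D t"
    by (intro eventually_mono[OF eventually_ge_at_top[of t]]) (rule order_trans)
  have "(w2 \<longlongrightarrow> 0) at_top" by (rule w_decay_tendsto[OF c y2])
  then have "((\<lambda>s. w2 s powr p) \<longlongrightarrow> 0) at_top"
    using p_gt by (intro tendsto_zero_powrI) (auto intro!: always_eventually less_imp_le w2)
  from tendsto_minus[OF tendsto_mult[OF tendsto_const[of \<mu>2] this]]
  have "((\<lambda>s. - (\<mu>2 * w2 s powr p)) \<longlongrightarrow> 0) at_top" by simp
  from tendsto_upperbound[OF this lb] show ?thesis by simp
qed

text \<open>Both components are bounded, so a coupling that is not small keeps each of them away
  from 0, during the next unit of time too. Both potentials would be bounded below there.\<close>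

lemma C_tendsto_0: "(C \<longlongrightarrow> 0) at_top"
proof (rule order_tendstoI)
  show "\<forall>\<^sub>F t in at_top. a < C t" if "a < 0" for a
    using that C_pos by (intro always_eventually) (auto intro: less_trans)
  fix \<eta> :: real assume \<eta>: "0 < \<eta>"
  obtain M1 M2 where M: "M1 > 0" "\<And>t. w1 t \<le> M1" "M2 > 0" "\<And>t. w2 t \<le> M2"
    using w1_bounded w2_bounded by metis
  \<comment> \<open>The value of w1 w2 at which the coupling equals \<eta>.\<close>
  define r where "r = (\<eta> / \<beta>) powr (2 / p)"
  have r: "r > 0" using \<eta> \<beta> by (simp add: r_def)
  define h1 h2 where "h1 = r / M2 * exp (- \<delta>)" and "h2 = r / M1 * exp (- \<delta>)"
  have h: "h1 > 0" "h2 > 0" using r M by (auto simp: h1_def h2_def)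
  define c where "c = min (\<mu>1 * h1 powr (p - 2)) (\<mu>2 * h2 powr (p - 2)) / 2"
  have c: "c > 0" using h \<mu>1 \<mu>2 by (simp add: c_def)
  show "\<forall>\<^sub>F t in at_top. C t < \<eta>"
    using g_not_both_large[OF c]
  proof eventually_elim
    case (elim t)
    then obtain s where s: "t \<le> s" "s \<le> t + 1" "\<not> (c < g1 s \<and> c < g2 s)" by blast
    show "C t < \<eta>"
    proof (rule ccontr)
      assume "\<not> C t < \<eta>"
      then have "\<eta> / \<beta> \<le> (w1 t * w2 t) powr (p / 2)" using \<beta> by (simp add: C_def field_simps)
      then have "r \<le> ((w1 t * w2 t) powr (p / 2)) powr (2 / p)"
        unfolding r_def using p_gt \<eta> \<beta> by (intro powr_mono2) auto
      also have "\<dots> = w1 t * w2 t" using p_gt w1[of t] w2[of t] by (simp add: powr_powr)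
      finally have rr: "r \<le> w1 t * w2 t" .
      have "r \<le> w1 t * M2" 
        using order_trans[OF rr mult_left_mono[OF M(4) less_imp_le[OF w1]]] .
      then have "h1 \<le> w1 t * exp (- \<delta>)" using M by (simp add: h1_def divide_le_eq mult.commute)
      then have ws1: "h1 \<le> w1 s" using w_ge_next[OF s(1,2)] by linarith
      have "r \<le> M1 * w2 t" 
        using order_trans[OF rr mult_right_mono[OF M(2) less_imp_le[OF w2]]] .
      then have "h2 \<le> w2 t * exp (- \<delta>)" using M by (simp add: h2_def divide_le_eq mult.commute)
      then have ws2: "h2 \<le> w2 s" using crit_ode.w_ge_next[OF swap s(1,2)] by linarith
      have "c < \<mu>1 * h1 powr (p - 2)" using c by (simp add: c_def min_def split: if_splits)
      also have "\<dots> \<le> \<mu>1 * w1 s powr (p - 2)" using \<mu>1 h ws1 p_gt by (intro mult_left_mono powr_mono2) auto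
      also have "\<dots> \<le> g1 s" using C_pos[of s] by (simp add: g1_def)
      finally have 1: "c < g1 s" .
      have "c < \<mu>2 * h2 powr (p - 2)" using c by (simp add: c_def min_def split: if_splits)
      also have "\<dots> \<le> \<mu>2 * w2 s powr (p - 2)" using \<mu>2 h ws2 p_gt by (intro mult_left_mono powr_mono2) auto
      also have "\<dots> \<le> g2 s" using C_pos[of s] by (simp add: g2_def)
      finally have 2: "c < g2 s" .
      from 1 2 s(3) show False by blast
    qed
  qed
qed

text \<open>As long as \<open>Y\<close> stays positive, \<open>C - p/2 * \<bar>D\<bar>\<close> increases, because its derivative is
  \<open>p * C * Y\<close> wherever \<open>D\<close> does not vanish.\<close>

lemma X_local:
  assumes x: "0 \<le> D x" and Y: "0 < Y x"
  shows "\<exists>d>0. \<forall>h. 0 < h \<and> h < d \<longrightarrow> - (C (x + h) - p / 2 * \<bar>D (x + h)\<bar>) \<le> - (C x - p / 2 * \<bar>D x\<bar>)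
    \<and> - (C x - p / 2 * \<bar>D x\<bar>) \<le> - (C (x - h) - p / 2 * \<bar>D (x - h)\<bar>)"
proof -
  let ?E = "\<lambda>s. - (C s - p / 2 * D s)" and ?E' = "\<lambda>s. - (C s + p / 2 * D s)"
  have dE1: "(?E has_real_derivative - (p * C x * y2 x)) (at x)" by (rule DERIV_minus[OF dE])
  have dE2: "(?E' has_real_derivative - (p * C x * y1 x)) (at x)"
    by (rule DERIV_cong[OF DERIV_minus[OF DERIV_add[OF dC DERIV_cmult[OF dD]]]]) (simp add: field_simps)
  have y2: "0 < y2 x" using x Y by (auto simp: Y_def min_def split: if_splits)
  then have "- (p * C x * y2 x) < 0" using p_gt C_pos[of x] by simp
  from DERIV_neg_local[OF dE1 this] obtain d1 where d1: "d1 > 0"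
    "\<And>h. 0 < h \<Longrightarrow> h < d1 \<Longrightarrow> ?E (x + h) < ?E x \<and> ?E x < ?E (x - h)" by blast
  show ?thesis
  proof (cases "D x = 0")
    case False
    then obtain d2 where d2: "d2 > 0" "\<And>s. \<bar>s - x\<bar> < d2 \<Longrightarrow> D s > 0"
      using isCont_pos_local[OF cont(1), of x] x by auto
    show ?thesis
    proof (intro exI[of _ "min d1 d2"] conjI allI impI)
      show "0 < min d1 d2" using d1 d2 by simp
      fix h assume h: "0 < h \<and> h < min d1 d2"
      then have "D (x + h) > 0" "D (x - h) > 0" using d2(2)[of "x + h"] d2(2)[of "x - h"] by auto
      then show "- (C (x + h) - p / 2 * \<bar>D (x + h)\<bar>) \<le> - (C x - p / 2 * \<bar>D x\<bar>)"
        "- (C x - p / 2 * \<bar>D x\<bar>) \<le> - (C (x - h) - p / 2 * \<bar>D (x - h)\<bar>)"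
        using d1(2)[of h] h x by auto
    qed
  next
    case True
    then have "0 < y1 x" using Y y_ge_Y_at_zero[of x] by simp
    then have "- (p * C x * y1 x) < 0" using p_gt C_pos[of x] by simp
    from DERIV_neg_local[OF dE2 this] obtain d2 where d2: "d2 > 0"
      "\<And>h. 0 < h \<Longrightarrow> h < d2 \<Longrightarrow> ?E' (x + h) < ?E' x \<and> ?E' x < ?E' (x - h)" by blast
    show ?thesis
    proof (intro exI[of _ "min d1 d2"] conjI allI impI)
      show "0 < min d1 d2" using d1 d2 by simp
      fix h assume h: "0 < h \<and> h < min d1 d2"
      show "- (C (x + h) - p / 2 * \<bar>D (x + h)\<bar>) \<le> - (C x - p / 2 * \<bar>D x\<bar>)"
        using d1(2)[of h] d2(2)[of h] h True by (cases "0 \<le> D (x + h)") auto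
      show "- (C x - p / 2 * \<bar>D x\<bar>) \<le> - (C (x - h) - p / 2 * \<bar>D (x - h)\<bar>)"
        using d1(2)[of h] d2(2)[of h] h True by (cases "0 \<le> D (x - h)") auto
    qed
  qed
qed

lemma X_mono:
  assumes Y: "\<And>t. 0 < Y t" and ab: "a \<le> b"
  shows "C a - p / 2 * \<bar>D a\<bar> \<le> C b - p / 2 * \<bar>D b\<bar>"
proof -
  have "- (C b - p / 2 * \<bar>D b\<bar>) \<le> - (C a - p / 2 * \<bar>D a\<bar>)"
  proof (rule local_imp_nonincreasing[OF ab, where F = "\<lambda>t. - (C t - p / 2 * \<bar>D t\<bar>)"])
    fix x
    show "\<exists>d>0. \<forall>h. 0 < h \<and> h < d \<longrightarrow> - (C (x + h) - p / 2 * \<bar>D (x + h)\<bar>) \<le> - (C x - p / 2 * \<bar>D x\<bar>)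
      \<and> - (C x - p / 2 * \<bar>D x\<bar>) \<le> - (C (x - h) - p / 2 * \<bar>D (x - h)\<bar>)"
    proof (cases "0 \<le> D x")
      case True then show ?thesis by (rule X_local[OF _ Y])
    next
      case False
      then show ?thesis using crit_ode.X_local[OF swap, of x] Y[of x] by (simp add: D_swap C_swap Y_swap)
    qed
  qed
  then show ?thesis by simp
qed

text \<open>Here Y = y2 > 0, so \<open>w2\<close> increases and \<open>g2\<close> stays above a
  positive constant; then \<open>y2\<close> decreases at a linear rate and cannot remain
  positive.\<close>

lemma Y_not_pos_if_D_pos:
  assumes "\<And>t. 0 < D t" and Y: "\<And>t. 0 < Y t"
  shows False
proof -
  have y2: "0 < y2 t" for t using Y[of t] assms(1)[of t] by (simp add: Y_def)
  have mono: "w2 0 \<le> w2 t" if "0 \<le> t" for t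
  proof (rule DERIV_nonneg_imp_nondecreasing[OF that])
    fix x show "\<exists>D. (w2 has_real_derivative D) (at x) \<and> 0 \<le> D"
      using dw2 w2[of x] y2[of x] by (intro exI[of _ "w2 x * y2 x"]) auto
  qed
  define c where "c = \<kappa> * (\<mu>2 * w2 0 powr (p - 2))"
  have c: "c > 0" using \<kappa>_pos \<mu>2 w2[of 0] by (simp add: c_def)
  have "y2 t + c * t \<le> y2 0 + c * 0" if t: "0 \<le> t" for t
  proof (rule DERIV_nonpos_imp_nonincreasing[OF t])
    fix x assume x: "0 \<le> x" "x \<le> t"
    have "\<mu>2 * w2 0 powr (p - 2) \<le> \<mu>2 * w2 x powr (p - 2)"
      using mono[OF x(1)] w2[of 0] \<mu>2 p_gt by (intro mult_left_mono powr_mono2) auto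
    also have "\<dots> \<le> g2 x" using C_pos[of x] by (simp add: g2_def)
    finally have "c \<le> \<kappa> * g2 x" unfolding c_def using \<kappa>_pos by (intro mult_left_mono) auto
    then have "\<delta>\<^sup>2 - (y2 x)\<^sup>2 - g2 x + c \<le> 0"
      using dy2_neg[of x] assms(1)[of x] by simp
    moreover have "((\<lambda>t. y2 t + c * t) has_real_derivative (\<delta>\<^sup>2 - (y2 x)\<^sup>2 - g2 x + c)) (at x)"
      by (auto intro!: derivative_eq_intros dy2')
    ultimately show "\<exists>D. ((\<lambda>t. y2 t + c * t) has_real_derivative D) (at x) \<and> D \<le> 0" by blast
  qed
  from this[of "y2 0 / c"] y2[of "y2 0 / c"] y2[of 0] c show False by simp
qed

text \<open>If \<open>Y\<close> never became negative it would be positive, as it decreases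
  strictly. A zero of \<open>D\<close> is then impossible: from its value C > 0 there, C - (p/2)|D|
  could not decrease, although \<open>C\<close> tends to 0. So \<open>D\<close> has one sign, which
  the preceding lemma excludes.\<close>

lemma Y_eventually_neg: "\<exists>T. Y T < 0"
proof (rule ccontr)
  assume "\<not> (\<exists>T. Y T < 0)"
  then have nn: "0 \<le> Y t" for t by (simp add: not_less)
  have Y: "0 < Y t" for t
  proof (rule ccontr)
    assume "\<not> 0 < Y t"
    then have Yt: "Y t = 0" using nn[of t] by simp
    have "continuous_on {t..t+1} g1" "continuous_on {t..t+1} g2"
      unfolding g1_def[abs_def] g2_def[abs_def]
      using w1 w2 by (auto intro!: continuous_intros continuous_at_imp_continuous_on cont simp: less_imp_neq[symmetric])
    then have "\<exists>x\<in>{t..t+1}. \<forall>s\<in>{t..t+1}. g1 x \<le> g1 s" "\<exists>x\<in>{t..t+1}. \<forall>s\<in>{t..t+1}. g2 x \<le> g2 s"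
      by (intro continuous_attains_inf; simp)+
    then obtain a b where ab: "\<And>s. t \<le> s \<Longrightarrow> s \<le> t + 1 \<Longrightarrow> g1 a \<le> g1 s \<and> g2 b \<le> g2 s"
      by (metis atLeastAtMost_iff)
    define c where "c = min (g1 a) (g2 b) / 2"
    have c: "0 < c" "c < g1 a" "c < g2 b" using g_pos(1)[of a] g_pos(2)[of b] by (auto simp: c_def min_def)
    have "Y (t + 1) \<le> Y t - \<kappa> * c * (t + 1 - t)"
      using ab c by (intro Y_decrease) (auto intro: less_le_trans)
    then have "Y (t + 1) < 0" using Yt mult_pos_pos[OF \<kappa>_pos c(1)] by simp
    with nn[of "t + 1"] show False by simp
  qed
  have "D t \<noteq> 0" for t
  proof
    assume t: "D t = 0"
    have "\<forall>\<^sub>F s in at_top. C s < C t" using order_tendstoD(2)[OF C_tendsto_0 C_pos] .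
    then obtain s where s: "t \<le> s" "C s < C t"
      using eventually_happens[OF eventually_conj[OF eventually_ge_at_top[of t]]] by fastforce
    have "C t \<le> C s - p / 2 * \<bar>D s\<bar>" using X_mono[OF Y s(1)] t by simp
    moreover have "0 \<le> p / 2 * \<bar>D s\<bar>" using p_gt by simp
    ultimately show False using s(2) by linarith
  qed
  then consider "\<forall>t. 0 < D t" | "\<forall>t. D t < 0"
  proof -
    assume nz: "\<And>t. D t \<noteq> 0"
    have "0 < D t" if "0 < D 0" for t
    proof (rule ccontr)
      assume "\<not> 0 < D t"
      have "\<exists>x. D x = 0"
      proof (cases "0 \<le> t")
        case True
        then show ?thesis using IVT2[of D t 0 0] \<open>\<not> 0 < D t\<close> \<open>0 < D 0\<close> cont(1) by auto
      next
        case False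
        then show ?thesis using IVT[of D t 0 0] \<open>\<not> 0 < D t\<close> \<open>0 < D 0\<close> cont(1) by auto
      qed
      then show False using nz by blast
    qed
    moreover have "D t < 0" if "\<not> 0 < D 0" for t
    proof (rule ccontr)
      assume "\<not> D t < 0"
      have "\<exists>x. D x = 0"
      proof (cases "0 \<le> t")
        case True
        then show ?thesis using IVT[of D 0 0 t] \<open>\<not> D t < 0\<close> \<open>\<not> 0 < D 0\<close> cont(1) by auto
      next
        case False
        then show ?thesis using IVT2[of D 0 0 t] \<open>\<not> D t < 0\<close> \<open>\<not> 0 < D 0\<close> cont(1) by auto
      qed
      then show False using nz by blast
    qed
    ultimately show ?thesis using that by blast
  qed
  then show False
  proof cases
    case 1 then show ?thesis using Y_not_pos_if_D_pos Y by blast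
  next
    case 2 then show ?thesis using crit_ode.Y_not_pos_if_D_pos[OF swap] Y by (simp add: D_swap Y_swap)
  qed
qed

section \<open>Decay for p > 4\<close>

lemma g1_small:
  assumes p4: "p > 4"
  obtains K where "K > 0" "\<And>t. g1 t \<le> K * w1 t powr (p / 2 - 2)"
proof -
  obtain M1 M2 where M: "M1 > 0" "\<And>t. w1 t \<le> M1" "M2 > 0" "\<And>t. w2 t \<le> M2"
    using w1_bounded w2_bounded by metis
  show ?thesis
  proof
    show "\<mu>1 * M1 powr (p / 2) + \<beta> * M2 powr (p / 2) > 0" using \<mu>1 \<beta> M by (simp add: add_pos_pos)
    fix t
    have "w1 t powr (p - 2) = w1 t powr (p / 2) * w1 t powr (p / 2 - 2)"
      by (simp flip: powr_add)
    moreover have "C t / (w1 t)\<^sup>2 = \<beta> * w2 t powr (p / 2) * w1 t powr (p / 2 - 2)"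
      using w1[of t] w2[of t] by (simp add: C_def powr_mult powr_diff)
    ultimately have "g1 t = (\<mu>1 * w1 t powr (p / 2) + \<beta> * w2 t powr (p / 2)) * w1 t powr (p / 2 - 2)"
      by (simp add: g1_def algebra_simps)
    also have "\<dots> \<le> (\<mu>1 * M1 powr (p / 2) + \<beta> * M2 powr (p / 2)) * w1 t powr (p / 2 - 2)"
      using \<mu>1 \<beta> M w1[of t] w2[of t] p_gt
      by (intro mult_right_mono add_mono mult_left_mono powr_mono2) (auto simp: less_imp_le)
    finally show "g1 t \<le> (\<mu>1 * M1 powr (p / 2) + \<beta> * M2 powr (p / 2)) * w1 t powr (p / 2 - 2)" .
  qed
qed

text \<open>For p > 4 the exponent p/2 - 2 is positive, so smallness of \<open>w1\<close> alone
  makes \<open>g1\<close> small. For p < 4 the coupling term could become large instead.\<close>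

lemma g1_lt_of_w1:
  assumes p4: "p > 4" and e: "e > 0"
  obtains \<eta> where "\<eta> > 0" "\<And>t. w1 t \<le> \<eta> \<Longrightarrow> g1 t < e"
proof -
  obtain K where K: "K > 0" "\<And>t. g1 t \<le> K * w1 t powr (p / 2 - 2)" using g1_small[OF p4] by blast
  define \<eta> where "\<eta> = (e / (2 * K)) powr (1 / (p / 2 - 2))"
  show ?thesis
  proof
    show "\<eta> > 0" using e K by (simp add: \<eta>_def)
    fix t assume t: "w1 t \<le> \<eta>"
    have "w1 t powr (p / 2 - 2) \<le> \<eta> powr (p / 2 - 2)" using t w1[of t] p4 by (intro powr_mono2) auto
    also have "\<dots> = e / (2 * K)"
    proof -
      have "1 / (p / 2 - 2) * (p / 2 - 2) = 1" using p4 by simp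
      then show ?thesis using e K by (simp only: \<eta>_def powr_powr) simp
    qed
    finally have "K * w1 t powr (p / 2 - 2) \<le> e / 2" using K(1) by (simp add: field_simps)
    with K(2)[of t] e show "g1 t < e" by linarith
  qed
qed

text \<open>For y \<le> 0 the factor \<delta> - y in \<delta>^2 - y^2 = (\<delta> - y)(\<delta> + y)
  is at least \<delta>.\<close>

lemma delta_plus_le:
  assumes "y \<le> 0" "- \<delta> \<le> y" "\<delta>\<^sup>2 - y\<^sup>2 \<le> \<delta> * e"
  shows "y \<le> - \<delta> + e"
proof -
  have "\<delta>\<^sup>2 - y\<^sup>2 = (\<delta> - y) * (\<delta> + y)" by (simp add: power2_eq_square algebra_simps)
  moreover have "\<delta> * (\<delta> + y) \<le> (\<delta> - y) * (\<delta> + y)" using assms by (intro mult_right_mono) auto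
  ultimately have "\<delta> * (\<delta> + y) \<le> \<delta> * e" using assms(3) by linarith
  then show ?thesis using \<delta> by simp
qed

text \<open>From y2 \<le> - c the component \<open>w2\<close> and its potential tend to 0, and D > 0
  gives \<delta>^2 - y2^2 < g2, so \<open>y2\<close> approaches - \<delta>. If \<open>y1\<close>
  stayed above \<open>y2\<close>, then \<open>D\<close> would increase although it is bounded by
  terms tending to 0; hence y1 \<le> y2 at arbitrarily late times.\<close>

lemma y_near_if_D_pos:
  assumes p4: "p > 4" and e: "e > 0" and c: "c > 0" "\<And>s. T0 < s \<Longrightarrow> Y s \<le> - c"
    and D: "\<And>s. T0 < s \<Longrightarrow> 0 < D s"
  shows "\<exists>t\<ge>T. y1 t \<le> - \<delta> + e \<and> y2 t \<le> - \<delta> + e"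
proof -
  have y2: "y2 s \<le> - c" if "T0 + 1 \<le> s" for s
    using c(2)[of s] D[of s] that by (simp add: Y_def)
  have w20: "(w2 \<longlongrightarrow> 0) at_top" by (rule w_decay_tendsto[OF c(1) y2])
  obtain \<eta> where \<eta>: "\<eta> > 0" "\<And>t. w2 t \<le> \<eta> \<Longrightarrow> g2 t < \<delta> * e"
    using crit_ode.g1_lt_of_w1[OF swap p4, of "\<delta> * e"] e \<delta> by (auto simp: g_swap)
  obtain T1 where T1: "\<And>t. T1 \<le> t \<Longrightarrow> w2 t < \<eta>"
    using order_tendstoD(2)[OF w20 \<eta>(1)] by (auto simp: eventually_at_top_linorder)
  define T2 where "T2 = max (max T (T0 + 1)) T1"
  have y2e: "y2 t \<le> - \<delta> + e" if t: "T2 \<le> t" for t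
  proof (rule delta_plus_le)
    have "\<delta>\<^sup>2 - (y2 t)\<^sup>2 - g2 t \<le> - \<kappa> * g2 t"
      using D[of t] t by (intro dy2_neg) (auto simp: T2_def)
    moreover have "0 < \<kappa> * g2 t" using \<kappa>_pos g_pos by simp
    moreover have "g2 t < \<delta> * e" using \<eta>(2)[of t] T1[of t] t by (auto simp: T2_def)
    ultimately show "\<delta>\<^sup>2 - (y2 t)\<^sup>2 \<le> \<delta> * e" by simp
    show "y2 t \<le> 0" using y2[of t] c t by (auto simp: T2_def)
  qed (rule y_bound)
  have "\<exists>t\<ge>T2. y1 t \<le> y2 t"
  proof (rule ccontr)
    assume "\<not> ?thesis"
    then have lt: "y2 t < y1 t" if "T2 \<le> t" for t using that by force
    have mono: "D T2 \<le> D t" if "T2 \<le> t" for t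
    proof (rule DERIV_nonneg_imp_nondecreasing[OF that])
      fix x assume "T2 \<le> x" "x \<le> t"
      then have "0 \<le> C x * (y1 x - y2 x)" using lt[of x] C_pos[of x] by simp
      then show "\<exists>d. (D has_real_derivative d) (at x) \<and> 0 \<le> d" using dD by blast
    qed
    have "((\<lambda>s. w2 s powr p) \<longlongrightarrow> 0) at_top"
      using p_gt w20 by (intro tendsto_zero_powrI) (auto intro!: always_eventually less_imp_le w2)
    then have "((\<lambda>s. 2 / p * (\<mu>2 * w2 s powr p + C s)) \<longlongrightarrow> 2 / p * (\<mu>2 * 0 + 0)) at_top"
      by (intro tendsto_intros C_tendsto_0)
    moreover have "0 < D T2" using D[of T2] by (auto simp: T2_def)
    ultimately have "\<forall>\<^sub>F s in at_top. 2 / p * (\<mu>2 * w2 s powr p + C s) < D T2"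
      using order_tendstoD(2) by force
    then have "\<forall>\<^sub>F s in at_top. D s < D T2"
      by eventually_elim (use D_le_of_w2 in \<open>blast intro: le_less_trans\<close>)
    then obtain s where "T2 \<le> s" "D s < D T2"
      using eventually_happens[OF eventually_conj[OF eventually_ge_at_top[of T2]]] by fastforce
    with mono show False by force
  qed
  then obtain t where t: "T2 \<le> t" "y1 t \<le> y2 t" by blast
  then have "T \<le> t" "y2 t \<le> - \<delta> + e" using y2e[of t] by (auto simp: T2_def)
  with t show ?thesis by force
qed

lemma C_small_imp_g_small:
  assumes p4: "p > 4" and e: "e > 0"
  obtains e0 where "e0 > 0" "\<And>t. C t < e0 \<Longrightarrow> g1 t < e \<or> g2 t < e"
proof -
  obtain \<eta>1 where \<eta>1: "\<eta>1 > 0" "\<And>t. w1 t \<le> \<eta>1 \<Longrightarrow> g1 t < e" using g1_lt_of_w1[OF p4 e] by blast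
  obtain \<eta>2 where \<eta>2: "\<eta>2 > 0" "\<And>t. w2 t \<le> \<eta>2 \<Longrightarrow> g2 t < e"
    using crit_ode.g1_lt_of_w1[OF swap p4 e] by (auto simp: g_swap)
  show ?thesis
  proof
    show "\<beta> * (\<eta>1 * \<eta>2) powr (p / 2) > 0" using \<beta> \<eta>1 \<eta>2 by simp
    fix t assume "C t < \<beta> * (\<eta>1 * \<eta>2) powr (p / 2)"
    then have "(w1 t * w2 t) powr (p / 2) < (\<eta>1 * \<eta>2) powr (p / 2)" using \<beta> by (simp add: C_def)
    then have "w1 t * w2 t < \<eta>1 * \<eta>2"
      using powr_mono2[of "p / 2" "\<eta>1 * \<eta>2" "w1 t * w2 t"] p_gt \<eta>1 \<eta>2 by force
    then have "w1 t \<le> \<eta>1 \<or> w2 t \<le> \<eta>2"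
      using mult_mono[of \<eta>1 "w1 t" \<eta>2 "w2 t"] \<eta>1 \<eta>2 w1[of t] by (force simp: less_imp_le)
    then show "g1 t < e \<or> g2 t < e" using \<eta>1 \<eta>2 by blast
  qed
qed

text \<open>At a zero of \<open>D\<close> both \<delta>^2 - y_i^2 equal (2/p) g_i. A small coupling
  makes one potential small, so one y_i is near - \<delta> and the infimum of \<open>Y\<close> is
  near - \<delta>. At late zeros both y_i lie close to that infimum or below it.\<close>

lemma y_near_if_zeros:
  assumes p4: "p > 4" and e: "e > 0" and c: "c > 0" "\<And>s. T0 < s \<Longrightarrow> Y s \<le> - c"
    and D: "\<And>s. \<exists>t>s. D t = 0"
  shows "\<exists>t\<ge>T. y1 t \<le> - \<delta> + e \<and> y2 t \<le> - \<delta> + e"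
proof -
  have bd: "bdd_below (range Y)" using Y_bound by (intro bdd_belowI[of _ "- \<delta>"]) auto
  define I where "I = Inf (range Y)"
  have IY: "I \<le> Y t" for t unfolding I_def by (intro cInf_lower bd) auto
  obtain T1 where T1: "Y T1 < I + e / 2"
    using cInf_less_iff[OF _ bd, of "I + e / 2"] e by (auto simp: I_def)
  have "p / 2 * (\<delta> * (e / 2)) > 0" using p_gt \<delta> e by simp
  then obtain e0 where e0: "e0 > 0" "\<And>t. C t < e0 \<Longrightarrow> g1 t < p / 2 * (\<delta> * (e / 2)) \<or> g2 t < p / 2 * (\<delta> * (e / 2))"
    using C_small_imp_g_small[OF p4] by blast
  obtain T2 where T2: "\<And>t. T2 \<le> t \<Longrightarrow> C t < e0"
    using order_tendstoD(2)[OF C_tendsto_0 e0(1)] by (auto simp: eventually_at_top_linorder)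
  define T3 where "T3 = max (max T T0) (max T1 T2)"
  obtain t where t: "t > T3" "D t = 0" using D by blast
  have Yle: "Y s \<le> min (- c) (I + e / 2)" if "T3 < s" for s
    using c(2)[of s] Y_mono[of T1 s] T1 that by (auto simp: T3_def)
  have y: "y1 t \<le> min (- c) (I + e / 2)" "y2 t \<le> min (- c) (I + e / 2)"
    using y_le_at_zero[OF Yle t] crit_ode.y_le_at_zero[OF swap, of T3 _ t] Yle t by (auto simp: Y_swap D_swap)
  have z: "\<delta>\<^sup>2 - (y1 t)\<^sup>2 = 2 / p * g1 t" "\<delta>\<^sup>2 - (y2 t)\<^sup>2 = 2 / p * g2 t"
    using D_eq[of t] D_eq2[of t] t(2) w1[of t] w2[of t] by auto
  have q: "2 / p * g \<le> \<delta> * (e / 2)" if "g < p / 2 * (\<delta> * (e / 2))" for g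
    using that p_gt by (simp add: field_simps)
  have "g1 t < p / 2 * (\<delta> * (e / 2)) \<or> g2 t < p / 2 * (\<delta> * (e / 2))"
    using e0(2)[OF T2[of t]] t(1) by (auto simp: T3_def)
  then have "y1 t \<le> - \<delta> + e / 2 \<or> y2 t \<le> - \<delta> + e / 2"
    using delta_plus_le[OF _ y_bound(1), of t "e / 2"] delta_plus_le[OF _ y_bound(3), of t "e / 2"] y c(1) q
    unfolding z by fastforce
  then have "I \<le> - \<delta> + e / 2"
    using IY[of t] y_ge_Y_at_zero[OF t(2)] by auto
  then have "y1 t \<le> - \<delta> + e" "y2 t \<le> - \<delta> + e" using y by auto
  then show ?thesis using t(1) by (intro exI[of _ t]) (auto simp: T3_def)
qed

lemma y_near:
  assumes p4: "p > 4" and e: "e > 0" and c: "c > 0" "\<And>s. T0 < s \<Longrightarrow> Y s \<le> - c"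
  shows "\<exists>t\<ge>T. y1 t \<le> - \<delta> + e \<and> y2 t \<le> - \<delta> + e"
proof (cases "\<forall>s. \<exists>t>s. D t = 0")
  case True
  then show ?thesis using y_near_if_zeros[OF p4 e c] by blast
next
  case False
  then obtain S where S: "\<And>t. S < t \<Longrightarrow> D t \<noteq> 0" by blast
  define T1 where "T1 = max S T0 + 1"
  have nz: "D t \<noteq> 0" if "T1 \<le> t" for t using S[of t] that by (auto simp: T1_def)
  have Yc: "Y s \<le> - c" if "T1 < s" for s using c(2)[of s] that by (auto simp: T1_def)
  show ?thesis
  proof (cases "0 < D T1")
    case True
    have "0 < D s" if "T1 < s" for s
    proof (rule ccontr)
      assume "\<not> 0 < D s"
      then have "\<exists>x\<ge>T1. x \<le> s \<and> D x = 0"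
        using True that cont(1) by (intro IVT2) auto
      then show False using nz by blast
    qed
    then show ?thesis using y_near_if_D_pos[OF p4 e c(1) Yc] by blast
  next
    case D1: False
    have "D s < 0" if "T1 < s" for s
    proof (rule ccontr)
      assume "\<not> D s < 0"
      then have "\<exists>x\<ge>T1. x \<le> s \<and> D x = 0"
        using D1 that cont(1) by (intro IVT) auto
      then show False using nz by blast
    qed
    then show ?thesis
      using crit_ode.y_near_if_D_pos[OF swap p4 e c(1), of T1 T] Yc by (simp add: Y_swap D_swap conj_commute)
  qed
qed

text \<open>Since C \<le> w1^2 g1, the comparison of \<open>D\<close> with \<open>C\<close> gives p
  (\<delta>^2 - y1^2) \<le> 4 g1. A small potential therefore excludes the value - \<delta>/2 for
  \<open>y1\<close>.\<close>

lemma y1_square_large: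
  assumes D: "p / 2 * D t \<le> C t" and g: "g1 t < p / 4 * (3 / 4 * \<delta>\<^sup>2)"
  shows "\<delta>\<^sup>2 / 4 < (y1 t)\<^sup>2"
proof -
  have pp: "p > 0" using p_gt by simp
  have "0 \<le> \<mu>1 * w1 t powr p" using \<mu>1 by simp
  then have "C t \<le> (w1 t)\<^sup>2 * g1 t" using w2g[of t] by simp
  moreover have "p / 2 * D t = (w1 t)\<^sup>2 * (p / 2 * (\<delta>\<^sup>2 - (y1 t)\<^sup>2) - g1 t)"
    using pp by (simp add: D_eq field_simps)
  ultimately have "(w1 t)\<^sup>2 * (p / 2 * (\<delta>\<^sup>2 - (y1 t)\<^sup>2) - g1 t) \<le> (w1 t)\<^sup>2 * g1 t" using D by linarith
  then have "p / 2 * (\<delta>\<^sup>2 - (y1 t)\<^sup>2) - g1 t \<le> g1 t" using w1[of t] by simp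
  then have "p / 2 * (\<delta>\<^sup>2 - (y1 t)\<^sup>2) < p / 2 * (3 / 4 * \<delta>\<^sup>2)" using g by simp
  then have "\<delta>\<^sup>2 - (y1 t)\<^sup>2 < 3 / 4 * \<delta>\<^sup>2" using pp by simp
  then show ?thesis by simp
qed

text \<open>A continuity argument from a time at which both y_i are near - \<delta>, where the
  energy makes both components small. Until max(y1, y2) reaches - \<delta>/2 the components decrease
  and stay small, but then \<open>y1_square_large\<close> forbids that value. Hence both y_i stay at
  or below - \<delta>/2.\<close>

lemma tendsto_0_if_gt4:
  assumes p4: "p > 4"
  shows "(w1 \<longlongrightarrow> 0) at_top \<and> (w2 \<longlongrightarrow> 0) at_top"
proof -
  obtain T0 where T0: "Y T0 < 0" using Y_eventually_neg by blast
  define c where "c = - Y T0"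
  have c: "c > 0" "\<And>s. T0 < s \<Longrightarrow> Y s \<le> - c" using T0 Y_mono[of T0] by (auto simp: c_def)
  have D1: "p / 2 * D t \<le> C t" if "T0 < t" for t
  proof (cases "0 < D t")
    case True then show ?thesis using D_le_C[OF c that] by simp
  next
    case False
    then have "p / 2 * D t \<le> 0" using p_gt by (simp add: mult_le_0_iff)
    then show ?thesis using C_pos[of t] by linarith
  qed
  have D2: "p / 2 * - D t \<le> C t" if "T0 < t" for t
  proof (cases "0 < - D t")
    case True then show ?thesis using crit_ode.D_le_C[OF swap c(1), of T0 t] c(2) that by (simp add: D_swap C_swap Y_swap)
  next
    case False
    then have "p / 2 * - D t \<le> 0" using p_gt by (simp add: zero_le_mult_iff)
    then show ?thesis using C_pos[of t] by linarith
  qed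
  have "p / 4 * (3 / 4 * \<delta>\<^sup>2) > 0" using p_gt \<delta> by simp
  then obtain \<eta>1 \<eta>2 where \<eta>: "\<eta>1 > 0" "\<And>t. w1 t \<le> \<eta>1 \<Longrightarrow> g1 t < p / 4 * (3 / 4 * \<delta>\<^sup>2)"
    "\<eta>2 > 0" "\<And>t. w2 t \<le> \<eta>2 \<Longrightarrow> g2 t < p / 4 * (3 / 4 * \<delta>\<^sup>2)"
    using g1_lt_of_w1[OF p4] crit_ode.g1_lt_of_w1[OF swap p4] unfolding g_swap by metis
  define \<eta> where "\<eta> = min \<eta>1 \<eta>2"
  have \<eta>0: "\<eta> > 0" using \<eta> by (simp add: \<eta>_def)
  \<comment> \<open>The first entry starts both y_i below - \<delta>/2; the second makes
    \<open>w_power_bound\<close>, applied with 2 \<delta> e, give components at most \<eta>.\<close>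
  define e where "e = min (\<delta> / 4) (\<eta> powr (p - 2) * min \<mu>1 \<mu>2 / (p * (2 * \<delta>)))"
  have e: "e > 0" "e \<le> \<delta> / 4" using \<delta> \<eta>0 \<mu>1 \<mu>2 p_gt by (auto simp: e_def)
  have ee: "p * (2 * \<delta> * e) / min \<mu>1 \<mu>2 \<le> \<eta> powr (p - 2)"
  proof -
    have "e \<le> \<eta> powr (p - 2) * min \<mu>1 \<mu>2 / (p * (2 * \<delta>))" by (simp add: e_def)
    then have "e * (p * (2 * \<delta>)) \<le> \<eta> powr (p - 2) * min \<mu>1 \<mu>2"
      using \<delta> p_gt by (simp add: pos_le_divide_eq)
    then show ?thesis using \<mu>1 \<mu>2 by (simp add: pos_divide_le_eq mult_ac)
  qed
  obtain t0 where t0: "t0 \<ge> T0 + 1" "y1 t0 \<le> - \<delta> + e" "y2 t0 \<le> - \<delta> + e"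
    using y_near[OF p4 e(1) c] by blast
  have sq: "\<delta>\<^sup>2 - y\<^sup>2 \<le> 2 * \<delta> * e" if "- \<delta> \<le> y" "y \<le> - \<delta> + e" for y
  proof -
    have "(\<delta> - y) * (\<delta> + y) \<le> (2 * \<delta>) * e" using that \<delta> e by (intro mult_mono) auto
    then show ?thesis by (simp add: power2_eq_square algebra_simps)
  qed
  note wb = w_power_bound[OF sq[OF y_bound(1) t0(2)] sq[OF y_bound(3) t0(3)]]
    crit_ode.w_power_bound[OF swap sq[OF y_bound(3) t0(3)] sq[OF y_bound(1) t0(2)]]
  have w\<eta>: "w1 t0 \<le> \<eta>" "w2 t0 \<le> \<eta>"
  proof -
    have "w1 t0 powr (p - 2) \<le> \<eta> powr (p - 2)" "w2 t0 powr (p - 2) \<le> \<eta> powr (p - 2)"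
      using wb ee by (auto simp: min.commute)
    moreover have "x \<le> \<eta>" if "x powr (p - 2) \<le> \<eta> powr (p - 2)" "x > 0" for x
      using powr_less_mono2[of "p - 2" \<eta> x] that \<eta>0 p_gt by force
    ultimately show "w1 t0 \<le> \<eta>" "w2 t0 \<le> \<eta>" using w1 w2 by auto
  qed
  define m where "m t = max (y1 t) (y2 t)" for t
  have cm: "continuous_on UNIV m"
    unfolding m_def by (intro continuous_on_max) (auto simp: cont continuous_at_imp_continuous_on)
  have m0: "m t0 < - \<delta> / 2" using t0 e \<delta> by (auto simp: m_def)
  have mle: "m t \<le> - \<delta> / 2" if "t0 \<le> t" for t
  proof (rule ccontr)
    assume "\<not> m t \<le> - \<delta> / 2"
    define S where "S = {s. t0 \<le> s \<and> m s = - \<delta> / 2}"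
    have "S \<noteq> {}"
      using IVT'[of m t0 "- \<delta> / 2" t] m0 \<open>\<not> m t \<le> - \<delta> / 2\<close> that continuous_on_subset[OF cm] by (force simp: S_def)
    moreover have "closed S" unfolding S_def
      by (intro closed_Collect_conj closed_Collect_le closed_Collect_eq continuous_intros cm)
    moreover have bdS: "bdd_below S" by (rule bdd_belowI[of _ t0]) (simp add: S_def)
    ultimately have "Inf S \<in> S" by (intro closed_contains_Inf)
    moreover define \<tau> where "\<tau> = Inf S"
    ultimately have \<tau>: "t0 \<le> \<tau>" "m \<tau> = - \<delta> / 2" by (auto simp: S_def)
    \<comment> \<open>\<tau> is the first time at which the threshold is attained, so up to it both
      components are nonincreasing.\<close>
    have before: "m s \<le> - \<delta> / 2" if s: "t0 \<le> s" "s \<le> \<tau>" for s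
    proof (rule ccontr)
      assume ns: "\<not> m s \<le> - \<delta> / 2"
      then obtain x where "t0 \<le> x" "x \<le> s" "m x = - \<delta> / 2"
        using IVT'[of m t0 "- \<delta> / 2" s] m0 s continuous_on_subset[OF cm] by force
      moreover have "\<tau> \<le> x" unfolding \<tau>_def using calculation by (intro cInf_lower bdS) (simp add: S_def)
      ultimately have "s = \<tau>" using s by linarith
      then show False using \<tau>(2) ns by simp
    qed
    have neg: "y1 s \<le> 0" "y2 s \<le> 0" if "t0 \<le> s" "s \<le> \<tau>" for s
      using before[OF that] \<delta> by (auto simp: m_def)
    have "w1 \<tau> \<le> w1 t0"
      by (rule DERIV_nonpos_imp_nonincreasing[OF \<tau>(1)])
        (use dw1 w1 neg in \<open>meson mult_nonneg_nonpos less_imp_le\<close>)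
    moreover have "w2 \<tau> \<le> w2 t0"
      by (rule DERIV_nonpos_imp_nonincreasing[OF \<tau>(1)])
        (use dw2 w2 neg in \<open>meson mult_nonneg_nonpos less_imp_le\<close>)
    ultimately have w: "w1 \<tau> \<le> \<eta>1" "w2 \<tau> \<le> \<eta>2" using w\<eta> by (auto simp: \<eta>_def)
    have "T0 < \<tau>" using t0 \<tau> by simp
    have "\<delta>\<^sup>2 / 4 < (y1 \<tau>)\<^sup>2"
      by (rule y1_square_large[OF D1[OF \<open>T0 < \<tau>\<close>] \<eta>(2)[OF w(1)]])
    moreover have "\<delta>\<^sup>2 / 4 < (y2 \<tau>)\<^sup>2"
      using crit_ode.y1_square_large[OF swap, of \<tau>] D2[OF \<open>T0 < \<tau>\<close>] \<eta>(4)[OF w(2)]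
      by (simp add: D_swap C_swap g_swap)
    moreover have "y1 \<tau> = - \<delta> / 2 \<or> y2 \<tau> = - \<delta> / 2" using \<tau>(2) by (auto simp: m_def max_def split: if_splits)
    then have "(y1 \<tau>)\<^sup>2 = \<delta>\<^sup>2 / 4 \<or> (y2 \<tau>)\<^sup>2 = \<delta>\<^sup>2 / 4" by (auto simp: power_divide)
    ultimately show False by auto
  qed
  have d2: "\<delta> / 2 > 0" using \<delta> by simp
  have y: "y1 s \<le> - (\<delta> / 2)" "y2 s \<le> - (\<delta> / 2)" if "t0 \<le> s" for s
    using mle[OF that] by (auto simp: m_def)
  show ?thesis
    using w_decay_tendsto[OF d2 y(2)] crit_ode.w_decay_tendsto[OF swap d2 y(1)] by blast
qed

text \<open>For \<sigma> = w1 + w2 the quantity a = \<sigma>' + \<delta> \<sigma> measures the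
  deviation from the rate exp(- \<delta> t). It satisfies a' \<ge> \<delta> a - K \<sigma>^(p - 1)
  and tends to 0, which forces a \<le> K1 \<sigma>^(p - 1). A crude decay rate makes the resulting
  error integrable and then gives the sharp rate.\<close>

lemma exponential_decay:
  assumes lim: "(w1 \<longlongrightarrow> 0) at_top" "(w2 \<longlongrightarrow> 0) at_top"
  shows "\<exists>K. \<forall>t. w1 t * exp (\<delta> * t) \<le> K \<and> w2 t * exp (\<delta> * t) \<le> K"
proof -
  define \<sigma> a where "\<sigma> t = w1 t + w2 t" and "a t = w1 t * (y1 t + \<delta>) + w2 t * (y2 t + \<delta>)" for t
  define K where "K = \<mu>1 + \<mu>2 + 2 * \<beta>"
  have K: "K > 0" using \<mu>1 \<mu>2 \<beta> by (simp add: K_def)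
  have \<sigma>: "\<sigma> t > 0" "w1 t \<le> \<sigma> t" "w2 t \<le> \<sigma> t" for t
    using w1[of t] w2[of t] by (auto simp: \<sigma>_def)
  have a0: "0 \<le> a t" "a t \<le> 2 * \<delta> * \<sigma> t" for t
  proof -
    show "0 \<le> a t" using w1[of t] w2[of t] y_bound[of t] by (simp add: a_def)
    have "w1 t * (y1 t + \<delta>) \<le> w1 t * (2 * \<delta>)" "w2 t * (y2 t + \<delta>) \<le> w2 t * (2 * \<delta>)"
      using w1[of t] w2[of t] y_bound[of t] by (auto intro!: mult_left_mono)
    then show "a t \<le> 2 * \<delta> * \<sigma> t" by (simp add: a_def \<sigma>_def algebra_simps)
  qed
  have ds: "(\<sigma> has_real_derivative a t - \<delta> * \<sigma> t) (at t)" for t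
    unfolding \<sigma>_def a_def by (auto intro!: derivative_eq_intros dw1 dw2 simp: algebra_simps)
  have da: "(a has_real_derivative \<delta> * a t - (w1 t * g1 t + w2 t * g2 t)) (at t)" for t
    unfolding a_def
    by (auto intro!: derivative_eq_intros dw1 dw2 dy1' dy2' simp: algebra_simps power2_eq_square)
  have pw: "x * (C t / x\<^sup>2) \<le> \<beta> * \<sigma> t powr (p - 1)" if x: "x = w1 t \<or> x = w2 t" for x t
  proof -
    have x0: "x > 0" "x \<le> \<sigma> t" using x w1 w2 \<sigma> by auto
    obtain z where z: "w1 t * w2 t = x * z" "z > 0" "z \<le> \<sigma> t"
      using x w1 w2 \<sigma> by (metis mult.commute)
    have "x * (C t / x\<^sup>2) = \<beta> * (x powr (p / 2 - 1) * z powr (p / 2))"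
      using x0 z by (simp add: C_def powr_mult powr_diff power2_eq_square)
    also have "\<dots> \<le> \<beta> * (\<sigma> t powr (p / 2 - 1) * \<sigma> t powr (p / 2))"
      using \<beta> p_gt x0 z by (intro mult_left_mono mult_mono powr_mono2) auto
    also have "\<sigma> t powr (p / 2 - 1) * \<sigma> t powr (p / 2) = \<sigma> t powr (p - 1)"
      by (simp flip: powr_add)
    finally show ?thesis .
  qed
  have pm: "x * (\<mu> * x powr (p - 2)) \<le> \<mu> * \<sigma> t powr (p - 1)" if "0 < x" "x \<le> \<sigma> t" "\<mu> > 0" for x \<mu> t
  proof -
    have "x * x powr (p - 2) = x powr (p - 1)" using that powr_add[of x 1 "p - 2"] by simp
    moreover have "x powr (p - 1) \<le> \<sigma> t powr (p - 1)" using that p_gt by (intro powr_mono2) auto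
    ultimately show ?thesis using that(3) by (simp add: mult.left_commute)
  qed
  have wg: "w1 t * g1 t + w2 t * g2 t \<le> K * \<sigma> t powr (p - 1)" for t
    using pw[of "w1 t" t] pw[of "w2 t" t] pm[OF w1 \<sigma>(2) \<mu>1, of t] pm[OF w2 \<sigma>(3) \<mu>2, of t]
    by (simp add: g1_def g2_def K_def algebra_simps)
  \<comment> \<open>Chosen so that differentiating K1 \<sigma>^(p - 1) along - \<delta> \<sigma>
    cancels K \<sigma>^(p - 1), leaving a nonnegative multiple of \<open>a\<close>.\<close>
  define K1 where "K1 = K / ((p - 1) * \<delta>)"
  have K1: "K1 > 0" "K1 * (p - 1) = K / \<delta>" "K1 \<le> K / \<delta>"
    using K p_gt \<delta> by (auto simp: K1_def field_simps)
  have s0: "(\<sigma> \<longlongrightarrow> 0) at_top" unfolding \<sigma>_def using tendsto_add[OF lim] by simp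
  have "((\<lambda>t. K / \<delta> * \<sigma> t powr (p - 2)) \<longlongrightarrow> K / \<delta> * 0) at_top"
    using p_gt \<sigma>(1) by (intro tendsto_mult tendsto_const tendsto_zero_powrI[OF s0]) (auto intro!: always_eventually less_imp_le)
  then have "\<forall>\<^sub>F t in at_top. K / \<delta> * \<sigma> t powr (p - 2) < \<delta> / 2"
    using \<delta> by (intro order_tendstoD(2)) auto
  then obtain T where T: "\<And>t. T \<le> t \<Longrightarrow> K / \<delta> * \<sigma> t powr (p - 2) < \<delta> / 2"
    by (auto simp: eventually_at_top_linorder)
  define P where "P t = \<sigma> t powr (p - 1)" for t
  have Ps: "P t = \<sigma> t powr (p - 2) * \<sigma> t" for t
    using \<sigma>(1)[of t] powr_add[of "\<sigma> t" "p - 2" 1] by (simp add: P_def)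
  have dP: "(P has_real_derivative (p - 1) * \<sigma> t powr (p - 2) * (a t - \<delta> * \<sigma> t)) (at t)" for t
  proof -
    have "((\<lambda>x. x powr (p - 1)) has_real_derivative (p - 1) * \<sigma> t powr (p - 2)) (at (\<sigma> t))"
      using \<sigma>(1)[of t] by (auto intro!: derivative_eq_intros)
    from DERIV_chain2[OF this ds] show ?thesis by (simp add: P_def[abs_def])
  qed
  have ale: "a t \<le> K1 * P t" if t: "T \<le> t" for t
  proof -
    have mono: "a t - K1 * P t \<le> a s - K1 * P s" if s: "t \<le> s" for s
    proof (rule DERIV_nonneg_imp_nondecreasing[OF s])
      fix x assume x: "t \<le> x" "x \<le> s"
      let ?S = "\<sigma> x powr (p - 2)"
      have "((\<lambda>t. a t - K1 * P t) has_real_derivative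
        \<delta> * a x - (w1 x * g1 x + w2 x * g2 x) - K1 * ((p - 1) * ?S * (a x - \<delta> * \<sigma> x))) (at x)"
        by (intro DERIV_diff DERIV_cmult da dP)
      moreover have "0 \<le> \<delta> * a x - (w1 x * g1 x + w2 x * g2 x) - K1 * ((p - 1) * ?S * (a x - \<delta> * \<sigma> x))"
      proof -
        have "K1 * ((p - 1) * ?S * (a x - \<delta> * \<sigma> x)) = K / \<delta> * ?S * (a x - \<delta> * \<sigma> x)"
          using K1(2) by (metis mult.assoc)
        also have "\<dots> = K / \<delta> * ?S * a x - K * P x" using \<delta> by (simp add: Ps field_simps)
        finally have "\<delta> * a x - (w1 x * g1 x + w2 x * g2 x) - K1 * ((p - 1) * ?S * (a x - \<delta> * \<sigma> x))
          \<ge> (\<delta> - K / \<delta> * ?S) * a x" using wg[of x] by (simp add: P_def left_diff_distrib)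
        moreover have "T \<le> x" using x t by simp
        then have "K / \<delta> * ?S \<le> \<delta>" using T[of x] \<delta> by linarith
        then have "0 \<le> (\<delta> - K / \<delta> * ?S) * a x"
          using a0(1)[of x] by (intro mult_nonneg_nonneg) auto
        ultimately show ?thesis by linarith
      qed
      ultimately show "\<exists>D. ((\<lambda>t. a t - K1 * P t) has_real_derivative D) (at x) \<and> 0 \<le> D" by blast
    qed
    have "((\<lambda>s. 2 * \<delta> * \<sigma> s) \<longlongrightarrow> 2 * \<delta> * 0) at_top" by (intro tendsto_intros s0)
    moreover have "\<forall>\<^sub>F s in at_top. a t - K1 * P t \<le> 2 * \<delta> * \<sigma> s"
      using eventually_ge_at_top[of t]
    proof eventually_elim
      case (elim s)
      have "0 \<le> K1 * P s" using K1 by (simp add: P_def)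
      then show ?case using mono[OF elim] a0(2)[of s] by linarith
    qed
    ultimately have "a t - K1 * P t \<le> 2 * \<delta> * 0"
      by (intro tendsto_lowerbound) auto
    then show ?thesis by simp
  qed
  have ale': "a t \<le> K1 * \<sigma> t powr (p - 2) * \<sigma> t" if "T \<le> t" for t
    using ale[OF that] by (simp add: Ps mult.assoc)
  have K1T: "K1 * \<sigma> t powr (p - 2) \<le> \<delta> / 2" if "T \<le> t" for t
    using T[OF that] mult_right_mono[OF K1(3), of "\<sigma> t powr (p - 2)"] by (meson less_imp_le order_trans powr_ge_zero)
  \<comment> \<open>The crude rate \<delta>/2; with (p - 2) \<delta> = 2 it gives \<sigma>^(p - 2) =
    O(exp(- t)).\<close>
  have dec: "\<sigma> t \<le> \<sigma> T * exp (- (\<delta> / 2) * (t - T))" if t: "T \<le> t" for t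
  proof -
    have "\<sigma> t * exp (\<delta> / 2 * (t - T)) \<le> \<sigma> T * exp (\<delta> / 2 * (T - T))"
    proof (rule DERIV_nonpos_imp_nonincreasing[OF t])
      fix x assume x: "T \<le> x" "x \<le> t"
      have "((\<lambda>t. \<sigma> t * exp (\<delta> / 2 * (t - T))) has_real_derivative
          (exp (\<delta> / 2 * (x - T)) * (a x - \<delta> / 2 * \<sigma> x))) (at x)"
        by (auto intro!: derivative_eq_intros ds simp: algebra_simps)
      moreover have "a x \<le> \<delta> / 2 * \<sigma> x"
        by (rule order_trans[OF ale'[OF x(1)] mult_right_mono[OF K1T[OF x(1)] less_imp_le[OF \<sigma>(1)]]])
      then have "exp (\<delta> / 2 * (x - T)) * (a x - \<delta> / 2 * \<sigma> x) \<le> 0"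
        by (intro mult_nonneg_nonpos) auto
      ultimately show "\<exists>D. ((\<lambda>t. \<sigma> t * exp (\<delta> / 2 * (t - T))) has_real_derivative D) (at x) \<and> D \<le> 0" by blast
    qed
    then have "\<sigma> t * exp (\<delta> / 2 * (t - T)) \<le> \<sigma> T" by simp
    moreover have "exp (- (\<delta> / 2) * (t - T)) = 1 / exp (\<delta> / 2 * (t - T))"
      by (simp add: exp_minus inverse_eq_divide)
    ultimately show ?thesis by (simp only: times_divide_eq_right pos_le_divide_eq[OF exp_gt_zero] mult_1_right)
  qed
  define c where "c = K1 * \<sigma> T powr (p - 2)"
  have c: "c \<ge> 0" using K1 by (simp add: c_def)
  have K1c: "K1 * \<sigma> t powr (p - 2) \<le> c * exp (- (t - T))" if t: "T \<le> t" for t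
  proof -
    have pd: "(p - 2) * \<delta> = 2" using \<delta> by (simp add: p)
    have "\<sigma> t powr (p - 2) \<le> (\<sigma> T * exp (- (\<delta> / 2) * (t - T))) powr (p - 2)"
      using dec[OF t] \<sigma>(1)[of t] p_gt by (intro powr_mono2) auto
    also have "\<dots> = \<sigma> T powr (p - 2) * exp ((p - 2) * (- (\<delta> / 2) * (t - T)))"
      using \<sigma>(1)[of T] by (simp add: powr_mult) (simp add: powr_def mult.commute)
    also have "(p - 2) * (- (\<delta> / 2) * (t - T)) = - ((p - 2) * \<delta>) / 2 * (t - T)" by simp
    also have "\<dots> = - (t - T)" unfolding pd by simp
    finally show ?thesis unfolding c_def using K1 by (simp add: mult.assoc)
  qed
  \<comment> \<open>The last factor absorbs the integrable error c exp(- (t - T)) in the logarithmic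
    derivative and always lies between 1 and exp c for t \<ge> T.\<close>
  let ?V = "\<lambda>t. \<sigma> t * exp (\<delta> * t) * exp (c * exp (- (t - T)))"
  have Vmono: "?V t \<le> ?V T" if t: "T \<le> t" for t
  proof (rule DERIV_nonpos_imp_nonincreasing[OF t])
    fix x assume x: "T \<le> x" "x \<le> t"
    let ?E = "exp (\<delta> * x) * exp (c * exp (- (x - T)))"
    have "(?V has_real_derivative (?E * (a x - c * exp (- (x - T)) * \<sigma> x))) (at x)"
      by (auto intro!: derivative_eq_intros ds simp: algebra_simps)
    moreover have "a x \<le> c * exp (- (x - T)) * \<sigma> x"
      by (rule order_trans[OF ale'[OF x(1)] mult_right_mono[OF K1c[OF x(1)] less_imp_le[OF \<sigma>(1)]]])
    then have "?E * (a x - c * exp (- (x - T)) * \<sigma> x) \<le> 0" by (intro mult_nonneg_nonpos) auto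
    ultimately show "\<exists>D. (?V has_real_derivative D) (at x) \<and> D \<le> 0" by blast
  qed
  have Vb: "\<sigma> t * exp (\<delta> * t) \<le> ?V T" if "T \<le> t" for t
  proof -
    have "\<sigma> t * exp (\<delta> * t) * 1 \<le> ?V t"
      using \<sigma>(1)[of t] c by (intro mult_left_mono) auto
    then show ?thesis using Vmono[OF that] by simp
  qed
  \<comment> \<open>Times before \<open>T\<close> are covered because w_i exp(\<delta> t) is
    nondecreasing.\<close>
  have "w1 t * exp (\<delta> * t) \<le> ?V T \<and> w2 t * exp (\<delta> * t) \<le> ?V T" for t
  proof -
    have "w1 t * exp (\<delta> * t) \<le> w1 (max t T) * exp (\<delta> * max t T)"
      "w2 t * exp (\<delta> * t) \<le> w2 (max t T) * exp (\<delta> * max t T)"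
      by (rule w_exp_mono crit_ode.w_exp_mono[OF swap], simp)+
    moreover have "w1 (max t T) * exp (\<delta> * max t T) \<le> \<sigma> (max t T) * exp (\<delta> * max t T)"
      "w2 (max t T) * exp (\<delta> * max t T) \<le> \<sigma> (max t T) * exp (\<delta> * max t T)"
      using \<sigma> by (auto intro!: mult_right_mono)
    ultimately show ?thesis using Vb[OF max.cobounded2, of t] by (meson order_trans)
  qed
  then show ?thesis by blast
qed

theorem decay: "\<exists>K. \<forall>t. w1 t * exp (\<delta> * t) \<le> K \<and> w2 t * exp (\<delta> * t) \<le> K"
proof (cases "p \<le> 4")
  case True
  show ?thesis
    by (rule exponential_decay[OF w1_tendsto_0_if_le4[OF True] crit_ode.w1_tendsto_0_if_le4[OF swap True]])
next
  case False
  then show ?thesis using tendsto_0_if_gt4 exponential_decay by simp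
qed

end

subsection \<open>Removable singularities\<close>

context conformal_pair begin

section \<open>Invariant spheres away from the singularity, and radial symmetry otherwise\<close>

lemma sol_cong:
  assumes "sol u v S" "open V" "V \<subseteq> S" "\<And>y. y \<in> V \<Longrightarrow> u y = u' y" "\<And>y. y \<in> V \<Longrightarrow> v y = v' y"
  shows "sol u' v' V"
proof -
  have t: "twice_on u V" "twice_on v V"
    using assms(1,3) by (auto simp: sol_def intro: twice_on_subset)
  have "twice_on u' V" "twice_on v' V"
    by (rule twice_on_cong[OF assms(2,4) t(1)], simp) (rule twice_on_cong[OF assms(2,5) t(2)], simp)
  moreover have "laplacian u' y = laplacian u y" "laplacian v' y = laplacian v y" if "y \<in> V" for y
    using laplacian_cong_open[OF assms(2) that, of u u'] laplacian_cong_open[OF assms(2) that, of v v'] assms(4,5)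
    by auto
  moreover have "0 < u' y \<and> 0 < v' y" if y: "y \<in> V" for y
    using assms(1,3) y unfolding assms(4)[OF y, symmetric] assms(5)[OF y, symmetric] by (auto simp: sol_def)
  moreover have "laplacian u y = - f (u' y) (v' y) \<and> laplacian v y = - g (u' y) (v' y)" if y: "y \<in> V" for y
    using assms(1,3) y unfolding assms(4)[OF y, symmetric] assms(5)[OF y, symmetric] by (auto simp: sol_def)
  ultimately show ?thesis
    using assms(1,2) by (simp add: sol_def)
qed

lemma sol_Un: "sol u v S \<Longrightarrow> sol u v T \<Longrightarrow> sol u v (S \<union> T)"
  by (auto simp: sol_def intro: twice_on_Un)

lemma sol_kel:
  fixes u v :: "real ^ 'n \<Rightarrow> real"
  assumes s: "sol u v S" and l: "l > 0"
  shows "sol (kel l u) (kel l v) {y. y \<noteq> 0 \<and> sinv l y \<in> S}"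
proof -
  have N: "3 \<le> CARD('n)" and S: "open S" "twice_on u S" "twice_on v S"
    using s N3 by (auto simp: sol_def)
  show ?thesis
    using twice_on_kel(1)[OF N l S(1,2)] twice_on_kel(1)[OF N l S(1,3)] open_sinv_preimage[OF S(1)]
      laplacian_kel[OF s l] s by (auto simp: sol_def)
qed

text \<open>The sphere about \<open>c\<close> has 0 in its exterior, so inversion maps 0 to a
  regular point inside it. The Kelvin transform is a solution near 0 and agrees with the given pair
  off 0, which supplies the extension.\<close>

lemma removable_if_equal_on_sphere:
  fixes u v :: "real ^ 'n \<Rightarrow> real"
  assumes s: "sol u v (- {0})" and l: "0 < l" "l < norm c"
    and E: "\<And>y. y \<noteq> - c \<Longrightarrow> l \<le> norm y \<Longrightarrow>
      kel l (\<lambda>z. u (c + z)) y = u (c + y) \<and> kel l (\<lambda>z. v (c + z)) y = v (c + y)"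
  obtains u' v' where "sol u' v' UNIV" "\<And>y. y \<noteq> 0 \<Longrightarrow> u' y = u y" "\<And>y. y \<noteq> 0 \<Longrightarrow> v' y = v y"
proof -
  let ?ku = "\<lambda>y. kel l (\<lambda>z. u (c + z)) (- c + y)" and ?kv = "\<lambda>y. kel l (\<lambda>z. v (c + z)) (- c + y)"
  define u' v' where "u' = (\<lambda>y. if y = 0 then ?ku 0 else u y)" and "v' = (\<lambda>y. if y = 0 then ?kv 0 else v y)"
  \<comment> \<open>This ball lies outside the sphere, and its image under inversion lies in the
    closed ball of radius \<open>l\<close> about \<open>c\<close>, which avoids 0.\<close>
  let ?V = "ball (0::real^'n) (norm c - l)"
  have s1: "sol u' v' (- {0})"
    by (rule sol_cong[OF s]) (auto simp: u'_def v'_def)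
  have "sol ?ku ?kv {y. - c + y \<in> {y. y \<noteq> 0 \<and> sinv l y \<in> {y. c + y \<in> - {0}}}}"
    by (rule sol_shift[OF sol_kel[OF sol_shift[OF s] l(1)]])
  then have s2: "sol u' v' ?V"
  proof (rule sol_cong)
    have far: "l < norm (- c + y)" if "y \<in> ?V" for y
      using that norm_triangle_sub[of c y] by (simp add: norm_minus_commute)
    show "?V \<subseteq> {y. - c + y \<in> {y. y \<noteq> 0 \<and> sinv l y \<in> {y. c + y \<in> - {0}}}}"
    proof
      fix y assume y: "y \<in> ?V"
      note f = far[OF y]
      have "norm (sinv l (- c + y)) \<le> l"
        using f l(1) mult_mono[of l "norm (- c + y)" l l] by (simp add: norm_sinv divide_le_eq power2_eq_square mult.commute)
      then have "c + sinv l (- c + y) \<noteq> 0"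
        using l(2) by (metis add_eq_0_iff2 norm_minus_cancel not_less minus_unique)
      moreover have "- c + y \<noteq> 0" using f l by auto
      ultimately show "y \<in> {y. - c + y \<in> {y. y \<noteq> 0 \<and> sinv l y \<in> {y. c + y \<in> - {0}}}}" by simp
    qed
    show "?ku y = u' y" "?kv y = v' y" if y: "y \<in> ?V" for y
      using E[of "- c + y"] far[OF y] by (auto simp: u'_def v'_def)
  qed simp
  have "- {0} \<union> ?V = UNIV" using l by auto
  then have "sol u' v' UNIV" using sol_Un[OF s1 s2] by simp
  then show ?thesis by (rule that) (auto simp: u'_def v'_def)
qed

text \<open>Without an invariant sphere every admissible sphere about every nonzero centre gives the
  comparison. For |a| = |b| the spheres carrying \<open>a\<close> to \<open>b\<close> are all
  admissible, so their limit gives u b \<le> u a, and exchanging the points gives equality.\<close>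

lemma singular_dichotomy:
  fixes u v :: "real ^ 'n \<Rightarrow> real"
  assumes s: "sol u v (- {0})"
  obtains (removable) u' v' where "sol u' v' UNIV" "\<And>y. y \<noteq> 0 \<Longrightarrow> u' y = u y" "\<And>y. y \<noteq> 0 \<Longrightarrow> v' y = v y"
  | (radial) "\<And>a b. a \<noteq> 0 \<Longrightarrow> norm a = norm b \<Longrightarrow> u a = u b \<and> v a = v b"
proof (cases "\<exists>c l. c \<noteq> 0 \<and> adm (- c) l \<and> (\<forall>y\<in>punct (- c). l \<le> norm y \<longrightarrow>
    kel l (\<lambda>z. u (c + z)) y = u (c + y) \<and> kel l (\<lambda>z. v (c + z)) y = v (c + y))")
  case True
  then obtain c l where cl: "c \<noteq> 0" "adm (- c) l" and E: "\<forall>y\<in>punct (- c). l \<le> norm y \<longrightarrow>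
    kel l (\<lambda>z. u (c + z)) y = u (c + y) \<and> kel l (\<lambda>z. v (c + z)) y = v (c + y)" by blast
  have l: "0 < l" "l < norm c" using cl by (auto simp: adm_def)
  have E': "kel l (\<lambda>z. u (c + z)) y = u (c + y) \<and> kel l (\<lambda>z. v (c + z)) y = v (c + y)"
    if "y \<noteq> - c" "l \<le> norm y" for y
    using E cl(1) that by (auto simp: punct_def)
  obtain u' v' where "sol u' v' UNIV" "\<And>y. y \<noteq> 0 \<Longrightarrow> u' y = u y" "\<And>y. y \<noteq> 0 \<Longrightarrow> v' y = v y"
    using removable_if_equal_on_sphere[OF s l E'] by metis
  then show ?thesis by (rule removable)
next
  case False
  have CN: "CARD('n) = N" using s by (simp add: sol_def)
  have B: "below_sphere (- c) (\<lambda>z. u (c + z)) l \<and> below_sphere (- c) (\<lambda>z. v (c + z)) l"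
    if "c \<noteq> 0" "adm (- c) l" for c l
  proof -
    have "{y. c + y \<in> - {0}} = punct (- c)"
      using that(1) by (auto simp: punct_def add_eq_0_iff)
    then have "sol (\<lambda>z. u (c + z)) (\<lambda>z. v (c + z)) (punct (- c))" using sol_shift[OF s, of c] by simp
    from moving_spheres[OF this] False that show ?thesis by blast
  qed
  have le: "u b \<le> u a \<and> v b \<le> v a" if a: "a \<noteq> 0" "norm a = norm b" for a b
  proof (cases "a = b")
    case ab: False
    have "sqrt (t / (1 + t)) ^ (CARD('n) - 2) * u b \<le> u a \<and> sqrt (t / (1 + t)) ^ (CARD('n) - 2) * v b \<le> v a"
      if t: "t > 0" for t
    proof -
      define x where "x = b + t *\<^sub>R (b - a)"
      define l where "l = sqrt (t * (1 + t)) * norm (b - a)"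
      note K1 = kel_on_line(1)[OF ab t, folded x_def l_def]
      note K = kel_on_line(2,3)[OF ab t, folded x_def l_def]
      \<comment> \<open>The power of the centre with respect to the sphere |z| = |a|, which the line
        meets at \<open>a\<close> and \<open>b\<close>; it shows l < |x|.\<close>
      have "x \<bullet> x = l\<^sup>2 + a \<bullet> a"
      proof -
        have aa: "a \<bullet> a = b \<bullet> b" using a(2) by (metis dot_square_norm)
        have "l\<^sup>2 = t * (1 + t) * ((b - a) \<bullet> (b - a))"
          using t by (simp add: l_def power_mult_distrib power2_norm_eq_inner)
        then show ?thesis using aa
          by (simp add: x_def inner_add_left inner_add_right inner_diff_left inner_diff_right inner_commute algebra_simps)
      qed
      then have "l\<^sup>2 < (norm x)\<^sup>2" using a(1) by (simp add: power2_norm_eq_inner)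
      then have lx: "l < norm x" by (rule power2_less_imp_less) simp
      have x0: "x \<noteq> 0" using lx K(2) by auto
      have "adm (- x) l" using lx K(2) by (simp add: adm_def)
      from B[OF x0 this] have "kel l (\<lambda>z. u (x + z)) (a - x) \<le> u (x + (a - x))"
        "kel l (\<lambda>z. v (x + z)) (a - x) \<le> v (x + (a - x))"
        using K(1) a(1) x0 by (auto simp: below_sphere_def punct_def)
      then show ?thesis using K1[of u] K1[of v] by simp
    qed
    then show ?thesis using le_of_kel_on_lines by blast
  qed simp
  show ?thesis
  proof (rule radial)
    fix a b :: "real ^ 'n" assume a: "a \<noteq> 0" "norm a = norm b"
    then have "b \<noteq> 0" by auto
    with a show "u a = u b \<and> v a = v b" using le[of a b] le[of b a] by auto
  qed
qed

end

section \<open>Radial functions near the origin\<close>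

lemma radial_profile:
  fixes u :: "real ^ 'n \<Rightarrow> real"
  assumes tw: "twice_on u (- {0})" and rad: "\<And>a b. a \<noteq> 0 \<Longrightarrow> norm a = norm b \<Longrightarrow> u a = u b"
  shows "\<exists>\<phi> \<phi>1 \<phi>2. (\<forall>s>0. (\<phi> has_real_derivative \<phi>1 s) (at s)) \<and>
    (\<forall>s>0. (\<phi>1 has_real_derivative \<phi>2 s) (at s)) \<and>
    (\<forall>y. y \<noteq> 0 \<longrightarrow> u y = \<phi> (y \<bullet> y)) \<and>
    (\<forall>y. y \<noteq> 0 \<longrightarrow> grad u y = (2 * \<phi>1 (y \<bullet> y)) *\<^sub>R y) \<and>
    (\<forall>y. y \<noteq> 0 \<longrightarrow> laplacian u y = 4 * \<phi>2 (y \<bullet> y) * (y \<bullet> y) + 2 * real CARD('n) * \<phi>1 (y \<bullet> y))"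
proof -
  obtain e :: "real ^ 'n" where e: "norm e = 1"
    using vector_choose_size[of 1] by auto
  have e0: "e \<noteq> 0" using e by auto
  define \<phi> where "\<phi> s = u (sqrt s *\<^sub>R e)" for s
  define \<phi>1 where "\<phi>1 s = (grad u (sqrt s *\<^sub>R e) \<bullet> e) * (inverse (sqrt s) / 2)" for s
  define \<phi>2 where "\<phi>2 = deriv \<phi>1"
  have L: "((\<lambda>s. sqrt s *\<^sub>R e) has_derivative (\<lambda>h. (h * (inverse (sqrt s) / 2)) *\<^sub>R e)) (at s)" if "0 < s" for s
    using that by (auto intro!: derivative_eq_intros)
  have nz: "sqrt s *\<^sub>R e \<in> - {0}" if "0 < s" for s using that e0 by simp
  have d1: "(\<phi> has_real_derivative \<phi>1 s) (at s)" if s: "0 < s" for s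
    unfolding has_field_derivative_def \<phi>_def
    by (rule has_derivative_eq_rhs[OF has_derivative_compose[OF L[OF s] twice_on_has_derivative(1)[OF tw nz[OF s]]]])
      (simp add: fun_eq_iff \<phi>1_def)
  have d2: "(\<phi>1 has_real_derivative \<phi>2 s) (at s)" if s: "0 < s" for s
  proof -
    have "((\<lambda>s. grad u (sqrt s *\<^sub>R e) \<bullet> e) has_derivative
        (\<lambda>h. hess u (sqrt s *\<^sub>R e) ((h * (inverse (sqrt s) / 2)) *\<^sub>R e) \<bullet> e)) (at s)"
      by (rule has_derivative_inner_left[OF has_derivative_compose[OF L[OF s] twice_on_has_derivative(2)[OF tw nz[OF s]]]])
    then have "((\<lambda>s. grad u (sqrt s *\<^sub>R e) \<bullet> e) has_real_derivative
        (inverse (sqrt s) / 2) * (hess u (sqrt s *\<^sub>R e) e \<bullet> e)) (at s)"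
      unfolding has_field_derivative_def
      by (rule has_derivative_eq_rhs) (simp add: fun_eq_iff linear_cmul[OF linear_hess])
    moreover have "((\<lambda>s. inverse (sqrt s) / 2) has_real_derivative (- (inverse (sqrt s) / 2) / (sqrt s)\<^sup>2) / 2) (at s)"
      using s by (auto intro!: derivative_eq_intros simp: power2_eq_square field_simps)
    ultimately have "\<exists>D. (\<phi>1 has_real_derivative D) (at s)"
      unfolding \<phi>1_def[abs_def] using DERIV_mult by blast
    then show ?thesis unfolding \<phi>2_def using DERIV_imp_deriv by blast
  qed
  have val: "u y = \<phi> (y \<bullet> y)" if "y \<noteq> 0" for y
    unfolding \<phi>_def using that e by (intro rad) (auto simp: norm_eq_sqrt_inner)
  have op: "open (- {0::real^'n})" by auto
  have p: "0 < (y - 0) \<bullet> (y - 0)" if "y \<in> - {0}" for y :: "real^'n" using that by simp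
  note R = twice_on_radial[OF op d1[OF p] d2[OF p]]
  have eq: "\<phi> ((y - 0) \<bullet> (y - 0)) = u y" if "y \<in> - {0}" for y using val[of y] that by simp
  show ?thesis
  proof (rule exI[of _ \<phi>], rule exI[of _ \<phi>1], rule exI[of _ \<phi>2], intro conjI allI impI)
    fix y :: "real ^ 'n" assume y: "y \<noteq> 0"
    then have y': "y \<in> - {0}" by simp
    have "partial i u y = partial i (\<lambda>y. \<phi> ((y - 0) \<bullet> (y - 0))) y" for i
      by (rule partial_cong_open[OF op y']) (rule eq[symmetric])
    then have "grad u y = grad (\<lambda>y. \<phi> ((y - 0) \<bullet> (y - 0))) y"
      by (simp only: grad_def)
    also have "\<dots> = (2 * \<phi>1 ((y - 0) \<bullet> (y - 0))) *\<^sub>R (y - 0)" using R(2)[of y] y' by auto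
    finally show "grad u y = (2 * \<phi>1 (y \<bullet> y)) *\<^sub>R y" by simp
    have "laplacian u y = laplacian (\<lambda>y. \<phi> ((y - 0) \<bullet> (y - 0))) y"
      by (rule laplacian_cong_open[OF op y']) (use eq in auto)
    then show "laplacian u y = 4 * \<phi>2 (y \<bullet> y) * (y \<bullet> y) + 2 * real CARD('n) * \<phi>1 (y \<bullet> y)"
      using R(3)[of y] y' by auto
  qed (rule d1 d2 val, assumption)+
qed

lemma filterlim_square_norm_at_right:
  "filterlim (\<lambda>y::'a::real_inner. y \<bullet> y) (at_right 0) (at 0)"
proof -
  have "((\<lambda>y::'a. y \<bullet> y) \<longlongrightarrow> (0::'a) \<bullet> 0) (at 0)"
    by (rule tendsto_inner[OF tendsto_ident_at tendsto_ident_at])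
  then show ?thesis
    unfolding filterlim_at by (auto simp: eventually_at_filter)
qed

text \<open>Boundedness of \<phi>1 gives |\<phi>(s) - \<phi>0| \<le> B s, quadratic in |y|, so the
  gradient at 0 is 0. The gradient 2 \<phi>1 y then has derivative 2 m times the identity there,
  with trace 2 N m.\<close>

lemma radial_extension:
  fixes u :: "real ^ 'n \<Rightarrow> real"
  assumes tw: "twice_on u (- {0})"
    and d: "\<And>s. 0 < s \<Longrightarrow> (\<phi> has_real_derivative \<phi>1 s) (at s)"
    and val: "\<And>y. y \<noteq> 0 \<Longrightarrow> u y = \<phi> (y \<bullet> y)"
    and gr: "\<And>y. y \<noteq> 0 \<Longrightarrow> grad u y = (2 * \<phi>1 (y \<bullet> y)) *\<^sub>R y"
    and lim0: "(\<phi> \<longlongrightarrow> \<phi>0) (at_right 0)" and lim1: "(\<phi>1 \<longlongrightarrow> m) (at_right 0)"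
  defines "u' \<equiv> \<lambda>y. if y = 0 then \<phi>0 else u y"
  shows "twice_on u' UNIV" "laplacian u' 0 = 2 * real CARD('n) * m"
proof -
  define G where "G y = (if y = 0 then 0 else grad u y)" for y
  define G' where "G' x = (if x = 0 then (\<lambda>h. (2 * m) *\<^sub>R h) else hess u x)" for x
  have op: "open (- {0::real^'n})" by auto
  have "\<forall>\<^sub>F s in at_right 0. dist (\<phi>1 s) m < 1"
    by (rule tendstoD[OF lim1]) simp
  then obtain b where b: "b > 0" "\<And>s. 0 < s \<Longrightarrow> s < b \<Longrightarrow> dist (\<phi>1 s) m < 1"
    by (auto simp: eventually_at_right_field)
  define B where "B = \<bar>m\<bar> + 1"
  have lip: "\<bar>\<phi> s - \<phi>0\<bar> \<le> B * s" if s: "0 < s" "s < b" for s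
  proof -
    have le: "\<bar>\<phi> s - \<phi> r\<bar> \<le> B * s" if r: "0 < r" "r < s" for r
    proof -
      obtain z where z: "r < z" "z < s" "\<phi> s - \<phi> r = (s - r) * \<phi>1 z"
        using MVT2[OF r(2), of \<phi> \<phi>1] d r by force
      have "\<bar>\<phi>1 z\<bar> \<le> B" using b(2)[of z] z r s by (simp add: B_def dist_real_def)
      then have "\<bar>(s - r) * \<phi>1 z\<bar> \<le> s * B"
        unfolding abs_mult using r s by (intro mult_mono) auto
      then show ?thesis using z by (simp add: mult.commute)
    qed
    have "((\<lambda>r. \<bar>\<phi> s - \<phi> r\<bar>) \<longlongrightarrow> \<bar>\<phi> s - \<phi>0\<bar>) (at_right 0)"
      by (intro tendsto_intros lim0)
    moreover have "\<forall>\<^sub>F r in at_right 0. \<bar>\<phi> s - \<phi> r\<bar> \<le> B * s"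
      unfolding eventually_at_right_field using le s(1) by blast
    ultimately show ?thesis by (intro tendsto_upperbound) auto
  qed
  have du0: "(u' has_derivative (\<lambda>h. 0)) (at 0)"
  proof (rule has_derivativeI_sandwich[where e = "sqrt b" and H = "\<lambda>y. B * norm y"])
    show "0 < sqrt b" using b by simp
    show "((\<lambda>y. B * norm y) \<longlongrightarrow> 0) (at 0)" by (rule tendsto_eq_intros | simp)+
    fix y :: "real ^ 'n" assume y: "y \<noteq> 0" "dist y 0 < sqrt b"
    then have "(norm y)\<^sup>2 < (sqrt b)\<^sup>2" by (intro power_strict_mono) auto
    then have "y \<bullet> y < b" using b by (simp add: power2_norm_eq_inner)
    then have "\<bar>\<phi> (y \<bullet> y) - \<phi>0\<bar> \<le> B * (norm y)\<^sup>2"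
      using lip[of "y \<bullet> y"] y(1) by (simp add: power2_norm_eq_inner)
    then show "norm (u' y - u' 0 - 0) / norm (y - 0) \<le> B * norm y"
      using y(1) by (simp add: u'_def val divide_le_eq power2_eq_square)
  qed simp
  have dG0: "(G has_derivative (\<lambda>h. (2 * m) *\<^sub>R h)) (at 0)"
  proof (rule has_derivativeI_sandwich[where e = 1 and H = "\<lambda>y. 2 * \<bar>\<phi>1 (y \<bullet> y) - m\<bar>"])
    have "((\<lambda>y::real^'n. \<phi>1 (y \<bullet> y)) \<longlongrightarrow> m) (at 0)"
      by (rule filterlim_compose[OF lim1 filterlim_square_norm_at_right])
    then have "((\<lambda>y::real^'n. 2 * \<bar>\<phi>1 (y \<bullet> y) - m\<bar>) \<longlongrightarrow> 2 * \<bar>m - m\<bar>) (at 0)"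
      by (intro tendsto_intros)
    then show "((\<lambda>y::real^'n. 2 * \<bar>\<phi>1 (y \<bullet> y) - m\<bar>) \<longlongrightarrow> 0) (at 0)" by simp
    show "bounded_linear (\<lambda>h::real^'n. (2 * m) *\<^sub>R h)" by (rule bounded_linear_scaleR_right)
    fix y :: "real ^ 'n" assume y: "y \<noteq> 0"
    have "G y - G 0 - (2 * m) *\<^sub>R (y - 0) = (2 * (\<phi>1 (y \<bullet> y) - m)) *\<^sub>R y"
      using y by (simp add: G_def gr algebra_simps)
    then show "norm (G y - G 0 - (2 * m) *\<^sub>R (y - 0)) / norm (y - 0) \<le> 2 * \<bar>\<phi>1 (y \<bullet> y) - m\<bar>"
      using y abs_mult[of 2 "\<phi>1 (y \<bullet> y) - m"] by simp
  qed simp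
  have 1: "(u' has_derivative (\<lambda>h. G x \<bullet> h)) (at x)" for x
  proof (cases "x = 0")
    case True then show ?thesis using du0 by (simp add: G_def)
  next
    case False
    then have "(u has_derivative (\<lambda>h. G x \<bullet> h)) (at x)"
      using twice_on_has_derivative(1)[OF tw, of x] by (simp add: G_def)
    then show ?thesis
      by (rule has_derivative_transform_within_open[OF _ op]) (use False in \<open>auto simp: u'_def\<close>)
  qed
  have 2: "(G has_derivative G' x) (at x)" for x
  proof (cases "x = 0")
    case True then show ?thesis using dG0 by (simp add: G'_def)
  next
    case False
    then have "(grad u has_derivative G' x) (at x)"
      using twice_on_has_derivative(2)[OF tw, of x] by (simp add: G'_def)
    then show ?thesis
      by (rule has_derivative_transform_within_open[OF _ op]) (use False in \<open>auto simp: G_def\<close>)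
  qed
  show "twice_on u' UNIV" by (rule twice_onI(1)[OF open_UNIV 1 2])
  have "laplacian u' 0 = trace_map (G' 0)" by (rule twice_onI(3)[OF open_UNIV 1 2]) simp
  then show "laplacian u' 0 = 2 * real CARD('n) * m"
    by (simp add: G'_def trace_map_scale trace_map_ident)
qed

text \<open>If \<open>s\<^bsup>N/2\<^esup> \<phi>1\<close> had a negative limit at \<open>0\<close>, then \<open>\<phi>\<close> would be unbounded; so the limit is \<open>0\<close>
  and l'Hospital's rule applies to \<open>\<phi>1 = s\<^bsup>N/2\<^esup> \<phi>1 / s\<^bsup>N/2\<^esup>\<close>.\<close>

lemma radial_profile_regular:
  fixes \<phi> \<phi>1 \<phi>2 h :: "real \<Rightarrow> real" and n :: real
  assumes n: "n \<ge> 3"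
    and d: "\<And>s. 0 < s \<Longrightarrow> (\<phi> has_real_derivative \<phi>1 s) (at s)"
      "\<And>s. 0 < s \<Longrightarrow> (\<phi>1 has_real_derivative \<phi>2 s) (at s)"
    and ode: "\<And>s. 0 < s \<Longrightarrow> 4 * \<phi>2 s * s + 2 * n * \<phi>1 s = - h s"
    and h: "\<And>s. 0 < s \<Longrightarrow> 0 \<le> h s" "(h \<longlongrightarrow> h0) (at_right 0)"
    and neg: "\<And>s. 0 < s \<Longrightarrow> \<phi>1 s \<le> 0" and bd: "\<And>s. 0 < s \<Longrightarrow> \<phi> s \<le> B"
  shows "(\<phi>1 \<longlongrightarrow> - h0 / (2 * n)) (at_right 0)"
proof -
  define M where "M s = s powr (n / 2) * \<phi>1 s" for s
  have dM: "(M has_real_derivative - (s powr (n / 2 - 1) * h s / 4)) (at s)" if s: "0 < s" for s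
  proof -
    have 1: "((\<lambda>s. s powr (n / 2)) has_real_derivative n / 2 * s powr (n / 2 - 1)) (at s)"
      using s by (auto intro!: derivative_eq_intros)
    have sp: "s powr (n / 2) = s powr (n / 2 - 1) * s" using s powr_add[of s "n / 2 - 1" 1] by simp
    have "(M has_real_derivative n / 2 * s powr (n / 2 - 1) * \<phi>1 s + \<phi>2 s * s powr (n / 2)) (at s)"
      unfolding M_def[abs_def] by (rule DERIV_mult[OF 1 d(2)[OF s]])
    moreover have "n / 2 * s powr (n / 2 - 1) * \<phi>1 s + \<phi>2 s * s powr (n / 2)
        = s powr (n / 2 - 1) * (4 * \<phi>2 s * s + 2 * n * \<phi>1 s) / 4"
      unfolding sp by (simp add: algebra_simps)
    ultimately show ?thesis unfolding ode[OF s] by simp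
  qed
  have Mmono: "M t \<le> M s" if "0 < s" "s \<le> t" for s t
  proof (rule DERIV_nonpos_imp_nonincreasing[OF that(2)])
    fix x assume "s \<le> x"
    then have x: "0 < x" using that by simp
    have "- (x powr (n / 2 - 1) * h x / 4) \<le> 0" using h(1)[OF x] by simp
    then show "\<exists>D. (M has_real_derivative D) (at x) \<and> D \<le> 0" using dM[OF x] by blast
  qed
  have Mneg: "M s \<le> 0" if "0 < s" for s
    using neg[OF that] by (simp add: M_def mult_nonneg_nonpos)
  have M0: "(M \<longlongrightarrow> 0) (at_right 0)"
  proof (rule order_tendstoI)
    show "\<forall>\<^sub>F s in at_right 0. M s < b" if "0 < b" for b
      unfolding eventually_at_right_field using Mneg that by (intro exI[of _ 1]) force
    fix a :: real assume a: "a < 0"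
    show "\<forall>\<^sub>F s in at_right 0. a < M s"
    proof (rule ccontr)
      assume na: "\<not> ?thesis"
      have Ma: "M s \<le> a" if s: "0 < s" for s
      proof (rule ccontr)
        assume "\<not> M s \<le> a"
        then have "\<forall>r>0. r < s \<longrightarrow> a < M r" using Mmono[of _ s] by force
        then show False using na s unfolding eventually_at_right_field by blast
      qed
      \<comment> \<open>With \<phi>1 \<le> 0 and s^(n/2) \<le> s, the bound M \<le> a < 0 yields
        logarithmic growth of \<phi> at 0.\<close>
      have p1: "\<phi>1 s \<le> a / s" if s: "0 < s" "s \<le> 1" for s
      proof -
        have "s powr (n / 2) \<le> s powr 1" using s n by (intro powr_mono') auto
        then have "s * \<phi>1 s \<le> s powr (n / 2) * \<phi>1 s"
          using neg[OF s(1)] s by (intro mult_right_mono_neg) auto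
        also have "\<dots> \<le> a" using Ma[OF s(1)] by (simp add: M_def)
        finally show ?thesis using s by (simp add: field_simps)
      qed
      have "\<phi> 1 - a * ln 1 \<le> \<phi> s - a * ln s" if s: "0 < s" "s \<le> 1" for s
      proof (rule DERIV_nonpos_imp_nonincreasing[OF s(2)])
        fix x assume x: "s \<le> x" "x \<le> 1"
        then have x0: "0 < x" using s by simp
        have "((\<lambda>s. \<phi> s - a * ln s) has_real_derivative (\<phi>1 x - a / x)) (at x)"
          using x0 by (auto intro!: derivative_eq_intros d(1))
        moreover have "\<phi>1 x - a / x \<le> 0" using p1[OF x0 x(2)] by simp
        ultimately show "\<exists>D. ((\<lambda>s. \<phi> s - a * ln s) has_real_derivative D) (at x) \<and> D \<le> 0" by blast
      qed
      then have "\<phi> 1 + a * ln s \<le> B" if "0 < s" "s \<le> 1" for s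
        using that bd[of s] by force
      \<comment> \<open>At this argument, which is at most 1 because a < 0, the term
        \<open>a * ln s\<close> equals |B - \<phi>(1)| + 1.\<close>
      note * = this[of "exp ((\<bar>B - \<phi> 1\<bar> + 1) / a)"]
      have "(\<bar>B - \<phi> 1\<bar> + 1) / a \<le> 0" using a by (intro divide_nonneg_neg) auto
      with * have "\<phi> 1 + (\<bar>B - \<phi> 1\<bar> + 1) \<le> B" using a by simp
      then show False by linarith
    qed
  qed
  let ?g = "\<lambda>s::real. s powr (n / 2)" and ?g' = "\<lambda>s::real. n / 2 * s powr (n / 2 - 1)"
  have pos: "\<forall>\<^sub>F s in at_right 0. (0::real) < s" by (simp add: eventually_at_right_less)
  have "((\<lambda>s. M s / ?g s) \<longlongrightarrow> - h0 / (2 * n)) (at_right 0)"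
  proof (rule lhopital_right_0[OF M0])
    show "(?g \<longlongrightarrow> 0) (at_right 0)"
      using n by (intro tendsto_zero_powrI[OF _ tendsto_const])
        (auto intro!: tendsto_eq_intros eventually_mono[OF pos] simp: less_imp_le)
    show "\<forall>\<^sub>F s in at_right 0. ?g s \<noteq> 0" using pos by eventually_elim simp
    show "\<forall>\<^sub>F s in at_right 0. ?g' s \<noteq> 0" using pos n by (auto elim!: eventually_mono)
    show "\<forall>\<^sub>F s in at_right 0. (M has_real_derivative - (s powr (n / 2 - 1) * h s / 4)) (at s)"
      using pos by eventually_elim (rule dM)
    show "\<forall>\<^sub>F s in at_right 0. (?g has_real_derivative ?g' s) (at s)"
      using pos by eventually_elim (auto intro!: derivative_eq_intros)
    have "((\<lambda>s. - h s / (2 * n)) \<longlongrightarrow> - h0 / (2 * n)) (at_right 0)"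
      using n by (intro tendsto_intros h(2)) auto
    moreover have "\<forall>\<^sub>F s in at_right 0. - h s / (2 * n) = - (s powr (n / 2 - 1) * h s / 4) / ?g' s"
      using pos by eventually_elim (use n in \<open>simp add: field_simps\<close>)
    ultimately show "((\<lambda>s. - (s powr (n / 2 - 1) * h s / 4) / ?g' s) \<longlongrightarrow> - h0 / (2 * n)) (at_right 0)"
      by (rule Lim_transform_eventually)
  qed
  moreover have "\<forall>\<^sub>F s in at_right 0. M s / ?g s = \<phi>1 s"
    using pos by eventually_elim (simp add: M_def)
  ultimately show ?thesis by (rule Lim_transform_eventually)
qed

lemma nonincreasing_bounded_tendsto_at_right_0:
  fixes \<phi> :: "real \<Rightarrow> real"
  assumes mono: "\<And>s t. 0 < s \<Longrightarrow> s \<le> t \<Longrightarrow> \<phi> t \<le> \<phi> s" and bd: "\<And>s. 0 < s \<Longrightarrow> \<phi> s \<le> B"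
  obtains c where "(\<phi> \<longlongrightarrow> c) (at_right 0)" "\<phi> 1 \<le> c"
proof
  define c where "c = Sup (\<phi> ` {0<..})"
  have bdd: "bdd_above (\<phi> ` {0<..})" using bd by (auto intro!: bdd_aboveI[of _ B])
  have up: "\<phi> s \<le> c" if "0 < s" for s
    unfolding c_def using that by (intro cSup_upper bdd) auto
  show "\<phi> 1 \<le> c" by (rule up) simp
  show "(\<phi> \<longlongrightarrow> c) (at_right 0)"
  proof (rule order_tendstoI)
    show "\<forall>\<^sub>F s in at_right 0. \<phi> s < b" if "c < b" for b
      unfolding eventually_at_right_field using up that by (intro exI[of _ 1]) force
    fix a assume "a < c"
    then obtain s where s: "0 < s" "a < \<phi> s"
      using less_cSup_iff[OF _ bdd, of a] by (auto simp: c_def)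
    then show "\<forall>\<^sub>F s in at_right 0. a < \<phi> s"
      unfolding eventually_at_right_field using mono[of _ s] by (intro exI[of _ s]) force
  qed
qed

section \<open>The critical nonlinearity as a conformal pair\<close>

locale crit_system =
  fixes N :: nat and \<mu>1 \<mu>2 \<beta> p \<delta> :: real
  assumes N: "3 \<le> N" and \<mu>1: "0 < \<mu>1" and \<mu>2: "0 < \<mu>2" and \<beta>: "0 < \<beta>"
    and p: "p = crit_exp N" and \<delta>: "\<delta> = (real N - 2) / 2"
begin

definition F1 where "F1 a b = \<mu>1 * a powr (p - 1) + \<beta> * a powr (p / 2 - 1) * b powr (p / 2)"
definition F2 where "F2 a b = \<mu>2 * b powr (p - 1) + \<beta> * b powr (p / 2 - 1) * a powr (p / 2)"

lemma \<delta>_pos: "\<delta> > 0" using N by (simp add: \<delta>)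

lemma p_eq: "p = 2 + 2 / \<delta>"
  using N by (simp add: p \<delta> crit_exp_def field_simps)

lemma p_gt: "p > 2" using \<delta>_pos by (simp add: p_eq)

lemma two_\<delta>: "2 * \<delta> = real N - 2"
proof -
  have "2 * (x / 2) = x" for x :: real by simp
  then show ?thesis by (simp only: \<delta>)
qed

lemma N_eq: "real N = 2 * \<delta> + 2" using two_\<delta> by simp

lemma \<delta>p: "\<delta> * p = real N" using \<delta>_pos by (simp add: p_eq N_eq distrib_left)

lemma F_mono_aux:
  assumes "0 < a" "a \<le> a'" "0 < b" "b \<le> b'" "\<mu> > 0"
  shows "\<mu> * a powr (p - 1) + \<beta> * a powr (p / 2 - 1) * b powr (p / 2)
    \<le> \<mu> * a' powr (p - 1) + \<beta> * a' powr (p / 2 - 1) * b' powr (p / 2)"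
  using assms p_gt \<beta> by (intro add_mono mult_mono mult_left_mono powr_mono2) auto

text \<open>Criticality enters here: (N - 2)(p - 1) = N + 2, and the two exponents of the coupling
  term add up to p - 1.\<close>

lemma F_hom_aux:
  assumes "0 < c" "0 < a" "0 < b"
  shows "\<mu> * (c ^ (N - 2) * a) powr (p - 1) + \<beta> * (c ^ (N - 2) * a) powr (p / 2 - 1) * (c ^ (N - 2) * b) powr (p / 2)
    = c ^ (N + 2) * (\<mu> * a powr (p - 1) + \<beta> * a powr (p / 2 - 1) * b powr (p / 2))"
proof -
  have c: "c ^ (N - 2) = c powr (2 * \<delta>)" "c ^ (N + 2) = c powr (2 * \<delta> + 4)"
  proof -
    have r: "2 * \<delta> = real (N - 2)" "2 * \<delta> + 4 = real (N + 2)" using N by (simp_all add: two_\<delta> of_nat_diff)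
    show "c ^ (N - 2) = c powr (2 * \<delta>)" unfolding r(1) by (rule powr_realpow[OF assms(1), symmetric])
    show "c ^ (N + 2) = c powr (2 * \<delta> + 4)" unfolding r(2) by (rule powr_realpow[OF assms(1), symmetric])
  qed
  have e: "2 * \<delta> * (p - 1) = 2 * \<delta> + 4" "2 * \<delta> * (p / 2 - 1) + 2 * \<delta> * (p / 2) = 2 * \<delta> + 4"
    using \<delta>_pos by (simp_all add: p_eq field_simps)
  have "(c powr (2 * \<delta>)) powr (p / 2 - 1) * (c powr (2 * \<delta>)) powr (p / 2) = c powr (2 * \<delta> + 4)"
    by (simp only: powr_powr powr_add[symmetric] e)
  moreover have "(c powr (2 * \<delta>)) powr (p - 1) = c powr (2 * \<delta> + 4)"
    by (simp only: powr_powr e)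
  ultimately show ?thesis
    unfolding c using assms by (simp add: powr_mult algebra_simps)
qed

sublocale conformal_pair N F1 F2
proof
  show "3 \<le> N" by (rule N)
  show "0 < F1 a b" "0 < F2 a b" if "0 < a" "0 < b" for a b
    using that \<mu>1 \<mu>2 \<beta> by (simp_all add: F1_def F2_def add_pos_pos)
  show "F1 a b \<le> F1 a' b'" "F2 a b \<le> F2 a' b'" if "0 < a" "a \<le> a'" "0 < b" "b \<le> b'" for a a' b b'
    unfolding F1_def F2_def using that \<mu>1 \<mu>2 by (intro F_mono_aux; simp)+
  show "F1 a b < F1 a b'" if "0 < a" "0 < b" "b < b'" for a b b'
    using that \<beta> p_gt by (simp add: F1_def powr_less_mono2)
  show "F2 a b < F2 a' b" if "0 < a" "0 < b" "a < a'" for a a' b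
    using that \<beta> p_gt by (simp add: F2_def powr_less_mono2)
  show "F1 (c ^ (N - 2) * a) (c ^ (N - 2) * b) = c ^ (N + 2) * F1 a b"
    "F2 (c ^ (N - 2) * a) (c ^ (N - 2) * b) = c ^ (N + 2) * F2 a b" if "0 < c" "0 < a" "0 < b" for a b c
    unfolding F1_def F2_def using that by (intro F_hom_aux; simp)+
qed

end

section \<open>The Pohozaev integral of a radial pair and the Emden-Fowler variables\<close>

lemma measure_sphere_measure:
  assumes r: "r > 0"
  shows "measure (sphere_measure r) (space (sphere_measure r :: 'a::euclidean_space measure))
    = real DIM('a) / r * (unit_ball_vol (real DIM('a)) * r ^ DIM('a))"
proof -
  have eq: "{t *\<^sub>R x | t x. 0 < t \<and> t < 1 \<and> x \<in> sphere (0::'a) r} = ball 0 r - {0}"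
  proof (intro equalityI subsetI)
    fix z assume "z \<in> {t *\<^sub>R x | t x. 0 < t \<and> t < 1 \<and> x \<in> sphere (0::'a) r}"
    then obtain t x where "z = t *\<^sub>R x" "0 < t" "t < 1" "norm x = r" by auto
    then show "z \<in> ball 0 r - {0}" using r by auto
  next
    fix z :: 'a assume z: "z \<in> ball 0 r - {0}"
    then have "z = (norm z / r) *\<^sub>R ((r / norm z) *\<^sub>R z)" using r by simp
    moreover have "(r / norm z) *\<^sub>R z \<in> sphere 0 r" "0 < norm z / r" "norm z / r < 1" using z r by auto
    ultimately show "z \<in> {t *\<^sub>R x | t x. 0 < t \<and> t < 1 \<and> x \<in> sphere (0::'a) r}" by blast
  qed
  have "emeasure (sphere_measure r) (sphere (0::'a) r) = ennreal (real DIM('a) / r) * emeasure lborel (ball (0::'a) r - {0})"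
    using emeasure_sphere_measure[OF r, of "sphere (0::'a) r"] sets.top[of "sphere_measure r :: 'a measure"] eq by simp
  also have "emeasure lborel (ball (0::'a) r - {0}) = emeasure lborel (ball (0::'a) r)"
    using r by (subst emeasure_Diff) auto
  also have "\<dots> = ennreal (unit_ball_vol (real DIM('a)) * r ^ DIM('a))"
    using r by (simp add: emeasure_ball)
  finally show ?thesis
    using r unit_ball_vol_nonneg[of "real DIM('a)"] by (simp add: measure_def enn2real_mult)
qed

context crit_system begin

lemma dF:
  assumes a: "(a has_real_derivative a') (at s)" and b: "(b has_real_derivative b') (at s)" and pos: "0 < a s" "0 < b s"
  shows "((\<lambda>s. \<mu>1 * a s powr p + \<mu>2 * b s powr p + 2 * \<beta> * a s powr (p / 2) * b s powr (p / 2))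
    has_real_derivative p * (F1 (a s) (b s) * a' + F2 (a s) (b s) * b')) (at s)"
proof -
  have pw: "((\<lambda>s. x s powr q) has_real_derivative q * x s powr (q - 1) * x') (at s)"
    if "(x has_real_derivative x') (at s)" "0 < x s" for x x' q
  proof -
    have "((\<lambda>t. t powr q) has_real_derivative q * x s powr (q - 1)) (at (x s))"
      using that(2) by (auto intro!: derivative_eq_intros)
    from DERIV_chain2[OF this that(1)] show ?thesis .
  qed
  have "((\<lambda>s. \<mu>1 * a s powr p + \<mu>2 * b s powr p + 2 * \<beta> * a s powr (p / 2) * b s powr (p / 2)) has_real_derivative
     \<mu>1 * (p * a s powr (p - 1) * a') + \<mu>2 * (p * b s powr (p - 1) * b')
     + (2 * \<beta> * (p / 2 * a s powr (p / 2 - 1) * a') * b s powr (p / 2)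
        + p / 2 * b s powr (p / 2 - 1) * b' * (2 * \<beta> * a s powr (p / 2)))) (at s)"
    by (intro DERIV_add DERIV_cmult DERIV_mult pw a b pos)
  then show ?thesis
    by (rule DERIV_cong) (simp add: F1_def F2_def algebra_simps)
qed

text \<open>Euler's identity: by \<open>dF\<close>, (F1, F2) is 1/p times the gradient of the
  right-hand side, which is homogeneous of degree \<open>p\<close>.\<close>

lemma F_euler:
  assumes "0 < a" "0 < b"
  shows "a * F1 a b + b * F2 a b = \<mu>1 * a powr p + \<mu>2 * b powr p + 2 * \<beta> * a powr (p / 2) * b powr (p / 2)"
proof -
  have "x * x powr (q - 1) = x powr q" if "0 < x" for x q :: real
    using that powr_add[of x 1 "q - 1"] by simp
  note this[OF assms(1), of p] this[OF assms(2), of p] this[OF assms(1), of "p / 2"] this[OF assms(2), of "p / 2"]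
  moreover have "a * F1 a b + b * F2 a b = \<mu>1 * (a * a powr (p - 1)) + \<mu>2 * (b * b powr (p - 1))
     + \<beta> * (a * a powr (p / 2 - 1)) * b powr (p / 2) + \<beta> * (b * b powr (p / 2 - 1)) * a powr (p / 2)"
    by (simp add: F1_def F2_def algebra_simps)
  ultimately show ?thesis by simp
qed

text \<open>A radial pair in the variable \<open>s = \<bar>x\<bar>\<^sup>2\<close>.\<close>

definition profile where
  "profile \<phi> \<phi>1 \<phi>2 \<psi> \<psi>1 \<psi>2 \<longleftrightarrow> (\<forall>s>0. 0 < \<phi> s \<and> 0 < \<psi> s \<and>
     (\<phi> has_real_derivative \<phi>1 s) (at s) \<and> (\<phi>1 has_real_derivative \<phi>2 s) (at s) \<and>
     (\<psi> has_real_derivative \<psi>1 s) (at s) \<and> (\<psi>1 has_real_derivative \<psi>2 s) (at s) \<and>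
     4 * \<phi>2 s * s + 2 * real N * \<phi>1 s = - F1 (\<phi> s) (\<psi> s) \<and>
     4 * \<psi>2 s * s + 2 * real N * \<psi>1 s = - F2 (\<phi> s) (\<psi> s))"

text \<open>The integrand of \<open>pohozaev\<close> on the sphere |x|^2 = s, divided by the
  radius.\<close>

definition poho_density where
  "poho_density \<phi> \<phi>1 \<psi> \<psi>1 s = 2 * \<delta> * (\<phi> s * \<phi>1 s + \<psi> s * \<psi>1 s) + 2 * s * ((\<phi>1 s)\<^sup>2 + (\<psi>1 s)\<^sup>2)
     + (\<mu>1 * \<phi> s powr p + \<mu>2 * \<psi> s powr p + 2 * \<beta> * \<phi> s powr (p / 2) * \<psi> s powr (p / 2)) / p"

text \<open>The radial Pohozaev identity. In the derivative the nonlinear terms are replaced through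
  the equations and Euler's identity; \<delta> p = N makes everything cancel.\<close>

lemma poho_density_conserved:
  assumes pr: "profile \<phi> \<phi>1 \<phi>2 \<psi> \<psi>1 \<psi>2"
  obtains c where "\<And>s. 0 < s \<Longrightarrow> s powr (real N / 2) * poho_density \<phi> \<phi>1 \<psi> \<psi>1 s = c"
proof -
  have "((\<lambda>s. s powr (real N / 2) * poho_density \<phi> \<phi>1 \<psi> \<psi>1 s) has_real_derivative 0) (at s)" if s: "0 < s" for s
  proof -
    note d = pr[unfolded profile_def, rule_format, OF s]
    define F where "F s = \<mu>1 * \<phi> s powr p + \<mu>2 * \<psi> s powr p + 2 * \<beta> * \<phi> s powr (p / 2) * \<psi> s powr (p / 2)" for s
    define f g where "f = F1 (\<phi> s) (\<psi> s)" and "g = F2 (\<phi> s) (\<psi> s)"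
    have dFs: "(F has_real_derivative p * (f * \<phi>1 s + g * \<psi>1 s)) (at s)"
      unfolding F_def[abs_def] f_def g_def using d by (intro dF) auto
    have Fe: "F s = \<phi> s * f + \<psi> s * g"
      unfolding F_def f_def g_def using F_euler d by simp
    have fg: "f = - (4 * \<phi>2 s * s + 2 * real N * \<phi>1 s)" "g = - (4 * \<psi>2 s * s + 2 * real N * \<psi>1 s)"
      using d by (auto simp: f_def g_def)
    have pp: "p \<noteq> 0" using p_gt by simp
    have dFp: "((\<lambda>s. F s / p) has_real_derivative (f * \<phi>1 s + g * \<psi>1 s)) (at s)"
      using DERIV_cdivide[OF dFs, of p] pp by simp
    define A where "A s = 2 * \<delta> * (\<phi> s * \<phi>1 s + \<psi> s * \<psi>1 s) + 2 * s * ((\<phi>1 s)\<^sup>2 + (\<psi>1 s)\<^sup>2)" for s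
    have dA: "(A has_real_derivative (2 * \<delta> * ((\<phi>1 s)\<^sup>2 + \<phi> s * \<phi>2 s + (\<psi>1 s)\<^sup>2 + \<psi> s * \<psi>2 s)
        + 2 * ((\<phi>1 s)\<^sup>2 + (\<psi>1 s)\<^sup>2) + 4 * s * (\<phi>1 s * \<phi>2 s + \<psi>1 s * \<psi>2 s))) (at s)"
      unfolding A_def[abs_def] using d
      by (auto intro!: derivative_eq_intros simp: power2_eq_square algebra_simps)
    have E: "poho_density \<phi> \<phi>1 \<psi> \<psi>1 = (\<lambda>s. A s + F s / p)"
      by (auto simp: fun_eq_iff poho_density_def A_def F_def)
    have dpw: "((\<lambda>s. s powr (real N / 2)) has_real_derivative real N / 2 * s powr (real N / 2 - 1)) (at s)"
      using s by (auto intro!: derivative_eq_intros)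
    have sp: "s powr (real N / 2) = s powr (real N / 2 - 1) * s"
      using s powr_add[of s "real N / 2 - 1" 1] by simp
    define A' where "A' = 2 * \<delta> * ((\<phi>1 s)\<^sup>2 + \<phi> s * \<phi>2 s + (\<psi>1 s)\<^sup>2 + \<psi> s * \<psi>2 s)
        + 2 * ((\<phi>1 s)\<^sup>2 + (\<psi>1 s)\<^sup>2) + 4 * s * (\<phi>1 s * \<phi>2 s + \<psi>1 s * \<psi>2 s)"
    have "((\<lambda>s. s powr (real N / 2) * poho_density \<phi> \<phi>1 \<psi> \<psi>1 s) has_real_derivative
       real N / 2 * s powr (real N / 2 - 1) * (A s + F s / p) + (A' + (f * \<phi>1 s + g * \<psi>1 s)) * s powr (real N / 2)) (at s)"
      unfolding E A'_def by (intro DERIV_mult DERIV_add dpw dA dFp)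
    moreover have "real N / 2 * s powr (real N / 2 - 1) * (A s + F s / p) + (A' + (f * \<phi>1 s + g * \<psi>1 s)) * s powr (real N / 2)
       = s powr (real N / 2 - 1) * (real N / 2 * (A s + F s / p) + s * (A' + f * \<phi>1 s + g * \<psi>1 s))"
      unfolding sp using pp by (simp add: algebra_simps)
    moreover have "real N / 2 * (A s + F s / p) + s * (A' + f * \<phi>1 s + g * \<psi>1 s) = 0"
    proof -
      have Np: "real N / 2 * (F s / p) = \<delta> / 2 * F s" using pp \<delta>p by (simp add: field_simps)
      have e: "real N / 2 * (A s + F s / p) = real N / 2 * A s + \<delta> / 2 * F s"
        unfolding distrib_left[of "real N / 2"] Np ..
      show ?thesis
        unfolding e unfolding Fe fg A_def A'_def N_eq
        by (simp add: power2_eq_square field_simps)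
    qed
    ultimately show ?thesis by simp
  qed
  then have "\<exists>c. \<forall>s\<in>{0<..}. s powr (real N / 2) * poho_density \<phi> \<phi>1 \<psi> \<psi>1 s = c"
    by (intro has_field_derivative_zero_constant) (auto intro: has_field_derivative_at_within)
  then show ?thesis using that by auto
qed

lemma pohozaev_radial:
  fixes u v :: "real ^ 'n \<Rightarrow> real"
  assumes CN: "CARD('n) = N" and r: "r > 0"
    and u: "\<And>y. y \<noteq> 0 \<Longrightarrow> u y = \<phi> (y \<bullet> y)" "\<And>y. y \<noteq> 0 \<Longrightarrow> grad u y = (2 * \<phi>1 (y \<bullet> y)) *\<^sub>R y"
    and v: "\<And>y. y \<noteq> 0 \<Longrightarrow> v y = \<psi> (y \<bullet> y)" "\<And>y. y \<noteq> 0 \<Longrightarrow> grad v y = (2 * \<psi>1 (y \<bullet> y)) *\<^sub>R y"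
  shows "pohozaev \<mu>1 \<mu>2 \<beta> u v r = real N * unit_ball_vol (real N) * ((r\<^sup>2) powr (real N / 2) * poho_density \<phi> \<phi>1 \<psi> \<psi>1 (r\<^sup>2))"
proof -
  define I where "I x = (real N - 2) / 2 * (u x * normal_deriv u x + v x * normal_deriv v x)
          - r / 2 * ((norm (grad u x))\<^sup>2 + (norm (grad v x))\<^sup>2)
          + r * \<bar>normal_deriv u x\<bar>\<^sup>2 + r * \<bar>normal_deriv v x\<bar>\<^sup>2
          + r / p * (\<mu>1 * u x powr p + \<mu>2 * v x powr p
                     + 2 * \<beta> * u x powr (p / 2) * v x powr (p / 2))" for x
  have I: "I x = r * poho_density \<phi> \<phi>1 \<psi> \<psi>1 (r\<^sup>2)" if x: "norm x = r" for x
  proof -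
    have x0: "x \<noteq> 0" using x r by auto
    have xx: "x \<bullet> x = r\<^sup>2" using x by (simp add: power2_norm_eq_inner[symmetric])
    have nu: "normal_deriv u x = 2 * \<phi>1 (r\<^sup>2) * r" "normal_deriv v x = 2 * \<psi>1 (r\<^sup>2) * r"
      using r by (simp_all add: normal_deriv_def u(2)[OF x0] v(2)[OF x0] xx x power2_eq_square)
    have gn: "(norm (grad u x))\<^sup>2 = 4 * (\<phi>1 (r\<^sup>2))\<^sup>2 * r\<^sup>2" "(norm (grad v x))\<^sup>2 = 4 * (\<psi>1 (r\<^sup>2))\<^sup>2 * r\<^sup>2"
      by (simp_all add: u(2)[OF x0] v(2)[OF x0] xx x power_mult_distrib)
    show ?thesis
      unfolding I_def nu gn u(1)[OF x0] v(1)[OF x0] xx poho_density_def power2_abs \<delta>[symmetric]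
      by (simp add: power2_eq_square algebra_simps add_divide_distrib)
  qed
  have "pohozaev \<mu>1 \<mu>2 \<beta> u v r = (\<integral>x. I x \<partial>(sphere_measure r))"
    by (simp add: pohozaev_def Let_def I_def CN p)
  also have "\<dots> = (\<integral>x. r * poho_density \<phi> \<phi>1 \<psi> \<psi>1 (r\<^sup>2) \<partial>(sphere_measure r :: (real^'n) measure))"
    by (rule Bochner_Integration.integral_cong) (auto simp: I)
  also have "\<dots> = measure (sphere_measure r) (space (sphere_measure r :: (real^'n) measure)) * (r * poho_density \<phi> \<phi>1 \<psi> \<psi>1 (r\<^sup>2))"
    by (simp only: lebesgue_integral_const real_scaleR_def)
  also have "\<dots> = real N * unit_ball_vol (real N) * (r ^ N * poho_density \<phi> \<phi>1 \<psi> \<psi>1 (r\<^sup>2))"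
    using r by (subst measure_sphere_measure[OF r]) (simp add: CN)
  also have "r ^ N = (r\<^sup>2) powr (real N / 2)"
  proof -
    have "(r\<^sup>2) powr (real N / 2) = (r powr 2) powr (real N / 2)" using r by simp
    also have "\<dots> = r powr real N" by (simp only: powr_powr) simp
    finally show ?thesis using r by (simp add: powr_realpow)
  qed
  finally show ?thesis .
qed

text \<open>Conservation shows that the boundary integral is the same for all r > 0, so the definite
  description in \<open>pohozaev_const\<close> denotes that value, a positive multiple of the
  conserved quantity.\<close>

lemma poho_density_zero:
  fixes u v :: "real ^ 'n \<Rightarrow> real"
  assumes CN: "CARD('n) = N" and pr: "profile \<phi> \<phi>1 \<phi>2 \<psi> \<psi>1 \<psi>2"
    and u: "\<And>y. y \<noteq> 0 \<Longrightarrow> u y = \<phi> (y \<bullet> y)" "\<And>y. y \<noteq> 0 \<Longrightarrow> grad u y = (2 * \<phi>1 (y \<bullet> y)) *\<^sub>R y"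
    and v: "\<And>y. y \<noteq> 0 \<Longrightarrow> v y = \<psi> (y \<bullet> y)" "\<And>y. y \<noteq> 0 \<Longrightarrow> grad v y = (2 * \<psi>1 (y \<bullet> y)) *\<^sub>R y"
    and K: "pohozaev_const \<mu>1 \<mu>2 \<beta> u v = 0" and s: "0 < s"
  shows "poho_density \<phi> \<phi>1 \<psi> \<psi>1 s = 0"
proof -
  obtain c where c: "\<And>s. 0 < s \<Longrightarrow> s powr (real N / 2) * poho_density \<phi> \<phi>1 \<psi> \<psi>1 s = c"
    using poho_density_conserved[OF pr] by blast
  let ?B = "real N * unit_ball_vol (real N)"
  have B: "?B > 0" using N unit_ball_vol_pos[of "real N"] by simp
  have P: "pohozaev \<mu>1 \<mu>2 \<beta> u v r = ?B * c" if r: "0 < r" for r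
    using pohozaev_radial[OF CN r u v] c[of "r\<^sup>2"] r by simp
  have "pohozaev_const \<mu>1 \<mu>2 \<beta> u v = ?B * c"
    unfolding pohozaev_const_def by (rule the_equality) (use P zero_less_one in \<open>auto, metis\<close>)
  then have "?B * c = 0" using K by simp
  then have "c = 0" using B by (metis less_irrefl mult_eq_0_iff)
  then show ?thesis using c[OF s] s by simp
qed

text \<open>With s = exp(- 2 t) the components are w = r^\<delta> u and their logarithmic
  derivatives are - \<delta> - 2 s \<phi>1/\<phi>. The weight is balanced by \<delta> (p - 2) = 2,
  which makes the system autonomous, and the vanishing density becomes the energy identity.\<close>

lemma crit_ode_of_profile:
  assumes pr: "profile \<phi> \<phi>1 \<phi>2 \<psi> \<psi>1 \<psi>2"
    and E0: "\<And>s. 0 < s \<Longrightarrow> poho_density \<phi> \<phi>1 \<psi> \<psi>1 s = 0"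
  shows "crit_ode \<mu>1 \<mu>2 \<beta> \<delta> p
    (\<lambda>t. exp (- \<delta> * t) * \<phi> (exp (- 2 * t))) (\<lambda>t. exp (- \<delta> * t) * \<psi> (exp (- 2 * t)))
    (\<lambda>t. - \<delta> - 2 * exp (- 2 * t) * \<phi>1 (exp (- 2 * t)) / \<phi> (exp (- 2 * t)))
    (\<lambda>t. - \<delta> - 2 * exp (- 2 * t) * \<psi>1 (exp (- 2 * t)) / \<psi> (exp (- 2 * t)))"
proof -
  have ds: "((\<lambda>t. exp (- 2 * t)) has_real_derivative - 2 * exp (- 2 * t)) (at t)" for t :: real
    by (auto intro!: derivative_eq_intros)
  have sp: "0 < exp (- 2 * t)" for t :: real by simp
  note d = pr[unfolded profile_def, rule_format, OF sp]
  have ch: "((\<lambda>t. x (exp (- 2 * t))) has_real_derivative x' * (- 2 * exp (- 2 * t))) (at t)"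
    if "(x has_real_derivative x') (at (exp (- 2 * t)))" for x x' t
    by (rule DERIV_chain2[OF that ds])
  have dw: "((\<lambda>t. exp (- \<delta> * t) * x (exp (- 2 * t))) has_real_derivative
     exp (- \<delta> * t) * x (exp (- 2 * t)) * (- \<delta> - 2 * exp (- 2 * t) * x' / x (exp (- 2 * t)))) (at t)"
    if "(x has_real_derivative x') (at (exp (- 2 * t)))" "0 < x (exp (- 2 * t))" for x x' t
  proof -
    have 1: "((\<lambda>t. exp (- \<delta> * t)) has_real_derivative - \<delta> * exp (- \<delta> * t)) (at t)"
      by (auto intro!: derivative_eq_intros)
    show ?thesis
      by (rule DERIV_cong[OF DERIV_mult[OF 1 ch[OF that(1)]]]) (use that(2) in \<open>simp add: field_simps\<close>)
  qed
  have p2: "exp (- \<delta> * t) powr q = exp (- \<delta> * q * t)" for t q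
    by (simp add: powr_def mult_ac)
  have dpe: "\<delta> * (p - 2) = 2" "\<delta> * p = 2 * \<delta> + 2" using \<delta>_pos by (simp_all add: p_eq field_simps)
  have g: "\<mu> * (exp (- \<delta> * t) * a) powr (p - 2) + \<beta> * (exp (- \<delta> * t) * a * (exp (- \<delta> * t) * b)) powr (p / 2) / (exp (- \<delta> * t) * a)\<^sup>2
     = exp (- 2 * t) * (\<mu> * a powr (p - 1) + \<beta> * a powr (p / 2 - 1) * b powr (p / 2)) / a"
    if ab: "0 < a" "0 < b" for a b t \<mu>
  proof -
    have "(exp (- \<delta> * t) * a) powr (p - 2) = exp (- (\<delta> * (p - 2)) * t) * a powr (p - 2)"
      using ab by (simp add: powr_mult p2[unfolded mult_minus_left])
    also have "\<dots> = exp (- 2 * t) * a powr (p - 2)" by (simp only: dpe)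
    finally have 1: "(exp (- \<delta> * t) * a) powr (p - 2) = exp (- 2 * t) * a powr (p - 2)" .
    have "(exp (- \<delta> * t) * a * (exp (- \<delta> * t) * b)) powr (p / 2)
       = (exp (- \<delta> * t) powr (p / 2) * exp (- \<delta> * t) powr (p / 2)) * (a powr (p / 2) * b powr (p / 2))"
      using ab by (simp add: powr_mult)
    also have "exp (- \<delta> * t) powr (p / 2) * exp (- \<delta> * t) powr (p / 2) = exp (- \<delta> * t) powr p"
      by (simp flip: powr_add)
    also have "\<dots> = exp (- (\<delta> * p) * t)" by (simp add: p2[unfolded mult_minus_left])
    also have "\<dots> = exp (- 2 * t) * (exp (- \<delta> * t))\<^sup>2"
      unfolding dpe by (simp add: power2_eq_square algebra_simps flip: exp_add)
    finally have 2: "(exp (- \<delta> * t) * a * (exp (- \<delta> * t) * b)) powr (p / 2) / (exp (- \<delta> * t) * a)\<^sup>2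
        = exp (- 2 * t) * (a powr (p / 2) * b powr (p / 2)) / a\<^sup>2"
      by (simp add: power_mult_distrib)
    have 3: "a powr (p - 2) = a powr (p - 1) / a" "a powr (p / 2) / a\<^sup>2 = a powr (p / 2 - 1) / a"
      using ab by (simp_all add: powr_diff power2_eq_square)
    have alg: "\<mu> * U + \<beta> * X / Z = E * (\<mu> * P + \<beta> * S * R) / a"
      if "X / Z = E * (Q * R) / a\<^sup>2" "U = E * (P / a)" "Q / a\<^sup>2 = S / a" for X Z E P Q R S U :: real
    proof -
      have "\<beta> * X / Z = \<beta> * E * R * (Q / a\<^sup>2)" 
      proof -
        have "\<beta> * X / Z = \<beta> * (X / Z)" by simp
        then show ?thesis unfolding that(1) by (simp add: mult_ac)
      qed
      then show ?thesis unfolding that(2,3) by (simp add: add_divide_distrib algebra_simps)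
    qed
    show ?thesis by (rule alg[OF 2 1[unfolded 3(1)] 3(2)])
  qed
  have dy: "((\<lambda>t. - \<delta> - 2 * exp (- 2 * t) * x1 (exp (- 2 * t)) / x (exp (- 2 * t))) has_real_derivative
      \<delta>\<^sup>2 - (- \<delta> - 2 * exp (- 2 * t) * x1 (exp (- 2 * t)) / x (exp (- 2 * t)))\<^sup>2 - exp (- 2 * t) * f / x (exp (- 2 * t))) (at t)"
    if x: "(x has_real_derivative x1 (exp (- 2 * t))) (at (exp (- 2 * t)))"
      "(x1 has_real_derivative x2) (at (exp (- 2 * t)))" "0 < x (exp (- 2 * t))"
      "4 * x2 * exp (- 2 * t) + 2 * real N * x1 (exp (- 2 * t)) = - f" for x x1 x2 f t
  proof -
    let ?s = "exp (- 2 * t)"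
    have "((\<lambda>t. - \<delta> - 2 * exp (- 2 * t) * x1 (exp (- 2 * t)) / x (exp (- 2 * t))) has_real_derivative
       0 - ((2 * (- 2 * ?s) * x1 ?s + x2 * (- 2 * ?s) * (2 * ?s)) * x ?s - 2 * ?s * x1 ?s * (x1 ?s * (- 2 * ?s))) / (x ?s * x ?s)) (at t)"
      using x(3) by (intro DERIV_diff DERIV_const DERIV_divide DERIV_mult DERIV_cmult ds ch x) auto
    moreover have "0 - ((2 * (- 2 * s) * a1 + a2 * (- 2 * s) * (2 * s)) * a - 2 * s * a1 * (a1 * (- 2 * s))) / (a * a)
       = \<delta>\<^sup>2 - (- \<delta> - 2 * s * a1 / a)\<^sup>2 - s * f / a"
      if "0 < a" "4 * a2 * s + 2 * real N * a1 = - f" for s a a1 a2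
    proof -
      have f: "f = - (4 * a2 * s + 2 * (2 * \<delta> + 2) * a1)" using that(2) by (simp add: N_eq)
      show ?thesis unfolding f using that(1) by (simp add: field_simps power2_eq_square)
    qed
    note this[OF x(3,4)]
    ultimately show ?thesis by (simp only:)
  qed
  show ?thesis
  proof
    fix t
    let ?s = "exp (- 2 * t)" and ?e = "exp (- \<delta> * t)"
    note dt = d[of t]
    show "((\<lambda>t. exp (- \<delta> * t) * \<phi> (exp (- 2 * t))) has_real_derivative
        ?e * \<phi> ?s * (- \<delta> - 2 * ?s * \<phi>1 ?s / \<phi> ?s)) (at t)"
      by (rule dw) (use dt in auto)
    show "((\<lambda>t. exp (- \<delta> * t) * \<psi> (exp (- 2 * t))) has_real_derivative
        ?e * \<psi> ?s * (- \<delta> - 2 * ?s * \<psi>1 ?s / \<psi> ?s)) (at t)"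
      by (rule dw) (use dt in auto)
    show "((\<lambda>t. - \<delta> - 2 * exp (- 2 * t) * \<phi>1 (exp (- 2 * t)) / \<phi> (exp (- 2 * t))) has_real_derivative
      \<delta>\<^sup>2 - (- \<delta> - 2 * ?s * \<phi>1 ?s / \<phi> ?s)\<^sup>2 -
        (\<mu>1 * (?e * \<phi> ?s) powr (p - 2) + \<beta> * (?e * \<phi> ?s * (?e * \<psi> ?s)) powr (p / 2) / (?e * \<phi> ?s)\<^sup>2)) (at t)"
    proof -
      have "\<mu>1 * (?e * \<phi> ?s) powr (p - 2) + \<beta> * (?e * \<phi> ?s * (?e * \<psi> ?s)) powr (p / 2) / (?e * \<phi> ?s)\<^sup>2
          = ?s * F1 (\<phi> ?s) (\<psi> ?s) / \<phi> ?s"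
        unfolding F1_def by (rule g) (use dt in auto)
      then have eq: "\<mu>1 * (?e * \<phi> ?s) powr (p - 2) + \<beta> * (?e * \<phi> ?s * (?e * \<psi> ?s)) powr (p / 2) / (?e * \<phi> ?s)\<^sup>2
          = ?s * F1 (\<phi> ?s) (\<psi> ?s) / \<phi> ?s" .
      show ?thesis unfolding eq by (rule dy) (use dt in auto)
    qed
    show "((\<lambda>t. - \<delta> - 2 * exp (- 2 * t) * \<psi>1 (exp (- 2 * t)) / \<psi> (exp (- 2 * t))) has_real_derivative
      \<delta>\<^sup>2 - (- \<delta> - 2 * ?s * \<psi>1 ?s / \<psi> ?s)\<^sup>2 -
        (\<mu>2 * (?e * \<psi> ?s) powr (p - 2) + \<beta> * (?e * \<psi> ?s * (?e * \<phi> ?s)) powr (p / 2) / (?e * \<psi> ?s)\<^sup>2)) (at t)"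
    proof -
      have "\<mu>2 * (?e * \<psi> ?s) powr (p - 2) + \<beta> * (?e * \<psi> ?s * (?e * \<phi> ?s)) powr (p / 2) / (?e * \<psi> ?s)\<^sup>2
          = ?s * F2 (\<phi> ?s) (\<psi> ?s) / \<psi> ?s"
        unfolding F2_def by (rule g) (use dt in auto)
      then have eq: "\<mu>2 * (?e * \<psi> ?s) powr (p - 2) + \<beta> * (?e * \<psi> ?s * (?e * \<phi> ?s)) powr (p / 2) / (?e * \<psi> ?s)\<^sup>2
          = ?s * F2 (\<phi> ?s) (\<psi> ?s) / \<psi> ?s" .
      show ?thesis unfolding eq by (rule dy) (use dt in auto)
    qed
    show "0 < ?e * \<phi> ?s" "0 < ?e * \<psi> ?s" using dt by auto
    have a: "0 < \<phi> ?s" "0 < \<psi> ?s" using dt by auto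
    define F where "F = \<mu>1 * \<phi> ?s powr p + \<mu>2 * \<psi> ?s powr p + 2 * \<beta> * \<phi> ?s powr (p / 2) * \<psi> ?s powr (p / 2)"
    have ep: "?e powr p = ?s * ?e\<^sup>2"
    proof -
      have "?e powr p = exp (- (\<delta> * p) * t)" by (simp add: p2[unfolded mult_minus_left])
      then show ?thesis unfolding dpe by (simp add: power2_eq_square algebra_simps flip: exp_add)
    qed
    have eh: "?e powr (p / 2) * ?e powr (p / 2) = ?s * ?e\<^sup>2" unfolding ep[symmetric] by (simp flip: powr_add)
    have "\<mu>1 * (?e * \<phi> ?s) powr p + \<mu>2 * (?e * \<psi> ?s) powr p + 2 * (\<beta> * (?e * \<phi> ?s * (?e * \<psi> ?s)) powr (p / 2))
       = \<mu>1 * (?e powr p * \<phi> ?s powr p) + \<mu>2 * (?e powr p * \<psi> ?s powr p) + 2 * (\<beta> * ((?e powr (p / 2) * ?e powr (p / 2)) * (\<phi> ?s powr (p / 2) * \<psi> ?s powr (p / 2))))"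
      using a by (simp add: powr_mult mult_ac)
    also have "\<dots> = ?s * ?e\<^sup>2 * F" unfolding ep eh by (simp add: F_def algebra_simps)
    finally have rhs: "\<mu>1 * (?e * \<phi> ?s) powr p + \<mu>2 * (?e * \<psi> ?s) powr p + 2 * (\<beta> * (?e * \<phi> ?s * (?e * \<psi> ?s)) powr (p / 2)) = ?s * ?e\<^sup>2 * F" .
    have sq: "(e * a)\<^sup>2 * (\<delta>\<^sup>2 - (- \<delta> - 2 * s * a1 / a)\<^sup>2) = - (2 * s * e\<^sup>2) * (2 * \<delta> * (a * a1) + 2 * s * a1\<^sup>2)"
      if "0 < a" for e a a1 s
      using that by (simp add: field_simps power2_eq_square)
    have "F / p = - (2 * \<delta> * (\<phi> ?s * \<phi>1 ?s + \<psi> ?s * \<psi>1 ?s) + 2 * ?s * ((\<phi>1 ?s)\<^sup>2 + (\<psi>1 ?s)\<^sup>2))"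
      using E0[OF sp, of t] by (simp add: poho_density_def F_def)
    then have "2 / p * (?s * ?e\<^sup>2 * F) = - (2 * ?s * ?e\<^sup>2) * (2 * \<delta> * (\<phi> ?s * \<phi>1 ?s + \<psi> ?s * \<psi>1 ?s) + 2 * ?s * ((\<phi>1 ?s)\<^sup>2 + (\<psi>1 ?s)\<^sup>2))"
    proof -
      assume h: "F / p = - (2 * \<delta> * (\<phi> ?s * \<phi>1 ?s + \<psi> ?s * \<psi>1 ?s) + 2 * ?s * ((\<phi>1 ?s)\<^sup>2 + (\<psi>1 ?s)\<^sup>2))"
      have "2 / p * (?s * ?e\<^sup>2 * F) = 2 * ?s * ?e\<^sup>2 * (F / p)" by simp
      then show ?thesis unfolding h by (simp only: mult_minus_left mult_minus_right)
    qed
    then show "(?e * \<phi> ?s)\<^sup>2 * (\<delta>\<^sup>2 - (- \<delta> - 2 * ?s * \<phi>1 ?s / \<phi> ?s)\<^sup>2) +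
         (?e * \<psi> ?s)\<^sup>2 * (\<delta>\<^sup>2 - (- \<delta> - 2 * ?s * \<psi>1 ?s / \<psi> ?s)\<^sup>2) =
         2 / p * (\<mu>1 * (?e * \<phi> ?s) powr p + \<mu>2 * (?e * \<psi> ?s) powr p + 2 * (\<beta> * (?e * \<phi> ?s * (?e * \<psi> ?s)) powr (p / 2)))"
      unfolding rhs sq[OF a(1)] sq[OF a(2)] by (simp add: algebra_simps)
  qed (use \<mu>1 \<mu>2 \<beta> \<delta>_pos p_eq in auto)
qed

text \<open>Since w exp(\<delta> t) is the profile itself, the decay theorem says that both profiles
  are bounded. They are also monotone, so they have limits at 0, and the equations then give limits
  of \<phi>1 and \<psi>1.\<close>

lemma removable_if_radial:
  fixes u v :: "real ^ 'n \<Rightarrow> real"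
  assumes s: "sol u v (- {0})" and rad: "\<And>a b. a \<noteq> 0 \<Longrightarrow> norm a = norm b \<Longrightarrow> u a = u b \<and> v a = v b"
    and K: "pohozaev_const \<mu>1 \<mu>2 \<beta> u v = 0"
  obtains u' v' where "sol u' v' UNIV" "\<And>y. y \<noteq> 0 \<Longrightarrow> u' y = u y" "\<And>y. y \<noteq> 0 \<Longrightarrow> v' y = v y"
proof -
  have tw: "twice_on u (- {0})" "twice_on v (- {0})" and CN: "CARD('n) = N" using s by (auto simp: sol_def)
  have rad1: "\<And>a b. a \<noteq> 0 \<Longrightarrow> norm a = norm b \<Longrightarrow> u a = u b"
    and rad2: "\<And>a b. a \<noteq> 0 \<Longrightarrow> norm a = norm b \<Longrightarrow> v a = v b"
    using rad by blast+
  obtain \<phi> \<phi>1 \<phi>2 where \<phi>: "\<And>s. 0 < s \<Longrightarrow> (\<phi> has_real_derivative \<phi>1 s) (at s)"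
    "\<And>s. 0 < s \<Longrightarrow> (\<phi>1 has_real_derivative \<phi>2 s) (at s)"
    "\<And>y. y \<noteq> 0 \<Longrightarrow> u y = \<phi> (y \<bullet> y)" "\<And>y. y \<noteq> 0 \<Longrightarrow> grad u y = (2 * \<phi>1 (y \<bullet> y)) *\<^sub>R y"
    "\<And>y. y \<noteq> 0 \<Longrightarrow> laplacian u y = 4 * \<phi>2 (y \<bullet> y) * (y \<bullet> y) + 2 * real CARD('n) * \<phi>1 (y \<bullet> y)"
    using radial_profile[OF tw(1) rad1] by blast
  obtain \<psi> \<psi>1 \<psi>2 where \<psi>: "\<And>s. 0 < s \<Longrightarrow> (\<psi> has_real_derivative \<psi>1 s) (at s)"
    "\<And>s. 0 < s \<Longrightarrow> (\<psi>1 has_real_derivative \<psi>2 s) (at s)"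
    "\<And>y. y \<noteq> 0 \<Longrightarrow> v y = \<psi> (y \<bullet> y)" "\<And>y. y \<noteq> 0 \<Longrightarrow> grad v y = (2 * \<psi>1 (y \<bullet> y)) *\<^sub>R y"
    "\<And>y. y \<noteq> 0 \<Longrightarrow> laplacian v y = 4 * \<psi>2 (y \<bullet> y) * (y \<bullet> y) + 2 * real CARD('n) * \<psi>1 (y \<bullet> y)"
    using radial_profile[OF tw(2) rad2] by blast
  obtain e :: "real ^ 'n" where e: "norm e = 1" using vector_choose_size[of 1] by auto
  have pt: "\<exists>y::real^'n. y \<noteq> 0 \<and> y \<bullet> y = t" if "0 < t" for t
    using that e by (intro exI[of _ "sqrt t *\<^sub>R e"]) (auto simp: norm_eq_1)
  have pr: "profile \<phi> \<phi>1 \<phi>2 \<psi> \<psi>1 \<psi>2"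
    unfolding profile_def
  proof (intro allI impI)
    fix t :: real assume t: "0 < t"
    then obtain y :: "real ^ 'n" where y: "y \<noteq> 0" "y \<bullet> y = t" using pt by blast
    have "0 < u y \<and> 0 < v y \<and> laplacian u y = - F1 (u y) (v y) \<and> laplacian v y = - F2 (u y) (v y)"
      using s y(1) by (simp add: sol_def)
    then show "0 < \<phi> t \<and> 0 < \<psi> t \<and> (\<phi> has_real_derivative \<phi>1 t) (at t) \<and> (\<phi>1 has_real_derivative \<phi>2 t) (at t) \<and>
      (\<psi> has_real_derivative \<psi>1 t) (at t) \<and> (\<psi>1 has_real_derivative \<psi>2 t) (at t) \<and>
      4 * \<phi>2 t * t + 2 * real N * \<phi>1 t = - F1 (\<phi> t) (\<psi> t) \<and> 4 * \<psi>2 t * t + 2 * real N * \<psi>1 t = - F2 (\<phi> t) (\<psi> t)"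
      using \<phi>(1,2)[OF t] \<psi>(1,2)[OF t] \<phi>(3,5)[OF y(1)] \<psi>(3,5)[OF y(1)] by (simp add: y(2) CN)
  qed
  have E0: "poho_density \<phi> \<phi>1 \<psi> \<psi>1 t = 0" if "0 < t" for t
    by (rule poho_density_zero[OF CN pr \<phi>(3,4) \<psi>(3,4) K that])
  note ode = crit_ode_of_profile[OF pr E0]
  note pos = pr[unfolded profile_def, rule_format]
  have tt: "\<exists>r. t = exp (- 2 * r)" if "0 < t" for t :: real
    using that by (intro exI[of _ "- ln t / 2"]) simp
  obtain B where B: "\<And>t. exp (- \<delta> * t) * \<phi> (exp (- 2 * t)) * exp (\<delta> * t) \<le> B"
    "\<And>t. exp (- \<delta> * t) * \<psi> (exp (- 2 * t)) * exp (\<delta> * t) \<le> B"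
    using crit_ode.decay[OF ode] by blast
  have ee: "exp (- \<delta> * t) * x * exp (\<delta> * t) = x" for t x
    by (simp add: mult.commute mult.left_commute exp_minus)
  have bd: "\<phi> t \<le> B" "\<psi> t \<le> B" if "0 < t" for t
    using tt[OF that] B[unfolded ee] by auto
  have neg: "\<phi>1 t \<le> 0" "\<psi>1 t \<le> 0" if t: "0 < t" for t
  proof -
    obtain r where r: "t = exp (- 2 * r)" using tt[OF t] by blast
    \<comment> \<open>The lower Riccati bound, read for the profiles, is the sign of their
      derivatives.\<close>
    have "- \<delta> \<le> - \<delta> - 2 * t * \<phi>1 t / \<phi> t" "- \<delta> \<le> - \<delta> - 2 * t * \<psi>1 t / \<psi> t"
      using crit_ode.y_bound(1,3)[OF ode, of r] unfolding r by auto
    then have "2 * t * \<phi>1 t / \<phi> t \<le> 0" "2 * t * \<psi>1 t / \<psi> t \<le> 0" by linarith+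
    then show "\<phi>1 t \<le> 0" "\<psi>1 t \<le> 0" using pos[OF t] t by (auto simp: divide_le_0_iff mult_le_0_iff)
  qed
  have mono: "\<phi> b \<le> \<phi> a" "\<psi> b \<le> \<psi> a" if "0 < a" "a \<le> b" for a b
    by (rule DERIV_nonpos_imp_nonincreasing[OF that(2)];
        use \<phi>(1) \<psi>(1) neg that(1) in \<open>meson less_le_trans\<close>)+
  obtain \<phi>0 where \<phi>0: "(\<phi> \<longlongrightarrow> \<phi>0) (at_right 0)" "\<phi> 1 \<le> \<phi>0"
    using nonincreasing_bounded_tendsto_at_right_0[of \<phi> B] mono(1) bd(1) by blast
  obtain \<psi>0 where \<psi>0: "(\<psi> \<longlongrightarrow> \<psi>0) (at_right 0)" "\<psi> 1 \<le> \<psi>0"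
    using nonincreasing_bounded_tendsto_at_right_0[of \<psi> B] mono(2) bd(2) by blast
  have pos0: "0 < \<phi>0" "0 < \<psi>0" using pos[of 1] \<phi>0(2) \<psi>0(2) by auto
  have h1: "((\<lambda>s. F1 (\<phi> s) (\<psi> s)) \<longlongrightarrow> F1 \<phi>0 \<psi>0) (at_right 0)"
    unfolding F1_def by (intro tendsto_intros \<phi>0 \<psi>0) (use pos0 in auto)
  have h2: "((\<lambda>s. F2 (\<phi> s) (\<psi> s)) \<longlongrightarrow> F2 \<phi>0 \<psi>0) (at_right 0)"
    unfolding F2_def by (intro tendsto_intros \<phi>0 \<psi>0) (use pos0 in auto)
  have n3: "real N \<ge> 3" using N by simp
  have m1: "(\<phi>1 \<longlongrightarrow> - F1 \<phi>0 \<psi>0 / (2 * real N)) (at_right 0)"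
    by (rule radial_profile_regular[OF n3 \<phi>(1,2) _ _ h1 neg(1) bd(1)])
      (use pos f_pos in \<open>auto simp: less_imp_le\<close>)
  have m2: "(\<psi>1 \<longlongrightarrow> - F2 \<phi>0 \<psi>0 / (2 * real N)) (at_right 0)"
    by (rule radial_profile_regular[OF n3 \<psi>(1,2) _ _ h2 neg(2) bd(2)])
      (use pos g_pos in \<open>auto simp: less_imp_le\<close>)
  define u' v' where "u' = (\<lambda>y. if y = 0 then \<phi>0 else u y)" and "v' = (\<lambda>y. if y = 0 then \<psi>0 else v y)"
  note X1 = radial_extension[OF tw(1) \<phi>(1,3,4) \<phi>0(1) m1, folded u'_def]
  note X2 = radial_extension[OF tw(2) \<psi>(1,3,4) \<psi>0(1) m2, folded v'_def]
  have s': "sol u' v' (- {0})"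
    by (rule sol_cong[OF s]) (auto simp: u'_def v'_def)
  have "sol u' v' UNIV"
    unfolding sol_def
  proof (intro conjI ballI)
    fix y
    have at0: "laplacian u' 0 = - F1 (u' 0) (v' 0)" "laplacian v' 0 = - F2 (u' 0) (v' 0)" "0 < u' 0" "0 < v' 0"
      using X1(2) X2(2) N pos0 by (simp_all add: CN u'_def v'_def)
    show "0 < u' y" "0 < v' y" "laplacian u' y = - F1 (u' y) (v' y)" "laplacian v' y = - F2 (u' y) (v' y)"
      using at0 s' by (cases "y = 0"; simp add: sol_def)+
  qed (use CN X1(1) X2(1) in auto)
  then show ?thesis by (rule that) (auto simp: u'_def v'_def)
qed

lemma removable:
  fixes u v :: "real ^ 'n \<Rightarrow> real"
  assumes s: "sol u v (- {0})" and K: "pohozaev_const \<mu>1 \<mu>2 \<beta> u v = 0"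
  obtains u' v' where "sol u' v' UNIV" "\<And>y. y \<noteq> 0 \<Longrightarrow> u' y = u y" "\<And>y. y \<noteq> 0 \<Longrightarrow> v' y = v y"
  using singular_dichotomy[OF s] removable_if_radial[OF s _ K] by metis

end

subsection \<open>Scalar curvature of conformally flat metrics\<close>

definition kron :: "'n \<Rightarrow> 'n \<Rightarrow> real" where
  "kron i j = (if i = j then 1 else 0)"

lemma sum_kron:
  fixes f :: "'n::finite \<Rightarrow> real"
  shows "(\<Sum>l\<in>UNIV. kron l k * f l) = f k" "(\<Sum>l\<in>UNIV. kron k l * f l) = f k"
    "(\<Sum>l\<in>UNIV. f l * kron l k) = f k" "(\<Sum>l\<in>UNIV. f l * kron k l) = f k"
  by (simp_all add: kron_def if_distrib[of "\<lambda>x. x * _"] if_distrib[of "\<lambda>x. _ * x"] cong: if_cong)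

lemma kron_self: "kron i i = 1" and kron_commute: "kron i j = kron j i"
  by (auto simp: kron_def)

text \<open>The Christoffel symbols of the metric exp(2 f) times the Euclidean one, with
  \<open>a\<close> the gradient of f.\<close>

definition conf_christoffel :: "('n \<Rightarrow> real) \<Rightarrow> 'n \<Rightarrow> 'n \<Rightarrow> 'n \<Rightarrow> real" where
  "conf_christoffel a k i j = a i * kron j k + a j * kron i k - a k * kron i j"

text \<open>The quadratic terms in the trace of the Ricci tensor; their difference is - (n - 1)(n -
  2)|a|^2.\<close>

lemma conf_christoffel_contractions:
  fixes a :: "'n::finite \<Rightarrow> real"
  defines "n \<equiv> real CARD('n)" and "A \<equiv> (\<Sum>l\<in>UNIV. (a l)\<^sup>2)"
  shows "(\<Sum>i\<in>UNIV. \<Sum>k\<in>UNIV. \<Sum>l\<in>UNIV. conf_christoffel a k k l * conf_christoffel a l i i) = n * (2 - n) * A"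
    and "(\<Sum>i\<in>UNIV. \<Sum>k\<in>UNIV. \<Sum>l\<in>UNIV. conf_christoffel a k i l * conf_christoffel a l i k) = (2 - n) * A"
proof -
  have AA: "(\<Sum>l\<in>UNIV. a l * a l) = A" by (simp add: A_def power2_eq_square)
  have t: "conf_christoffel a k k l = a l" for k l
    by (simp add: conf_christoffel_def kron_self kron_commute[of l k])
  have "(\<Sum>l\<in>UNIV. conf_christoffel a k k l * conf_christoffel a l i i) = 2 * (a i)\<^sup>2 - A" for i k
  proof -
    have "conf_christoffel a k k l * conf_christoffel a l i i = 2 * a i * (a l * kron i l) - a l * a l" for l
      unfolding t by (simp add: conf_christoffel_def kron_self algebra_simps)
    then show ?thesis
      by (simp add: sum_subtractf sum_kron AA power2_eq_square flip: sum_distrib_left)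
  qed
  then show "(\<Sum>i\<in>UNIV. \<Sum>k\<in>UNIV. \<Sum>l\<in>UNIV. conf_christoffel a k k l * conf_christoffel a l i i) = n * (2 - n) * A"
    by (simp add: sum_subtractf A_def[symmetric] n_def flip: sum_distrib_left) (simp add: algebra_simps)
  have "(\<Sum>l\<in>UNIV. conf_christoffel a k i l * conf_christoffel a l i k)
      = (a i)\<^sup>2 + kron i k * (2 * (a i)\<^sup>2 - A) - (a k)\<^sup>2" for i k
  proof -
    let ?f = "\<lambda>l. conf_christoffel a l i k"
    have "conf_christoffel a k i l * ?f l = a i * (kron l k * ?f l) + kron i k * (a l * ?f l) - a k * (kron i l * ?f l)" for l
      by (simp add: conf_christoffel_def[of a k i l] algebra_simps)
    then have "(\<Sum>l\<in>UNIV. conf_christoffel a k i l * ?f l)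
        = a i * (\<Sum>l\<in>UNIV. kron l k * ?f l) + kron i k * (\<Sum>l\<in>UNIV. a l * ?f l) - a k * (\<Sum>l\<in>UNIV. kron i l * ?f l)"
      by (simp add: sum.distrib sum_subtractf sum_distrib_left)
    also have "\<dots> = a i * ?f k + kron i k * (\<Sum>l\<in>UNIV. a l * ?f l) - a k * ?f i"
      by (simp only: sum_kron)
    also have "(\<Sum>l\<in>UNIV. a l * ?f l) = 2 * a i * a k - kron i k * A"
    proof -
      have "a l * ?f l = a i * (a l * kron k l) + a k * (a l * kron i l) - kron i k * (a l * a l)" for l
        by (simp add: conf_christoffel_def algebra_simps)
      then have "(\<Sum>l\<in>UNIV. a l * ?f l) = a i * (\<Sum>l\<in>UNIV. a l * kron k l) + a k * (\<Sum>l\<in>UNIV. a l * kron i l)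
          - kron i k * (\<Sum>l\<in>UNIV. a l * a l)"
        by (simp add: sum.distrib sum_subtractf sum_distrib_left)
      then show ?thesis by (simp add: sum_kron AA)
    qed
    also have "?f k = a i" by (simp add: conf_christoffel_def kron_self)
    also have "?f i = a k" by (simp add: conf_christoffel_def kron_self kron_commute[of k i])
    finally show ?thesis
      by (auto simp: kron_def power2_eq_square)
  qed
  then have "(\<Sum>i\<in>UNIV. \<Sum>k\<in>UNIV. \<Sum>l\<in>UNIV. conf_christoffel a k i l * conf_christoffel a l i k)
      = (\<Sum>i\<in>UNIV. \<Sum>k\<in>UNIV. (a i)\<^sup>2 + kron i k * (2 * (a i)\<^sup>2 - A) - (a k)\<^sup>2)" by simp
  also have "\<dots> = (\<Sum>i\<in>UNIV. n * (a i)\<^sup>2 + (2 * (a i)\<^sup>2 - A) - A)"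
    by (simp add: sum.distrib sum_subtractf sum_kron(2)[of _ "\<lambda>_. _"] n_def A_def)
  also have "\<dots> = (2 - n) * A"
    by (simp add: sum.distrib sum_subtractf A_def[symmetric] n_def flip: sum_distrib_left) (simp add: algebra_simps)
  finally show "(\<Sum>i\<in>UNIV. \<Sum>k\<in>UNIV. \<Sum>l\<in>UNIV. conf_christoffel a k i l * conf_christoffel a l i k) = (2 - n) * A" .
qed

lemma matrix_inv_mat:
  assumes "c \<noteq> (0::real)"
  shows "matrix_inv (mat c :: real ^ 'n ^ 'n) = mat (1 / c)"
proof -
  have m: "(mat a :: real ^ 'n ^ 'n) ** mat b = mat (a * b)" for a b :: real
    by (simp add: matrix_matrix_mult_def mat_def vec_eq_iff if_distrib[of "\<lambda>x. x * _"] cong: if_cong)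
  have inv: "(mat c :: real ^ 'n ^ 'n) ** mat (1 / c) = mat 1" "(mat (1 / c) :: real ^ 'n ^ 'n) ** mat c = mat 1"
    using assms by (simp_all add: m)
  have "\<exists>B. (mat c :: real ^ 'n ^ 'n) ** B = mat 1 \<and> B ** mat c = mat 1" using inv by blast
  then have "mat c ** matrix_inv (mat c :: real ^ 'n ^ 'n) = mat 1 \<and> matrix_inv (mat c :: real ^ 'n ^ 'n) ** mat c = mat 1"
    using someI_ex[of "\<lambda>B. (mat c :: real ^ 'n ^ 'n) ** B = mat 1 \<and> B ** mat c = mat 1"]
    unfolding matrix_inv_def by blast
  then have "mat (1 / c) = mat (1 / c) ** (mat c ** matrix_inv (mat c :: real ^ 'n ^ 'n))" by simp
  also have "\<dots> = matrix_inv (mat c)" by (simp add: matrix_mul_assoc inv)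
  finally show ?thesis by simp
qed

text \<open>With \<open>a = \<nabla>\<phi>\<close> for the conformal factor \<open>e\<^bsup>2\<phi>\<^esup> = w\<^bsup>4/(N-2)\<^esup>\<close>, the trace of the Ricci tensor is
  \<open>-2 (N-1) \<Delta>\<phi> - (N-1) (N-2) \<bar>\<nabla>\<phi>\<bar>\<^sup>2\<close>; the gradient terms cancel when \<open>\<phi>\<close> is expressed by \<open>w\<close>.\<close>

lemma scalar_curvature_conformal:
  fixes w :: "real ^ 'n \<Rightarrow> real"
  assumes N: "3 \<le> CARD('n)" and S: "open S" and tw: "twice_on w S"
    and pos: "\<And>y. y \<in> S \<Longrightarrow> 0 < w y" and x: "x \<in> S"
  shows "scalar_curvature (conformal_metric w) x
    = - (4 * (real CARD('n) - 1) / (real CARD('n) - 2)) * laplacian w x / (w x * w x powr (4 / (real CARD('n) - 2)))"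
proof -
  define n where "n = real CARD('n)"
  have n: "n \<ge> 3" using N by (simp add: n_def)
  define q where "q = 4 / (n - 2)"
  define h where "h y = w y powr q" for y
  have h: "h y > 0" if "y \<in> S" for y using pos[OF that] by (simp add: h_def)
  let ?g = "conformal_metric w"
  have g: "?g y $ i $ j = kron i j * h y" for y i j
    by (simp add: conformal_metric_def mat_def kron_def h_def q_def n_def)
  have gi: "matrix_inv (?g y) $ i $ j = kron i j / h y" if "y \<in> S" for y i j
  proof -
    have "?g y = mat (h y)" by (simp add: conformal_metric_def h_def q_def n_def)
    then have "matrix_inv (?g y) = mat (1 / h y)" using h[OF that] matrix_inv_mat[of "h y"] by simp
    then show ?thesis by (simp add: mat_def kron_def)
  qed
  have dw: "(w has_derivative (\<lambda>v. grad w y \<bullet> v)) (at y)" if "y \<in> S" for y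
    by (rule twice_on_has_derivative(1)[OF tw that])
  have dh: "(h has_derivative (\<lambda>v. q * h y / w y * (grad w y \<bullet> v))) (at y)" if y: "y \<in> S" for y
  proof -
    have "((\<lambda>t. t powr q) has_real_derivative q * w y powr (q - 1)) (at (w y))"
      using pos[OF y] by (auto intro!: derivative_eq_intros)
    from has_derivative_compose[OF dw[OF y] this[unfolded has_field_derivative_def]]
    show ?thesis unfolding h_def
      by (rule has_derivative_eq_rhs) (use pos[OF y] in \<open>simp add: fun_eq_iff powr_diff\<close>)
  qed
  have gw: "grad w y \<bullet> axis i 1 = partial i w y" for y i
    by (simp add: grad_def inner_axis)
  have pg: "partial i (\<lambda>y. ?g y $ j $ k) y = kron j k * (q * h y / w y * partial i w y)" if y: "y \<in> S" for i j k y
    unfolding g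
    by (subst partial_eq[OF has_derivative_mult_right[OF dh[OF y]]]) (simp add: gw)
  \<comment> \<open>The gradient of (q/2) ln w, as the metric factor is w^q = exp(q ln w).\<close>
  define a where "a y i = q / 2 * (partial i w y / w y)" for y i
  have chr: "christoffel ?g k i j y = conf_christoffel (a y) k i j" if y: "y \<in> S" for k i j y
  proof -
    have "christoffel ?g k i j y = (\<Sum>l\<in>UNIV. kron k l * ((1 / h y) *
        (kron j l * (q * h y / w y * partial i w y) + kron i l * (q * h y / w y * partial j w y)
         - kron i j * (q * h y / w y * partial l w y)))) / 2"
      unfolding christoffel_def by (simp only: pg[OF y] gi[OF y]) simp
    also have "\<dots> = ((1 / h y) * (kron j k * (q * h y / w y * partial i w y) + kron i k * (q * h y / w y * partial j w y)
         - kron i j * (q * h y / w y * partial k w y))) / 2"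
      by (simp only: sum_kron)
    also have "\<dots> = conf_christoffel (a y) k i j"
      using h[OF y] pos[OF y] by (simp add: conf_christoffel_def a_def field_simps)
    finally show ?thesis .
  qed
  have da: "((\<lambda>y. a y i) has_derivative (\<lambda>v. q / 2 * ((grad (partial i w) x \<bullet> v) / w x
      - partial i w x * (grad w x \<bullet> v) / (w x)\<^sup>2))) (at x)" for i
  proof -
    have "(partial i w has_derivative (\<lambda>v. grad (partial i w) x \<bullet> v)) (at x)"
      using tw x by (auto simp: twice_on_def intro: has_derivative_grad)
    from has_derivative_divide[OF this dw[OF x]] pos[OF x]
    have "((\<lambda>y. partial i w y / w y) has_derivative (\<lambda>v. (grad (partial i w) x \<bullet> v) / w x
      - partial i w x * (grad w x \<bullet> v) / (w x)\<^sup>2)) (at x)"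
      by (auto elim!: has_derivative_eq_rhs simp: fun_eq_iff field_simps power2_eq_square)
    from has_derivative_mult_right[OF this, of "q / 2"] show ?thesis unfolding a_def .
  qed
  define b where "b m i = q / 2 * (partial m (partial i w) x / w x - partial i w x * partial m w x / (w x)\<^sup>2)" for m i
  have pchr: "partial m (christoffel ?g k i j) x = b m i * kron j k + b m j * kron i k - b m k * kron i j" for m k i j
  proof -
    have "partial m (christoffel ?g k i j) x = partial m (\<lambda>y. a y i * kron j k + a y j * kron i k - a y k * kron i j) x"
      by (rule partial_cong_open[OF S x]) (simp add: chr conf_christoffel_def)
    also have "\<dots> = b m i * kron j k + b m j * kron i k - b m k * kron i j"
      by (subst partial_eq[OF has_derivative_diff[OF has_derivative_add[OF
              has_derivative_mult_left[OF da] has_derivative_mult_left[OF da]] has_derivative_mult_left[OF da]]])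
        (simp add: b_def grad_def inner_axis)
    finally show ?thesis .
  qed
  define T where "T = (\<Sum>k\<in>UNIV. b k k)"
  define A where "A = (\<Sum>k\<in>UNIV. (a x k)\<^sup>2)"
  have r1: "(\<Sum>k\<in>UNIV. partial k (christoffel ?g k i i) x - partial i (christoffel ?g k i k) x) = 2 * b i i - T - n * b i i" for i
  proof -
    have "partial k (christoffel ?g k i i) x - partial i (christoffel ?g k i k) x
        = 2 * (b k i * kron i k) - b k k - b i i" for k
      by (simp add: pchr kron_self kron_commute[of k i] algebra_simps)
    then show ?thesis
      by (simp add: sum_subtractf sum_kron T_def n_def flip: sum_distrib_left)
  qed
  have ric: "(\<Sum>i\<in>UNIV. ricci ?g i i x) = - 2 * (n - 1) * T - (n - 1) * (n - 2) * A"
  proof -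
    have "(\<Sum>i\<in>UNIV. ricci ?g i i x) = (\<Sum>i\<in>UNIV. 2 * b i i - T - n * b i i)
       + (\<Sum>i\<in>UNIV. \<Sum>k\<in>UNIV. \<Sum>l\<in>UNIV. conf_christoffel (a x) k k l * conf_christoffel (a x) l i i)
       - (\<Sum>i\<in>UNIV. \<Sum>k\<in>UNIV. \<Sum>l\<in>UNIV. conf_christoffel (a x) k i l * conf_christoffel (a x) l i k)"
      unfolding ricci_def r1 chr[OF x] by (simp add: sum.distrib sum_subtractf)
    also have "(\<Sum>i\<in>UNIV. 2 * b i i - T - n * b i i) = 2 * T - n * T - n * T"
      by (simp add: sum_subtractf T_def[symmetric] n_def flip: sum_distrib_left)
    finally show ?thesis
      unfolding conf_christoffel_contractions n_def[symmetric] A_def[symmetric] by (simp add: algebra_simps)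
  qed
  have "scalar_curvature ?g x = (\<Sum>i\<in>UNIV. \<Sum>j\<in>UNIV. kron i j * (ricci ?g i j x / h x))"
    unfolding scalar_curvature_def by (simp add: gi[OF x])
  also have "\<dots> = (\<Sum>i\<in>UNIV. ricci ?g i i x) / h x"
    by (simp only: sum_kron sum_divide_distrib)
  also have "\<dots> = (- 2 * (n - 1) * T - (n - 1) * (n - 2) * A) / h x" by (simp only: ric)
  also have "- 2 * (n - 1) * T - (n - 1) * (n - 2) * A = - (4 * (n - 1) / (n - 2)) * laplacian w x / w x"
  proof -
    define G where "G = (\<Sum>k\<in>UNIV. (partial k w x)\<^sup>2)"
    have T: "T = q / 2 * (laplacian w x / w x - G / (w x)\<^sup>2)"
      unfolding T_def b_def laplacian_def G_def
      by (simp add: sum_subtractf[symmetric] sum_divide_distrib sum_distrib_left power2_eq_square)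
    have A: "A = (q / 2)\<^sup>2 * (G / (w x)\<^sup>2)"
      unfolding A_def a_def G_def
      by (simp add: power_mult_distrib power_divide sum_divide_distrib sum_distrib_left)
    \<comment> \<open>The choice q = 4/(n - 2) is the one for which the gradient squares from the
      divergence and from the quadratic terms cancel.\<close>
    have "(n - 2) * (q / 2)\<^sup>2 = 2 * (q / 2)"
    proof -
      have "n - 2 \<noteq> 0" using n by simp
      then have "(n - 2) * q = 4" unfolding q_def times_divide_eq_right by (rule nonzero_mult_div_cancel_left)
      then have "(n - 2) * q * q = 4 * q" by simp
      then show ?thesis by (simp add: power2_eq_square algebra_simps)
    qed
    then have e1: "(n - 1) * ((n - 2) * (q / 2)\<^sup>2) * (G / (w x)\<^sup>2) = (n - 1) * (2 * (q / 2)) * (G / (w x)\<^sup>2)" by simp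
    have e2: "2 * (n - 1) * (q / 2) = 4 * (n - 1) / (n - 2)"
      unfolding q_def by (simp only: times_divide_eq_right times_divide_eq_left) (use n in \<open>simp add: divide_simps algebra_simps\<close>)
    have "- 2 * (n - 1) * (Q * (L - H)) - (n - 1) * (n - 2) * (Q\<^sup>2 * H)
        = - (2 * (n - 1) * Q) * L + ((n - 1) * (2 * Q) * H - (n - 1) * ((n - 2) * Q\<^sup>2) * H)" for Q L H
      by (simp add: algebra_simps)
    from this[of "q / 2" "laplacian w x / w x" "G / (w x)\<^sup>2", folded T A]
    show ?thesis unfolding e1 e2 by (simp only: diff_self add_0_right times_divide_eq_right)
  qed
  finally show ?thesis
    by (simp add: h_def q_def n_def)
qed

subsection \<open>Bubbles\<close>

text \<open>Matches the profile of \<open>entire_classification\<close> with a bubble for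
  \<epsilon>^2 = d; normalising at the centre avoids carrying the explicit constant.\<close>

lemma bubble_eq:
  fixes y :: "real ^ 'n"
  assumes d: "0 < d"
  shows "bubble (sqrt d) x0 y = bubble (sqrt d) x0 x0 * d powr ((real CARD('n) - 2) / 2)
      * (1 / (d + (y - x0) \<bullet> (y - x0))) powr ((real CARD('n) - 2) / 2)"
proof -
  let ?\<delta> = "(real CARD('n) - 2) / 2"
  have e: "sqrt d / d * d = sqrt d" using d by simp
  have s: "0 < d + (y - x0) \<bullet> (y - x0)" using d by (simp add: add_pos_nonneg)
  have "(sqrt d / (d + (y - x0) \<bullet> (y - x0))) powr ?\<delta> = (sqrt d / d) powr ?\<delta> * d powr ?\<delta> * (1 / (d + (y - x0) \<bullet> (y - x0))) powr ?\<delta>"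
  proof -
    have "sqrt d / (d + (y - x0) \<bullet> (y - x0)) = sqrt d / d * d * (1 / (d + (y - x0) \<bullet> (y - x0)))"
      using e by simp
    then show ?thesis using d s by (simp only: powr_mult)
  qed
  then show ?thesis using d by (simp add: bubble_def Let_def power2_norm_eq_inner)
qed

context crit_system begin

text \<open>For K (d + s)^(- \<delta>) the radial formula with N = 2 \<delta> + 2 collapses to one
  term, - 4 \<delta> (\<delta> + 1) d K (d + s)^(- \<delta> - 2), and the new exponent is - \<delta>
  (p - 1).\<close>

lemma laplacian_bubble:
  fixes y :: "real ^ 'n"
  assumes CN: "CARD('n) = N" and d: "0 < d"
  shows "laplacian (bubble (sqrt d) x0) y = - (bubble (sqrt d) x0 y powr (p - 1))"
proof -
  define K where "K = (real N * (real N - 2)) powr (\<delta> / 2) * (sqrt d) powr \<delta>"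
  have NN: "real N * (real N - 2) > 0" using N by simp
  have K: "K > 0" unfolding K_def using NN d by (intro mult_pos_pos) (simp_all only: powr_gt_zero, simp_all)
  let ?\<phi> = "\<lambda>s. K * (d + s) powr (- \<delta>)"
  let ?\<phi>' = "\<lambda>s. K * (- \<delta> * (d + s) powr (- \<delta> - 1))"
  let ?\<phi>'' = "\<lambda>s. K * (- \<delta> * ((- \<delta> - 1) * (d + s) powr (- \<delta> - 2)))"
  have pw: "((\<lambda>s. (d + s) powr q) has_real_derivative q * (d + s) powr (q - 1)) (at s)" if "0 \<le> s" for s q
    using d that by (auto intro!: derivative_eq_intros)
  have d1: "(?\<phi> has_real_derivative ?\<phi>' s) (at s)" if "0 \<le> s" for s
    by (intro DERIV_cmult pw that)
  have d2: "(?\<phi>' has_real_derivative ?\<phi>'' s) (at s)" if "0 \<le> s" for s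
    using pw[OF that, of "- \<delta> - 1"] by (intro DERIV_cmult) (simp only: diff_diff_eq one_add_one)
  have nn: "0 \<le> (y - x0) \<bullet> (y - x0)" for y by simp
  have b: "bubble (sqrt d) x0 = (\<lambda>y. ?\<phi> ((y - x0) \<bullet> (y - x0)))"
  proof
    fix y
    have s: "0 < d + (y - x0) \<bullet> (y - x0)" using d by (simp add: add_pos_nonneg)
    have "real N - 2 = 2 * \<delta>" by (simp add: two_\<delta>)
    then have e: "(real N - 2) / 4 = \<delta> / 2" "(real N - 2) / 2 = \<delta>" by simp_all
    have "bubble (sqrt d) x0 y = (real N * (real N - 2)) powr (\<delta> / 2) * (sqrt d / (d + (y - x0) \<bullet> (y - x0))) powr \<delta>"
      using d by (simp only: bubble_def Let_def CN e power2_norm_eq_inner real_sqrt_pow2[OF less_imp_le[OF d]])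
    also have "(sqrt d / (d + (y - x0) \<bullet> (y - x0))) powr \<delta> = (sqrt d) powr \<delta> * (d + (y - x0) \<bullet> (y - x0)) powr (- \<delta>)"
      using s d by (simp add: powr_divide powr_minus_divide)
    finally show "bubble (sqrt d) x0 y = ?\<phi> ((y - x0) \<bullet> (y - x0))" by (simp add: K_def)
  qed
  let ?s = "(y - x0) \<bullet> (y - x0)"
  have s: "0 < d + ?s" using d by (simp add: add_pos_nonneg)
  have "laplacian (bubble (sqrt d) x0) y = 4 * ?\<phi>'' ?s * ?s + 2 * real CARD('n) * ?\<phi>' ?s"
    unfolding b by (rule twice_on_radial(3)[OF open_UNIV d1[OF nn] d2[OF nn]]) simp
  also have "(d + ?s) powr (- \<delta> - 1) = (d + ?s) powr (- \<delta> - 2) * (d + ?s)"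
  proof -
    have "- \<delta> - 2 + 1 = - \<delta> - 1" by simp
    then show ?thesis using powr_add[of "d + ?s" "- \<delta> - 2" 1] s by (simp only: powr_one less_imp_le)
  qed
  also have "4 * (K * (- \<delta> * ((- \<delta> - 1) * (d + ?s) powr (- \<delta> - 2)))) * ?s
      + 2 * real CARD('n) * (K * (- \<delta> * ((d + ?s) powr (- \<delta> - 2) * (d + ?s))))
      = - (K * (4 * \<delta> * (\<delta> + 1) * d) * (d + ?s) powr (- \<delta> - 2))"
    by (simp add: CN N_eq algebra_simps)
  \<comment> \<open>This is where the normalisation N (N - 2) = 4 \<delta> (\<delta> + 1) of the
    bubble is used: K^(p - 2) = N (N - 2) d.\<close>
  also have "K * (4 * \<delta> * (\<delta> + 1) * d) = K powr (p - 1)"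
  proof -
    have "K powr (2 / \<delta>) = ((real N * (real N - 2)) powr (\<delta> / 2)) powr (2 / \<delta>) * ((sqrt d) powr \<delta>) powr (2 / \<delta>)"
      using NN d by (simp add: K_def powr_mult)
    also have "((real N * (real N - 2)) powr (\<delta> / 2)) powr (2 / \<delta>) = real N * (real N - 2)"
    proof -
      have "\<delta> / 2 * (2 / \<delta>) = 1" using \<delta>_pos by simp
      then show ?thesis using NN by (simp only: powr_powr) simp
    qed
    also have "((sqrt d) powr \<delta>) powr (2 / \<delta>) = d"
    proof -
      have "\<delta> * (2 / \<delta>) = 2" using \<delta>_pos by simp
      then show ?thesis using d by (simp only: powr_powr) simp
    qed
    also have "real N * (real N - 2) * d = 4 * \<delta> * (\<delta> + 1) * d" by (simp add: N_eq algebra_simps)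
    finally have "K * (4 * \<delta> * (\<delta> + 1) * d) = K powr 1 * K powr (2 / \<delta>)" using K by simp
    also have "\<dots> = K powr (1 + 2 / \<delta>)" by (rule powr_add[symmetric])
    finally show ?thesis by (simp add: p_eq)
  qed
  also have "(d + ?s) powr (- \<delta> - 2) = ((d + ?s) powr (- \<delta>)) powr (p - 1)"
  proof -
    have "- \<delta> * (p - 1) = - \<delta> - 2" using \<delta>_pos by (simp add: p_eq algebra_simps)
    then show ?thesis by (simp only: powr_powr)
  qed
  also have "K powr (p - 1) * ((d + ?s) powr (- \<delta>)) powr (p - 1) = bubble (sqrt d) x0 y powr (p - 1)"
    unfolding b using K by (simp add: powr_mult)
  finally show ?thesis .
qed

lemma coefficients_eq:
  assumes k: "0 < k" "0 < l" and U: "0 < U"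
    and eq: "k * U powr (p - 1) = \<mu> * (k * U) powr (p - 1) + \<beta> * (k * U) powr (p / 2 - 1) * (l * U) powr (p / 2)"
  shows "\<mu> * k powr (p - 2) + \<beta> * k powr (p / 2 - 2) * l powr (p / 2) = 1"
proof -
  have "U powr (p / 2 - 1) * U powr (p / 2) = U powr (p - 1)" by (simp flip: powr_add)
  then have "\<mu> * (k * U) powr (p - 1) + \<beta> * (k * U) powr (p / 2 - 1) * (l * U) powr (p / 2)
      = (\<mu> * k powr (p - 1) + \<beta> * k powr (p / 2 - 1) * l powr (p / 2)) * U powr (p - 1)"
    using k U by (simp add: powr_mult algebra_simps)
  with eq U have "k = \<mu> * k powr (p - 1) + \<beta> * k powr (p / 2 - 1) * l powr (p / 2)" by simp
  moreover have "k powr (p - 1) = k * k powr (p - 2)" "k powr (p / 2 - 1) = k * k powr (p / 2 - 2)"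
    using k powr_add[of k 1 "p - 2"] powr_add[of k 1 "p / 2 - 2"] by simp_all
  ultimately have "k * 1 = k * (\<mu> * k powr (p - 2) + \<beta> * k powr (p / 2 - 2) * l powr (p / 2))"
    by (simp add: algebra_simps)
  then show ?thesis using k by simp
qed

text \<open>Both components are multiples of one bubble, so the system reduces to algebra for the
  two factors, and evaluating it at the single point \<open>x0\<close> gives both equations.\<close>

lemma entire_bubbles:
  fixes u v :: "real ^ 'n \<Rightarrow> real"
  assumes s: "sol u v UNIV"
  shows "\<exists>k>0. \<exists>l>0.
            \<mu>1 * k powr (p - 2) + \<beta> * k powr (p / 2 - 2) * l powr (p / 2) = 1 \<and>
            \<mu>2 * l powr (p - 2) + \<beta> * l powr (p / 2 - 2) * k powr (p / 2) = 1 \<and>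
            (\<exists>\<epsilon>>0. \<exists>y. \<forall>x. u x = k * bubble \<epsilon> y x \<and> v x = l * bubble \<epsilon> y x)"
proof -
  have CN: "CARD('n) = N" using s by (simp add: sol_def)
  have N': "3 \<le> CARD('n)" using N CN by simp
  obtain A B d x0 where AB: "A > 0" "B > 0" "d > 0"
    "\<And>y. u y = A * (1 / (d + (y - x0) \<bullet> (y - x0))) powr ((real N - 2) / 2)"
    "\<And>y. v y = B * (1 / (d + (y - x0) \<bullet> (y - x0))) powr ((real N - 2) / 2)"
    using entire_classification[OF s] by metis
  let ?U = "bubble (sqrt d) x0"
  define c where "c = ?U x0 * d powr ((real N - 2) / 2)"
  have Upos: "0 < ?U y" for y
  proof -
    have "0 < d + (norm (y - x0))\<^sup>2" using AB(3) by (simp add: add_pos_nonneg)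
    then show ?thesis using AB(3) N' by (simp add: bubble_def Let_def zero_less_mult_iff)
  qed
  have c: "c > 0" using Upos AB(3) by (simp add: c_def)
  define k l where "k = A / c" and "l = B / c"
  have kl: "k > 0" "l > 0" using AB c by (simp_all add: k_def l_def)
  have u: "u y = k * ?U y" and v: "v y = l * ?U y" for y
    using bubble_eq[OF AB(3), of x0 y] c by (simp_all add: AB(4,5) k_def l_def CN c_def[symmetric])
  have tb: "twice_on ?U UNIV"
  proof -
    have "twice_on u UNIV" using s by (simp add: sol_def)
    from twice_on_cmult(1)[OF open_UNIV this, of "1 / k"] show ?thesis
      using kl by (simp add: u)
  qed
  have lap: "laplacian u x0 = - (k * ?U x0 powr (p - 1))" "laplacian v x0 = - (l * ?U x0 powr (p - 1))"
    using twice_on_cmult(2)[OF open_UNIV tb, of x0 k] twice_on_cmult(2)[OF open_UNIV tb, of x0 l]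
      laplacian_bubble[OF CN AB(3), of x0 x0] by (simp_all add: u[abs_def] v[abs_def])
  have "laplacian u x0 = - F1 (u x0) (v x0)" "laplacian v x0 = - F2 (u x0) (v x0)"
    using s by (simp_all add: sol_def)
  then have "k * ?U x0 powr (p - 1) = F1 (k * ?U x0) (l * ?U x0)" "l * ?U x0 powr (p - 1) = F2 (k * ?U x0) (l * ?U x0)"
    unfolding lap unfolding u v by simp_all
  from this(1)[unfolded F1_def, THEN coefficients_eq[OF kl Upos]]
    this(2)[unfolded F2_def, THEN coefficients_eq[OF kl(2,1) Upos]]
  show ?thesis using kl u v AB(3) by (intro exI[of _ k] exI[of _ l] conjI exI[of _ "sqrt d"] exI[of _ x0]) auto
qed

text \<open>The exponent 4/(N - 2) of the metric equals p - 2, so the denominator is a^(p -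
  1).\<close>

lemma scalar_curvature_solution:
  assumes "0 < a" "0 < b"
  shows "(\<mu> * a powr (p - 1) + \<beta> * a powr (p / 2 - 1) * b powr (p / 2)) / (a * a powr (4 / (real N - 2)))
    = \<mu> + \<beta> * (b / a) powr (p / 2)"
proof -
  have "4 / (real N - 2) = p - 2" using two_\<delta>[symmetric] \<delta>_pos by (simp add: p_eq)
  then have a: "a * a powr (4 / (real N - 2)) = a powr (p - 1)"
    using assms powr_add[of a 1 "p - 2"] by simp
  have "a powr (p / 2 - 1) = a powr (p - 1) / a powr (p / 2)"
    by (simp flip: powr_diff)
  then show ?thesis
    unfolding a using assms by (simp add: powr_divide add_divide_distrib)
qed

end

text \<open>The hypotheses leave the values of \<open>u\<close> and \<open>v\<close> at 0 arbitrary,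
  so the formulas are asserted off 0, although the bubble itself is smooth there.\<close>

theorem corollary1p1:
  fixes u v :: "real ^ 'n \<Rightarrow> real" and \<mu>1 \<mu>2 \<beta> p :: real and N :: nat
  assumes N: "N = CARD('n)" "N \<ge> 3"
    and p: "p = crit_exp N"
    and pos: "\<mu>1 > 0" "\<mu>2 > 0" "\<beta> > 0"
    and C2: "Ck_on 2 u (- {0})" "Ck_on 2 v (- {0})"
    and uv_pos: "\<And>x. x \<noteq> 0 \<Longrightarrow> u x > 0" "\<And>x. x \<noteq> 0 \<Longrightarrow> v x > 0"
    and eq_u: "\<And>x. x \<noteq> 0 \<Longrightarrow>
      - laplacian u x = \<mu>1 * u x powr (p - 1) + \<beta> * u x powr (p / 2 - 1) * v x powr (p / 2)"
    and eq_v: "\<And>x. x \<noteq> 0 \<Longrightarrow>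
      - laplacian v x = \<mu>2 * v x powr (p - 1) + \<beta> * v x powr (p / 2 - 1) * u x powr (p / 2)"
    and K: "pohozaev_const \<mu>1 \<mu>2 \<beta> u v = 0"
  shows "(\<exists>k>0. \<exists>l>0.
            \<mu>1 * k powr (p - 2) + \<beta> * k powr (p / 2 - 2) * l powr (p / 2) = 1 \<and>
            \<mu>2 * l powr (p - 2) + \<beta> * l powr (p / 2 - 2) * k powr (p / 2) = 1 \<and>
            (\<exists>\<epsilon>>0. \<exists>y. \<forall>x. x \<noteq> 0 \<longrightarrow> u x = k * bubble \<epsilon> y x \<and> v x = l * bubble \<epsilon> y x)) \<and>
         (\<forall>x. x \<noteq> 0 \<longrightarrow>
            scalar_curvature (conformal_metric u) x
              = 4 * (real N - 1) / (real N - 2) * (\<mu>1 + \<beta> * (v x / u x) powr (p / 2)) \<and>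
            scalar_curvature (conformal_metric v) x
              = 4 * (real N - 1) / (real N - 2) * (\<mu>2 + \<beta> * (u x / v x) powr (p / 2))) \<and>
         scalar_curvature (conformal_metric u) constant_on (- {0}) \<and>
         scalar_curvature (conformal_metric v) constant_on (- {0})"
proof -
  note dim = assms(1)
  interpret crit_system N \<mu>1 \<mu>2 \<beta> p "(real N - 2) / 2"
    by unfold_locales (use N pos p in auto)
  have op: "open (- {0::real^'n})" by auto
  have tw: "twice_on u (- {0})" "twice_on v (- {0})" using C2 by (auto intro: Ck_on_2_twice_on)
  have lap: "laplacian u x = - F1 (u x) (v x)" "laplacian v x = - F2 (u x) (v x)" if "x \<noteq> 0" for x
    using eq_u[OF that] eq_v[OF that] by (simp_all add: F1_def F2_def)
  have s: "sol u v (- {0})"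
    using dim[symmetric] op tw uv_pos lap by (simp add: sol_def)
  obtain u' v' where s': "sol u' v' UNIV" "\<And>y. y \<noteq> 0 \<Longrightarrow> u' y = u y" "\<And>y. y \<noteq> 0 \<Longrightarrow> v' y = v y"
    using removable[OF s K] by metis
  obtain k l \<epsilon> y where kl: "k > 0" "l > 0"
    "\<mu>1 * k powr (p - 2) + \<beta> * k powr (p / 2 - 2) * l powr (p / 2) = 1"
    "\<mu>2 * l powr (p - 2) + \<beta> * l powr (p / 2 - 2) * k powr (p / 2) = 1" "\<epsilon> > 0"
    "\<And>x. u' x = k * bubble \<epsilon> y x \<and> v' x = l * bubble \<epsilon> y x"
    using entire_bubbles[OF s'(1)] by metis
  have uv: "u x = k * bubble \<epsilon> y x" "v x = l * bubble \<epsilon> y x" if "x \<noteq> 0" for x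
    using kl(6)[of x] s'(2,3)[OF that] by simp_all
  have N': "3 \<le> CARD('n)" using assms(1,2) by simp
  have cu: "scalar_curvature (conformal_metric u) x
      = 4 * (real N - 1) / (real N - 2) * (\<mu>1 + \<beta> * (v x / u x) powr (p / 2))"
    and cv: "scalar_curvature (conformal_metric v) x
      = 4 * (real N - 1) / (real N - 2) * (\<mu>2 + \<beta> * (u x / v x) powr (p / 2))" if x: "x \<noteq> 0" for x
  proof -
    have x': "x \<in> - {0}" using x by simp
    have "scalar_curvature (conformal_metric u) x
      = 4 * (real N - 1) / (real N - 2) * (F1 (u x) (v x) / (u x * u x powr (4 / (real N - 2))))"
      using scalar_curvature_conformal[OF N' op tw(1) _ x'] uv_pos(1) lap(1)[OF x] by (simp add: dim)
    then show "scalar_curvature (conformal_metric u) x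
      = 4 * (real N - 1) / (real N - 2) * (\<mu>1 + \<beta> * (v x / u x) powr (p / 2))"
      unfolding F1_def scalar_curvature_solution[OF uv_pos[OF x]] .
    have "scalar_curvature (conformal_metric v) x
      = 4 * (real N - 1) / (real N - 2) * (F2 (u x) (v x) / (v x * v x powr (4 / (real N - 2))))"
      using scalar_curvature_conformal[OF N' op tw(2) _ x'] uv_pos(2) lap(2)[OF x] by (simp add: dim)
    then show "scalar_curvature (conformal_metric v) x
      = 4 * (real N - 1) / (real N - 2) * (\<mu>2 + \<beta> * (u x / v x) powr (p / 2))"
      unfolding F2_def scalar_curvature_solution[OF uv_pos(2)[OF x] uv_pos(1)[OF x]] .
  qed
  \<comment> \<open>The bubble cancels in both ratios, which makes the curvature formulas
    constant.\<close>
  have ratio: "v x / u x = l / k" "u x / v x = k / l" if x: "x \<noteq> 0" for x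
  proof -
    have "bubble \<epsilon> y x \<noteq> 0" using uv_pos(1)[OF x] uv(1)[OF x] by auto
    then show "v x / u x = l / k" "u x / v x = k / l" unfolding uv[OF x] by simp_all
  qed
  have "scalar_curvature (conformal_metric u) constant_on (- {0})"
    "scalar_curvature (conformal_metric v) constant_on (- {0})"
    unfolding constant_on_def using cu cv ratio by auto
  then show ?thesis
    using kl(1-5) uv cu cv by blast
qed

end
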